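(* Let $\mathcal{A}$ be a separable unital residually finite-dimensional (RFD) C*-algebra and let $\mathcal{D}$ be a unital finite-dimensional C*-subalgebra of $\mathcal{A}$. Then the unital full amalgamated free product $\mathcal{A}\ast_{\mathcal{D}}\mathcal{A}$ (of two copies of $\mathcal{A}$, amalgamated over $\mathcal{D}$ via the inclusion $\mathcal{D}\subseteq\mathcal{A}$ in each copy) is RFD.
   Context: A separable C*-algebra $\mathcal{R}$ is residually finite-dimensional (RFD) if for each nonzero $x\in\mathcal{R}$ there is a *-homomorphism $\pi$ from $\mathcal{R}$ to a finite-dimensional C*-algebra with $\pi(x)\neq 0$. A unital C*-subalgebra contains the unit of the larger algebra. Given unital embeddings (injective *-homomorphisms) $\psi_{\mathcal{A}}:\mathcal{D}\to\mathcal{A}$, $\psi_{\mathcal{B}}:\mathcal{D}\to\mathcal{B}$, the unital full amalgamated free product $\mathcal{A}\ast_{\mathcal{D}}\mathcal{B}$ is the C*-algebra $\mathcal{C}$ with unital embeddings $\sigma_{\mathcal{A}}:\mathcal{A}\to\mathcal{C}$, $\sigma_{\mathcal{B}}:\mathcal{B}\to\mathcal{C}$ such that $\sigma_{\mathcal{A}}\circ\psi_{\mathcal{A}}=\sigma_{\mathcal{B}}\circ\psi_{\mathcal{B}}$, $\mathcal{C}$ is generated by $\sigma_{\mathcal{A}}(\mathcal{A})\cup\sigma_{\mathcal{B}}(\mathcal{B})$, and whenever $\pi_{\mathcal{A}}:\mathcal{A}\to\mathcal{E}$, $\pi_{\mathcal{B}}:\mathcal{B}\to\mathcal{E}$ are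 *-homomorphisms into a C*-algebra $\mathcal{E}$ with $\pi_{\mathcal{A}}\circ\psi_{\mathcal{A}}=\pi_{\mathcal{B}}\circ\psi_{\mathcal{B}}$, there is a *-homomorphism $\pi:\mathcal{C}\to\mathcal{E}$ with $\pi\circ\sigma_{\mathcal{A}}=\pi_{\mathcal{A}}$ and $\pi\circ\sigma_{\mathcal{B}}=\pi_{\mathcal{B}}$. *)

theory Defs
  imports "HOL-Analysis.Analysis" "HOL-Algebra.Module"
begin

section \<open>C*-algebras\<close>

definition complex_ring :: "complex ring" where
  "complex_ring = \<lparr>carrier = UNIV, monoid.mult = (*), one = 1, ring.zero = 0, add = (+)\<rparr>"

text \<open>
  C*-algebras need not be unital. The component \<open>one\<close> inherited from the ring record carries
  no meaning unless the algebra satisfies \<open>unital_cstar_algebra\<close> below.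
\<close>

record 'a cstar = "(complex, 'a) module" +
  star :: "'a \<Rightarrow> 'a"
  cnorm :: "'a \<Rightarrow> real"

text \<open>
  The locale \<open>Metric_space\<close> asks for symmetry and nonnegativity also off the carrier, hence
  the value 0 there.
\<close>

definition cdist :: "'a cstar \<Rightarrow> 'a \<Rightarrow> 'a \<Rightarrow> real" where
  "cdist A x y = (if x \<in> carrier A \<and> y \<in> carrier A then cnorm A (x \<ominus>\<^bsub>A\<^esub> y) else 0)"

definition norm_topology :: "'a cstar \<Rightarrow> 'a topology" where
  "norm_topology A = Metric_space.mtopology (carrier A) (cdist A)"

locale cstar_algebra = Module.module complex_ring A for A :: "'a cstar" (structure) +
  assumes mult_closed: "\<lbrakk>x \<in> carrier A; y \<in> carrier A\<rbrakk> \<Longrightarrow> x \<otimes> y \<in> carrier A"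
    and mult_assoc: "\<lbrakk>x \<in> carrier A; y \<in> carrier A; z \<in> carrier A\<rbrakk> \<Longrightarrow>
          (x \<otimes> y) \<otimes> z = x \<otimes> (y \<otimes> z)"
    and mult_l_distr: "\<lbrakk>x \<in> carrier A; y \<in> carrier A; z \<in> carrier A\<rbrakk> \<Longrightarrow>
          (x \<oplus> y) \<otimes> z = x \<otimes> z \<oplus> y \<otimes> z"
    and mult_r_distr: "\<lbrakk>x \<in> carrier A; y \<in> carrier A; z \<in> carrier A\<rbrakk> \<Longrightarrow>
          z \<otimes> (x \<oplus> y) = z \<otimes> x \<oplus> z \<otimes> y"
    and smult_mult_l: "\<lbrakk>x \<in> carrier A; y \<in> carrier A\<rbrakk> \<Longrightarrow> (c \<odot> x) \<otimes> y = c \<odot> (x \<otimes> y)"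
    and smult_mult_r: "\<lbrakk>x \<in> carrier A; y \<in> carrier A\<rbrakk> \<Longrightarrow> x \<otimes> (c \<odot> y) = c \<odot> (x \<otimes> y)"
    and star_closed: "x \<in> carrier A \<Longrightarrow> star A x \<in> carrier A"
    and star_star: "x \<in> carrier A \<Longrightarrow> star A (star A x) = x"
    and star_add: "\<lbrakk>x \<in> carrier A; y \<in> carrier A\<rbrakk> \<Longrightarrow> star A (x \<oplus> y) = star A x \<oplus> star A y"
    and star_smult: "x \<in> carrier A \<Longrightarrow> star A (c \<odot> x) = cnj c \<odot> star A x"
    and star_mult: "\<lbrakk>x \<in> carrier A; y \<in> carrier A\<rbrakk> \<Longrightarrow> star A (x \<otimes> y) = star A y \<otimes> star A x"
    and cnorm_nonneg: "x \<in> carrier A \<Longrightarrow> 0 \<le> cnorm A x"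
    and cnorm_eq_0_iff: "x \<in> carrier A \<Longrightarrow> cnorm A x = 0 \<longleftrightarrow> x = \<zero>"
    and cnorm_triangle: "\<lbrakk>x \<in> carrier A; y \<in> carrier A\<rbrakk> \<Longrightarrow>
          cnorm A (x \<oplus> y) \<le> cnorm A x + cnorm A y"
    and cnorm_smult: "x \<in> carrier A \<Longrightarrow> cnorm A (c \<odot> x) = cmod c * cnorm A x"
    and cnorm_mult: "\<lbrakk>x \<in> carrier A; y \<in> carrier A\<rbrakk> \<Longrightarrow>
          cnorm A (x \<otimes> y) \<le> cnorm A x * cnorm A y"
    and cstar_identity: "x \<in> carrier A \<Longrightarrow> cnorm A (star A x \<otimes> x) = (cnorm A x)\<^sup>2"
    and complete: "Metric_space.mcomplete (carrier A) (cdist A)"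

locale unital_cstar_algebra = cstar_algebra +
  assumes unit_closed: "\<one> \<in> carrier A"
    and unit_l: "x \<in> carrier A \<Longrightarrow> \<one> \<otimes> x = x"
    and unit_r: "x \<in> carrier A \<Longrightarrow> x \<otimes> \<one> = x"

definition cstar_subalgebra :: "'a set \<Rightarrow> 'a cstar \<Rightarrow> bool" where
  "cstar_subalgebra S A \<longleftrightarrow>
     submodule S complex_ring A \<and>
     (\<forall>x\<in>S. \<forall>y\<in>S. x \<otimes>\<^bsub>A\<^esub> y \<in> S) \<and>
     (\<forall>x\<in>S. star A x \<in> S) \<and>
     closedin (norm_topology A) S"

definition unital_cstar_subalgebra :: "'a set \<Rightarrow> 'a cstar \<Rightarrow> bool" where
  "unital_cstar_subalgebra S A \<longleftrightarrow> cstar_subalgebra S A \<and> \<one>\<^bsub>A\<^esub> \<in> S"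

definition finite_dimensional :: "'a cstar \<Rightarrow> bool" where
  "finite_dimensional A \<longleftrightarrow>
     (\<exists>B. finite B \<and> B \<subseteq> carrier A \<and>
        (\<forall>x\<in>carrier A. \<exists>c :: 'a \<Rightarrow> complex. x = (\<Oplus>\<^bsub>A\<^esub>b\<in>B. c b \<odot>\<^bsub>A\<^esub> b)))"

text \<open>Units need not be preserved. Values off the carrier are irrelevant.\<close>

definition star_hom :: "'a cstar \<Rightarrow> 'b cstar \<Rightarrow> ('a \<Rightarrow> 'b) set" where
  "star_hom A B =
     {h. h \<in> carrier A \<rightarrow> carrier B \<and>
         (\<forall>x\<in>carrier A. \<forall>y\<in>carrier A. h (x \<oplus>\<^bsub>A\<^esub> y) = h x \<oplus>\<^bsub>B\<^esub> h y) \<and>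
         (\<forall>c. \<forall>x\<in>carrier A. h (c \<odot>\<^bsub>A\<^esub> x) = c \<odot>\<^bsub>B\<^esub> h x) \<and>
         (\<forall>x\<in>carrier A. \<forall>y\<in>carrier A. h (x \<otimes>\<^bsub>A\<^esub> y) = h x \<otimes>\<^bsub>B\<^esub> h y) \<and>
         (\<forall>x\<in>carrier A. h (star A x) = star B (h x))}"

definition unital_embedding :: "'a cstar \<Rightarrow> 'b cstar \<Rightarrow> ('a \<Rightarrow> 'b) \<Rightarrow> bool" where
  "unital_embedding A B h \<longleftrightarrow>
     h \<in> star_hom A B \<and> inj_on h (carrier A) \<and> h \<one>\<^bsub>A\<^esub> = \<one>\<^bsub>B\<^esub>"

section \<open>Residual finite-dimensionality and amalgamated free products\<close>

text \<open>
  Both definitions below quantify over target algebras. As HOL formulas cannot quantify over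
  types, the targets are all C*-algebras whose carrier is some set of complex sequences; the
  operations and the norm on that set are arbitrary and unrelated to sequences. Up to
  isomorphism these are all C*-algebras of cardinality at most the continuum, in particular
  all separable ones. This loses nothing: a finite-dimensional C*-algebra is separable,
  and *-homomorphisms from separable \<open>A\<close> and \<open>B\<close> into an arbitrary
  C*-algebra take values in the C*-subalgebra generated by their images, which is separable.
\<close>

type_synonym seq = "nat \<Rightarrow> complex"

definition rfd :: "'a cstar \<Rightarrow> bool" where
  "rfd R \<longleftrightarrow>
     cstar_algebra R \<and> separable_space (norm_topology R) \<and>
     (\<forall>x\<in>carrier R. x \<noteq> \<zero>\<^bsub>R\<^esub> \<longrightarrow>
        (\<exists>(F :: seq cstar) \<pi>. cstar_algebra F \<and> finite_dimensional F \<and>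
            \<pi> \<in> star_hom R F \<and> \<pi> x \<noteq> \<zero>\<^bsub>F\<^esub>))"

text \<open>
  \<open>amalgamated_free_product D A B \<psi>\<^sub>A \<psi>\<^sub>B C \<sigma>\<^sub>A \<sigma>\<^sub>B\<close>: the algebra \<open>C\<close> with the embeddings
  \<open>\<sigma>\<^sub>A\<close> and \<open>\<sigma>\<^sub>B\<close> is the unital full amalgamated free product of separable \<open>A\<close> and \<open>B\<close>
  over \<open>D\<close> with respect to \<open>\<psi>\<^sub>A\<close> and \<open>\<psi>\<^sub>B\<close>.
\<close>

locale amalgamated_free_product =
  D: unital_cstar_algebra D + A: unital_cstar_algebra A +
  B: unital_cstar_algebra B + C: unital_cstar_algebra C
  for D :: "'d cstar" and A :: "'a cstar" and B :: "'b cstar"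
    and \<psi>\<^sub>A :: "'d \<Rightarrow> 'a" and \<psi>\<^sub>B :: "'d \<Rightarrow> 'b"
    and C :: "'c cstar" and \<sigma>\<^sub>A :: "'a \<Rightarrow> 'c" and \<sigma>\<^sub>B :: "'b \<Rightarrow> 'c" +
  assumes separable_A: "separable_space (norm_topology A)"
    and separable_B: "separable_space (norm_topology B)"
    and embedding_\<psi>\<^sub>A: "unital_embedding D A \<psi>\<^sub>A"
    and embedding_\<psi>\<^sub>B: "unital_embedding D B \<psi>\<^sub>B"
    and embedding_\<sigma>\<^sub>A: "unital_embedding A C \<sigma>\<^sub>A"
    and embedding_\<sigma>\<^sub>B: "unital_embedding B C \<sigma>\<^sub>B"
    and amalgamated: "d \<in> carrier D \<Longrightarrow> \<sigma>\<^sub>A (\<psi>\<^sub>A d) = \<sigma>\<^sub>B (\<psi>\<^sub>B d)"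
    and generated: "\<lbrakk>cstar_subalgebra S C; \<sigma>\<^sub>A ` carrier A \<union> \<sigma>\<^sub>B ` carrier B \<subseteq> S\<rbrakk> \<Longrightarrow>
          S = carrier C"
    and universal: "\<And>(E :: seq cstar) \<pi>\<^sub>A \<pi>\<^sub>B.
          \<lbrakk>cstar_algebra E; \<pi>\<^sub>A \<in> star_hom A E; \<pi>\<^sub>B \<in> star_hom B E;
           \<forall>d\<in>carrier D. \<pi>\<^sub>A (\<psi>\<^sub>A d) = \<pi>\<^sub>B (\<psi>\<^sub>B d)\<rbrakk> \<Longrightarrow>
          \<exists>\<pi>\<in>star_hom C E. (\<forall>a\<in>carrier A. \<pi> (\<sigma>\<^sub>A a) = \<pi>\<^sub>A a) \<and> (\<forall>b\<in>carrier B. \<pi> (\<sigma>\<^sub>B b) = \<pi>\<^sub>B b)"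

end

theory Submission
  imports Defs
begin

text \<open>
  Take a positive functional \<open>q\<close> of the free product \<open>C\<close> with \<open>q (star y y) > 0\<close>. The two copies of \<open>A\<close> act on the
  GNS space of \<open>q\<close>. As \<open>A\<close> is RFD, a Hahn--Banach type argument approximates both actions, on finitely
  many vectors and elements, inside one finite-dimensional representation \<open>\<rho>\<close> of \<open>A\<close>: a vector \<open>v\<close> gets
  two orthogonal copies \<open>\<eta> True v\<close> and \<open>\<eta> False v\<close>, on which \<open>\<rho>\<close> imitates the first and the second
  action. A self-adjoint contraction \<open>c\<close> nearly exchanges the two copies. Both actions agree on \<open>D\<close>, so
  averaging \<open>c\<close> over \<open>D\<close> changes its effect on the copies only slightly and makes it commute with
  \<open>\<rho> D\<close>. The averaged contraction \<open>c'\<close> is dilated to a symmetry \<open>W = c' + P sqrt (1 - c'^2)\<close> in the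
  commutant of \<open>\<rho> D\<close>. Then \<open>\<rho>\<close> and \<open>W \<rho> W\<close> agree on \<open>D\<close> and induce a finite-dimensional
  representation of \<open>C\<close>; along the net of such models it converges on the vectors \<open>\<eta> True v\<close> to the
  GNS representation of \<open>q\<close>, hence some model does not kill \<open>y\<close>.
\<close>

section \<open>Identities and convergence in C*-algebras\<close>

text \<open>Approximating the two actions separately would give two representations of
  \<open>A\<close> whose restrictions to \<open>D\<close> need not be equivalent, since
  multiplicities may differ, and then they could not be glued. One \<open>\<rho>\<close> for both
  factors makes the restrictions equal from the start; it remains to twist the second factor by a
  symmetry in the commutant of \<open>\<rho> D\<close> that still exchanges the two kinds of
  vectors. The contraction \<open>c\<close> exchanges them but is neither unitary nor in the
  commutant. The sign \<open>P\<close>, which is 1 on the summands modelling the first action and -1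
  on the others, commutes with \<open>\<rho> A\<close> and anticommutes with \<open>c\<close>.
  Averaging over \<open>D\<close> keeps the anticommutation, which cancels the cross terms in
  \<open>W^2\<close>, so that no larger space is needed. Moreover \<open>W - c'\<close> is small
  exactly where \<open>c'\<close> nearly preserves norms, and it does so on the approximating
  vectors. The order theory of C*-algebras is derived from square roots obtained by iteration,
  without spectrum or functional calculus; the same lemmas serve \<open>A\<close>, \<open>C\<close>,
  \<open>D\<close> and the matrix algebras.\<close>

lemma complex_ring_simps [simp]:
  "carrier complex_ring = UNIV" "x \<otimes>\<^bsub>complex_ring\<^esub> y = x * y" "\<one>\<^bsub>complex_ring\<^esub> = 1"
  "\<zero>\<^bsub>complex_ring\<^esub> = 0" "x \<oplus>\<^bsub>complex_ring\<^esub> y = x + y"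
  by (simp_all add: complex_ring_def)

lemma cring_complex_ring: "cring complex_ring"
  by (rule cringI, rule abelian_groupI)
     (auto simp: algebra_simps intro!: comm_monoidI exI[where x = "- _"] intro: left_minus)

lemma complex_ring_minus [simp]: "\<ominus>\<^bsub>complex_ring\<^esub> x = - x"
proof -
  interpret cring complex_ring by (rule cring_complex_ring)
  show ?thesis by (rule minus_equality) auto
qed

text \<open>Continuity is deliberately not asked: these functionals act as coordinates. An equality
  of elements, a spanning property or an expansion in a basis is expressed by saying that all of
  them respect it.\<close>

definition lin :: "'a cstar \<Rightarrow> ('a \<Rightarrow> complex) \<Rightarrow> bool" where
  "lin A g \<longleftrightarrow> (\<forall>x\<in>carrier A. \<forall>y\<in>carrier A. g (x \<oplus>\<^bsub>A\<^esub> y) = g x + g y) \<and>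
     (\<forall>c. \<forall>x\<in>carrier A. g (c \<odot>\<^bsub>A\<^esub> x) = c * g x)"

context cstar_algebra
begin

lemmas closed [simp, intro] = mult_closed star_closed M.add.m_closed M.zero_closed M.minus_closed M.a_inv_closed

lemma smult_closed' [simp, intro]: "x \<in> carrier A \<Longrightarrow> c \<odot> x \<in> carrier A"
  by (simp add: smult_closed)

lemma smult_one' [simp]: "x \<in> carrier A \<Longrightarrow> 1 \<odot> x = x"
  using smult_one by simp

lemma smult_smult [simp]: "x \<in> carrier A \<Longrightarrow> c \<odot> (d \<odot> x) = (c * d) \<odot> x"
  using smult_assoc1[of c d x] by simp

lemma smult_add_left: "x \<in> carrier A \<Longrightarrow> (c + d) \<odot> x = c \<odot> x \<oplus> d \<odot> x"
  using smult_l_distr[of c d x] by simp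

lemma smult_add_right: "x \<in> carrier A \<Longrightarrow> y \<in> carrier A \<Longrightarrow> c \<odot> (x \<oplus> y) = c \<odot> x \<oplus> c \<odot> y"
  using smult_r_distr[of c x y] by simp

lemma smult_zero [simp]: "x \<in> carrier A \<Longrightarrow> 0 \<odot> x = \<zero>" "c \<odot> \<zero> = \<zero>"
  using smult_l_null[of x] smult_r_null[of c] by simp_all

lemma smult_m1: "x \<in> carrier A \<Longrightarrow> (-1) \<odot> x = \<ominus> x"
  using smult_l_minus[of 1 x] by simp

lemma mult_zero [simp]: "x \<in> carrier A \<Longrightarrow> x \<otimes> \<zero> = \<zero>" "x \<in> carrier A \<Longrightarrow> \<zero> \<otimes> x = \<zero>"
  using smult_mult_r[of x \<zero> 0] smult_mult_l[of \<zero> x 0] by simp_all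

lemma a_inv_zero [simp]: "\<ominus> \<zero> = \<zero>"
  using smult_m1[of \<zero>] by simp

lemma star_zero [simp]: "star A \<zero> = \<zero>"
  using star_smult[of \<zero> 0] by simp

lemma minus_eq_zero: "x \<in> carrier A \<Longrightarrow> y \<in> carrier A \<Longrightarrow> x \<ominus> y = \<zero> \<longleftrightarrow> x = y"
  by (metis M.add.inv_closed M.add.inv_inv M.r_neg M.minus_equality a_minus_def)

lemma star_a_inv: "x \<in> carrier A \<Longrightarrow> star A (\<ominus> x) = \<ominus> star A x"
  using star_smult[of x "-1"] by (simp add: smult_m1)

lemma star_minus: "x \<in> carrier A \<Longrightarrow> y \<in> carrier A \<Longrightarrow> star A (x \<ominus> y) = star A x \<ominus> star A y"
  by (simp add: a_minus_def star_add star_a_inv)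

lemma minus_mult_l: "\<lbrakk>x \<in> carrier A; y \<in> carrier A; z \<in> carrier A\<rbrakk> \<Longrightarrow> (x \<ominus> y) \<otimes> z = x \<otimes> z \<ominus> y \<otimes> z"
  using smult_mult_l[of y z "-1"] by (simp add: a_minus_def smult_m1 mult_l_distr)

lemma minus_mult_r: "\<lbrakk>x \<in> carrier A; y \<in> carrier A; z \<in> carrier A\<rbrakk> \<Longrightarrow> z \<otimes> (x \<ominus> y) = z \<otimes> x \<ominus> z \<otimes> y"
  using smult_mult_r[of z y "-1"] by (simp add: a_minus_def smult_m1 mult_r_distr)

lemma a_inv_mult_l: "\<lbrakk>x \<in> carrier A; z \<in> carrier A\<rbrakk> \<Longrightarrow> (\<ominus> x) \<otimes> z = \<ominus> (x \<otimes> z)"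
  using smult_mult_l[of x z "-1"] by (simp add: smult_m1)

lemma a_inv_mult_r: "\<lbrakk>x \<in> carrier A; z \<in> carrier A\<rbrakk> \<Longrightarrow> z \<otimes> (\<ominus> x) = \<ominus> (z \<otimes> x)"
  using smult_mult_r[of z x "-1"] by (simp add: smult_m1)

lemmas distrib = mult_l_distr mult_r_distr minus_mult_l minus_mult_r a_inv_mult_l a_inv_mult_r
  smult_mult_l smult_mult_r mult_assoc

lemmas star_simps = star_add star_minus star_a_inv star_smult star_mult star_star

section \<open>Algebraic linear functionals\<close>

lemma lin_add: "lin A g \<Longrightarrow> x \<in> carrier A \<Longrightarrow> y \<in> carrier A \<Longrightarrow> g (x \<oplus> y) = g x + g y"
  by (simp add: lin_def)

lemma lin_smult: "lin A g \<Longrightarrow> x \<in> carrier A \<Longrightarrow> g (c \<odot> x) = c * g x"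
  by (simp add: lin_def)

lemma lin_a_inv: "lin A g \<Longrightarrow> x \<in> carrier A \<Longrightarrow> g (\<ominus> x) = - g x"
  using lin_smult[of g x "-1"] by (simp add: smult_m1)

lemma lin_minus: "lin A g \<Longrightarrow> x \<in> carrier A \<Longrightarrow> y \<in> carrier A \<Longrightarrow> g (x \<ominus> y) = g x - g y"
  by (simp add: a_minus_def lin_add lin_a_inv)

lemma lin_zero: "lin A g \<Longrightarrow> g \<zero> = 0"
  using lin_smult[of g \<zero> 0] by simp

lemmas lin_simps = lin_add lin_smult lin_a_inv lin_minus lin_zero

lemma lin_mult_l: "lin A g \<Longrightarrow> y \<in> carrier A \<Longrightarrow> lin A (\<lambda>x. g (y \<otimes> x))"
  by (simp add: lin_def mult_r_distr smult_mult_r)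

lemma lin_mult_r: "lin A g \<Longrightarrow> y \<in> carrier A \<Longrightarrow> lin A (\<lambda>x. g (x \<otimes> y))"
  by (simp add: lin_def mult_l_distr smult_mult_l)

lemma lin_finsum: "lin A g \<Longrightarrow> finite I \<Longrightarrow> f \<in> I \<rightarrow> carrier A \<Longrightarrow> g (finsum A f I) = (\<Sum>i\<in>I. g (f i))"
proof (induction I arbitrary: f rule: infinite_finite_induct)
  case (insert i I)
  then have "finsum A f (insert i I) = f i \<oplus> finsum A f I" "finsum A f I \<in> carrier A"
    by (auto intro!: M.finsum_insert M.finsum_closed)
  then show ?case using insert by (auto simp: lin_add)
qed (auto simp: lin_zero)

text \<open>By Zorn there is a subspace \<open>U\<close> maximal among those that avoid
  \<open>x\<close>. Maximality makes \<open>U\<close> a complement of the line through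
  \<open>x\<close>, and the functional is the coefficient along that line.\<close>

lemma exists_lin:
  assumes "x \<in> carrier A" "x \<noteq> \<zero>"
  shows "\<exists>g. lin A g \<and> g x \<noteq> 0"
proof -
  define sub where "sub U \<longleftrightarrow> U \<subseteq> carrier A \<and> \<zero> \<in> U \<and> (\<forall>u\<in>U. \<forall>v\<in>U. u \<oplus> v \<in> U) \<and> (\<forall>c. \<forall>u\<in>U. c \<odot> u \<in> U)" for U
  define F where "F = {U. sub U \<and> x \<notin> U}"
  have "\<exists>U\<in>F. \<forall>X\<in>F. U \<subseteq> X \<longrightarrow> X = U"
  proof (rule subset_Zorn_nonempty)
    have "{\<zero>} \<in> F" using assms by (auto simp: F_def sub_def)
    then show "F \<noteq> {}" by blast
    fix C assume C: "C \<noteq> {}" "subset.chain F C"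
    then have CF: "C \<subseteq> F" and ch: "\<And>U V. U \<in> C \<Longrightarrow> V \<in> C \<Longrightarrow> U \<subseteq> V \<or> V \<subseteq> U"
      by (auto simp: subset.chain_def)
    have "u \<oplus> v \<in> \<Union>C" if uv: "u \<in> \<Union>C" "v \<in> \<Union>C" for u v
    proof -
      obtain U V where UV: "U \<in> C" "V \<in> C" "u \<in> U" "v \<in> V" using uv by blast
      then obtain W where "W \<in> C" "u \<in> W" "v \<in> W" using ch[of U V] by blast
      moreover have "sub W" using CF \<open>W \<in> C\<close> by (auto simp: F_def)
      ultimately show ?thesis by (auto simp: sub_def)
    qed
    moreover obtain U where "U \<in> C" using C(1) by blast
    moreover have "\<And>U. U \<in> C \<Longrightarrow> sub U \<and> x \<notin> U" using CF by (auto simp: F_def)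
    ultimately have "\<Union>C \<subseteq> carrier A" "\<zero> \<in> \<Union>C" "x \<notin> \<Union>C" "\<forall>c. \<forall>u\<in>\<Union>C. c \<odot> u \<in> \<Union>C"
        "\<forall>u\<in>\<Union>C. \<forall>v\<in>\<Union>C. u \<oplus> v \<in> \<Union>C"
      unfolding sub_def by blast+
    then show "\<Union>C \<in> F" by (simp add: F_def sub_def)
  qed
  then obtain U where U: "sub U" "x \<notin> U" and max: "\<And>V. sub V \<Longrightarrow> x \<notin> V \<Longrightarrow> U \<subseteq> V \<Longrightarrow> V = U"
    by (auto simp: F_def)
  have Uc: "U \<subseteq> carrier A" and U0: "\<zero> \<in> U" and Ua: "\<And>u v. u \<in> U \<Longrightarrow> v \<in> U \<Longrightarrow> u \<oplus> v \<in> U"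
    and Us: "\<And>c u. u \<in> U \<Longrightarrow> c \<odot> u \<in> U" using U(1) by (auto simp: sub_def)
  have Uc': "\<And>u. u \<in> U \<Longrightarrow> u \<in> carrier A" using Uc by blast
  note sa = smult_add_left smult_add_right
  \<comment> \<open>Adjoining a \<open>y\<close> outside \<open>U\<close> must capture
    \<open>x\<close>, by maximality; the resulting equation for \<open>x\<close> is then solved for
    \<open>y\<close>.\<close>
  have ex: "\<exists>t. y \<oplus> t \<odot> x \<in> U" if y: "y \<in> carrier A" for y
  proof (cases "y \<in> U")
    case True
    then show ?thesis using assms y by (intro exI[of _ 0]) simp
  next
    case False
    define V where "V = {u \<oplus> c \<odot> y |u c. u \<in> U}"
    have "sub V" unfolding sub_def
    proof (intro conjI ballI allI)
      show "V \<subseteq> carrier A" using Uc y by (auto simp: V_def)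
      show "\<zero> \<in> V" unfolding V_def using U0 y by (intro CollectI exI[of _ \<zero>] exI[of _ 0]) simp
      fix u assume "u \<in> V"
      then obtain u' c where u: "u = u' \<oplus> c \<odot> y" "u' \<in> U" by (auto simp: V_def)
      show "d \<odot> u \<in> V" for d
        unfolding V_def using u Us[of u' d] y Uc by (intro CollectI exI[of _ "d \<odot> u'"] exI[of _ "d * c"]) (auto simp: smult_add_right)
      fix v assume "v \<in> V"
      then obtain v' d where v: "v = v' \<oplus> d \<odot> y" "v' \<in> U" by (auto simp: V_def)
      show "u \<oplus> v \<in> V"
        unfolding V_def using u v Ua[of u' v'] y Uc'[of u'] Uc'[of v'] by (intro CollectI exI[of _ "u' \<oplus> v'"] exI[of _ "c + d"]) (auto simp: smult_add_left M.add.m_ac)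
    qed
    moreover have "U \<subseteq> V"
    proof
      fix u assume "u \<in> U"
      then have "u = u \<oplus> 0 \<odot> y" using y Uc'[of u] by simp
      then show "u \<in> V" unfolding V_def using \<open>u \<in> U\<close> by blast
    qed
    moreover have "y \<in> V"
      unfolding V_def using U0 y by (intro CollectI exI[of _ \<zero>] exI[of _ 1]) simp
    ultimately have "x \<in> V" using max[of V] False by blast
    then obtain u c where uc: "x = u \<oplus> c \<odot> y" "u \<in> U" by (auto simp: V_def)
    have "c \<noteq> 0" using uc U(2) y Uc by auto
    have "y \<oplus> (- 1 / c) \<odot> x = (- 1 / c) \<odot> u"
    proof -
      have "y \<oplus> (- 1 / c) \<odot> x = (- 1 / c) \<odot> u \<oplus> (y \<oplus> (- 1 / c * c) \<odot> y)"
        using uc y Uc'[of u] by (simp add: smult_add_right M.add.m_ac)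
      also have "y \<oplus> (- 1 / c * c) \<odot> y = \<zero>"
        using \<open>c \<noteq> 0\<close> y by (simp add: smult_m1 M.r_neg)
      finally show ?thesis using Uc'[OF uc(2)] by simp
    qed
    then show ?thesis using Us[OF uc(2)] by metis
  qed
  have uniq: "s = t" if y: "y \<in> carrier A" "y \<oplus> s \<odot> x \<in> U" "y \<oplus> t \<odot> x \<in> U" for y s t
  proof (rule ccontr)
    assume "s \<noteq> t"
    have "(y \<oplus> s \<odot> x) \<oplus> (-1) \<odot> (y \<oplus> t \<odot> x) = (y \<oplus> (-1) \<odot> y) \<oplus> (s \<odot> x \<oplus> (-t) \<odot> x)"
      using y assms by (simp add: smult_add_right M.add.m_ac)
    also have "\<dots> = (s - t) \<odot> x"
      using y assms smult_add_left[of y 1 "-1"] smult_add_left[of x s "-t"] by simp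
    finally have "(s - t) \<odot> x \<in> U" using Ua[OF y(2) Us[OF y(3), of "-1"]] by simp
    then have "(1 / (s - t)) \<odot> ((s - t) \<odot> x) \<in> U" by (rule Us)
    then show False using \<open>s \<noteq> t\<close> U(2) assms by simp
  qed
  \<comment> \<open>The sign is that of \<open>y = u - t x\<close> with \<open>u\<close> in
    \<open>U\<close>, whence \<open>g x = 1\<close>.\<close>
  define g where "g y = - (THE t. y \<oplus> t \<odot> x \<in> U)" for y
  have gI: "g y = - t" if "y \<in> carrier A" "y \<oplus> t \<odot> x \<in> U" for y t
    unfolding g_def using that uniq by (metis (mono_tags, lifting) the_equality)
  have "lin A g" unfolding lin_def
  proof (intro conjI ballI allI)
    fix y z assume yz: "y \<in> carrier A" "z \<in> carrier A"
    obtain s t where st: "y \<oplus> s \<odot> x \<in> U" "z \<oplus> t \<odot> x \<in> U" using ex yz by blast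
    have "(y \<oplus> z) \<oplus> (s + t) \<odot> x = (y \<oplus> s \<odot> x) \<oplus> (z \<oplus> t \<odot> x)"
      using yz assms by (simp add: smult_add_left M.add.m_ac)
    then have "g (y \<oplus> z) = - (s + t)" using Ua[OF st] yz by (intro gI) auto
    then show "g (y \<oplus> z) = g y + g z" using gI st yz by simp
  next
    fix c y assume y: "y \<in> carrier A"
    obtain s where s: "y \<oplus> s \<odot> x \<in> U" using ex y by blast
    have "c \<odot> y \<oplus> (c * s) \<odot> x = c \<odot> (y \<oplus> s \<odot> x)"
      using y assms by (simp add: smult_add_right)
    then have "g (c \<odot> y) = - (c * s)" using Us[OF s] y by (intro gI) auto
    then show "g (c \<odot> y) = c * g y" using gI s y by simp
  qed
  moreover have "g x = 1"
    using gI[of x "-1"] U0 assms by (simp add: smult_m1 M.r_neg)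
  ultimately show ?thesis by (intro exI[of _ g]) simp
qed

text \<open>Reduces an identity between elements to one between complex numbers, where \<open>algebra_simps\<close> applies.\<close>

lemma lin_eqI:
  assumes "x \<in> carrier A" "y \<in> carrier A" "\<And>g. lin A g \<Longrightarrow> g x = g y"
  shows "x = y"
proof (rule ccontr)
  assume "x \<noteq> y"
  then have "x \<ominus> y \<noteq> \<zero>" using assms minus_eq_zero by blast
  then obtain g where "lin A g" "g (x \<ominus> y) \<noteq> 0" using exists_lin[of "x \<ominus> y"] assms by auto
  then show False using assms by (simp add: lin_minus)
qed

lemma cnorm_zero [simp]: "cnorm A \<zero> = 0"
  by (simp add: cnorm_eq_0_iff)

lemma cnorm_a_inv: "x \<in> carrier A \<Longrightarrow> cnorm A (\<ominus> x) = cnorm A x"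
  using cnorm_smult[of x "-1"] by (simp add: smult_m1)

lemma cnorm_minus_commute: "x \<in> carrier A \<Longrightarrow> y \<in> carrier A \<Longrightarrow> cnorm A (x \<ominus> y) = cnorm A (y \<ominus> x)"
proof -
  assume xy: "x \<in> carrier A" "y \<in> carrier A"
  then have "x \<ominus> y = \<ominus> (y \<ominus> x)" by (intro lin_eqI) (auto simp: lin_simps)
  then show ?thesis using xy by (simp add: cnorm_a_inv)
qed

lemma cnorm_triangle3: "x \<in> carrier A \<Longrightarrow> y \<in> carrier A \<Longrightarrow> z \<in> carrier A \<Longrightarrow>
    cnorm A (x \<ominus> z) \<le> cnorm A (x \<ominus> y) + cnorm A (y \<ominus> z)"
proof -
  assume xyz: "x \<in> carrier A" "y \<in> carrier A" "z \<in> carrier A"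
  then have "x \<ominus> z = (x \<ominus> y) \<oplus> (y \<ominus> z)" by (intro lin_eqI) (auto simp: lin_simps)
  then show ?thesis using xyz by (simp add: cnorm_triangle)
qed

lemma cnorm_star: 
  assumes x: "x \<in> carrier A" shows "cnorm A (star A x) = cnorm A x"
proof -
  have le: "cnorm A y \<le> cnorm A (star A y)" if y: "y \<in> carrier A" for y
  proof (cases "cnorm A y = 0")
    case True
    then show ?thesis using y by (simp add: cnorm_nonneg)
  next
    case False
    have "(cnorm A y)\<^sup>2 \<le> cnorm A (star A y) * cnorm A y"
      using cstar_identity[OF y] cnorm_mult[of "star A y" y] y by simp
    then show ?thesis using False y cnorm_nonneg[OF y]
      by (simp add: power2_eq_square mult_le_cancel_right)
  qed
  show ?thesis using le[OF x] le[of "star A x"] x by (simp add: star_star)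
qed

lemma Metric_space: "Metric_space (carrier A) (cdist A)"
proof
  show "0 \<le> cdist A x y" for x y by (auto simp: cdist_def cnorm_nonneg)
  show "cdist A x y = cdist A y x" for x y by (auto simp: cdist_def cnorm_minus_commute)
  show "cdist A x y = 0 \<longleftrightarrow> x = y" if "x \<in> carrier A" "y \<in> carrier A" for x y
    using that by (simp add: cdist_def cnorm_eq_0_iff minus_eq_zero)
  show "cdist A x z \<le> cdist A x y + cdist A y z" if "x \<in> carrier A" "y \<in> carrier A" "z \<in> carrier A" for x y z
    using that by (simp add: cdist_def cnorm_triangle3)
qed

lemma Cauchy_limit:
  assumes x: "\<And>n. x n \<in> carrier A"
    and "\<And>e. e > 0 \<Longrightarrow> \<exists>N. \<forall>m\<ge>N. \<forall>n\<ge>N. cnorm A (x m \<ominus> x n) < e"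
  shows "\<exists>l\<in>carrier A. (\<lambda>n. cnorm A (x n \<ominus> l)) \<longlonglongrightarrow> 0"
proof -
  interpret Ms: Metric_space "carrier A" "cdist A" by (rule Metric_space)
  have "Ms.MCauchy x" using assms by (auto simp: Ms.MCauchy_def cdist_def)
  then obtain l where "limitin Ms.mtopology x l sequentially"
    using complete by (auto simp: Ms.mcomplete_def)
  then have "l \<in> carrier A" "(\<lambda>n. cdist A (x n) l) \<longlonglongrightarrow> 0"
    by (auto simp: Ms.limitin_metric_dist_null)
  then show ?thesis using x by (auto simp: cdist_def)
qed

lemma cnorm_diff_le: "x \<in> carrier A \<Longrightarrow> y \<in> carrier A \<Longrightarrow> cnorm A x \<le> cnorm A y + cnorm A (x \<ominus> y)"
proof -
  assume xy: "x \<in> carrier A" "y \<in> carrier A"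
  then have "x = y \<oplus> (x \<ominus> y)" by (intro lin_eqI) (auto simp: lin_simps)
  then show ?thesis using xy cnorm_triangle[of y "x \<ominus> y"] by simp
qed

lemma limit_unique:
  assumes "\<And>n. x n \<in> carrier A" "l \<in> carrier A" "k \<in> carrier A"
    "(\<lambda>n. cnorm A (x n \<ominus> l)) \<longlonglongrightarrow> 0" "(\<lambda>n. cnorm A (x n \<ominus> k)) \<longlonglongrightarrow> 0"
  shows "l = k"
proof -
  have "cnorm A (l \<ominus> k) \<le> 0"
  proof (rule LIMSEQ_le_const)
    show "(\<lambda>n. cnorm A (x n \<ominus> l) + cnorm A (x n \<ominus> k)) \<longlonglongrightarrow> 0" using tendsto_add[OF assms(4,5)] by simp
    show "\<exists>N. \<forall>n\<ge>N. cnorm A (l \<ominus> k) \<le> cnorm A (x n \<ominus> l) + cnorm A (x n \<ominus> k)"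
      using assms cnorm_triangle3[of l "x _" k] cnorm_minus_commute[of l "x _"] by (metis (full_types))
  qed
  then have "cnorm A (l \<ominus> k) = 0" using assms cnorm_nonneg[of "l \<ominus> k"] by simp
  then show ?thesis using assms by (simp add: cnorm_eq_0_iff minus_eq_zero)
qed

end

lemma mcompleteI:
  assumes "Metric_space (carrier A) (cdist A)"
    and "\<And>x. (\<And>n. x n \<in> carrier A) \<Longrightarrow> 
        (\<And>e. e > 0 \<Longrightarrow> \<exists>N. \<forall>m\<ge>N. \<forall>n\<ge>N. cnorm A (x m \<ominus>\<^bsub>A\<^esub> x n) < e) \<Longrightarrow>
        \<exists>l\<in>carrier A. (\<lambda>n. cnorm A (x n \<ominus>\<^bsub>A\<^esub> l)) \<longlonglongrightarrow> 0"
  shows "Metric_space.mcomplete (carrier A) (cdist A)"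
proof -
  interpret Ms: Metric_space "carrier A" "cdist A" by fact
  show ?thesis unfolding Ms.mcomplete_def
  proof (intro allI impI)
    fix x assume C: "Ms.MCauchy x"
    then have x: "\<And>n. x n \<in> carrier A" by (auto simp: Ms.MCauchy_def)
    then have "\<exists>l\<in>carrier A. (\<lambda>n. cnorm A (x n \<ominus>\<^bsub>A\<^esub> l)) \<longlonglongrightarrow> 0"
      using C by (intro assms(2)) (auto simp: Ms.MCauchy_def cdist_def)
    then obtain l where "l \<in> carrier A" "(\<lambda>n. cdist A (x n) l) \<longlonglongrightarrow> 0"
      using x by (auto simp: cdist_def)
    then have "limitin Ms.mtopology x l sequentially" using x by (auto simp: Ms.limitin_metric_dist_null)
    then show "\<exists>l. limitin Ms.mtopology x l sequentially" by blast
  qed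
qed

section \<open>Positive elements and square roots\<close>

definition self_adjoint :: "'a cstar \<Rightarrow> 'a \<Rightarrow> bool" where
  "self_adjoint A x \<longleftrightarrow> x \<in> carrier A \<and> star A x = x"

text \<open>A description of positivity that needs neither a spectrum nor a square root.\<close>

definition pos :: "'a cstar \<Rightarrow> 'a \<Rightarrow> bool" where
  "pos A h \<longleftrightarrow> self_adjoint A h \<and>
     (\<exists>t\<ge>0. cnorm A (complex_of_real t \<odot>\<^bsub>A\<^esub> \<one>\<^bsub>A\<^esub> \<ominus>\<^bsub>A\<^esub> h) \<le> t)"

text \<open>The limit \<open>s\<close> solves \<open>s = (k + s^2) / 2\<close>, that is, \<open>(1 - s)^2 = 1 - k\<close>.\<close>

primrec sqrt_iter :: "'a cstar \<Rightarrow> 'a \<Rightarrow> nat \<Rightarrow> 'a" where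
  "sqrt_iter A k 0 = \<zero>\<^bsub>A\<^esub>"
| "sqrt_iter A k (Suc n) = (1/2) \<odot>\<^bsub>A\<^esub> (k \<oplus>\<^bsub>A\<^esub> sqrt_iter A k n \<otimes>\<^bsub>A\<^esub> sqrt_iter A k n)"

text \<open>The same iteration for the number \<open>k = 1\<close>. It is increasing and bounded by
  1, and it majorizes the norms of the iterates as well as their increments.\<close>

primrec sqrt_bound :: "nat \<Rightarrow> real" where
  "sqrt_bound 0 = 0"
| "sqrt_bound (Suc n) = (1 + (sqrt_bound n)\<^sup>2) / 2"

lemma sqrt_bound_le_1: "0 \<le> sqrt_bound n \<and> sqrt_bound n \<le> 1"
  by (induction n) (auto simp: power_le_one_iff add_nonneg_nonneg)

lemma sqrt_bound_mono: "m \<le> n \<Longrightarrow> sqrt_bound m \<le> sqrt_bound n"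
proof (rule lift_Suc_mono_le[of sqrt_bound])
  fix n
  have "0 \<le> (1 - sqrt_bound n)\<^sup>2" by simp
  then show "sqrt_bound n \<le> sqrt_bound (Suc n)" by (simp add: power2_eq_square algebra_simps)
qed

context unital_cstar_algebra
begin

lemmas unit [simp, intro] = unit_closed unit_l unit_r

lemma star_one [simp]: "star A \<one> = \<one>"
proof -
  have "star A (star A \<one> \<otimes> \<one>) = star A \<one> \<otimes> \<one>"
    by (subst star_mult) (auto simp: star_star)
  then show ?thesis by (simp add: star_star)
qed

lemma cnorm_one_le: "cnorm A \<one> \<le> 1"
  using cstar_identity[of \<one>] cnorm_nonneg[of \<one>] by (auto simp: power2_eq_square)

lemma cnorm_scalar_le: "cnorm A (c \<odot> \<one>) \<le> cmod c"
  using cnorm_one_le by (simp add: cnorm_smult mult_left_le)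

text \<open>The majorant method. All iterates are polynomials in \<open>k\<close> and commute, so
  the difference of consecutive squares factors as \<open>(a + b)(a - b)\<close>; the increments
  thus obey the recursion of the scalar sequence, with an inequality.\<close>

lemma sqrt_iter:
  assumes k: "k \<in> carrier A" "star A k = k" "cnorm A k \<le> 1"
  defines "s \<equiv> sqrt_iter A k"
  shows sqrt_iter_closed: "s n \<in> carrier A"
    and sqrt_iter_star: "star A (s n) = s n"
    and sqrt_iter_commute: "z \<in> carrier A \<Longrightarrow> z \<otimes> k = k \<otimes> z \<Longrightarrow> z \<otimes> s n = s n \<otimes> z"
    and sqrt_iter_norm: "cnorm A (s n) \<le> sqrt_bound n"
    and sqrt_iter_diff: "n \<le> m \<Longrightarrow> cnorm A (s m \<ominus> s n) \<le> sqrt_bound m - sqrt_bound n"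
proof -
  show cl: "s n \<in> carrier A" for n unfolding s_def using k by (induction n) auto
  show "star A (s n) = s n" for n 
    using k cl by (induction n) (auto simp: s_def star_simps)
  show com: "z \<otimes> s n = s n \<otimes> z" if z: "z \<in> carrier A" "z \<otimes> k = k \<otimes> z" for z n
  proof (induction n)
    case 0
    then show ?case using z by (simp add: s_def)
  next
    case (Suc n)
    have "z \<otimes> (s n \<otimes> s n) = (s n \<otimes> s n) \<otimes> z"
      using Suc z cl[of n] mult_assoc by metis
    then show ?case using z k(1) cl[of n] by (simp add: s_def smult_mult_l smult_mult_r mult_l_distr mult_r_distr)
  qed
  have com2: "s m \<otimes> s n = s n \<otimes> s m" for m n
    using com[of "s m" n] com[of k m] cl k(1) by simp
  show nrm: "cnorm A (s n) \<le> sqrt_bound n" for n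
  proof (induction n)
    case (Suc n)
    have "cnorm A (s n \<otimes> s n) \<le> (sqrt_bound n)\<^sup>2"
      using cnorm_mult[OF cl[of n] cl[of n]] mult_mono[OF Suc Suc] cnorm_nonneg[OF cl[of n]] sqrt_bound_le_1[of n]
      by (simp add: power2_eq_square)
    then show ?case using cnorm_triangle[of k "s n \<otimes> s n"] k cl[of n] by (simp add: s_def cnorm_smult)
  qed (simp add: s_def)
  have step: "cnorm A (s (Suc n) \<ominus> s n) \<le> sqrt_bound (Suc n) - sqrt_bound n" for n
  proof (induction n)
    case 0
    have "s (Suc 0) \<ominus> s 0 = (1/2) \<odot> k" using k by (intro lin_eqI) (auto simp: lin_simps s_def)
    then show ?case using k by (simp add: cnorm_smult)
  next
    case (Suc n)
    define a where "a = s (Suc n)"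
    define b where "b = s n"
    have ab: "a \<in> carrier A" "b \<in> carrier A" "b \<otimes> a = a \<otimes> b" using cl com2 by (auto simp: a_def b_def)
    have "s (Suc (Suc n)) = (1/2) \<odot> (k \<oplus> a \<otimes> a)" "s (Suc n) = (1/2) \<odot> (k \<oplus> b \<otimes> b)"
      by (simp_all add: s_def a_def b_def)
    then have "s (Suc (Suc n)) \<ominus> s (Suc n) = (1/2) \<odot> ((a \<oplus> b) \<otimes> (a \<ominus> b))"
      using ab k by (intro lin_eqI) (auto simp: lin_simps distrib algebra_simps)
    then have "cnorm A (s (Suc (Suc n)) \<ominus> s (Suc n)) \<le> (cnorm A (a \<oplus> b) * cnorm A (a \<ominus> b)) / 2"
      using ab cnorm_mult[of "a \<oplus> b" "a \<ominus> b"] by (simp add: cnorm_smult)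
    also have "\<dots> \<le> ((sqrt_bound (Suc n) + sqrt_bound n) * (sqrt_bound (Suc n) - sqrt_bound n)) / 2"
    proof -
      have "cnorm A (a \<oplus> b) \<le> sqrt_bound (Suc n) + sqrt_bound n"
        using cnorm_triangle[OF ab(1,2)] nrm[of n] nrm[of "Suc n"] unfolding a_def b_def by linarith
      moreover have "cnorm A (a \<ominus> b) \<le> sqrt_bound (Suc n) - sqrt_bound n" using Suc by (simp add: a_def b_def)
      ultimately show ?thesis using ab cnorm_nonneg[of "a \<ominus> b"] sqrt_bound_le_1[of n] sqrt_bound_le_1[of "Suc n"]
        by (intro divide_right_mono mult_mono) auto
    qed
    also have "\<dots> = sqrt_bound (Suc (Suc n)) - sqrt_bound (Suc n)"
      unfolding sqrt_bound.simps(2)[of "Suc n"] sqrt_bound.simps(2)[of n] by (simp add: power2_eq_square field_simps)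
    finally show ?case .
  qed
  show "cnorm A (s m \<ominus> s n) \<le> sqrt_bound m - sqrt_bound n" if "n \<le> m" for m n
    using that
  proof (induction m rule: dec_induct)
    case base
    then show ?case using cl[of n] by (simp add: minus_eq_zero[THEN iffD2])
  next
    case (step m)
    then show ?case using cnorm_triangle3[OF cl[of "Suc m"] cl[of m] cl[of n]] \<open>\<And>n. cnorm A (s (Suc n) \<ominus> s n) \<le> _\<close>[of m] by linarith
  qed
qed

text \<open>The scalar majorant converges, so the iterates form a Cauchy sequence. Self-adjointness,
  the bound 1 and commutation pass to the limit, and the fixed-point equation of the limit is the
  quadratic equation for \<open>1 - s\<close>.\<close>

lemma sqrt_one_minus:
  assumes k: "k \<in> carrier A" "star A k = k" "cnorm A k \<le> 1"
  shows "\<exists>s\<in>carrier A. star A s = s \<and> cnorm A s \<le> 1 \<and> (\<one> \<ominus> s) \<otimes> (\<one> \<ominus> s) = \<one> \<ominus> k \<and>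
     (\<forall>z\<in>carrier A. z \<otimes> k = k \<otimes> z \<longrightarrow> z \<otimes> s = s \<otimes> z)"
proof -
  define s where "s = sqrt_iter A k"
  note s = sqrt_iter[OF k, folded s_def]
  have "Bseq sqrt_bound" using sqrt_bound_le_1 by (intro BseqI'[of _ 1]) auto
  then have "convergent sqrt_bound" 
    by (intro Bseq_monoseq_convergent) (auto simp: monoseq_def sqrt_bound_mono)
  then have C: "Cauchy sqrt_bound" by (simp add: convergent_Cauchy)
  have "\<exists>N. \<forall>m\<ge>N. \<forall>n\<ge>N. cnorm A (s m \<ominus> s n) < e" if "e > 0" for e
  proof -
    obtain N where N: "\<And>m n. m \<ge> N \<Longrightarrow> n \<ge> N \<Longrightarrow> \<bar>sqrt_bound m - sqrt_bound n\<bar> < e"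
      using CauchyD[OF C \<open>e > 0\<close>] by auto
    have "cnorm A (s m \<ominus> s n) < e" if "m \<ge> N" "n \<ge> N" for m n
      using s(5)[of n m] s(5)[of m n] N[OF that] N[OF that(2,1)] cnorm_minus_commute[OF s(1) s(1), of n m]
      by (cases "n \<le> m") auto
    then show ?thesis by blast
  qed
  then obtain l where l: "l \<in> carrier A" and lim: "(\<lambda>n. cnorm A (s n \<ominus> l)) \<longlonglongrightarrow> 0"
    using Cauchy_limit[of s] s(1) by blast
  have ln: "cnorm A l \<le> 1"
  proof (rule LIMSEQ_le_const)
    show "(\<lambda>n. 1 + cnorm A (s n \<ominus> l)) \<longlonglongrightarrow> 1" using tendsto_add[OF tendsto_const lim, of 1] by simp
    show "\<exists>N. \<forall>n\<ge>N. cnorm A l \<le> 1 + cnorm A (s n \<ominus> l)"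
      using cnorm_diff_le[OF l s(1)] cnorm_minus_commute[OF l s(1)] s(4) sqrt_bound_le_1
      by (intro exI[of _ 0] allI impI) (smt (verit))
  qed
  have lstar: "star A l = l"
  proof (rule limit_unique)
    have "cnorm A (s n \<ominus> star A l) = cnorm A (s n \<ominus> l)" for n
      using cnorm_star[of "s n \<ominus> l"] s(1,2)[of n] l by (simp add: star_simps)
    then show "(\<lambda>n. cnorm A (s n \<ominus> star A l)) \<longlonglongrightarrow> 0" using lim by simp
  qed (use l s lim in auto)
  have lcom: "z \<otimes> l = l \<otimes> z" if z: "z \<in> carrier A" "z \<otimes> k = k \<otimes> z" for z
  proof (rule limit_unique)
    show "(\<lambda>n. cnorm A (z \<otimes> s n \<ominus> z \<otimes> l)) \<longlonglongrightarrow> 0"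
    proof (rule tendsto_sandwich[OF _ _ tendsto_const])
      show "(\<lambda>n. cnorm A z * cnorm A (s n \<ominus> l)) \<longlonglongrightarrow> 0" using tendsto_mult_right_zero[OF lim] .
      show "\<forall>\<^sub>F n in sequentially. cnorm A (z \<otimes> s n \<ominus> z \<otimes> l) \<le> cnorm A z * cnorm A (s n \<ominus> l)"
        using cnorm_mult[of z "s _ \<ominus> l"] z s(1) l by (auto simp: minus_mult_r)
    qed (use z l s(1) in \<open>auto intro!: cnorm_nonneg always_eventually\<close>)
    show "(\<lambda>n. cnorm A (z \<otimes> s n \<ominus> l \<otimes> z)) \<longlonglongrightarrow> 0"
    proof (rule tendsto_sandwich[OF _ _ tendsto_const])
      show "(\<lambda>n. cnorm A (s n \<ominus> l) * cnorm A z) \<longlonglongrightarrow> 0" using tendsto_mult_left_zero[OF lim] .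
      show "\<forall>\<^sub>F n in sequentially. cnorm A (z \<otimes> s n \<ominus> l \<otimes> z) \<le> cnorm A (s n \<ominus> l) * cnorm A z"
        using cnorm_mult[of "s _ \<ominus> l" z] z s(1) l s(3)[OF z] by (auto simp: minus_mult_l)
    qed (use z l s(1) in \<open>auto intro!: cnorm_nonneg always_eventually\<close>)
  qed (use z l s in auto)
  have fix_l: "l = (1/2) \<odot> (k \<oplus> l \<otimes> l)"
  proof (rule limit_unique)
    show "(\<lambda>n. cnorm A (s (Suc n) \<ominus> l)) \<longlonglongrightarrow> 0" using lim by (rule LIMSEQ_Suc)
    \<comment> \<open>The images of \<open>s n\<close> and \<open>l\<close> under the iteration are
      no farther apart than \<open>s n\<close> and \<open>l\<close>, because both have norm at most
      1; so the iterates also tend to the image of \<open>l\<close>.\<close>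
    have *: "cnorm A (s (Suc n) \<ominus> (1/2) \<odot> (k \<oplus> l \<otimes> l)) \<le> cnorm A (s n \<ominus> l)" for n
    proof -
      have "s (Suc n) \<ominus> (1/2) \<odot> (k \<oplus> l \<otimes> l) = (1/2) \<odot> (s n \<otimes> (s n \<ominus> l) \<oplus> (s n \<ominus> l) \<otimes> l)"
        using s(1)[of n] k l by (intro lin_eqI) (auto simp: lin_simps distrib s_def algebra_simps)
      then have "cnorm A (s (Suc n) \<ominus> (1/2) \<odot> (k \<oplus> l \<otimes> l)) \<le>
         (cnorm A (s n) * cnorm A (s n \<ominus> l) + cnorm A (s n \<ominus> l) * cnorm A l) / 2"
        using cnorm_triangle[of "s n \<otimes> (s n \<ominus> l)" "(s n \<ominus> l) \<otimes> l"] cnorm_mult[of "s n" "s n \<ominus> l"]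
          cnorm_mult[of "s n \<ominus> l" l] s(1)[of n] l by (simp add: cnorm_smult)
      also have "\<dots> \<le> (1 * cnorm A (s n \<ominus> l) + cnorm A (s n \<ominus> l) * 1) / 2"
        using ln s(1)[of n] s(4)[of n] sqrt_bound_le_1[of n] l cnorm_nonneg[of "s n \<ominus> l"]
        by (intro divide_right_mono add_mono mult_right_mono mult_left_mono) auto
      finally show ?thesis by simp
    qed
    show "(\<lambda>n. cnorm A (s (Suc n) \<ominus> (1/2) \<odot> (k \<oplus> l \<otimes> l))) \<longlonglongrightarrow> 0"
      by (rule tendsto_sandwich[OF _ _ tendsto_const lim]) 
        (use * k l s(1) in \<open>auto intro!: cnorm_nonneg always_eventually\<close>)
  qed (use l k s in auto)
  have "(\<one> \<ominus> l) \<otimes> (\<one> \<ominus> l) = \<one> \<ominus> k"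
  proof (rule lin_eqI)
    fix g assume g: "lin A g"
    have "g l = (1/2) * (g k + g (l \<otimes> l))" using arg_cong[OF fix_l, of g] g k l by (simp add: lin_simps)
    then have "g (l \<otimes> l) = 2 * g l - g k" by (simp add: field_simps)
    then show "g ((\<one> \<ominus> l) \<otimes> (\<one> \<ominus> l)) = g (\<one> \<ominus> k)" using g l k by (simp add: lin_simps distrib)
  qed (use l k in auto)
  then show ?thesis using l ln lstar lcom by blast
qed

section \<open>Order and norm\<close>

lemma pos_self_adjoint: "pos A x \<Longrightarrow> self_adjoint A x" by (simp add: pos_def)

lemma pos_closed: "pos A x \<Longrightarrow> x \<in> carrier A" by (simp add: pos_def self_adjoint_def)

lemma pos_star: "pos A x \<Longrightarrow> star A x = x" by (simp add: pos_def self_adjoint_def)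

lemma pos_scalar_minus:
  assumes "self_adjoint A h" "cnorm A h \<le> M"
  shows "pos A (complex_of_real M \<odot> \<one> \<ominus> h)"
proof -
  have h: "h \<in> carrier A" "star A h = h" using assms by (auto simp: self_adjoint_def)
  have "complex_of_real M \<odot> \<one> \<ominus> (complex_of_real M \<odot> \<one> \<ominus> h) = h"
    using h by (intro lin_eqI) (auto simp: lin_simps)
  moreover have "0 \<le> M" using assms cnorm_nonneg h(1) order_trans by blast
  ultimately show ?thesis using h assms by (auto simp: pos_def self_adjoint_def star_simps)
qed

lemma pos_add:
  assumes "pos A h" "pos A k" shows "pos A (h \<oplus> k)"
proof -
  obtain t u where tu: "t \<ge> 0" "u \<ge> 0" "cnorm A (complex_of_real t \<odot> \<one> \<ominus> h) \<le> t"
    "cnorm A (complex_of_real u \<odot> \<one> \<ominus> k) \<le> u" using assms by (auto simp: pos_def)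
  have c: "h \<in> carrier A" "k \<in> carrier A" using assms by (auto dest: pos_closed)
  have "complex_of_real (t + u) \<odot> \<one> \<ominus> (h \<oplus> k) = (complex_of_real t \<odot> \<one> \<ominus> h) \<oplus> (complex_of_real u \<odot> \<one> \<ominus> k)"
    using c by (intro lin_eqI) (auto simp: lin_simps algebra_simps)
  then have "cnorm A (complex_of_real (t + u) \<odot> \<one> \<ominus> (h \<oplus> k)) \<le> t + u"
    using tu c cnorm_triangle[of "complex_of_real t \<odot> \<one> \<ominus> h" "complex_of_real u \<odot> \<one> \<ominus> k"] by simp
  then show ?thesis using tu c assms unfolding pos_def self_adjoint_def by (auto simp: star_simps intro!: exI[of _ "t + u"])
qed

lemma pos_smult:
  assumes "pos A h" "0 \<le> c" shows "pos A (complex_of_real c \<odot> h)"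
proof -
  obtain t where t: "t \<ge> 0" "cnorm A (complex_of_real t \<odot> \<one> \<ominus> h) \<le> t"
    using assms by (auto simp: pos_def)
  have h: "h \<in> carrier A" using assms by (auto dest: pos_closed)
  have "complex_of_real (c * t) \<odot> \<one> \<ominus> (complex_of_real c \<odot> h) = complex_of_real c \<odot> (complex_of_real t \<odot> \<one> \<ominus> h)"
    using h by (intro lin_eqI) (auto simp: lin_simps algebra_simps)
  then have "cnorm A (complex_of_real (c * t) \<odot> \<one> \<ominus> (complex_of_real c \<odot> h)) \<le> c * t"
    using t h assms by (simp add: cnorm_smult mult_left_mono)
  then show ?thesis using t h assms unfolding pos_def self_adjoint_def by (auto simp: star_simps intro!: exI[of _ "c * t"])
qed

lemma pos_zero: "pos A \<zero>"
  by (auto simp: pos_def self_adjoint_def a_minus_def intro!: exI[of _ 0])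

lemma pos_scalar: "0 \<le> c \<Longrightarrow> pos A (complex_of_real c \<odot> \<one>)"
  using pos_scalar_minus[of \<zero> c] by (simp add: self_adjoint_def a_minus_def)

text \<open>If \<open>t > 0\<close> witnesses positivity, \<open>k = 1 - h / t\<close> is a
  contraction, so \<open>1 - k = h / t\<close> has a root, and \<open>sqrt t\<close> times it is a
  root of \<open>h\<close>. The clause that the root commutes with everything commuting with
  \<open>h\<close> replaces functional calculus in all that follows.\<close>

lemma pos_sqrt:
  assumes "pos A h"
  shows "\<exists>s. self_adjoint A s \<and> pos A s \<and> s \<otimes> s = h \<and> (\<forall>z\<in>carrier A. z \<otimes> h = h \<otimes> z \<longrightarrow> z \<otimes> s = s \<otimes> z)"
proof -
  obtain t where t: "t \<ge> 0" "cnorm A (complex_of_real t \<odot> \<one> \<ominus> h) \<le> t" using assms by (auto simp: pos_def)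
  have h: "h \<in> carrier A" "star A h = h" using assms by (auto simp: pos_def self_adjoint_def)
  show ?thesis
  proof (cases "t = 0")
    case True
    then have "cnorm A (\<ominus> h) = 0" using t h cnorm_nonneg[of "\<ominus> h"] by (simp add: a_minus_def)
    then have "h = \<zero>" using h by (simp add: cnorm_a_inv cnorm_eq_0_iff)
    then show ?thesis using pos_zero by (intro exI[of _ \<zero>]) (auto simp: pos_self_adjoint)
  next
    case False
    then have t0: "t > 0" using t by simp
    define k where "k = \<one> \<ominus> complex_of_real (1/t) \<odot> h"
    have kc: "k \<in> carrier A" "star A k = k" using h by (auto simp: k_def star_simps)
    have "k = complex_of_real (1/t) \<odot> (complex_of_real t \<odot> \<one> \<ominus> h)"
      unfolding k_def using h t0 by (intro lin_eqI) (auto simp: lin_simps algebra_simps)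
    then have "cnorm A k = cnorm A (complex_of_real t \<odot> \<one> \<ominus> h) / t" using h t0 
      by (simp add: cnorm_smult norm_divide)
    then have "cnorm A k \<le> 1" using t t0 by simp
    then obtain s where s: "s \<in> carrier A" "star A s = s" "cnorm A s \<le> 1" "(\<one> \<ominus> s) \<otimes> (\<one> \<ominus> s) = \<one> \<ominus> k"
      "\<And>z. z \<in> carrier A \<Longrightarrow> z \<otimes> k = k \<otimes> z \<Longrightarrow> z \<otimes> s = s \<otimes> z" using sqrt_one_minus[OF kc] by blast
    define r where "r = complex_of_real (sqrt t) \<odot> (\<one> \<ominus> s)"
    have "pos A (\<one> \<ominus> s)" using pos_scalar_minus[of s 1] s by (simp add: self_adjoint_def)
    then have "pos A r" using pos_smult[of "\<one> \<ominus> s" "sqrt t"] t by (simp add: r_def)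
    moreover have "r \<otimes> r = h"
    proof -
      have "r \<otimes> r = complex_of_real (sqrt t * sqrt t) \<odot> ((\<one> \<ominus> s) \<otimes> (\<one> \<ominus> s))"
        using s(1) unfolding of_real_mult by (simp add: r_def smult_mult_l smult_mult_r)
      also have "\<dots> = complex_of_real t \<odot> (\<one> \<ominus> k)" using t s(4) by (simp del: of_real_mult)
      also have "\<dots> = h" unfolding k_def using h t0 by (intro lin_eqI) (auto simp: lin_simps)
      finally show ?thesis .
    qed
    moreover have "z \<otimes> r = r \<otimes> z" if z: "z \<in> carrier A" "z \<otimes> h = h \<otimes> z" for z
    proof -
      have "z \<otimes> k = k \<otimes> z" using z h by (simp add: k_def minus_mult_l minus_mult_r smult_mult_l smult_mult_r)
      then have "z \<otimes> s = s \<otimes> z" using s(5) z by simp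
      then show ?thesis using z s(1) by (simp add: r_def minus_mult_l minus_mult_r smult_mult_l smult_mult_r)
    qed
    ultimately show ?thesis by (auto intro!: exI[of _ r] simp: pos_self_adjoint)
  qed
qed

text \<open>For commuting self-adjoint \<open>a\<close> and \<open>b\<close> the identity says that \<open>a + i b\<close> is a multiple of a unitary.\<close>

lemma cnorm_le_of_sum_squares:
  assumes "self_adjoint A a" "self_adjoint A b" "a \<otimes> b = b \<otimes> a"
    "a \<otimes> a \<oplus> b \<otimes> b = complex_of_real M \<odot> \<one>" "0 \<le> M"
  shows "(cnorm A a)\<^sup>2 \<le> M"
proof -
  have c: "a \<in> carrier A" "b \<in> carrier A" "star A a = a" "star A b = b" using assms by (auto simp: self_adjoint_def)
  define u where "u = a \<oplus> \<i> \<odot> b"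
  have u: "u \<in> carrier A" using c by (simp add: u_def)
  have "star A u \<otimes> u = a \<otimes> a \<oplus> b \<otimes> b"
    using c assms(3) by (intro lin_eqI) (auto simp: lin_simps u_def star_simps distrib algebra_simps)
  then have "(cnorm A u)\<^sup>2 \<le> M" using cstar_identity[OF u] cnorm_scalar_le[of "complex_of_real M"] assms by simp
  moreover have "a = (1/2) \<odot> (u \<oplus> star A u)"
    using c by (intro lin_eqI) (auto simp: lin_simps u_def star_simps)
  then have "cnorm A a \<le> cnorm A u" 
    using cnorm_triangle[of u "star A u"] u cnorm_star[OF u] by (simp add: cnorm_smult)
  then have "(cnorm A a)\<^sup>2 \<le> (cnorm A u)\<^sup>2" using cnorm_nonneg c(1) by (intro power_mono) auto
  ultimately show ?thesis by simp
qed

lemma cnorm_square: "self_adjoint A a \<Longrightarrow> cnorm A (a \<otimes> a) = (cnorm A a)\<^sup>2"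
  using cstar_identity[of a] by (simp add: self_adjoint_def)

lemma self_adjoint_square: "self_adjoint A a \<Longrightarrow> self_adjoint A (a \<otimes> a)"
  by (simp add: self_adjoint_def star_mult)

text \<open>Let \<open>b\<close> be the root of \<open>M - a^2\<close>. It commutes with
  \<open>a\<close>, and \<open>b^2 + a^2 = M\<close>, so \<open>cnorm_le_of_sum_squares\<close>
  bounds the norm of \<open>b^2\<close>. This is what makes squares positive in the sense of
  \<open>pos\<close>.\<close>

lemma cnorm_scalar_minus_square:
  assumes a: "self_adjoint A a" "(cnorm A a)\<^sup>2 \<le> M"
  shows "cnorm A (complex_of_real M \<odot> \<one> \<ominus> a \<otimes> a) \<le> M"
proof -
  have ac: "a \<in> carrier A" using a by (simp add: self_adjoint_def)
  have "pos A (complex_of_real M \<odot> \<one> \<ominus> a \<otimes> a)"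
    using a by (intro pos_scalar_minus) (auto simp: self_adjoint_square cnorm_square)
  from pos_sqrt[OF this] obtain b where b: "self_adjoint A b" "b \<otimes> b = complex_of_real M \<odot> \<one> \<ominus> a \<otimes> a"
    "\<And>z. z \<in> carrier A \<Longrightarrow> z \<otimes> (complex_of_real M \<odot> \<one> \<ominus> a \<otimes> a) = (complex_of_real M \<odot> \<one> \<ominus> a \<otimes> a) \<otimes> z \<Longrightarrow> z \<otimes> b = b \<otimes> z"
    by blast
  have "a \<otimes> b = b \<otimes> a" using ac by (intro b(3)) (auto simp: distrib)
  moreover have "b \<otimes> b \<oplus> a \<otimes> a = complex_of_real M \<odot> \<one>" 
    using ac b(2) by (intro lin_eqI) (auto simp: lin_simps)
  moreover have "0 \<le> M" using a(2) order_trans[OF zero_le_power2] by blast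
  ultimately have "(cnorm A b)\<^sup>2 \<le> M" using cnorm_le_of_sum_squares[of b a M] a b by simp
  then show ?thesis using cnorm_square[OF b(1)] b(2) by simp
qed

lemma pos_square: "self_adjoint A a \<Longrightarrow> pos A (a \<otimes> a)"
  unfolding pos_def[of A "a \<otimes> a"] using cnorm_scalar_minus_square[of a "(cnorm A a)\<^sup>2"] self_adjoint_square zero_le_power2 by blast

text \<open>Roots \<open>a\<close> of \<open>h\<close> and \<open>b\<close> of \<open>M - h\<close>
  commute and satisfy \<open>a^2 + b^2 = M\<close>, which bounds the norm of \<open>a^2 = h\<close>.
  So order controls the norm, although \<open>pos\<close> only speaks of some unspecified
  \<open>t\<close>.\<close>

lemma cnorm_le_of_pos:
  assumes h: "pos A h" "pos A (complex_of_real M \<odot> \<one> \<ominus> h)" "0 \<le> M"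
  shows "cnorm A h \<le> M"
proof -
  have hc: "h \<in> carrier A" using h pos_closed by blast
  obtain a where a: "self_adjoint A a" "a \<otimes> a = h" using pos_sqrt[OF h(1)] by blast
  obtain b where b: "self_adjoint A b" "b \<otimes> b = complex_of_real M \<odot> \<one> \<ominus> h" 
    "\<And>z. z \<in> carrier A \<Longrightarrow> z \<otimes> (complex_of_real M \<odot> \<one> \<ominus> h) = (complex_of_real M \<odot> \<one> \<ominus> h) \<otimes> z \<Longrightarrow> z \<otimes> b = b \<otimes> z"
    using pos_sqrt[OF h(2)] by blast
  have ac: "a \<in> carrier A" using a by (simp add: self_adjoint_def)
  have "a \<otimes> b = b \<otimes> a" using ac a(2)[symmetric] by (intro b(3)) (auto simp: distrib)
  moreover have "a \<otimes> a \<oplus> b \<otimes> b = complex_of_real M \<odot> \<one>" 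
    using hc a(2) b(2) by (intro lin_eqI) (auto simp: lin_simps)
  ultimately have "(cnorm A a)\<^sup>2 \<le> M" using cnorm_le_of_sum_squares[of a b M] a b h(3) by simp
  then show ?thesis using cnorm_square[OF a(1)] a(2) by simp
qed

lemma pos_antisym: "pos A h \<Longrightarrow> pos A (\<ominus> h) \<Longrightarrow> h = \<zero>"
  using cnorm_le_of_pos[of h 0] pos_closed[of h] cnorm_nonneg[of h] by (simp add: a_minus_def cnorm_eq_0_iff)

lemma cnorm_mono:
  assumes "pos A a" "pos A (b \<ominus> a)" "b \<in> carrier A"
  shows "cnorm A a \<le> cnorm A b"
proof -
  have ac: "a \<in> carrier A" using assms pos_closed by blast
  have "b = a \<oplus> (b \<ominus> a)" using assms ac by (intro lin_eqI) (auto simp: lin_simps)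
  then have "self_adjoint A b" using pos_add[OF assms(1,2)] pos_self_adjoint by metis
  then have "pos A ((complex_of_real (cnorm A b) \<odot> \<one> \<ominus> b) \<oplus> (b \<ominus> a))"
    using assms by (intro pos_add pos_scalar_minus) auto
  moreover have "(complex_of_real (cnorm A b) \<odot> \<one> \<ominus> b) \<oplus> (b \<ominus> a) = complex_of_real (cnorm A b) \<odot> \<one> \<ominus> a"
    using assms ac by (intro lin_eqI) (auto simp: lin_simps)
  ultimately show ?thesis using assms cnorm_nonneg by (intro cnorm_le_of_pos) auto
qed

section \<open>Positivity of the elements \<open>star x x\<close>\<close>

lemma real_imaginary_parts:
  assumes "y \<in> carrier A"
  shows "\<exists>a b. self_adjoint A a \<and> self_adjoint A b \<and> y = a \<oplus> \<i> \<odot> b"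
proof (intro exI conjI)
  show "self_adjoint A ((1/2) \<odot> (y \<oplus> star A y))"
    unfolding self_adjoint_def using assms by (auto simp: star_simps M.a_comm)
  show "self_adjoint A ((-\<i>/2) \<odot> (y \<ominus> star A y))"
    unfolding self_adjoint_def
    using assms by (auto simp: star_simps intro!: lin_eqI simp: lin_simps algebra_simps)
  show "y = (1/2) \<odot> (y \<oplus> star A y) \<oplus> \<i> \<odot> ((-\<i>/2) \<odot> (y \<ominus> star A y))"
    using assms by (intro lin_eqI) (auto simp: lin_simps algebra_simps)
qed

text \<open>The classical argument compares the spectra of \<open>y* y\<close> and
  \<open>y y*\<close>; here two norm estimates do. For \<open>y = a + i b\<close> the sum of
  \<open>y* y\<close> and \<open>y y*\<close> is \<open>2 a^2 + 2 b^2\<close>, so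
  \<open>G = y y*\<close> is positive. With \<open>N = |y|^2\<close>, the element
  \<open>z = y (N + y* y)^2 y*\<close> has norm at most \<open>N^3\<close>, because
  \<open>N + y* y = N - q^2\<close> has norm at most \<open>N\<close>. But
  \<open>z = N^2 G + 2 N G^2 + G^3\<close> dominates \<open>2 N G^2\<close>, of norm
  \<open>2 N^3\<close>. Hence \<open>N = 0\<close>.\<close>

lemma eq_zero_if_neg_star_mult:
  assumes y: "y \<in> carrier A" and q: "self_adjoint A q" "star A y \<otimes> y = \<ominus> (q \<otimes> q)"
  shows "y = \<zero>"
proof -
  have qc: "q \<in> carrier A" using q by (simp add: self_adjoint_def)
  define G where "G = y \<otimes> star A y"
  define N where "N = (cnorm A y)\<^sup>2"
  have Gc: "G \<in> carrier A" using y by (simp add: G_def)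
  obtain a b where ab: "self_adjoint A a" "self_adjoint A b" "y = a \<oplus> \<i> \<odot> b" using real_imaginary_parts[OF y] by blast
  have abc: "a \<in> carrier A" "b \<in> carrier A" "star A a = a" "star A b = b" using ab by (auto simp: self_adjoint_def)
  have "G = (complex_of_real 2 \<odot> (a \<otimes> a) \<oplus> complex_of_real 2 \<odot> (b \<otimes> b)) \<oplus> q \<otimes> q"
  proof (rule lin_eqI)
    fix g assume g: "lin A g"
    have "g (star A y \<otimes> y) = - g (q \<otimes> q)" using q(2) g qc by (simp add: lin_simps)
    then have "g (a \<otimes> a) + g (b \<otimes> b) + \<i> * g (a \<otimes> b) - \<i> * g (b \<otimes> a) = - g (q \<otimes> q)"
      using g abc by (simp add: ab(3) lin_simps distrib star_simps algebra_simps)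
    then show "g G = g ((complex_of_real 2 \<odot> (a \<otimes> a) \<oplus> complex_of_real 2 \<odot> (b \<otimes> b)) \<oplus> q \<otimes> q)"
      using g abc qc by (simp add: G_def ab(3) lin_simps distrib star_simps algebra_simps)
  qed (use Gc abc qc in auto)
  then have Gpos: "pos A G" using ab q by (auto intro!: pos_add pos_smult pos_square simp del: of_real_numeral)
  have Gsa: "self_adjoint A G" using Gpos pos_self_adjoint by blast
  have N: "cnorm A G = N" using cstar_identity[of "star A y"] y by (simp add: G_def star_star cnorm_star N_def)
  have "cnorm A (q \<otimes> q) = N"
    using cstar_identity[OF y] q(2) qc by (simp add: cnorm_a_inv N_def)
  then have qN: "(cnorm A q)\<^sup>2 = N" using cnorm_square[OF q(1)] by simp
  define E where "E = complex_of_real N \<odot> \<one> \<ominus> q \<otimes> q"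
  have E: "E \<in> carrier A" "cnorm A E \<le> N" using cnorm_scalar_minus_square[OF q(1), of N] qN qc by (auto simp: E_def)
  define z where "z = y \<otimes> (E \<otimes> E \<otimes> star A y)"
  have zc: "z \<in> carrier A" using y E by (simp add: z_def)
  have zN: "cnorm A z \<le> N ^ 3"
  proof -
    have "cnorm A z \<le> cnorm A y * (cnorm A E * cnorm A E * cnorm A y)"
      unfolding z_def using y E cnorm_mult[of y "E \<otimes> E \<otimes> star A y"] cnorm_mult[of "E \<otimes> E" "star A y"] cnorm_mult[of E E]
      by (smt (verit, best) cnorm_nonneg cnorm_star mult_closed mult_left_mono mult_right_mono star_closed)
    also have "\<dots> \<le> cnorm A y * (N * N * cnorm A y)"
      using E y cnorm_nonneg order_trans[OF cnorm_nonneg[OF E(1)] E(2)]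
      by (intro mult_left_mono mult_right_mono mult_mono) auto
    also have "\<dots> = N ^ 3" by (simp add: N_def power2_eq_square power3_eq_cube)
    finally show ?thesis .
  qed
  have E': "E = complex_of_real N \<odot> \<one> \<oplus> star A y \<otimes> y" unfolding E_def q(2) using qc by (simp add: a_minus_def)
  have zeq: "z = complex_of_real (N\<^sup>2) \<odot> G \<oplus> complex_of_real (2 * N) \<odot> (G \<otimes> G) \<oplus> G \<otimes> (G \<otimes> G)"
    using y by (intro lin_eqI) (auto simp: z_def E' G_def lin_simps distrib power2_eq_square algebra_simps)
  \<comment> \<open>A root of \<open>G\<close> exhibits \<open>G^3\<close> as the square of the
    self-adjoint element \<open>g G\<close>.\<close>
  obtain g where g: "self_adjoint A g" "g \<otimes> g = G" using pos_sqrt[OF Gpos] by blast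
  have gc: "g \<in> carrier A" "star A g = g" using g by (auto simp: self_adjoint_def)
  have "self_adjoint A (g \<otimes> G)" using gc g(2)[symmetric] by (auto simp: self_adjoint_def star_simps mult_assoc)
  moreover have "G \<otimes> (G \<otimes> G) = (g \<otimes> G) \<otimes> (g \<otimes> G)" using gc by (simp add: g(2)[symmetric] mult_assoc)
  ultimately have G3: "pos A (G \<otimes> (G \<otimes> G))" using pos_square by metis
  have N0: "0 \<le> N" by (simp add: N_def)
  have "z \<ominus> complex_of_real (2 * N) \<odot> (G \<otimes> G) = complex_of_real (N\<^sup>2) \<odot> G \<oplus> G \<otimes> (G \<otimes> G)"
    using Gc by (intro lin_eqI) (auto simp: lin_simps zeq)
  then have "pos A (z \<ominus> complex_of_real (2 * N) \<odot> (G \<otimes> G))" using G3 Gpos by (auto intro!: pos_add pos_smult simp del: of_real_power)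
  then have "cnorm A (complex_of_real (2 * N) \<odot> (G \<otimes> G)) \<le> cnorm A z"
    using zc pos_square[OF Gsa] N0 by (intro cnorm_mono pos_smult) auto
  then have "2 * N * N\<^sup>2 \<le> N ^ 3" using zN N0 cnorm_square[OF Gsa] N Gc by (simp add: cnorm_smult norm_mult)
  then have "N ^ 3 \<le> 0" by (simp add: power2_eq_square power3_eq_cube)
  then have "N = 0" using N0 by (simp add: power_le_zero_eq)
  then show ?thesis using y by (simp add: N_def cnorm_eq_0_iff)
qed

text \<open>With \<open>m\<close> the root of \<open>h^2\<close>, that is \<open>|h|\<close>, the
  element \<open>n = m - h\<close> is twice the negative part of \<open>h\<close>. Since
  \<open>n h = - m n\<close>, the product \<open>(x n)* (x n) = n h n\<close> is minus the square of
  \<open>r n\<close>, where \<open>r^2 = m\<close>; so \<open>x n = 0\<close> by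
  \<open>eq_zero_if_neg_star_mult\<close>. Then \<open>m n^2 = 0\<close>, and
  \<open>n^2 = 2 m n\<close> forces \<open>n^4 = 0\<close>, so \<open>n = 0\<close> and
  \<open>h = m\<close>.\<close>

lemma pos_star_mult:
  assumes x: "x \<in> carrier A"
  shows "pos A (star A x \<otimes> x)"
proof -
  define h where "h = star A x \<otimes> x"
  have hsa: "self_adjoint A h" and hc: "h \<in> carrier A" using x by (auto simp: h_def self_adjoint_def star_simps)
  obtain m where m: "pos A m" "m \<otimes> m = h \<otimes> h" "\<And>z. z \<in> carrier A \<Longrightarrow> z \<otimes> (h \<otimes> h) = (h \<otimes> h) \<otimes> z \<Longrightarrow> z \<otimes> m = m \<otimes> z"
    using pos_sqrt[OF pos_square[OF hsa]] by blast
  have mc: "m \<in> carrier A" "star A m = m" using m(1) by (auto simp: pos_closed pos_star)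
  have hm: "h \<otimes> m = m \<otimes> h" using hc by (intro m(3)) (auto simp: mult_assoc)
  obtain r where r: "self_adjoint A r" "r \<otimes> r = m" "\<And>z. z \<in> carrier A \<Longrightarrow> z \<otimes> m = m \<otimes> z \<Longrightarrow> z \<otimes> r = r \<otimes> z"
    using pos_sqrt[OF m(1)] by blast
  have rc: "r \<in> carrier A" "star A r = r" using r(1) by (auto simp: self_adjoint_def)
  have hr: "h \<otimes> r = r \<otimes> h" using hc hm by (intro r(3)) auto
  have mr: "m \<otimes> r = r \<otimes> m" using mc by (intro r(3)) auto
  have hstar: "star A h = h" using hsa by (simp add: self_adjoint_def)
  define n where "n = m \<ominus> h"
  have nc: "n \<in> carrier A" "star A n = n" using mc hc hstar by (auto simp: n_def star_simps)
  have nr: "n \<otimes> r = r \<otimes> n" using hr mr hc mc rc by (simp add: n_def distrib)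
  have nh: "n \<otimes> h = \<ominus> (m \<otimes> n)" and nn: "n \<otimes> n = 2 \<odot> (m \<otimes> n)"
    using hc mc hm m(2) by (auto simp: n_def distrib intro!: lin_eqI simp: lin_simps)
  have eq: "star A (x \<otimes> n) \<otimes> (x \<otimes> n) = \<ominus> ((r \<otimes> n) \<otimes> (r \<otimes> n))"
  proof -
    have "star A (x \<otimes> n) \<otimes> (x \<otimes> n) = (n \<otimes> h) \<otimes> n" using x nc by (simp add: star_simps h_def mult_assoc)
    also have "\<dots> = \<ominus> (m \<otimes> n \<otimes> n)" unfolding nh using nc mc by (simp add: a_inv_mult_l mult_assoc)
    also have "m \<otimes> n \<otimes> n = r \<otimes> (r \<otimes> n) \<otimes> n" using r(2)[symmetric] nc rc by (simp add: mult_assoc)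
    also have "\<dots> = (r \<otimes> n) \<otimes> (r \<otimes> n)" using nr nc rc by (metis mult_assoc mult_closed)
    finally show ?thesis .
  qed
  have "x \<otimes> n = \<zero>"
  proof (rule eq_zero_if_neg_star_mult[OF _ _ eq])
    show "self_adjoint A (r \<otimes> n)" using rc nc nr by (simp add: self_adjoint_def star_simps)
  qed (use x nc in auto)
  then have "\<ominus> (m \<otimes> n \<otimes> n) = \<zero>" using x nc mc nh h_def 
    by (metis a_inv_mult_l mult_assoc mult_closed mult_zero(1) star_closed)
  then have mnn: "m \<otimes> n \<otimes> n = \<zero>" using mc nc by (metis M.add.inv_eq_1_iff mult_closed)
  have "(n \<otimes> n) \<otimes> (n \<otimes> n) = (2 \<odot> (m \<otimes> n)) \<otimes> (n \<otimes> n)"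
    using arg_cong[OF nn, of "\<lambda>w. w \<otimes> (n \<otimes> n)"] .
  also have "\<dots> = (2 \<odot> (m \<otimes> n \<otimes> n)) \<otimes> n"
    using nc mc by (simp add: smult_mult_l mult_assoc)
  also have "\<dots> = \<zero>" using mnn nc by simp
  finally have "cnorm A ((n \<otimes> n) \<otimes> (n \<otimes> n)) = 0" by simp
  then have "cnorm A n = 0" 
    using cnorm_square[of n] cnorm_square[of "n \<otimes> n"] nc by (simp add: self_adjoint_def star_mult)
  then have "h = m" using nc hc mc by (simp add: cnorm_eq_0_iff n_def minus_eq_zero)
  then show ?thesis using m(1) by (simp add: h_def)
qed

end

section \<open>Positive functionals\<close>

text \<open>Neither continuity nor normalization is asked; boundedness on the GNS space is derived
  in \<open>posf_bound\<close>. The hermitian condition makes the values at \<open>star x x\<close>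
  real, so it suffices to constrain their real parts.\<close>

definition posf :: "'a cstar \<Rightarrow> ('a \<Rightarrow> complex) \<Rightarrow> bool" where
  "posf A \<phi> \<longleftrightarrow> lin A \<phi> \<and> (\<forall>x\<in>carrier A. \<phi> (star A x) = cnj (\<phi> x)) \<and>
     (\<forall>x\<in>carrier A. 0 \<le> Re (\<phi> (star A x \<otimes>\<^bsub>A\<^esub> x)))"

context cstar_algebra
begin

lemma posf_lin: "posf A \<phi> \<Longrightarrow> lin A \<phi>" by (simp add: posf_def)

lemma posf_star: "posf A \<phi> \<Longrightarrow> x \<in> carrier A \<Longrightarrow> \<phi> (star A x) = cnj (\<phi> x)" by (simp add: posf_def)

lemma posf_nonneg: "posf A \<phi> \<Longrightarrow> x \<in> carrier A \<Longrightarrow> 0 \<le> Re (\<phi> (star A x \<otimes> x))" by (simp add: posf_def)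

lemma posf_Im: "posf A \<phi> \<Longrightarrow> x \<in> carrier A \<Longrightarrow> Im (\<phi> (star A x \<otimes> x)) = 0"
  using posf_star[of \<phi> "star A x \<otimes> x"] by (simp add: star_simps complex_eq_iff)

lemma posf_eq_Re: "posf A \<phi> \<Longrightarrow> x \<in> carrier A \<Longrightarrow> \<phi> (star A x \<otimes> x) = complex_of_real (Re (\<phi> (star A x \<otimes> x)))"
  using posf_Im by (simp add: complex_eq_iff)

lemma posf_swap: "posf A \<phi> \<Longrightarrow> x \<in> carrier A \<Longrightarrow> y \<in> carrier A \<Longrightarrow> \<phi> (star A x \<otimes> y) = cnj (\<phi> (star A y \<otimes> x))"
  using posf_star[of \<phi> "star A y \<otimes> x"] by (simp add: star_simps)

text \<open>Expand the nonnegative value at \<open>a - z b\<close>. For nonzero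
  \<open>\<beta>\<close> the minimizing \<open>z\<close> is \<open>\<gamma> / \<beta>\<close>; for
  \<open>\<beta> = 0\<close> the expression is affine along the multiples of
  \<open>\<gamma>\<close>, hence unbounded below unless \<open>\<gamma> = 0\<close>.\<close>

lemma posf_Cauchy_Schwarz:
  assumes f: "posf A \<phi>" and a: "a \<in> carrier A" and b: "b \<in> carrier A"
  shows "(cmod (\<phi> (star A b \<otimes> a)))\<^sup>2 \<le> Re (\<phi> (star A a \<otimes> a)) * Re (\<phi> (star A b \<otimes> b))"
proof -
  define \<alpha> \<beta> \<gamma> where "\<alpha> = Re (\<phi> (star A a \<otimes> a))" and "\<beta> = Re (\<phi> (star A b \<otimes> b))" and "\<gamma> = \<phi> (star A b \<otimes> a)"
  have ab: "\<phi> (star A a \<otimes> b) = cnj \<gamma>" using posf_swap[OF f a b] by (simp add: \<gamma>_def)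
  have ge: "0 \<le> \<alpha> - 2 * Re (cnj z * \<gamma>) + (cmod z)\<^sup>2 * \<beta>" for z
  proof -
    have "\<phi> (star A (a \<ominus> z \<odot> b) \<otimes> (a \<ominus> z \<odot> b)) =
        \<phi> (star A a \<otimes> a) - cnj z * \<gamma> - z * cnj \<gamma> + z * cnj z * \<phi> (star A b \<otimes> b)"
      using a b ab posf_lin[OF f] by (simp add: star_simps distrib lin_simps \<gamma>_def algebra_simps)
    moreover have "Re (z * cnj z * \<phi> (star A b \<otimes> b)) = (cmod z)\<^sup>2 * \<beta>"
      using posf_Im[OF f b] by (simp add: complex_norm_square[symmetric] \<beta>_def)
    ultimately have "Re (\<phi> (star A (a \<ominus> z \<odot> b) \<otimes> (a \<ominus> z \<odot> b))) = \<alpha> - 2 * Re (cnj z * \<gamma>) + (cmod z)\<^sup>2 * \<beta>"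
      by (simp add: \<alpha>_def)
    then show ?thesis using posf_nonneg[OF f, of "a \<ominus> z \<odot> b"] a b by simp
  qed
  have b0: "0 \<le> \<beta>" using posf_nonneg[OF f b] by (simp add: \<beta>_def)
  have "(cmod \<gamma>)\<^sup>2 \<le> \<alpha> * \<beta>"
  proof (cases "\<beta> = 0")
    case False
    have 1: "Re (cnj (\<gamma> / \<beta>) * \<gamma>) = (cmod \<gamma>)\<^sup>2 / \<beta>"
      using complex_norm_square[of \<gamma>, symmetric] by (simp add: mult.commute)
    have 2: "(cmod (\<gamma> / \<beta>))\<^sup>2 * \<beta> = (cmod \<gamma>)\<^sup>2 / \<beta>"
      using False b0 by (simp add: norm_divide power_divide power2_eq_square)
    have "0 \<le> \<alpha> - (cmod \<gamma>)\<^sup>2 / \<beta>" using ge[of "\<gamma> / \<beta>"] unfolding 1 2 by simp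
    then show ?thesis using False b0 by (simp add: field_simps)
  next
    case True
    have "\<gamma> = 0"
    proof (rule ccontr)
      assume "\<gamma> \<noteq> 0"
      define t where "t = \<alpha> / (cmod \<gamma>)\<^sup>2"
      have "Re (cnj (t * \<gamma>) * \<gamma>) = t * (cmod \<gamma>)\<^sup>2" for t :: real
        by (simp add: cmod_power2) (simp add: power2_eq_square algebra_simps)
      \<comment> \<open>This multiple of \<open>\<gamma>\<close> turns the expression into
        \<open>- \<alpha> - 2\<close>, which is negative.\<close>
      then have "0 \<le> \<alpha> - 2 * (((\<alpha> + 1) / (cmod \<gamma>)\<^sup>2) * (cmod \<gamma>)\<^sup>2)" using ge[of "((\<alpha> + 1) / (cmod \<gamma>)\<^sup>2) * \<gamma>"] True by simp
      then have "0 \<le> - \<alpha> - 2" using \<open>\<gamma> \<noteq> 0\<close> by simp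
      moreover have "0 \<le> \<alpha>" using posf_nonneg[OF f a] by (simp add: \<alpha>_def)
      ultimately show False by simp
    qed
    then show ?thesis using True by simp
  qed
  then show ?thesis by (simp add: \<alpha>_def \<beta>_def \<gamma>_def)
qed

text \<open>Null vectors are orthogonal to everything, on either side. This takes the place of the
  quotient in the GNS construction, which is never formed.\<close>

lemma posf_null:
  assumes "posf A \<phi>" "a \<in> carrier A" "b \<in> carrier A" "Re (\<phi> (star A a \<otimes> a)) = 0"
  shows "\<phi> (star A b \<otimes> a) = 0" "\<phi> (star A a \<otimes> b) = 0"
  using posf_Cauchy_Schwarz[of \<phi> a b] posf_Cauchy_Schwarz[of \<phi> b a] assms by auto

lemma posf_add: "posf A \<phi> \<Longrightarrow> posf A \<psi> \<Longrightarrow> posf A (\<lambda>x. \<phi> x + \<psi> x)"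
  by (auto simp: posf_def lin_def algebra_simps)

lemma posf_sum: "finite I \<Longrightarrow> (\<And>i. i \<in> I \<Longrightarrow> posf A (f i)) \<Longrightarrow> posf A (\<lambda>x. \<Sum>i\<in>I. f i x)"
proof (induction I rule: finite_induct)
  case empty
  show ?case by (simp add: posf_def lin_def)
next
  case (insert i I)
  then show ?case using posf_add[of "f i" "\<lambda>x. \<Sum>i\<in>I. f i x"] by simp
qed

end

context unital_cstar_algebra
begin

lemma posf_pos: "posf A \<phi> \<Longrightarrow> pos A h \<Longrightarrow> c \<in> carrier A \<Longrightarrow> 0 \<le> Re (\<phi> (star A c \<otimes> (h \<otimes> c)))"
proof -
  assume f: "posf A \<phi>" and h: "pos A h" and c: "c \<in> carrier A"
  obtain s where s: "self_adjoint A s" "s \<otimes> s = h" using pos_sqrt[OF h] by blast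
  have sc: "s \<in> carrier A" "star A s = s" using s(1) by (auto simp: self_adjoint_def)
  have "star A (s \<otimes> c) \<otimes> (s \<otimes> c) = star A c \<otimes> (h \<otimes> c)"
    using sc c by (simp add: star_simps s(2)[symmetric] mult_assoc)
  then show ?thesis using posf_nonneg[OF f, of "s \<otimes> c"] sc c by simp
qed

lemma pos_bound: "a \<in> carrier A \<Longrightarrow> pos A (complex_of_real ((cnorm A a)\<^sup>2) \<odot> \<one> \<ominus> star A a \<otimes> a)"
  using cstar_identity[of a] by (intro pos_scalar_minus) (auto simp: self_adjoint_def star_simps)

text \<open>Conjugating \<open>a* a \<le> |a|^2\<close> by \<open>c\<close> shows that left
  multiplication by \<open>a\<close> has norm at most \<open>cnorm A a\<close> on the GNS space of
  \<open>\<phi>\<close>.\<close>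

lemma posf_bound:
  assumes "posf A \<phi>" "a \<in> carrier A" "c \<in> carrier A"
  shows "Re (\<phi> (star A (a \<otimes> c) \<otimes> (a \<otimes> c))) \<le> (cnorm A a)\<^sup>2 * Re (\<phi> (star A c \<otimes> c))"
  using posf_pos[OF assms(1) pos_bound[OF assms(2)] assms(3)] assms posf_lin[OF assms(1)]
  by (simp add: distrib lin_simps star_simps del: of_real_power)

section \<open>Separation of points by positive functionals\<close>

lemma self_adjoint_intros:
  "self_adjoint A x \<Longrightarrow> self_adjoint A y \<Longrightarrow> self_adjoint A (x \<oplus> y)"
  "self_adjoint A x \<Longrightarrow> self_adjoint A y \<Longrightarrow> self_adjoint A (x \<ominus> y)"
  "self_adjoint A x \<Longrightarrow> self_adjoint A (complex_of_real c \<odot> x)"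
  "self_adjoint A x \<Longrightarrow> self_adjoint A (\<ominus> x)"
  "self_adjoint A \<one>" "self_adjoint A \<zero>"
  by (auto simp: self_adjoint_def star_simps)

text \<open>A positive functional is read off a maximal cone of self-adjoint elements that contains the
  positive ones and \<open>star x x - \<delta>\<close> but not \<open>-1\<close>.\<close>

definition cone :: "'a set \<Rightarrow> bool" where
  "cone Q \<longleftrightarrow> (\<forall>h\<in>Q. self_adjoint A h) \<and> (\<forall>h. pos A h \<longrightarrow> h \<in> Q) \<and>
     (\<forall>h\<in>Q. \<forall>k\<in>Q. h \<oplus> k \<in> Q) \<and> (\<forall>h\<in>Q. \<forall>c\<ge>0. complex_of_real c \<odot> h \<in> Q)"

lemma cone_extend:
  assumes Q: "cone Q" and w: "self_adjoint A w"
  shows "cone {p \<oplus> complex_of_real s \<odot> w |p s. p \<in> Q \<and> 0 \<le> s}" (is "cone ?E")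
    and "Q \<subseteq> {p \<oplus> complex_of_real s \<odot> w |p s. p \<in> Q \<and> 0 \<le> s}"
    and "w \<in> {p \<oplus> complex_of_real s \<odot> w |p s. p \<in> Q \<and> 0 \<le> s}"
proof -
  have wc: "w \<in> carrier A" using w by (simp add: self_adjoint_def)
  have Qc: "p \<in> Q \<Longrightarrow> p \<in> carrier A" for p using Q by (auto simp: cone_def self_adjoint_def)
  show QE: "Q \<subseteq> ?E"
  proof
    fix p assume "p \<in> Q"
    moreover have "p = p \<oplus> complex_of_real 0 \<odot> w" using wc Qc[OF \<open>p \<in> Q\<close>] by simp
    ultimately show "p \<in> ?E" by blast
  qed
  have "\<zero> \<in> Q" using Q pos_zero by (auto simp: cone_def)
  moreover have "w = \<zero> \<oplus> complex_of_real 1 \<odot> w" using wc by simp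
  ultimately show "w \<in> ?E" using zero_le_one by blast
  show "cone ?E" unfolding cone_def
  proof (intro conjI ballI allI impI)
    fix h assume "h \<in> ?E"
    then obtain p s where h: "h = p \<oplus> complex_of_real s \<odot> w" "p \<in> Q" "0 \<le> s" by blast
    then show "self_adjoint A h" using Q w by (auto simp: cone_def intro!: self_adjoint_intros)
    {
      fix c :: real assume c: "0 \<le> c"
      have "complex_of_real c \<odot> h = complex_of_real c \<odot> p \<oplus> complex_of_real (c * s) \<odot> w"
        using h wc Qc[OF h(2)] by (simp add: smult_add_right)
      moreover have "complex_of_real c \<odot> p \<in> Q" using Q h(2) c by (auto simp: cone_def)
      ultimately show "complex_of_real c \<odot> h \<in> ?E" using mult_nonneg_nonneg[OF c h(3)] by blast
    }
    fix k assume "k \<in> ?E"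
    then obtain q t where k: "k = q \<oplus> complex_of_real t \<odot> w" "q \<in> Q" "0 \<le> t" by blast
    have "h \<oplus> k = (p \<oplus> q) \<oplus> complex_of_real (s + t) \<odot> w"
      using h k wc Qc[OF h(2)] Qc[OF k(2)] by (intro lin_eqI) (auto simp: lin_simps algebra_simps)
    moreover have "p \<oplus> q \<in> Q" using Q h(2) k(2) by (auto simp: cone_def)
    ultimately show "h \<oplus> k \<in> ?E" using add_nonneg_nonneg[OF h(3) k(3)] by blast
  qed (use QE Q in \<open>auto simp: cone_def\<close>)
qed

lemma cone_pos: "cone {h. pos A h}"
  using pos_add pos_smult by (auto simp: cone_def pos_self_adjoint)

text \<open>If neither \<open>h\<close> nor \<open>- h\<close> belongs to a maximal cone
  \<open>Q\<close>, both extensions contain \<open>-1\<close>, say \<open>-1 = p + s h\<close> and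
  \<open>-1 = q - t h\<close>. Multiplying by \<open>t\<close> and \<open>s\<close> and adding
  eliminates \<open>h\<close> and puts \<open>-1\<close> into \<open>Q\<close>.\<close>

lemma exists_maximal_cone:
  assumes "cone Q0" "\<ominus> \<one> \<notin> Q0"
  shows "\<exists>Q. cone Q \<and> Q0 \<subseteq> Q \<and> \<ominus> \<one> \<notin> Q \<and> (\<forall>h. self_adjoint A h \<longrightarrow> h \<in> Q \<or> \<ominus> h \<in> Q)"
proof -
  define F where "F = {Q. cone Q \<and> Q0 \<subseteq> Q \<and> \<ominus> \<one> \<notin> Q}"
  have "\<exists>U\<in>F. \<forall>X\<in>F. U \<subseteq> X \<longrightarrow> X = U"
  proof (rule subset_Zorn_nonempty)
    show "F \<noteq> {}" using assms by (auto simp: F_def)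
    fix C assume C: "C \<noteq> {}" "subset.chain F C"
    then have CF: "\<And>U. U \<in> C \<Longrightarrow> cone U \<and> Q0 \<subseteq> U \<and> \<ominus> \<one> \<notin> U" and ch: "\<And>U V. U \<in> C \<Longrightarrow> V \<in> C \<Longrightarrow> U \<subseteq> V \<or> V \<subseteq> U"
      by (auto simp: subset.chain_def F_def)
    obtain U0 where U0: "U0 \<in> C" using C(1) by blast
    have "u \<oplus> v \<in> \<Union>C" if uv: "u \<in> \<Union>C" "v \<in> \<Union>C" for u v
    proof -
      obtain U V where UV: "U \<in> C" "V \<in> C" "u \<in> U" "v \<in> V" using uv by blast
      then obtain W where W: "W \<in> C" "u \<in> W" "v \<in> W" using ch[of U V] by blast
      then have "u \<oplus> v \<in> W" using CF[OF W(1)] by (simp add: cone_def)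
      then show ?thesis using W by blast
    qed
    moreover have "\<forall>h\<in>\<Union>C. self_adjoint A h" "\<forall>h. pos A h \<longrightarrow> h \<in> \<Union>C" 
        "\<forall>h\<in>\<Union>C. \<forall>c\<ge>0. complex_of_real c \<odot> h \<in> \<Union>C" "Q0 \<subseteq> \<Union>C" "\<ominus> \<one> \<notin> \<Union>C"
      using CF U0 unfolding cone_def by blast+
    ultimately show "\<Union>C \<in> F" by (simp add: F_def cone_def)
  qed
  then obtain Q where Q: "cone Q" "Q0 \<subseteq> Q" "\<ominus> \<one> \<notin> Q" 
    and max: "\<And>V. cone V \<Longrightarrow> Q \<subseteq> V \<Longrightarrow> \<ominus> \<one> \<notin> V \<Longrightarrow> V = Q"
    unfolding F_def by (smt (verit) mem_Collect_eq subset_trans)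
  have Qc: "p \<in> Q \<Longrightarrow> p \<in> carrier A" for p using Q by (auto simp: cone_def self_adjoint_def)
  have ext: "\<exists>p s. \<ominus> \<one> = p \<oplus> complex_of_real s \<odot> h \<and> p \<in> Q \<and> 0 < s" if h: "self_adjoint A h" "h \<notin> Q" for h
  proof -
    note E = cone_extend[OF Q(1) h(1)]
    have "\<ominus> \<one> \<in> {p \<oplus> complex_of_real s \<odot> h |p s. p \<in> Q \<and> 0 \<le> s}"
      using max[OF E(1,2)] E(3) h(2) by blast
    then obtain p s where ps: "\<ominus> \<one> = p \<oplus> complex_of_real s \<odot> h" "p \<in> Q" "0 \<le> s" by blast
    moreover have "s \<noteq> 0" using ps Q(3) Qc[OF ps(2)] h(1) by (auto simp: self_adjoint_def)
    ultimately show ?thesis by (metis less_eq_real_def)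
  qed
  have "h \<in> Q \<or> \<ominus> h \<in> Q" if h: "self_adjoint A h" for h
  proof (rule ccontr)
    assume n: "\<not> (h \<in> Q \<or> \<ominus> h \<in> Q)"
    have hc: "h \<in> carrier A" using h by (simp add: self_adjoint_def)
    obtain p s where ps: "\<ominus> \<one> = p \<oplus> complex_of_real s \<odot> h" "p \<in> Q" "0 < s" using ext[OF h] n by blast
    obtain q t where qt: "\<ominus> \<one> = q \<oplus> complex_of_real t \<odot> (\<ominus> h)" "q \<in> Q" "0 < t"
      using ext[OF self_adjoint_intros(4)[OF h]] n by blast
    have "\<ominus> \<one> = complex_of_real (1 / (s + t)) \<odot> (complex_of_real t \<odot> p \<oplus> complex_of_real s \<odot> q)"
    proof (rule lin_eqI)
      fix g assume g: "lin A g"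
      have 1: "- g \<one> = g p + s * g h" using arg_cong[OF ps(1), of g] g hc Qc[OF ps(2)] by (simp add: lin_simps)
      have 2: "- g \<one> = g q - t * g h" using arg_cong[OF qt(1), of g] g hc Qc[OF qt(2)] by (simp add: lin_simps)
      have "t * g p + s * g q = - (s + t) * g \<one>"
      proof -
        have "t * (g p + s * g h) + s * (g q - t * g h) = t * (- g \<one>) + s * (- g \<one>)" using 1 2 by simp
        then show ?thesis by (simp add: algebra_simps)
      qed
      then have "g (complex_of_real (1 / (s + t)) \<odot> (complex_of_real t \<odot> p \<oplus> complex_of_real s \<odot> q)) =
        complex_of_real (1 / (s + t)) * (- complex_of_real (s + t) * g \<one>)" 
        using g Qc[OF ps(2)] Qc[OF qt(2)] by (simp add: lin_simps)
      also have "\<dots> = - ((complex_of_real (1 / (s + t)) * complex_of_real (s + t)) * g \<one>)" by (simp only: mult_minus_left mult_minus_right mult.assoc)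
      also have "complex_of_real (1 / (s + t)) * complex_of_real (s + t) = 1"
      proof -
        have "s + t \<noteq> 0" using ps(3) qt(3) by simp
        then show ?thesis by (simp only: of_real_mult[symmetric]) simp
      qed
      finally show "g (\<ominus> \<one>) = g (complex_of_real (1 / (s + t)) \<odot> (complex_of_real t \<odot> p \<oplus> complex_of_real s \<odot> q))" 
        using g by (simp add: lin_simps)
    qed (use Qc[OF ps(2)] Qc[OF qt(2)] in auto)
    moreover have "complex_of_real (1 / (s + t)) \<odot> (complex_of_real t \<odot> p \<oplus> complex_of_real s \<odot> q) \<in> Q"
    proof -
      have sm: "\<And>c h. 0 \<le> c \<Longrightarrow> h \<in> Q \<Longrightarrow> complex_of_real c \<odot> h \<in> Q" using Q(1) by (auto simp: cone_def)
      have ad: "\<And>h k. h \<in> Q \<Longrightarrow> k \<in> Q \<Longrightarrow> h \<oplus> k \<in> Q" using Q(1) by (auto simp: cone_def)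
      show ?thesis using ps qt by (intro sm ad) auto
    qed
    ultimately show False using Q(3) by simp
  qed
  then show ?thesis using Q by blast
qed

text \<open>In the order given by \<open>Q\<close>, every self-adjoint \<open>h\<close> is
  comparable with every real multiple of the unit, so it determines a Dedekind cut, consistent
  because \<open>Q\<close> does not contain \<open>-1\<close>. Lower and upper bounds add and scale,
  which makes the cut point \<open>f h\<close> additive and homogeneous.\<close>

lemma maximal_cone_functional:
  assumes Q: "cone Q" "\<ominus> \<one> \<notin> Q" "\<And>h. self_adjoint A h \<Longrightarrow> h \<in> Q \<or> \<ominus> h \<in> Q"
  shows "\<exists>f. (\<forall>h k. self_adjoint A h \<longrightarrow> self_adjoint A k \<longrightarrow> f (h \<oplus> k) = f h + f k) \<and>
     (\<forall>c h. self_adjoint A h \<longrightarrow> f (complex_of_real c \<odot> h) = c * f h) \<and>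
     (\<forall>h t. self_adjoint A h \<longrightarrow> h \<ominus> complex_of_real t \<odot> \<one> \<in> Q \<longrightarrow> t \<le> f h)"
proof -
  have sm: "\<And>c h. 0 \<le> c \<Longrightarrow> h \<in> Q \<Longrightarrow> complex_of_real c \<odot> h \<in> Q" using Q(1) by (auto simp: cone_def)
  have ad: "\<And>h k. h \<in> Q \<Longrightarrow> k \<in> Q \<Longrightarrow> h \<oplus> k \<in> Q" using Q(1) by (auto simp: cone_def)
  have psQ: "\<And>h. pos A h \<Longrightarrow> h \<in> Q" using Q(1) by (auto simp: cone_def)
  have sac: "\<And>h. self_adjoint A h \<Longrightarrow> h \<in> carrier A" by (simp add: self_adjoint_def)
  define L where "L h t \<longleftrightarrow> h \<ominus> complex_of_real t \<odot> \<one> \<in> Q" for h t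
  define U where "U h t \<longleftrightarrow> complex_of_real t \<odot> \<one> \<ominus> h \<in> Q" for h t
  have LU: "L h t \<or> U h t" if "self_adjoint A h" for h t
  proof -
    have "\<ominus> (h \<ominus> complex_of_real t \<odot> \<one>) = complex_of_real t \<odot> \<one> \<ominus> h"
      using sac[OF that] by (intro lin_eqI) (auto simp: lin_simps)
    then show ?thesis using Q(3)[of "h \<ominus> complex_of_real t \<odot> \<one>"] that 
      by (auto simp: L_def U_def intro!: self_adjoint_intros)
  qed
  \<comment> \<open>A lower bound \<open>t\<close> above an upper bound \<open>u\<close> would place
    \<open>u - t\<close> times the unit in \<open>Q\<close>, hence \<open>-1\<close> after
    rescaling.\<close>
  have le: "t \<le> u" if h: "self_adjoint A h" "L h t" "U h u" for h t u
  proof (rule ccontr)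
    assume "\<not> t \<le> u"
    then have tu: "t - u > 0" by simp
    have "complex_of_real (1 / (t - u)) \<odot> ((h \<ominus> complex_of_real t \<odot> \<one>) \<oplus> (complex_of_real u \<odot> \<one> \<ominus> h)) \<in> Q"
      using h tu by (intro sm ad) (auto simp: L_def U_def)
    moreover have "(h \<ominus> complex_of_real t \<odot> \<one>) \<oplus> (complex_of_real u \<odot> \<one> \<ominus> h) = complex_of_real (- (t - u)) \<odot> \<one>"
      using sac[OF h(1)] by (intro lin_eqI) (auto simp: lin_simps algebra_simps)
    moreover have "complex_of_real (1 / (t - u)) \<odot> (complex_of_real (- (t - u)) \<odot> \<one>) = \<ominus> \<one>"
    proof -
      have "complex_of_real (1 / (t - u)) * complex_of_real (- (t - u)) = -1" 
      proof -
        have "1 / (t - u) * (- (t - u)) = -1" using tu by (simp del: minus_diff_eq)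
        then show ?thesis by (metis of_real_mult of_real_minus of_real_1)
      qed
      then show ?thesis by (simp add: smult_m1 del: of_real_minus of_real_diff of_real_divide)
    qed
    ultimately show False using Q(2) by simp
  qed
  have Ladd: "L (h \<oplus> k) (t + u)" if h: "self_adjoint A h" "self_adjoint A k" "L h t" "L k u" for h k t u
  proof -
    have "(h \<oplus> k) \<ominus> complex_of_real (t + u) \<odot> \<one> = (h \<ominus> complex_of_real t \<odot> \<one>) \<oplus> (k \<ominus> complex_of_real u \<odot> \<one>)"
      using sac[OF h(1)] sac[OF h(2)] by (intro lin_eqI) (auto simp: lin_simps algebra_simps)
    then show ?thesis using h ad by (auto simp: L_def)
  qed
  have Uadd: "U (h \<oplus> k) (t + u)" if h: "self_adjoint A h" "self_adjoint A k" "U h t" "U k u" for h k t u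
  proof -
    have "complex_of_real (t + u) \<odot> \<one> \<ominus> (h \<oplus> k) = (complex_of_real t \<odot> \<one> \<ominus> h) \<oplus> (complex_of_real u \<odot> \<one> \<ominus> k)"
      using sac[OF h(1)] sac[OF h(2)] by (intro lin_eqI) (auto simp: lin_simps algebra_simps)
    then show ?thesis using h ad by (auto simp: U_def)
  qed
  have Lsm: "L (complex_of_real c \<odot> h) (c * t)" if h: "self_adjoint A h" "L h t" "0 \<le> c" for h t c
  proof -
    have "complex_of_real c \<odot> h \<ominus> complex_of_real (c * t) \<odot> \<one> = complex_of_real c \<odot> (h \<ominus> complex_of_real t \<odot> \<one>)"
      using sac[OF h(1)] by (intro lin_eqI) (auto simp: lin_simps algebra_simps)
    then show ?thesis using h sm by (auto simp: L_def)
  qed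
  have Usm: "U (complex_of_real c \<odot> h) (c * t)" if h: "self_adjoint A h" "U h t" "0 \<le> c" for h t c
  proof -
    have "complex_of_real (c * t) \<odot> \<one> \<ominus> complex_of_real c \<odot> h = complex_of_real c \<odot> (complex_of_real t \<odot> \<one> \<ominus> h)"
      using sac[OF h(1)] by (intro lin_eqI) (auto simp: lin_simps algebra_simps)
    then show ?thesis using h sm by (auto simp: U_def)
  qed
  have U0: "U h (cnorm A h)" if "self_adjoint A h" for h
    using pos_scalar_minus[OF that order_refl] psQ by (simp add: U_def)
  have L0: "L h (- cnorm A h)" if h: "self_adjoint A h" for h
  proof -
    have "h \<ominus> complex_of_real (- cnorm A h) \<odot> \<one> = complex_of_real (cnorm A h) \<odot> \<one> \<ominus> (\<ominus> h)"
      using sac[OF h] by (intro lin_eqI) (auto simp: lin_simps)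
    then show ?thesis 
      using pos_scalar_minus[OF self_adjoint_intros(4)[OF h] order_refl] psQ sac[OF h] by (simp add: L_def cnorm_a_inv)
  qed
  define f where "f h = Sup {t. L h t}" for h
  have fL: "t \<le> f h" if "self_adjoint A h" "L h t" for h t
    unfolding f_def using that le[OF that(1) _ U0[OF that(1)]] by (intro cSup_upper bdd_aboveI[of _ "cnorm A h"]) auto
  have fU: "f h \<le> t" if "self_adjoint A h" "U h t" for h t
    unfolding f_def using that L0[OF that(1)] le[OF that(1) _ that(2)] by (intro cSup_least) auto
  have fL': "L h t" if "self_adjoint A h" "t < f h" for h t
    using LU[OF that(1), of t] fU[OF that(1)] that(2) by force
  have fU': "U h t" if "self_adjoint A h" "f h < t" for h t
    using LU[OF that(1), of t] fL[OF that(1)] that(2) by force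
  have add: "f (h \<oplus> k) = f h + f k" if h: "self_adjoint A h" "self_adjoint A k" for h k
  proof (rule antisym)
    have hk: "self_adjoint A (h \<oplus> k)" using h by (rule self_adjoint_intros)
    show "f (h \<oplus> k) \<le> f h + f k"
    proof (rule field_le_epsilon)
      fix e :: real assume "e > 0"
      then have "U (h \<oplus> k) ((f h + e/2) + (f k + e/2))" using h by (intro Uadd fU') auto
      then show "f (h \<oplus> k) \<le> f h + f k + e" using fU[OF hk] by force
    qed
    show "f h + f k \<le> f (h \<oplus> k)"
    proof (rule field_le_epsilon)
      fix e :: real assume "e > 0"
      then have "L (h \<oplus> k) ((f h - e/2) + (f k - e/2))" using h by (intro Ladd fL') auto
      then show "f h + f k \<le> f (h \<oplus> k) + e" using fL[OF hk] by force
    qed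
  qed
  have smp: "f (complex_of_real c \<odot> h) = c * f h" if h: "self_adjoint A h" "c > 0" for c h
  proof (rule antisym)
    have hk: "self_adjoint A (complex_of_real c \<odot> h)" using h by (intro self_adjoint_intros)
    show "f (complex_of_real c \<odot> h) \<le> c * f h"
    proof (rule field_le_epsilon)
      fix e :: real assume "e > 0"
      then have "U (complex_of_real c \<odot> h) (c * (f h + e/c))" using h by (intro Usm fU') auto
      then show "f (complex_of_real c \<odot> h) \<le> c * f h + e" using fU[OF hk] h(2) by (force simp: distrib_left)
    qed
    show "c * f h \<le> f (complex_of_real c \<odot> h)"
    proof (rule field_le_epsilon)
      fix e :: real assume "e > 0"
      then have "L (complex_of_real c \<odot> h) (c * (f h - e/c))" using h by (intro Lsm fL') auto
      then show "c * f h \<le> f (complex_of_real c \<odot> h) + e" using fL[OF hk] h(2) by (force simp: right_diff_distrib)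
    qed
  qed
  have f0: "f \<zero> = 0" using add[of \<zero> \<zero>] self_adjoint_intros(6) by simp
  have sml: "f (complex_of_real c \<odot> h) = c * f h" if h: "self_adjoint A h" for c h
  proof (cases c "0 :: real" rule: linorder_cases)
    case less
    have "complex_of_real c \<odot> h \<oplus> complex_of_real (- c) \<odot> h = \<zero>"
      using sac[OF h] by (intro lin_eqI) (auto simp: lin_simps)
    then have "f (complex_of_real c \<odot> h) + f (complex_of_real (- c) \<odot> h) = 0"
      using add[OF self_adjoint_intros(3)[OF h, of c] self_adjoint_intros(3)[OF h, of "-c"]] f0 by simp
    then show ?thesis using smp[OF h, of "-c"] less by simp
  qed (use smp h f0 sac in auto)
  show ?thesis using add sml fL unfolding L_def by blast
qed

text \<open>If \<open>-1 = p + s w\<close> with \<open>p\<close> positive, \<open>s > 0\<close> and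
  \<open>w = x* x - |x|^2\<close>, then \<open>x* x \<le> |x|^2 - 1/s\<close>, which
  \<open>cnorm_le_of_pos\<close> refutes, as \<open>x* x\<close> has norm \<open>|x|^2\<close>. So
  some maximal cone contains \<open>w\<close> but not \<open>-1\<close>, and its functional is at
  least \<open>|x|^2\<close> at \<open>x* x\<close>.\<close>

lemma exists_posf:
  assumes x: "x \<in> carrier A" "x \<noteq> \<zero>"
  shows "\<exists>\<phi>. posf A \<phi> \<and> 0 < Re (\<phi> (star A x \<otimes> x))"
proof -
  define d where "d = (cnorm A x)\<^sup>2"
  have d0: "d > 0" using x by (simp add: d_def cnorm_eq_0_iff)
  have nx: "cnorm A (star A x \<otimes> x) = d" using cstar_identity x by (simp add: d_def)
  have xsa: "self_adjoint A (star A x \<otimes> x)" using pos_star_mult[OF x(1)] by (simp add: pos_self_adjoint)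
  define w where "w = star A x \<otimes> x \<ominus> complex_of_real d \<odot> \<one>"
  have w: "self_adjoint A w" unfolding w_def using xsa by (intro self_adjoint_intros)
  define Q0 where "Q0 = {p \<oplus> complex_of_real s \<odot> w |p s. p \<in> {h. pos A h} \<and> 0 \<le> s}"
  note E = cone_extend[OF cone_pos w, folded Q0_def]
  have "\<ominus> \<one> \<notin> Q0"
  proof
    assume "\<ominus> \<one> \<in> Q0"
    then obtain p s where ps: "\<ominus> \<one> = p \<oplus> complex_of_real s \<odot> w" "pos A p" "0 \<le> s" by (auto simp: Q0_def)
    have pc: "p \<in> carrier A" using ps(2) pos_closed by blast
    show False
    proof (cases "s = 0")
      case True
      then have "pos A (\<ominus> \<one>)" using ps pc w by (simp add: self_adjoint_def)
      moreover have "pos A \<one>" using pos_scalar[of 1] by simp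
      ultimately have "\<one> = \<zero>" using pos_antisym by blast
      then show False using x unit_l[of x] by simp
    next
      case False
      then have s: "s > 0" using ps by simp
      have "complex_of_real (d - 1 / s) \<odot> \<one> \<ominus> star A x \<otimes> x = complex_of_real (1 / s) \<odot> p"
      proof (rule lin_eqI)
        fix g assume g: "lin A g"
        have "- g \<one> = g p + s * (g (star A x \<otimes> x) - d * g \<one>)" 
          using arg_cong[OF ps(1), of g] g pc x by (simp add: lin_simps w_def)
        then have "g p = - g \<one> - s * (g (star A x \<otimes> x) - d * g \<one>)" by (simp add: algebra_simps)
        then show "g (complex_of_real (d - 1 / s) \<odot> \<one> \<ominus> star A x \<otimes> x) = g (complex_of_real (1 / s) \<odot> p)"
          using g pc x s by (simp add: lin_simps field_simps)
      qed (use x pc in auto)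
      then have 1: "pos A (complex_of_real (d - 1 / s) \<odot> \<one> \<ominus> star A x \<otimes> x)" using ps(2) s by (metis pos_smult less_eq_real_def zero_less_divide_1_iff)
      \<comment> \<open>The bound \<open>d - 1 / s\<close> may be negative, but
        \<open>cnorm_le_of_pos\<close> requires a nonnegative one.\<close>
      define M where "M = max 0 (d - 1 / s)"
      have "pos A (complex_of_real (M - (d - 1 / s)) \<odot> \<one> \<oplus> (complex_of_real (d - 1 / s) \<odot> \<one> \<ominus> star A x \<otimes> x))"
        using 1 by (intro pos_add pos_scalar) (auto simp: M_def)
      moreover have "complex_of_real (M - (d - 1 / s)) \<odot> \<one> \<oplus> (complex_of_real (d - 1 / s) \<odot> \<one> \<ominus> star A x \<otimes> x)
          = complex_of_real M \<odot> \<one> \<ominus> star A x \<otimes> x"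
        using x by (intro lin_eqI) (auto simp: lin_simps algebra_simps)
      ultimately have "d \<le> M" using cnorm_le_of_pos[OF pos_star_mult[OF x(1)], of M] nx by (simp add: M_def)
      then show False using d0 s by (auto simp: M_def max_def split: if_splits)
    qed
  qed
  from exists_maximal_cone[OF E(1) this] obtain Q where Q: "cone Q" "Q0 \<subseteq> Q" "\<ominus> \<one> \<notin> Q"
    "\<And>h. self_adjoint A h \<Longrightarrow> h \<in> Q \<or> \<ominus> h \<in> Q" by blast
  from maximal_cone_functional[OF Q(1,3,4)] obtain f where
    fadd: "\<And>h k. self_adjoint A h \<Longrightarrow> self_adjoint A k \<Longrightarrow> f (h \<oplus> k) = f h + f k" and
    fsm: "\<And>c h. self_adjoint A h \<Longrightarrow> f (complex_of_real c \<odot> h) = c * f h" and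
    fQ: "\<And>h t. self_adjoint A h \<Longrightarrow> h \<ominus> complex_of_real t \<odot> \<one> \<in> Q \<Longrightarrow> t \<le> f h" by blast
  have fpos: "0 \<le> f h" if "pos A h" for h
    using fQ[of h 0] that Q(1) pos_closed[OF that] by (auto simp: cone_def pos_self_adjoint a_minus_def)
  have fx: "d \<le> f (star A x \<otimes> x)" using fQ[OF xsa, of d] Q(2) E(3) by (auto simp: w_def)
  \<comment> \<open>\<open>R\<close> and \<open>I\<close> are the real and imaginary parts of an
    element; through them the real-linear functional on self-adjoint elements extends to a
    complex-linear one.\<close>
  define R where "R y = (1/2) \<odot> (y \<oplus> star A y)" for y
  define I where "I y = (-\<i>/2) \<odot> (y \<ominus> star A y)" for y
  have RI: "self_adjoint A (R y)" "self_adjoint A (I y)" if "y \<in> carrier A" for y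
    unfolding self_adjoint_def R_def I_def using that 
    by (auto simp: star_simps intro!: lin_eqI simp: lin_simps algebra_simps)
  define \<phi> where "\<phi> y = complex_of_real (f (R y)) + \<i> * complex_of_real (f (I y))" for y
  have "posf A \<phi>" unfolding posf_def lin_def
  proof (intro conjI ballI allI)
    fix y z assume yz: "y \<in> carrier A" "z \<in> carrier A"
    have "R (y \<oplus> z) = R y \<oplus> R z" "I (y \<oplus> z) = I y \<oplus> I z"
      using yz by (auto simp: R_def I_def star_simps intro!: lin_eqI simp: lin_simps algebra_simps)
    then show "\<phi> (y \<oplus> z) = \<phi> y + \<phi> z" using yz RI fadd by (simp add: \<phi>_def algebra_simps)
  next
    fix c y assume y: "y \<in> carrier A"
    note cc = complex_eq[of c] complex_cnj
    obtain a b where ab: "c = complex_of_real a + \<i> * complex_of_real b" using complex_eq[of c] by blast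
    have "R (c \<odot> y) = complex_of_real a \<odot> R y \<oplus> complex_of_real (- b) \<odot> I y" 
      "I (c \<odot> y) = complex_of_real a \<odot> I y \<oplus> complex_of_real b \<odot> R y"
      using y by (auto simp: ab R_def I_def star_simps intro!: lin_eqI simp: lin_simps field_simps)
    then have "f (R (c \<odot> y)) = a * f (R y) - b * f (I y)" "f (I (c \<odot> y)) = a * f (I y) + b * f (R y)"
      using y RI[OF y] by (simp_all add: fadd fsm self_adjoint_intros del: of_real_minus)
    then have "\<phi> (c \<odot> y) = complex_of_real (a * f (R y) - b * f (I y)) + \<i> * complex_of_real (a * f (I y) + b * f (R y))"
      by (simp only: \<phi>_def)
    then show "\<phi> (c \<odot> y) = c * \<phi> y" by (simp add: \<phi>_def ab algebra_simps)
  next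
    fix y assume y: "y \<in> carrier A"
    have "R (star A y) = R y" "I (star A y) = complex_of_real (-1) \<odot> I y"
      using y by (auto simp: R_def I_def star_simps intro!: lin_eqI simp: lin_simps algebra_simps)
    then show "\<phi> (star A y) = cnj (\<phi> y)" using RI[OF y] fsm[of "I y" "-1"] by (simp add: \<phi>_def)
  next
    fix y assume y: "y \<in> carrier A"
    have "R (star A y \<otimes> y) = star A y \<otimes> y"
      using y by (auto simp: R_def star_simps intro!: lin_eqI simp: lin_simps)
    then show "0 \<le> Re (\<phi> (star A y \<otimes> y))" using fpos[OF pos_star_mult[OF y]] by (simp add: \<phi>_def)
  qed
  moreover have "R (star A x \<otimes> x) = star A x \<otimes> x"
    using x by (auto simp: R_def star_simps intro!: lin_eqI simp: lin_simps)
  then have "Re (\<phi> (star A x \<otimes> x)) \<ge> d" using fx by (simp add: \<phi>_def)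
  ultimately show ?thesis using d0 by (intro exI[of _ \<phi>]) auto
qed

text \<open>Let \<open>n = m - h\<close> with \<open>m\<close> the root of \<open>h^2\<close>. From
  \<open>h n = - m n\<close>, each \<open>\<psi>\<close> satisfies
  \<open>\<psi> (n h n) = - \<psi> (n m n)\<close>, so nonnegativity on the left forces both to
  vanish. With \<open>m = s^2\<close> the vector \<open>s n\<close> is null, whence
  \<open>\<psi> (m n) = 0\<close> and \<open>\<psi> (n* n) = 2 \<psi> (m n) = 0\<close>. Separation
  gives \<open>n = 0\<close>, so \<open>h = m\<close> is positive. Applied to the finite-rank
  functionals, this tests positivity in finite-dimensional representations.\<close>

lemma pos_if_posf_nonneg:
  assumes h: "self_adjoint A h"
    and P: "\<And>\<psi>. \<psi> \<in> P \<Longrightarrow> posf A \<psi>"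
    and sep: "\<And>x. x \<in> carrier A \<Longrightarrow> x \<noteq> \<zero> \<Longrightarrow> \<exists>\<psi>\<in>P. \<psi> (star A x \<otimes> x) \<noteq> 0"
    and nn: "\<And>\<psi> c. \<psi> \<in> P \<Longrightarrow> c \<in> carrier A \<Longrightarrow> 0 \<le> Re (\<psi> (star A c \<otimes> (h \<otimes> c)))"
  shows "pos A h"
proof -
  have hc: "h \<in> carrier A" "star A h = h" using h by (auto simp: self_adjoint_def)
  obtain m where m: "pos A m" "m \<otimes> m = h \<otimes> h" "\<And>z. z \<in> carrier A \<Longrightarrow> z \<otimes> (h \<otimes> h) = (h \<otimes> h) \<otimes> z \<Longrightarrow> z \<otimes> m = m \<otimes> z"
    using pos_sqrt[OF pos_square[OF h]] by blast
  have mc: "m \<in> carrier A" "star A m = m" using m(1) by (auto simp: pos_closed pos_star)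
  have hm: "h \<otimes> m = m \<otimes> h" using hc by (intro m(3)) (auto simp: mult_assoc)
  obtain s where s: "self_adjoint A s" "s \<otimes> s = m" using pos_sqrt[OF m(1)] by blast
  have sc: "s \<in> carrier A" "star A s = s" using s(1) by (auto simp: self_adjoint_def)
  define n where "n = m \<ominus> h"
  have nc: "n \<in> carrier A" "star A n = n" using mc hc by (auto simp: n_def star_simps)
  have nn1: "h \<otimes> n = \<ominus> (m \<otimes> n)" and nn2: "n \<otimes> n = 2 \<odot> (m \<otimes> n)"
    using hc mc hm m(2) by (auto simp: n_def distrib intro!: lin_eqI simp: lin_simps)
  have "\<psi> (star A n \<otimes> n) = 0" if \<psi>: "\<psi> \<in> P" for \<psi>
  proof -
    note f = P[OF \<psi>]
    have 1: "star A n \<otimes> (m \<otimes> n) = star A (s \<otimes> n) \<otimes> (s \<otimes> n)"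
      using sc nc by (simp add: star_simps mult_assoc s(2)[symmetric])
    have "Re (\<psi> (star A n \<otimes> (h \<otimes> n))) = - Re (\<psi> (star A n \<otimes> (m \<otimes> n)))"
      unfolding nn1 using nc mc posf_lin[OF f] by (simp add: distrib lin_simps)
    then have "Re (\<psi> (star A (s \<otimes> n) \<otimes> (s \<otimes> n))) \<le> 0" using nn[OF \<psi> nc(1)] 1 by simp
    then have "Re (\<psi> (star A (s \<otimes> n) \<otimes> (s \<otimes> n))) = 0" using posf_nonneg[OF f, of "s \<otimes> n"] sc nc by simp
    then have "\<psi> (star A s \<otimes> (s \<otimes> n)) = 0" using posf_null(1)[OF f, of "s \<otimes> n" s] sc nc by simp
    moreover have "star A s \<otimes> (s \<otimes> n) = m \<otimes> n" using sc nc by (simp add: mult_assoc s(2)[symmetric])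
    ultimately show ?thesis unfolding nc(2) nn2 using posf_lin[OF f] mc nc by (simp add: lin_simps)
  qed
  then have "n = \<zero>" using sep[OF nc(1)] by blast
  then have "m = h" using mc hc by (simp add: n_def minus_eq_zero)
  then show ?thesis using m(1) by simp
qed

text \<open>A Neumann series. Positivity of \<open>h - e\<close> with witness \<open>t\<close> says
  that \<open>w = 1 - h / (t + e)\<close> has norm at most \<open>t / (t + e) < 1\<close>; the sum
  of the powers of \<open>w\<close>, divided by \<open>t + e\<close>, inverts
  \<open>h\<close>.\<close>

lemma exists_inverse:
  assumes "pos A (h \<ominus> complex_of_real e \<odot> \<one>)" "h \<in> carrier A" "0 < e"
  shows "\<exists>g. self_adjoint A g \<and> h \<otimes> g = \<one> \<and> g \<otimes> h = \<one>"
proof -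
  obtain t where t: "t \<ge> 0" "cnorm A (complex_of_real t \<odot> \<one> \<ominus> (h \<ominus> complex_of_real e \<odot> \<one>)) \<le> t"
    using assms(1) by (auto simp: pos_def)
  have "h = (h \<ominus> complex_of_real e \<odot> \<one>) \<oplus> complex_of_real e \<odot> \<one>" using assms(2) by (intro lin_eqI) (auto simp: lin_simps)
  then have hsa: "self_adjoint A h" using assms(1) self_adjoint_intros pos_self_adjoint by metis
  have hs: "star A h = h" using hsa by (simp add: self_adjoint_def)
  define u where "u = complex_of_real (1 / (t + e))"
  define w where "w = \<one> \<ominus> u \<odot> h"
  define r where "r = t / (t + e)"
  have wc: "w \<in> carrier A" using assms by (simp add: w_def)
  have te: "t + e > 0" using t assms by simp
  have r: "0 \<le> r" "r < 1" using t assms by (auto simp: r_def)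
  have "w = u \<odot> (complex_of_real t \<odot> \<one> \<ominus> (h \<ominus> complex_of_real e \<odot> \<one>))"
  proof (rule lin_eqI)
    fix g assume g: "lin A g"
    have "u * complex_of_real (t + e) = 1" using te by (simp add: u_def flip: of_real_mult of_real_add)
    then have *: "u * complex_of_real t + u * complex_of_real e = 1" by (simp add: distrib_left)
    have "u * (complex_of_real t * g \<one> - (g h - complex_of_real e * g \<one>)) = (u * complex_of_real t + u * complex_of_real e) * g \<one> - u * g h"
      by (simp add: algebra_simps)
    then show "g w = g (u \<odot> (complex_of_real t \<odot> \<one> \<ominus> (h \<ominus> complex_of_real e \<odot> \<one>)))"
      using g assms(2) * by (simp add: w_def lin_simps)
  qed (use wc assms(2) in auto)
  then have "cnorm A w = cnorm A (complex_of_real t \<odot> \<one> \<ominus> (h \<ominus> complex_of_real e \<odot> \<one>)) / (t + e)"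
    using te assms(2) by (simp add: cnorm_smult u_def norm_divide flip: of_real_add)
  then have wr: "cnorm A w \<le> r" using t te by (simp add: r_def divide_right_mono)
  define S where "S = rec_nat \<zero> (\<lambda>_ x. \<one> \<oplus> w \<otimes> x)"
  have S0: "S 0 = \<zero>" and SS: "S (Suc n) = \<one> \<oplus> w \<otimes> S n" for n by (simp_all add: S_def)
  have Sc: "S n \<in> carrier A" for n using wc by (induction n) (auto simp: S0 SS)
  have d: "cnorm A (S (Suc n) \<ominus> S n) \<le> r ^ n" for n
  proof (induction n)
    case 0
    then show ?case using cnorm_one_le wc by (simp add: S0 SS a_minus_def)
  next
    case (Suc n)
    have "S (Suc (Suc n)) \<ominus> S (Suc n) = w \<otimes> (S (Suc n) \<ominus> S n)"
      unfolding SS[of "Suc n"] SS[of n] using wc Sc[of n] by (intro lin_eqI) (auto simp: lin_simps distrib)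
    then have "cnorm A (S (Suc (Suc n)) \<ominus> S (Suc n)) \<le> cnorm A w * cnorm A (S (Suc n) \<ominus> S n)"
      using cnorm_mult[of w "S (Suc n) \<ominus> S n"] wc Sc by simp
    also have "\<dots> \<le> r * r ^ n" using wr Suc wc Sc cnorm_nonneg r by (intro mult_mono) auto
    finally show ?case by simp
  qed
  have dd: "n \<le> m \<Longrightarrow> cnorm A (S m \<ominus> S n) \<le> r ^ n / (1 - r) - r ^ m / (1 - r)" for m n
  proof (induction m rule: dec_induct)
    case base
    then show ?case using Sc[of n] by (simp add: minus_eq_zero[THEN iffD2])
  next
    case (step m)
    have "r ^ m / (1 - r) - r ^ Suc m / (1 - r) = r ^ m * (1 - r) / (1 - r)"
      by (simp only: diff_divide_distrib[symmetric]) (simp add: algebra_simps)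
    then have "r ^ m = r ^ m / (1 - r) - r ^ Suc m / (1 - r)" using r by simp
    then show ?case using cnorm_triangle3[OF Sc[of "Suc m"] Sc[of m] Sc[of n]] d[of m] step by linarith
  qed
  have "\<exists>N. \<forall>m\<ge>N. \<forall>n\<ge>N. cnorm A (S m \<ominus> S n) < \<epsilon>" if "\<epsilon> > 0" for \<epsilon>
  proof -
    have "(\<lambda>n. r ^ n / (1 - r)) \<longlonglongrightarrow> 0 / (1 - r)" using r by (intro tendsto_divide LIMSEQ_power_zero tendsto_const) auto
    then have "\<forall>\<^sub>F n in sequentially. r ^ n / (1 - r) < \<epsilon>" using \<open>\<epsilon> > 0\<close> by (intro order_tendstoD(2)[of _ 0]) auto
    then obtain N where N: "\<And>n. n \<ge> N \<Longrightarrow> r ^ n / (1 - r) < \<epsilon>" by (auto simp: eventually_sequentially)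
    have p: "0 \<le> r ^ n / (1 - r)" for n using r by simp
    have "cnorm A (S m \<ominus> S n) < \<epsilon>" if mn: "m \<ge> N" "n \<ge> N" for m n
      using dd[of n m] dd[of m n] N[OF mn(1)] N[OF mn(2)] cnorm_minus_commute[OF Sc[of n] Sc[of m]] p[of m] p[of n]
      by (cases "n \<le> m") auto
    then show ?thesis by blast
  qed
  then obtain l where l: "l \<in> carrier A" and lim: "(\<lambda>n. cnorm A (S n \<ominus> l)) \<longlonglongrightarrow> 0"
    using Cauchy_limit[of S] Sc by blast
  have fl: "l = \<one> \<oplus> w \<otimes> l"
  proof (rule limit_unique)
    show "(\<lambda>n. cnorm A (S (Suc n) \<ominus> l)) \<longlonglongrightarrow> 0" using lim by (rule LIMSEQ_Suc)
    have "S (Suc n) \<ominus> (\<one> \<oplus> w \<otimes> l) = w \<otimes> (S n \<ominus> l)" for n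
      unfolding SS using wc Sc[of n] l by (intro lin_eqI) (auto simp: lin_simps distrib)
    then have "cnorm A (S (Suc n) \<ominus> (\<one> \<oplus> w \<otimes> l)) \<le> cnorm A w * cnorm A (S n \<ominus> l)" for n
      using cnorm_mult[of w "S n \<ominus> l"] wc Sc l by simp
    then show "(\<lambda>n. cnorm A (S (Suc n) \<ominus> (\<one> \<oplus> w \<otimes> l))) \<longlonglongrightarrow> 0"
      by (intro tendsto_sandwich[OF _ _ tendsto_const tendsto_mult_right_zero[OF lim, of "cnorm A w"]])
        (use wc l Sc in \<open>auto intro!: cnorm_nonneg always_eventually\<close>)
  qed (use l Sc wc in auto)
  define g where "g = u \<odot> l"
  have gc: "g \<in> carrier A" using l by (simp add: g_def)
  have hg: "h \<otimes> g = \<one>"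
  proof (rule lin_eqI)
    fix k assume k: "lin A k"
    have "k l = k \<one> + (k l - u * k (h \<otimes> l))" using arg_cong[OF fl, of k] k l assms(2) wc
      by (simp add: lin_simps) (simp add: w_def lin_simps distrib assms(2) k l)
    then show "k (h \<otimes> g) = k \<one>" using k l assms(2) by (simp add: g_def lin_simps distrib)
  qed (use gc assms(2) in auto)
  \<comment> \<open>Taking adjoints of \<open>h g = 1\<close> makes \<open>star g\<close> a left
    inverse, which coincides with the right inverse \<open>g\<close>; this gives self-adjointness
    and the other equation together.\<close>
  have "star A g \<otimes> h = \<one>" using arg_cong[OF hg, of "star A"] gc assms(2) hs by (simp add: star_mult)
  moreover have "star A g = star A g \<otimes> (h \<otimes> g)" using hg gc by simp
  ultimately have "star A g = g" using gc assms(2) by (metis mult_assoc star_closed unit_l)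
  then show ?thesis using hg gc \<open>star A g \<otimes> h = \<one>\<close> by (auto simp: self_adjoint_def)
qed

end

section \<open>Homomorphisms\<close>

lemma star_homD:
  assumes "h \<in> star_hom A B"
  shows "x \<in> carrier A \<Longrightarrow> h x \<in> carrier B"
    and "x \<in> carrier A \<Longrightarrow> y \<in> carrier A \<Longrightarrow> h (x \<oplus>\<^bsub>A\<^esub> y) = h x \<oplus>\<^bsub>B\<^esub> h y"
    and "x \<in> carrier A \<Longrightarrow> h (c \<odot>\<^bsub>A\<^esub> x) = c \<odot>\<^bsub>B\<^esub> h x"
    and "x \<in> carrier A \<Longrightarrow> y \<in> carrier A \<Longrightarrow> h (x \<otimes>\<^bsub>A\<^esub> y) = h x \<otimes>\<^bsub>B\<^esub> h y"
    and "x \<in> carrier A \<Longrightarrow> h (star A x) = star B (h x)"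
  using assms by (auto simp: star_hom_def)

lemma star_hom_minus:
  assumes "cstar_algebra A" "cstar_algebra B" "h \<in> star_hom A B" "x \<in> carrier A" "y \<in> carrier A"
  shows "h (x \<ominus>\<^bsub>A\<^esub> y) = h x \<ominus>\<^bsub>B\<^esub> h y"
proof -
  interpret A: cstar_algebra A by fact
  interpret B: cstar_algebra B by fact
  have "x \<ominus>\<^bsub>A\<^esub> y = x \<oplus>\<^bsub>A\<^esub> (-1) \<odot>\<^bsub>A\<^esub> y" using assms by (simp add: a_minus_def A.smult_m1)
  then show ?thesis using assms star_homD[OF assms(3)] by (simp add: a_minus_def B.smult_m1)
qed

lemma star_hom_lin:
  assumes "cstar_algebra A" "h \<in> star_hom A B" "lin B g" shows "lin A (\<lambda>x. g (h x))"
  using star_homD[OF assms(2)] assms(3) by (simp add: lin_def)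

lemma star_hom_posf:
  assumes "h \<in> star_hom A B" "cstar_algebra A" "posf B g" shows "posf A (\<lambda>x. g (h x))"
proof -
  interpret A: cstar_algebra A by fact
  show ?thesis using assms star_homD[OF assms(1)] by (auto simp: posf_def intro: star_hom_lin)
qed

text \<open>A unital homomorphism preserves the root \<open>s\<close> of
  \<open>|x|^2 - x* x\<close>, so \<open>|x|^2 - h(x)* h(x)\<close> is again a square and hence
  positive; order then bounds the norm.\<close>

lemma star_hom_contractive:
  assumes "unital_cstar_algebra A" "unital_cstar_algebra B" "h \<in> star_hom A B" "h \<one>\<^bsub>A\<^esub> = \<one>\<^bsub>B\<^esub>"
    and x: "x \<in> carrier A"
  shows "cnorm B (h x) \<le> cnorm A x"
proof -
  interpret A: unital_cstar_algebra A by fact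
  interpret B: unital_cstar_algebra B by fact
  note h = star_homD[OF assms(3)]
  have cs: "cstar_algebra A" "cstar_algebra B" by unfold_locales
  obtain s where s: "self_adjoint A s" "s \<otimes>\<^bsub>A\<^esub> s = complex_of_real ((cnorm A x)\<^sup>2) \<odot>\<^bsub>A\<^esub> \<one>\<^bsub>A\<^esub> \<ominus>\<^bsub>A\<^esub> star A x \<otimes>\<^bsub>A\<^esub> x"
    using A.pos_sqrt[OF A.pos_bound[OF x]] by blast
  have sc: "s \<in> carrier A" "star A s = s" using s(1) by (auto simp: self_adjoint_def)
  have "h s \<otimes>\<^bsub>B\<^esub> h s = complex_of_real ((cnorm A x)\<^sup>2) \<odot>\<^bsub>B\<^esub> \<one>\<^bsub>B\<^esub> \<ominus>\<^bsub>B\<^esub> star B (h x) \<otimes>\<^bsub>B\<^esub> h x"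
    using arg_cong[OF s(2), of h] sc x h assms(4) by (simp add: star_hom_minus[OF cs assms(3)] A.unit_closed)
  moreover have "self_adjoint B (h s)" using sc h by (metis self_adjoint_def)
  ultimately have "pos B (complex_of_real ((cnorm A x)\<^sup>2) \<odot>\<^bsub>B\<^esub> \<one>\<^bsub>B\<^esub> \<ominus>\<^bsub>B\<^esub> star B (h x) \<otimes>\<^bsub>B\<^esub> h x)"
    using B.pos_square by metis
  then have "cnorm B (star B (h x) \<otimes>\<^bsub>B\<^esub> h x) \<le> (cnorm A x)\<^sup>2"
    using x h by (intro B.cnorm_le_of_pos B.pos_star_mult) auto
  then have "(cnorm B (h x))\<^sup>2 \<le> (cnorm A x)\<^sup>2" using x h B.cstar_identity by simp
  then show ?thesis using A.cnorm_nonneg[OF x] power2_le_imp_le by blast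
qed

section \<open>Functionals of finite rank\<close>

text \<open>Gaussian elimination, by induction on the equations. The dimension counts below rest on
  it.\<close>

lemma homogeneous_system:
  fixes c :: "'j \<Rightarrow> 'b \<Rightarrow> complex"
  assumes "finite B" "finite J" "card B < card J"
  shows "\<exists>l. (\<exists>j\<in>J. l j \<noteq> 0) \<and> (\<forall>b\<in>B. (\<Sum>j\<in>J. l j * c j b) = 0)"
  using assms
proof (induction B arbitrary: J c rule: finite_induct)
  case empty
  then obtain j where "j \<in> J" by (metis all_not_in_conv card.empty less_irrefl)
  then show ?case by (intro exI[of _ "\<lambda>_. 1"]) auto
next
  case (insert b B)
  show ?case
  proof (cases "\<forall>j\<in>J. c j b = 0")
    case True
    obtain l where "\<exists>j\<in>J. l j \<noteq> 0" "\<forall>b\<in>B. (\<Sum>j\<in>J. l j * c j b) = 0"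
      using insert.IH[of J c] insert.prems insert.hyps by auto
    then show ?thesis using True by (intro exI[of _ l]) auto
  next
    case False
    then obtain k where k: "k \<in> J" "c k b \<noteq> 0" by blast
    \<comment> \<open>Elimination with pivot \<open>k\<close>: these are the coefficients of the
      remaining equations after equation \<open>b\<close> has been solved for the unknown
      \<open>k\<close>.\<close>
    define c' where "c' j x = c j x - c j b / c k b * c k x" for j x
    have "card B < card (J - {k})" using insert.prems insert.hyps k(1) by simp
    then obtain l where l: "\<exists>j\<in>J - {k}. l j \<noteq> 0" "\<forall>b\<in>B. (\<Sum>j\<in>J - {k}. l j * c' j b) = 0"
      using insert.IH[of "J - {k}" c'] insert.prems by auto
    define s where "s = (\<Sum>j\<in>J - {k}. l j * c j b)"
    define l' where "l' = l(k := - s / c k b)"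
    have sum': "(\<Sum>j\<in>J. l' j * c j x) = - s / c k b * c k x + (\<Sum>j\<in>J - {k}. l j * c j x)" for x
      using k(1) insert.prems(1) by (subst sum.remove[of J k]) (auto simp: l'_def intro!: sum.cong)
    have "(\<Sum>j\<in>J. l' j * c j x) = 0" if "x \<in> B" for x
    proof -
      have "(\<Sum>j\<in>J - {k}. l j * c' j x) = (\<Sum>j\<in>J - {k}. l j * c j x) - s / c k b * c k x"
        unfolding c'_def s_def sum_divide_distrib sum_distrib_right sum_subtractf[symmetric]
        by (intro sum.cong) (auto simp: algebra_simps)
      then show ?thesis using l(2) that sum'[of x] by simp
    qed
    moreover have "(\<Sum>j\<in>J. l' j * c j b) = 0" using sum'[of b] k(2) by (simp add: s_def)
    moreover have "\<exists>j\<in>J. l' j \<noteq> 0" using l(1) by (auto simp: l'_def)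
    ultimately show ?thesis by (intro exI[of _ l']) auto
  qed
qed

text \<open>\<open>\<phi> (star y x)\<close> is the inner product of the GNS classes of
  \<open>x\<close> and \<open>y\<close>, linear in \<open>x\<close>. Systems are indexed by the
  numbers below \<open>r\<close>, so that their lengths can be maximized.\<close>

definition orthonormal :: "'a cstar \<Rightarrow> ('a \<Rightarrow> complex) \<Rightarrow> nat \<Rightarrow> (nat \<Rightarrow> 'a) \<Rightarrow> bool" where
  "orthonormal A \<phi> r e \<longleftrightarrow> (\<forall>i<r. \<forall>j<r. \<phi> (star A (e j) \<otimes>\<^bsub>A\<^esub> e i) = (if i = j then 1 else 0))"

text \<open>The Gram matrix factors through the index set \<open>J\<close>, so its rank is at most
  \<open>card J\<close>; being the identity matrix, it has rank \<open>r\<close>.\<close>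

lemma orthonormal_bound:
  assumes "orthonormal A \<phi> r e" "finite J"
    and uv: "\<And>i j. i < r \<Longrightarrow> j < r \<Longrightarrow> \<phi> (star A (e j) \<otimes>\<^bsub>A\<^esub> e i) = (\<Sum>x\<in>J. u x i * v x j)"
  shows "r \<le> card J"
proof (rule ccontr)
  assume "\<not> r \<le> card J"
  then obtain l j where l: "j < r" "l j \<noteq> 0" "\<forall>x\<in>J. (\<Sum>i<r. l i * u x i) = 0"
    using homogeneous_system[of J "{..<r}" "\<lambda>i x. u x i"] assms(2) by auto
  have "(\<Sum>i<r. l i * \<phi> (star A (e j) \<otimes>\<^bsub>A\<^esub> e i)) = (\<Sum>i<r. \<Sum>x\<in>J. l i * u x i * v x j)"
    using l(1) by (simp add: uv sum_distrib_left mult.assoc)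
  also have "\<dots> = (\<Sum>x\<in>J. (\<Sum>i<r. l i * u x i) * v x j)"
    by (subst sum.swap) (simp add: sum_distrib_right)
  also have "\<dots> = 0" using l(3) by simp
  also have "(\<Sum>i<r. l i * \<phi> (star A (e j) \<otimes>\<^bsub>A\<^esub> e i)) = (\<Sum>i<r. if i = j then l i else 0)"
    using assms(1) l(1) by (intro sum.cong) (auto simp: orthonormal_def)
  finally show False using l by simp
qed

text \<open>\<open>N\<close> bounds the dimension of the GNS space of \<open>\<psi>\<close>.\<close>

definition fin_rank :: "'a cstar \<Rightarrow> ('a \<Rightarrow> complex) \<Rightarrow> bool" where
  "fin_rank A \<psi> \<longleftrightarrow> posf A \<psi> \<and>
     (\<exists>N. \<forall>r e. (\<forall>i<r. e i \<in> carrier A) \<longrightarrow> orthonormal A \<psi> r e \<longrightarrow> r \<le> N)"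

lemma fin_rank_posf: "fin_rank A \<psi> \<Longrightarrow> posf A \<psi>" by (simp add: fin_rank_def)

context cstar_algebra
begin

text \<open>Choose an orthonormal system in \<open>V\<close> of greatest length. Subtracting from
  \<open>a\<close> its Fourier sum leaves a vector orthogonal to the system, which must be null
  since otherwise it could be normalized and appended. Null vectors are invisible to all inner
  products, so the Parseval identity holds against every \<open>b\<close> of the whole algebra, not
  only of \<open>V\<close>.\<close>

lemma exists_complete_orthonormal:
  assumes f: "posf A \<phi>" and V: "V \<subseteq> carrier A" "\<zero> \<in> V"
    "\<And>x y. x \<in> V \<Longrightarrow> y \<in> V \<Longrightarrow> x \<oplus> y \<in> V" "\<And>c x. x \<in> V \<Longrightarrow> c \<odot> x \<in> V"
    and bd: "\<And>r e. (\<forall>i<r. e i \<in> V) \<Longrightarrow> orthonormal A \<phi> r e \<Longrightarrow> r \<le> N"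
  shows "\<exists>r e. (\<forall>i<r. e i \<in> V) \<and> orthonormal A \<phi> r e \<and>
     (\<forall>a\<in>V. \<forall>b\<in>carrier A. \<phi> (star A b \<otimes> a) = (\<Sum>i<r. \<phi> (star A (e i) \<otimes> a) * \<phi> (star A b \<otimes> e i)))"
proof -
  define P where "P r \<longleftrightarrow> (\<exists>e. (\<forall>i<r. e i \<in> V) \<and> orthonormal A \<phi> r e)" for r
  have "P 0" by (simp add: P_def orthonormal_def)
  moreover have "\<And>r. P r \<Longrightarrow> r \<le> N" using bd by (auto simp: P_def)
  ultimately obtain r where r: "P r" "\<And>s. P s \<Longrightarrow> s \<le> r"
    using Nat.ex_has_greatest_nat[of P 0 N] by blast
  then obtain e where e: "\<And>i. i < r \<Longrightarrow> e i \<in> V" and on: "orthonormal A \<phi> r e" by (auto simp: P_def)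
  have ec: "i < r \<Longrightarrow> e i \<in> carrier A" for i using e V by blast
  note lf = posf_lin[OF f]
  have "\<phi> (star A b \<otimes> a) = (\<Sum>i<r. \<phi> (star A (e i) \<otimes> a) * \<phi> (star A b \<otimes> e i))"
    if a: "a \<in> V" and b: "b \<in> carrier A" for a b
  proof -
    have ac: "a \<in> carrier A" using a V by blast
    define s where "s = (\<Oplus>\<^bsub>A\<^esub>i\<in>{..<r}. \<phi> (star A (e i) \<otimes> a) \<odot> e i)"
    have sV: "s \<in> V"
    proof -
      have "k \<le> r \<Longrightarrow> (\<Oplus>\<^bsub>A\<^esub>i\<in>{..<k}. \<phi> (star A (e i) \<otimes> a) \<odot> e i) \<in> V" for k
      proof (induction k)
        case (Suc k)
        have "(\<Oplus>\<^bsub>A\<^esub>i\<in>{..<Suc k}. \<phi> (star A (e i) \<otimes> a) \<odot> e i) =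
            (\<phi> (star A (e k) \<otimes> a) \<odot> e k) \<oplus> (\<Oplus>\<^bsub>A\<^esub>i\<in>{..<k}. \<phi> (star A (e i) \<otimes> a) \<odot> e i)"
          unfolding lessThan_Suc using Suc.prems ec by (intro M.finsum_insert) auto
        then show ?case using Suc e V by auto
      qed (use V in auto)
      then show ?thesis by (simp add: s_def)
    qed
    have sc: "s \<in> carrier A" using sV V by blast
    define a' where "a' = a \<ominus> s"
    have a'V: "a' \<in> V" using V a sV unfolding a'_def a_minus_def using smult_m1[OF sc] by metis
    have a'c: "a' \<in> carrier A" using a'V V by blast
    have s1: "\<phi> (star A y \<otimes> s) = (\<Sum>i<r. \<phi> (star A (e i) \<otimes> a) * \<phi> (star A y \<otimes> e i))" if y: "y \<in> carrier A" for y
    proof -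
      have "\<phi> (star A y \<otimes> s) = (\<Sum>i<r. \<phi> (star A y \<otimes> (\<phi> (star A (e i) \<otimes> a) \<odot> e i)))"
        unfolding s_def using lin_finsum[OF lin_mult_l[OF lf, of "star A y"], of "{..<r}" "\<lambda>i. \<phi> (star A (e i) \<otimes> a) \<odot> e i"] y ec
        by auto
      then show ?thesis using y ec lf by (simp add: smult_mult_r lin_smult)
    qed
    have orth: "\<phi> (star A (e j) \<otimes> a') = 0" if j: "j < r" for j
    proof -
      have "\<phi> (star A (e j) \<otimes> s) = (\<Sum>i<r. if i = j then \<phi> (star A (e i) \<otimes> a) else 0)"
        unfolding s1[OF ec[OF j]] using on j by (intro sum.cong) (auto simp: orthonormal_def)
      then show ?thesis using j ac sc ec[OF j] lf by (simp add: a'_def minus_mult_r lin_minus)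
    qed
    have "Re (\<phi> (star A a' \<otimes> a')) = 0"
    proof (rule ccontr)
      assume n: "Re (\<phi> (star A a' \<otimes> a')) \<noteq> 0"
      define k where "k = Re (\<phi> (star A a' \<otimes> a'))"
      have k: "k > 0" using n posf_nonneg[OF f a'c] by (simp add: k_def)
      have \<phi>k: "\<phi> (star A a' \<otimes> a') = complex_of_real k" using posf_eq_Re[OF f a'c] by (simp add: k_def)
      define e' where "e' = e(r := complex_of_real (1 / sqrt k) \<odot> a')"
      have "complex_of_real (1 / sqrt k) * (complex_of_real (1 / sqrt k) * complex_of_real k) = complex_of_real (1 / sqrt k * (1 / sqrt k * k))"
        by (simp only: of_real_mult)
      also have "1 / sqrt k * (1 / sqrt k * k) = 1" using k by (simp add: field_simps)
      finally have kk: "complex_of_real (1 / sqrt k) * (complex_of_real (1 / sqrt k) * complex_of_real k) = 1" by simp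
      have "\<phi> (star A (e' j) \<otimes> e' i) = (if i = j then 1 else 0)" if ij: "i < Suc r" "j < Suc r" for i j
      proof -
        consider "i < r" "j < r" | "i = r" "j < r" | "i < r" "j = r" | "i = r" "j = r" using ij by linarith
        then show ?thesis
        proof cases
          case 1
          then show ?thesis using on by (simp add: e'_def orthonormal_def)
        next
          case 2
          then show ?thesis using orth[of j] a'c ec[of j] lf by (simp add: e'_def smult_mult_r lin_smult)
        next
          case 3
          have "\<phi> (star A a' \<otimes> e i) = 0" using orth[of i] posf_swap[OF f a'c ec[of i]] 3 by simp
          then show ?thesis using 3 a'c ec[of i] lf by (simp add: e'_def smult_mult_l star_smult lin_smult)
        next
          case 4
          then show ?thesis using a'c lf kk \<phi>k by (simp add: e'_def smult_mult_l smult_mult_r star_smult lin_smult)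
        qed
      qed
      moreover have "\<forall>i<Suc r. e' i \<in> V" using e a'V V(4) by (auto simp: e'_def less_Suc_eq)
      ultimately have "P (Suc r)" by (auto simp: P_def orthonormal_def)
      then show False using r(2) by force
    qed
    then have "\<phi> (star A b \<otimes> a') = 0" using posf_null[OF f a'c b] by simp
    then show ?thesis using s1[OF b] b ac sc lf by (simp add: a'_def minus_mult_r lin_minus)
  qed
  then show ?thesis using e on by blast
qed

text \<open>The corner \<open>e A e\<close> is closed, being cut out by continuous equations, and
  has unit \<open>e\<close>. It is needed because the homomorphisms in \<open>rfd\<close> may go
  into an algebra without unit and need not preserve units; the corner at the image of the unit
  repairs both.\<close>

lemma corner_unital_cstar_algebra:
  assumes e: "e \<in> carrier A" "e \<otimes> e = e" "star A e = e"
  shows "unital_cstar_algebra (A\<lparr>carrier := {x \<in> carrier A. e \<otimes> x = x \<and> x \<otimes> e = x}, one := e\<rparr>)"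
    (is "unital_cstar_algebra ?F")
proof -
  have ops [simp]: "x \<otimes>\<^bsub>?F\<^esub> y = x \<otimes> y" "x \<oplus>\<^bsub>?F\<^esub> y = x \<oplus> y" "\<zero>\<^bsub>?F\<^esub> = \<zero>" "c \<odot>\<^bsub>?F\<^esub> x = c \<odot> x" "star ?F x = star A x"
    "cnorm ?F x = cnorm A x" "\<one>\<^bsub>?F\<^esub> = e" for x y c by simp_all
  have car: "x \<in> carrier ?F \<longleftrightarrow> x \<in> carrier A \<and> e \<otimes> x = x \<and> x \<otimes> e = x" for x by simp
  have ag: "abelian_group ?F"
  proof (rule abelian_groupI)
    fix x assume "x \<in> carrier ?F"
    then show "\<exists>y\<in>carrier ?F. y \<oplus>\<^bsub>?F\<^esub> x = \<zero>\<^bsub>?F\<^esub>"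
      using e by (intro bexI[of _ "\<ominus> x"]) (auto simp: M.l_neg distrib)
  qed (use e in \<open>auto simp: distrib M.add.m_ac\<close>)
  interpret F: abelian_group ?F by fact
  have mod: "Module.module complex_ring ?F"
    by (rule moduleI[OF cring_complex_ring ag]) (use e in \<open>auto simp: distrib smult_add_left smult_add_right\<close>)
  have inv: "\<ominus>\<^bsub>?F\<^esub> x = \<ominus> x" if "x \<in> carrier ?F" for x
    by (rule F.minus_equality) (use that e in \<open>auto simp: M.l_neg distrib\<close>)
  have minus: "x \<ominus>\<^bsub>?F\<^esub> y = x \<ominus> y" if "y \<in> carrier ?F" for x y
    using inv[OF that] by (simp add: a_minus_def)
  have cd: "cdist ?F x y = (if x \<in> carrier ?F \<and> y \<in> carrier ?F then cnorm A (x \<ominus> y) else 0)" for x y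
    unfolding cdist_def using minus by auto
  have met: "Metric_space (carrier ?F) (cdist ?F)"
  proof
    show "0 \<le> cdist ?F x y" for x y by (auto simp: cd cnorm_nonneg)
    show "cdist ?F x y = cdist ?F y x" for x y by (auto simp: cd cnorm_minus_commute)
    show "cdist ?F x y = 0 \<longleftrightarrow> x = y" if "x \<in> carrier ?F" "y \<in> carrier ?F" for x y
      using that by (auto simp: cd cnorm_eq_0_iff minus_eq_zero)
    show "cdist ?F x z \<le> cdist ?F x y + cdist ?F y z" if "x \<in> carrier ?F" "y \<in> carrier ?F" "z \<in> carrier ?F" for x y z
      using that by (auto simp: cd cnorm_triangle3)
  qed
  have comp: "Metric_space.mcomplete (carrier ?F) (cdist ?F)"
  proof (rule mcompleteI[OF met])
    fix x :: "nat \<Rightarrow> 'a" assume x: "\<And>n. x n \<in> carrier ?F" and C: "\<And>d. d > 0 \<Longrightarrow> \<exists>N. \<forall>m\<ge>N. \<forall>n\<ge>N. cnorm ?F (x m \<ominus>\<^bsub>?F\<^esub> x n) < d"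
    have xc: "x n \<in> carrier A" "e \<otimes> x n = x n" "x n \<otimes> e = x n" for n using x[of n] by auto
    have "\<exists>N. \<forall>m\<ge>N. \<forall>n\<ge>N. cnorm A (x m \<ominus> x n) < d" if "d > 0" for d
      using C[OF that] unfolding ops minus[OF x] by simp
    then obtain l where l: "l \<in> carrier A" and lim: "(\<lambda>n. cnorm A (x n \<ominus> l)) \<longlonglongrightarrow> 0"
      using Cauchy_limit[of x] xc by blast
    have "e \<otimes> l = l"
    proof (rule limit_unique[OF xc(1) _ l _ lim])
      have "cnorm A (x n \<ominus> e \<otimes> l) \<le> cnorm A e * cnorm A (x n \<ominus> l)" for n
        using cnorm_mult[of e "x n \<ominus> l"] e l xc[of n] by (simp add: minus_mult_r)
      then show "(\<lambda>n. cnorm A (x n \<ominus> e \<otimes> l)) \<longlonglongrightarrow> 0"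
        by (intro tendsto_sandwich[OF _ _ tendsto_const tendsto_mult_right_zero[OF lim, of "cnorm A e"]])
          (use e l xc in \<open>auto intro!: cnorm_nonneg always_eventually\<close>)
    qed (use e l in auto)
    moreover have "l \<otimes> e = l"
    proof (rule limit_unique[OF xc(1) _ l _ lim])
      have "cnorm A (x n \<ominus> l \<otimes> e) \<le> cnorm A (x n \<ominus> l) * cnorm A e" for n
        using cnorm_mult[of "x n \<ominus> l" e] e l xc[of n] by (simp add: minus_mult_l)
      then show "(\<lambda>n. cnorm A (x n \<ominus> l \<otimes> e)) \<longlonglongrightarrow> 0"
        by (intro tendsto_sandwich[OF _ _ tendsto_const tendsto_mult_left_zero[OF lim, of "cnorm A e"]])
          (use e l xc in \<open>auto intro!: cnorm_nonneg always_eventually\<close>)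
    qed (use e l in auto)
    ultimately have lF: "l \<in> carrier ?F" using l by simp
    then show "\<exists>l\<in>carrier ?F. (\<lambda>n. cnorm ?F (x n \<ominus>\<^bsub>?F\<^esub> l)) \<longlonglongrightarrow> 0"
      using lim by (intro bexI[of _ l]) (simp_all only: minus[OF lF] ops)
  qed
  have star_e: "e \<otimes> star A x = star A x" "star A x \<otimes> e = star A x" if "x \<in> carrier A" "e \<otimes> x = x" "x \<otimes> e = x" for x
    using star_mult[of x e] star_mult[of e x] that e by simp_all
  have mul_e: "e \<otimes> (x \<otimes> y) = x \<otimes> y" "(x \<otimes> y) \<otimes> e = x \<otimes> y" if "x \<in> carrier A" "e \<otimes> x = x" "y \<in> carrier A" "y \<otimes> e = y" for x y
    using mult_assoc[of e x y] mult_assoc[of x y e] that e by simp_all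
  have cs: "cstar_algebra ?F"
    by (intro cstar_algebra.intro mod cstar_algebra_axioms.intro)
      (use e comp star_e mul_e in \<open>simp_all add: mult_assoc mult_l_distr mult_r_distr smult_mult_l smult_mult_r star_simps
        cnorm_nonneg cnorm_eq_0_iff cnorm_triangle cnorm_smult cnorm_mult cstar_identity\<close>)
  show ?thesis
    by (intro unital_cstar_algebra.intro cs unital_cstar_algebra_axioms.intro) (use e in auto)
qed

end

text \<open>Pull back a positive functional that detects \<open>\<pi> x\<close> in the corner at the
  image of the unit. Its GNS inner products factor through coordinates with respect to a finite
  spanning set \<open>B\<close> of the target, so orthonormal systems have at most
  \<open>card B\<close> members.\<close>

lemma rfd_separating:
  assumes "unital_cstar_algebra A" "rfd A" "x \<in> carrier A" "x \<noteq> \<zero>\<^bsub>A\<^esub>"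
  shows "\<exists>\<psi>. fin_rank A \<psi> \<and> \<psi> (star A x \<otimes>\<^bsub>A\<^esub> x) \<noteq> 0"
proof -
  interpret A: unital_cstar_algebra A by fact
  obtain F :: "seq cstar" and \<pi> where F: "cstar_algebra F" "finite_dimensional F" and \<pi>: "\<pi> \<in> star_hom A F" "\<pi> x \<noteq> \<zero>\<^bsub>F\<^esub>"
    using assms by (auto simp: rfd_def)
  interpret F: cstar_algebra F by fact
  note h = star_homD[OF \<pi>(1)]
  define e where "e = \<pi> \<one>\<^bsub>A\<^esub>"
  have e: "e \<in> carrier F" "e \<otimes>\<^bsub>F\<^esub> e = e" "star F e = e"
    using h(1)[of "\<one>\<^bsub>A\<^esub>"] h(4)[of "\<one>\<^bsub>A\<^esub>" "\<one>\<^bsub>A\<^esub>"] h(5)[of "\<one>\<^bsub>A\<^esub>"] by (auto simp: e_def)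
  have eh: "e \<otimes>\<^bsub>F\<^esub> \<pi> y = \<pi> y" "\<pi> y \<otimes>\<^bsub>F\<^esub> e = \<pi> y" if "y \<in> carrier A" for y
    using h(4)[of "\<one>\<^bsub>A\<^esub>" y] h(4)[of y "\<one>\<^bsub>A\<^esub>"] that by (auto simp: e_def)
  define G where "G = F\<lparr>carrier := {x \<in> carrier F. e \<otimes>\<^bsub>F\<^esub> x = x \<and> x \<otimes>\<^bsub>F\<^esub> e = x}, one := e\<rparr>"
  have ops [simp]: "x \<otimes>\<^bsub>G\<^esub> y = x \<otimes>\<^bsub>F\<^esub> y" "x \<oplus>\<^bsub>G\<^esub> y = x \<oplus>\<^bsub>F\<^esub> y" "\<zero>\<^bsub>G\<^esub> = \<zero>\<^bsub>F\<^esub>" "c \<odot>\<^bsub>G\<^esub> x = c \<odot>\<^bsub>F\<^esub> x" "star G x = star F x"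
    for x y c by (simp_all add: G_def)
  have Gc: "x \<in> carrier G \<longleftrightarrow> x \<in> carrier F \<and> e \<otimes>\<^bsub>F\<^esub> x = x \<and> x \<otimes>\<^bsub>F\<^esub> e = x" for x by (simp add: G_def)
  interpret G: unital_cstar_algebra G unfolding G_def by (rule F.corner_unital_cstar_algebra[OF e])
  have \<pi>G: "\<pi> \<in> star_hom A G" using h eh by (auto simp: star_hom_def Gc)
  have "\<pi> x \<in> carrier G" using assms h eh by (auto simp: Gc)
  then obtain \<phi> where \<phi>: "posf G \<phi>" "0 < Re (\<phi> (star G (\<pi> x) \<otimes>\<^bsub>G\<^esub> \<pi> x))" using G.exists_posf[of "\<pi> x"] \<pi>(2) by auto
  define \<psi> where "\<psi> y = \<phi> (\<pi> y)" for y
  have "posf A \<psi>" unfolding \<psi>_def using star_hom_posf[OF \<pi>G A.cstar_algebra_axioms \<phi>(1)] .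
  obtain B where B: "finite B" "B \<subseteq> carrier F" "\<And>y. y \<in> carrier F \<Longrightarrow> \<exists>c. y = (\<Oplus>\<^bsub>F\<^esub>b\<in>B. c b \<odot>\<^bsub>F\<^esub> b)"
    using F(2) unfolding finite_dimensional_def by blast
  obtain c where c: "\<And>y. y \<in> carrier F \<Longrightarrow> y = (\<Oplus>\<^bsub>F\<^esub>b\<in>B. c y b \<odot>\<^bsub>F\<^esub> b)" using B(3) by metis
  have "r \<le> card B" if u: "\<forall>i<r. u i \<in> carrier A" "orthonormal A \<psi> r u" for r u
  proof (rule orthonormal_bound[OF u(2) B(1)])
    fix i j assume ij: "i < r" "j < r"
    define z where "z = \<pi> (u j)"
    have zc: "z \<in> carrier F" "e \<otimes>\<^bsub>F\<^esub> z = z" "z \<otimes>\<^bsub>F\<^esub> e = z" using u ij h eh by (auto simp: z_def)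
    have z: "star F z \<otimes>\<^bsub>F\<^esub> e = star F z" using F.star_mult[of e z] e zc by simp
    \<comment> \<open>\<open>\<phi>\<close> is linear only on the corner, while \<open>B\<close>
      spans all of \<open>F\<close>; compressing by \<open>e\<close> from both sides carries every
      \<open>w\<close> into the corner and leaves the values at images of \<open>\<pi>\<close>
      unchanged.\<close>
    define g where "g w = \<phi> (star F z \<otimes>\<^bsub>F\<^esub> (e \<otimes>\<^bsub>F\<^esub> w \<otimes>\<^bsub>F\<^esub> e))" for w
    have sz: "e \<otimes>\<^bsub>F\<^esub> star F z = star F z" using F.star_mult[of z e] e zc by simp
    have inG: "star F z \<otimes>\<^bsub>F\<^esub> (e \<otimes>\<^bsub>F\<^esub> w \<otimes>\<^bsub>F\<^esub> e) \<in> carrier G" if "w \<in> carrier F" for w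
      using that e zc sz by (simp add: Gc F.mult_assoc) (metis F.mult_assoc F.mult_closed F.star_closed)
    have "lin F g"
      unfolding lin_def
    proof (intro conjI ballI allI)
      fix w w' assume "w \<in> carrier F" "w' \<in> carrier F"
      then show "g (w \<oplus>\<^bsub>F\<^esub> w') = g w + g w'"
        using G.lin_add[OF G.posf_lin[OF \<phi>(1)] inG[of w] inG[of w']] e zc
        by (simp add: g_def F.mult_l_distr F.mult_r_distr)
    next
      fix d w assume "w \<in> carrier F"
      then show "g (d \<odot>\<^bsub>F\<^esub> w) = d * g w"
        using G.lin_smult[OF G.posf_lin[OF \<phi>(1)] inG[of w], of d] e zc
        by (simp add: g_def F.smult_mult_l F.smult_mult_r)
    qed
    define y where "y = \<pi> (u i)"
    have y: "y \<in> carrier F" "e \<otimes>\<^bsub>F\<^esub> y = y" "y \<otimes>\<^bsub>F\<^esub> e = y" using u ij h eh by (auto simp: y_def)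
    have "\<psi> (star A (u j) \<otimes>\<^bsub>A\<^esub> u i) = g y"
      using u ij h y by (simp add: \<psi>_def g_def z_def y_def)
    also have "\<dots> = (\<Sum>b\<in>B. g (c y b \<odot>\<^bsub>F\<^esub> b))"
      using F.lin_finsum[OF \<open>lin F g\<close> B(1), of "\<lambda>b. c y b \<odot>\<^bsub>F\<^esub> b"] c[OF y(1)] B(2) by auto
    also have "\<dots> = (\<Sum>b\<in>B. c y b * g b)" using B(2) by (intro sum.cong F.lin_smult[OF \<open>lin F g\<close>]) auto
    finally show "\<psi> (star A (u j) \<otimes>\<^bsub>A\<^esub> u i) = (\<Sum>b\<in>B. c (\<pi> (u i)) b * \<phi> (star F (\<pi> (u j)) \<otimes>\<^bsub>F\<^esub> (e \<otimes>\<^bsub>F\<^esub> b \<otimes>\<^bsub>F\<^esub> e)))"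
      by (simp add: g_def y_def z_def)
  qed
  then have "fin_rank A \<psi>" using \<open>posf A \<psi>\<close> by (auto simp: fin_rank_def)
  moreover have "\<psi> (star A x \<otimes>\<^bsub>A\<^esub> x) \<noteq> 0" using \<phi>(2) h assms(3) by (auto simp: \<psi>_def)
  ultimately show ?thesis by blast
qed

section \<open>Approximation of positive kernels\<close>

text \<open>The entries of a positive functional on the \<open>I\<close> by \<open>I\<close>
  matrices over \<open>A\<close>. The model is \<open>t i j a = <a v_j, v_i>\<close> for vectors
  \<open>v_i\<close> of a representation, where the double sum is the squared norm of the sum of the
  \<open>c_i v_i\<close>.\<close>

definition kernel :: "'a cstar \<Rightarrow> 'i set \<Rightarrow> ('i \<Rightarrow> 'i \<Rightarrow> 'a \<Rightarrow> complex) \<Rightarrow> bool" where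
  "kernel A I t \<longleftrightarrow> (\<forall>i\<in>I. \<forall>j\<in>I. lin A (t i j)) \<and>
     (\<forall>i\<in>I. \<forall>j\<in>I. \<forall>a\<in>carrier A. t i j (star A a) = cnj (t j i a)) \<and>
     (\<forall>c. (\<forall>i\<in>I. c i \<in> carrier A) \<longrightarrow> 0 \<le> Re (\<Sum>i\<in>I. \<Sum>j\<in>I. t i j (star A (c i) \<otimes>\<^bsub>A\<^esub> c j)))"

text \<open>Data for vectors in a finite direct sum of GNS spaces of finite-rank functionals: the
  vector with index \<open>i\<close> has the class of \<open>c k i\<close> as its
  \<open>k\<close>-th component, and \<open>kernel_of\<close> is the kernel of these
  vectors.\<close>

definition fin_kernel :: "'a cstar \<Rightarrow> 'i set \<Rightarrow> nat \<Rightarrow> (nat \<Rightarrow> 'a \<Rightarrow> complex) \<Rightarrow> (nat \<Rightarrow> 'i \<Rightarrow> 'a) \<Rightarrow> bool" where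
  "fin_kernel A I r \<psi> c \<longleftrightarrow> (\<forall>k<r. fin_rank A (\<psi> k) \<and> (\<forall>i\<in>I. c k i \<in> carrier A))"

definition kernel_of :: "'a cstar \<Rightarrow> nat \<Rightarrow> (nat \<Rightarrow> 'a \<Rightarrow> complex) \<Rightarrow> (nat \<Rightarrow> 'i \<Rightarrow> 'a) \<Rightarrow> 'i \<Rightarrow> 'i \<Rightarrow> 'a \<Rightarrow> complex" where
  "kernel_of A r \<psi> c i j a = (\<Sum>k<r. \<psi> k (star A (c k i) \<otimes>\<^bsub>A\<^esub> (a \<otimes>\<^bsub>A\<^esub> c k j)))"

lemma kernel_subset:
  assumes "unital_cstar_algebra A" "kernel A J t" "I \<subseteq> J" "finite J" shows "kernel A I t"
proof -
  interpret unital_cstar_algebra A by fact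
  note k = assms(2)[unfolded kernel_def]
  have "0 \<le> Re (\<Sum>i\<in>I. \<Sum>j\<in>I. t i j (star A (c i) \<otimes>\<^bsub>A\<^esub> c j))" if c: "\<forall>i\<in>I. c i \<in> carrier A" for c
  proof -
    define d where "d i = (if i \<in> I then c i else \<zero>\<^bsub>A\<^esub>)" for i
    have dc: "\<forall>i\<in>J. d i \<in> carrier A" using c by (auto simp: d_def)
    have z: "t i j \<zero>\<^bsub>A\<^esub> = 0" if "i \<in> J" "j \<in> J" for i j using k that lin_zero by blast
    have "(\<Sum>i\<in>J. \<Sum>j\<in>J. t i j (star A (d i) \<otimes>\<^bsub>A\<^esub> d j)) = (\<Sum>i\<in>I. \<Sum>j\<in>J. t i j (star A (d i) \<otimes>\<^bsub>A\<^esub> d j))"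
      using assms dc z by (intro sum.mono_neutral_right) (auto simp: d_def)
    also have "\<dots> = (\<Sum>i\<in>I. \<Sum>j\<in>I. t i j (star A (d i) \<otimes>\<^bsub>A\<^esub> d j))"
      using assms c z by (intro sum.cong refl sum.mono_neutral_right) (auto simp: d_def)
    also have "\<dots> = (\<Sum>i\<in>I. \<Sum>j\<in>I. t i j (star A (c i) \<otimes>\<^bsub>A\<^esub> c j))"
      by (intro sum.cong refl) (auto simp: d_def)
    finally have eq: "(\<Sum>i\<in>J. \<Sum>j\<in>J. t i j (star A (d i) \<otimes>\<^bsub>A\<^esub> d j)) = (\<Sum>i\<in>I. \<Sum>j\<in>I. t i j (star A (c i) \<otimes>\<^bsub>A\<^esub> c j))" .
    have "0 \<le> Re (\<Sum>i\<in>J. \<Sum>j\<in>J. t i j (star A (d i) \<otimes>\<^bsub>A\<^esub> d j))" using k dc by blast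
    then show ?thesis unfolding eq .
  qed
  then show ?thesis using k assms(3) unfolding kernel_def by blast
qed

text \<open>An operator-valued positivity test by Schur complements: a hermitian matrix over \<open>A\<close> that is
  bounded below in all finite-rank representations is positive, without a norm on matrices.\<close>

lemma Schur_positivity:
  assumes A: "unital_cstar_algebra A"
    and sep: "\<And>x. x \<in> carrier A \<Longrightarrow> x \<noteq> \<zero>\<^bsub>A\<^esub> \<Longrightarrow> \<exists>\<psi>. fin_rank A \<psi> \<and> \<psi> (star A x \<otimes>\<^bsub>A\<^esub> x) \<noteq> 0"
    and I: "finite I" and e: "0 < e"
    and h: "\<And>i j. i \<in> I \<Longrightarrow> j \<in> I \<Longrightarrow> h i j \<in> carrier A"
      "\<And>i j. i \<in> I \<Longrightarrow> j \<in> I \<Longrightarrow> star A (h i j) = h j i"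
    and ge: "\<And>\<psi> c. fin_rank A \<psi> \<Longrightarrow> (\<forall>i\<in>I. c i \<in> carrier A) \<Longrightarrow>
      e * (\<Sum>i\<in>I. Re (\<psi> (star A (c i) \<otimes>\<^bsub>A\<^esub> c i))) \<le> Re (\<Sum>i\<in>I. \<Sum>j\<in>I. \<psi> (star A (c i) \<otimes>\<^bsub>A\<^esub> (h i j \<otimes>\<^bsub>A\<^esub> c j)))"
    and t: "kernel A I t"
  shows "0 \<le> Re (\<Sum>i\<in>I. \<Sum>j\<in>I. t i j (h i j))"
  using I h ge t
proof (induction I arbitrary: h rule: finite_induct)
  case (insert p I)
  interpret unital_cstar_algebra A by fact
  note hc = insert.prems(1) and hs = insert.prems(2) and ge = insert.prems(3) and t = insert.prems(4)
  have hpp: "h p p \<in> carrier A" "star A (h p p) = h p p" using hc hs by auto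
  have hsa: "self_adjoint A (h p p)" using hpp by (simp add: self_adjoint_def)
  \<comment> \<open>Testing the lower bound on families supported at \<open>p\<close> alone shows
    that the pivot is bounded below by \<open>e\<close>, hence invertible.\<close>
  have pos0: "pos A (h p p \<ominus>\<^bsub>A\<^esub> complex_of_real e \<odot>\<^bsub>A\<^esub> \<one>\<^bsub>A\<^esub>)"
  proof (rule pos_if_posf_nonneg[where P = "Collect (fin_rank A)"])
    show "self_adjoint A (h p p \<ominus>\<^bsub>A\<^esub> complex_of_real e \<odot>\<^bsub>A\<^esub> \<one>\<^bsub>A\<^esub>)" using hsa by (intro self_adjoint_intros)
    fix \<psi> c assume "\<psi> \<in> Collect (fin_rank A)" and c: "c \<in> carrier A"
    then have \<psi>: "fin_rank A \<psi>" and l: "lin A \<psi>" by (auto intro: posf_lin fin_rank_posf)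
    define d where "d i = (if i = p then c else \<zero>\<^bsub>A\<^esub>)" for i
    have d: "\<forall>i\<in>insert p I. d i \<in> carrier A" using c by (auto simp: d_def)
    have dI: "d i = \<zero>\<^bsub>A\<^esub>" if "i \<in> I" for i using that insert.hyps by (auto simp: d_def)
    have "(\<Sum>i\<in>insert p I. Re (\<psi> (star A (d i) \<otimes>\<^bsub>A\<^esub> d i))) = Re (\<psi> (star A c \<otimes>\<^bsub>A\<^esub> c))"
      using insert.hyps dI l by (simp add: lin_zero) (simp add: d_def)
    moreover have "(\<Sum>i\<in>insert p I. \<Sum>j\<in>insert p I. \<psi> (star A (d i) \<otimes>\<^bsub>A\<^esub> (h i j \<otimes>\<^bsub>A\<^esub> d j))) = \<psi> (star A c \<otimes>\<^bsub>A\<^esub> (h p p \<otimes>\<^bsub>A\<^esub> c))"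
    proof -
      have 1: "(\<Sum>j\<in>insert p I. \<psi> (star A (d i) \<otimes>\<^bsub>A\<^esub> (h i j \<otimes>\<^bsub>A\<^esub> d j))) = \<psi> (star A (d i) \<otimes>\<^bsub>A\<^esub> (h i p \<otimes>\<^bsub>A\<^esub> c))" if "i \<in> insert p I" for i
        using insert.hyps dI l c d that hc by (simp add: lin_zero) (simp add: d_def lin_zero)
      show ?thesis 
        using insert.hyps dI l c hc by (simp add: 1 lin_zero cong: sum.cong) (simp add: d_def lin_zero)
    qed
    ultimately have "e * Re (\<psi> (star A c \<otimes>\<^bsub>A\<^esub> c)) \<le> Re (\<psi> (star A c \<otimes>\<^bsub>A\<^esub> (h p p \<otimes>\<^bsub>A\<^esub> c)))" using ge[OF \<psi> d] by simp
    then show "0 \<le> Re (\<psi> (star A c \<otimes>\<^bsub>A\<^esub> ((h p p \<ominus>\<^bsub>A\<^esub> complex_of_real e \<odot>\<^bsub>A\<^esub> \<one>\<^bsub>A\<^esub>) \<otimes>\<^bsub>A\<^esub> c)))"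
      using c hpp l by (simp add: distrib lin_simps)
  qed (use sep fin_rank_posf in auto)
  obtain g where g: "self_adjoint A g" "h p p \<otimes>\<^bsub>A\<^esub> g = \<one>\<^bsub>A\<^esub>" "g \<otimes>\<^bsub>A\<^esub> h p p = \<one>\<^bsub>A\<^esub>"
    using exists_inverse[OF pos0 hpp(1) e] by blast
  have gc: "g \<in> carrier A" "star A g = g" using g(1) by (auto simp: self_adjoint_def)
  have "h p p = (h p p \<ominus>\<^bsub>A\<^esub> complex_of_real e \<odot>\<^bsub>A\<^esub> \<one>\<^bsub>A\<^esub>) \<oplus>\<^bsub>A\<^esub> complex_of_real e \<odot>\<^bsub>A\<^esub> \<one>\<^bsub>A\<^esub>"
    using hpp by (intro lin_eqI) (auto simp: lin_simps)
  then have "pos A (h p p)" using pos_add[OF pos0 pos_scalar[of e]] e by simp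
  then obtain s where s: "self_adjoint A s" "s \<otimes>\<^bsub>A\<^esub> s = h p p" using pos_sqrt by blast
  have sc: "s \<in> carrier A" "star A s = s" using s(1) by (auto simp: self_adjoint_def)
  \<comment> \<open>\<open>k\<close> is the part of the matrix carried by the pivot, and
    \<open>h' = h - k\<close> is the Schur complement, whose row and column \<open>p\<close>
    vanish.\<close>
  define k where "k i j = h i p \<otimes>\<^bsub>A\<^esub> (g \<otimes>\<^bsub>A\<^esub> h p j)" for i j
  define h' where "h' i j = h i j \<ominus>\<^bsub>A\<^esub> k i j" for i j
  have kc: "k i j \<in> carrier A" "star A (k i j) = k j i" if "i \<in> insert p I" "j \<in> insert p I" for i j
    using hc[of i p] hc[of p j] hc[of j p] hc[of p i] hs[of i p] hs[of p j] gc that by (auto simp: k_def star_simps mult_assoc)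
  have h'c: "h' i j \<in> carrier A" "star A (h' i j) = h' j i" if "i \<in> insert p I" "j \<in> insert p I" for i j
    using kc[OF that] hc[OF that] hs[OF that] by (auto simp: h'_def star_simps)
  have kp: "k p j = h p j" if "j \<in> insert p I" for j
    using hc[of p j] hpp gc g(2) that by (simp add: k_def mult_assoc[symmetric])
  have kp': "k i p = h i p" if "i \<in> insert p I" for i
    using hc[of i p] hpp gc g(3) that by (simp add: k_def)
  have h'0: "h' i j = \<zero>\<^bsub>A\<^esub>" if "i \<in> insert p I" "j \<in> insert p I" "i = p \<or> j = p" for i j
    using that hc[of i j] by (auto simp: h'_def kp kp' minus_eq_zero)
  have reduce: "(\<Sum>i\<in>insert p I. \<Sum>j\<in>insert p I. f i j (h' i j)) = (\<Sum>i\<in>I. \<Sum>j\<in>I. f i j (h' i j))"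
    if f: "\<And>i j. i \<in> insert p I \<Longrightarrow> j \<in> insert p I \<Longrightarrow> f i j \<zero>\<^bsub>A\<^esub> = 0" for f :: "'b \<Rightarrow> 'b \<Rightarrow> 'a \<Rightarrow> complex"
  proof -
    have "(\<Sum>j\<in>insert p I. f i j (h' i j)) = (\<Sum>j\<in>I. f i j (h' i j))" if "i \<in> insert p I" for i
      using insert.hyps that f[of i p] by (simp add: h'0)
    moreover have "(\<Sum>j\<in>I. f p j (h' p j)) = 0" using f by (intro sum.neutral) (auto simp: h'0)
    ultimately show ?thesis using insert.hyps by simp
  qed
  \<comment> \<open>The Schur complement inherits the lower bound: completing \<open>c\<close> by
    the minimizing entry \<open>- g w\<close> at \<open>p\<close> makes the form of \<open>h\<close>
    equal to that of \<open>h'\<close>, while the sum of squared norms can only grow.\<close>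
  have ge': "e * (\<Sum>i\<in>I. Re (\<psi> (star A (c i) \<otimes>\<^bsub>A\<^esub> c i))) \<le> Re (\<Sum>i\<in>I. \<Sum>j\<in>I. \<psi> (star A (c i) \<otimes>\<^bsub>A\<^esub> (h' i j \<otimes>\<^bsub>A\<^esub> c j)))"
    if \<psi>: "fin_rank A \<psi>" and c: "\<forall>i\<in>I. c i \<in> carrier A" for \<psi> c
  proof -
    have l: "lin A \<psi>" using \<psi> by (auto intro: posf_lin fin_rank_posf)
    define w where "w = (\<Oplus>\<^bsub>A\<^esub>j\<in>I. h p j \<otimes>\<^bsub>A\<^esub> c j)"
    have wI: "(\<lambda>j. h p j \<otimes>\<^bsub>A\<^esub> c j) \<in> I \<rightarrow> carrier A" using c hc by auto
    then have wc: "w \<in> carrier A" unfolding w_def by (rule M.finsum_closed)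
    define d where "d = c(p := \<ominus>\<^bsub>A\<^esub> (g \<otimes>\<^bsub>A\<^esub> w))"
    have dp: "d p = \<ominus>\<^bsub>A\<^esub> (g \<otimes>\<^bsub>A\<^esub> w)" by (simp add: d_def)
    have dI: "d i = c i" if "i \<in> I" for i using that insert.hyps by (auto simp: d_def)
    have dc: "d i \<in> carrier A" if "i \<in> insert p I" for i using that c gc wc by (auto simp: d_def)
    have hd: "h p p \<otimes>\<^bsub>A\<^esub> d p = \<ominus>\<^bsub>A\<^esub> w"
      using hpp gc wc g(2) by (simp add: dp a_inv_mult_r mult_assoc[symmetric])
    have k0: "(\<Sum>j\<in>insert p I. \<psi> (star A (d i) \<otimes>\<^bsub>A\<^esub> (k i j \<otimes>\<^bsub>A\<^esub> d j))) = 0" if i: "i \<in> insert p I" for i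
    proof -
      define y where "y = star A (d i) \<otimes>\<^bsub>A\<^esub> (h i p \<otimes>\<^bsub>A\<^esub> g)"
      have yc: "y \<in> carrier A" using dc[OF i] hc[OF i, of p] gc by (simp add: y_def)
      have yk: "star A (d i) \<otimes>\<^bsub>A\<^esub> (k i j \<otimes>\<^bsub>A\<^esub> d j) = y \<otimes>\<^bsub>A\<^esub> (h p j \<otimes>\<^bsub>A\<^esub> d j)" if "j \<in> insert p I" for j
        using dc[OF i] dc[OF that] hc[OF i, of p] hc[of p j] gc that by (simp add: y_def k_def mult_assoc)
      have "(\<Sum>j\<in>I. \<psi> (y \<otimes>\<^bsub>A\<^esub> (h p j \<otimes>\<^bsub>A\<^esub> c j))) = \<psi> (y \<otimes>\<^bsub>A\<^esub> w)"
        unfolding w_def using lin_finsum[OF lin_mult_l[OF l yc] insert.hyps(1) wI] by simp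
      moreover have "(\<Sum>j\<in>insert p I. \<psi> (star A (d i) \<otimes>\<^bsub>A\<^esub> (k i j \<otimes>\<^bsub>A\<^esub> d j))) = (\<Sum>j\<in>insert p I. \<psi> (y \<otimes>\<^bsub>A\<^esub> (h p j \<otimes>\<^bsub>A\<^esub> d j)))"
        by (intro sum.cong refl) (simp only: yk)
      moreover have "(\<Sum>j\<in>I. \<psi> (y \<otimes>\<^bsub>A\<^esub> (h p j \<otimes>\<^bsub>A\<^esub> d j))) = (\<Sum>j\<in>I. \<psi> (y \<otimes>\<^bsub>A\<^esub> (h p j \<otimes>\<^bsub>A\<^esub> c j)))"
        by (intro sum.cong refl) (simp only: dI)
      ultimately show ?thesis using insert.hyps l yc wc hd by (simp add: a_inv_mult_r lin_simps)
    qed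
    have "\<psi> (star A (d i) \<otimes>\<^bsub>A\<^esub> (h i j \<otimes>\<^bsub>A\<^esub> d j)) = \<psi> (star A (d i) \<otimes>\<^bsub>A\<^esub> (h' i j \<otimes>\<^bsub>A\<^esub> d j)) + \<psi> (star A (d i) \<otimes>\<^bsub>A\<^esub> (k i j \<otimes>\<^bsub>A\<^esub> d j))"
      if "i \<in> insert p I" "j \<in> insert p I" for i j
      using dc[OF that(1)] dc[OF that(2)] hc[OF that] kc[OF that] l by (simp add: h'_def distrib lin_simps)
    then have "(\<Sum>i\<in>insert p I. \<Sum>j\<in>insert p I. \<psi> (star A (d i) \<otimes>\<^bsub>A\<^esub> (h i j \<otimes>\<^bsub>A\<^esub> d j))) =
       (\<Sum>i\<in>insert p I. (\<Sum>j\<in>insert p I. \<psi> (star A (d i) \<otimes>\<^bsub>A\<^esub> (h' i j \<otimes>\<^bsub>A\<^esub> d j))) + (\<Sum>j\<in>insert p I. \<psi> (star A (d i) \<otimes>\<^bsub>A\<^esub> (k i j \<otimes>\<^bsub>A\<^esub> d j))))"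
      unfolding sum.distrib[symmetric] by (intro sum.cong refl) auto
    also have "\<dots> = (\<Sum>i\<in>insert p I. \<Sum>j\<in>insert p I. \<psi> (star A (d i) \<otimes>\<^bsub>A\<^esub> (h' i j \<otimes>\<^bsub>A\<^esub> d j)))"
      using k0 by (intro sum.cong refl) simp
    also have "\<dots> = (\<Sum>i\<in>I. \<Sum>j\<in>I. \<psi> (star A (d i) \<otimes>\<^bsub>A\<^esub> (h' i j \<otimes>\<^bsub>A\<^esub> d j)))"
      using dc l by (intro reduce[of "\<lambda>i j x. \<psi> (star A (d i) \<otimes>\<^bsub>A\<^esub> (x \<otimes>\<^bsub>A\<^esub> d j))"]) (auto simp: lin_zero)
    also have "\<dots> = (\<Sum>i\<in>I. \<Sum>j\<in>I. \<psi> (star A (c i) \<otimes>\<^bsub>A\<^esub> (h' i j \<otimes>\<^bsub>A\<^esub> c j)))"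
      by (intro sum.cong refl) (simp add: dI)
    finally have eq: "(\<Sum>i\<in>insert p I. \<Sum>j\<in>insert p I. \<psi> (star A (d i) \<otimes>\<^bsub>A\<^esub> (h i j \<otimes>\<^bsub>A\<^esub> d j))) =
        (\<Sum>i\<in>I. \<Sum>j\<in>I. \<psi> (star A (c i) \<otimes>\<^bsub>A\<^esub> (h' i j \<otimes>\<^bsub>A\<^esub> c j)))" .
    have "(\<Sum>i\<in>I. Re (\<psi> (star A (c i) \<otimes>\<^bsub>A\<^esub> c i))) \<le> (\<Sum>i\<in>insert p I. Re (\<psi> (star A (d i) \<otimes>\<^bsub>A\<^esub> d i)))"
      using insert.hyps posf_nonneg[OF fin_rank_posf[OF \<psi>] dc[of p]] by (simp add: dI cong: sum.cong)
    then have "e * (\<Sum>i\<in>I. Re (\<psi> (star A (c i) \<otimes>\<^bsub>A\<^esub> c i))) \<le> e * (\<Sum>i\<in>insert p I. Re (\<psi> (star A (d i) \<otimes>\<^bsub>A\<^esub> d i)))"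
      using e by simp
    also have "\<dots> \<le> Re (\<Sum>i\<in>insert p I. \<Sum>j\<in>insert p I. \<psi> (star A (d i) \<otimes>\<^bsub>A\<^esub> (h i j \<otimes>\<^bsub>A\<^esub> d j)))"
      using ge[OF \<psi>, of d] dc by blast
    finally show ?thesis unfolding eq .
  qed
  have IH: "0 \<le> Re (\<Sum>i\<in>I. \<Sum>j\<in>I. t i j (h' i j))"
    using h'c kernel_subset[OF A t, of I] insert.hyps by (intro insert.IH ge') auto
  have lt: "lin A (t i j)" if "i \<in> insert p I" "j \<in> insert p I" for i j using t that unfolding kernel_def by blast
  \<comment> \<open>As \<open>s^2\<close> is the pivot and \<open>g\<close> its inverse, this
    factors \<open>k i j\<close> as \<open>star (c i) c j\<close>, the shape on which kernels are
    nonnegative.\<close>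
  define c where "c i = s \<otimes>\<^bsub>A\<^esub> (g \<otimes>\<^bsub>A\<^esub> h p i)" for i
  have cc: "\<forall>i\<in>insert p I. c i \<in> carrier A" using sc gc hc by (auto simp: c_def)
  have ck: "star A (c i) \<otimes>\<^bsub>A\<^esub> c j = k i j" if "i \<in> insert p I" "j \<in> insert p I" for i j
  proof -
    have h2: "h p i \<in> carrier A" "h p j \<in> carrier A" "star A (h p i) = h i p" "h i p \<in> carrier A" using hc hs that by auto
    have "star A (c i) \<otimes>\<^bsub>A\<^esub> c j = h i p \<otimes>\<^bsub>A\<^esub> (g \<otimes>\<^bsub>A\<^esub> ((s \<otimes>\<^bsub>A\<^esub> s) \<otimes>\<^bsub>A\<^esub> g) \<otimes>\<^bsub>A\<^esub> h p j)"
      using h2 sc gc by (simp add: c_def star_simps mult_assoc)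
    also have "\<dots> = k i j" unfolding s(2) g(2) using h2 gc by (simp add: k_def mult_assoc)
    finally show ?thesis .
  qed
  have "0 \<le> Re (\<Sum>i\<in>insert p I. \<Sum>j\<in>insert p I. t i j (star A (c i) \<otimes>\<^bsub>A\<^esub> c j))"
    using t cc unfolding kernel_def by blast
  also have "(\<Sum>i\<in>insert p I. \<Sum>j\<in>insert p I. t i j (star A (c i) \<otimes>\<^bsub>A\<^esub> c j)) = (\<Sum>i\<in>insert p I. \<Sum>j\<in>insert p I. t i j (k i j))"
    using ck by (intro sum.cong refl) simp
  finally have K: "0 \<le> Re (\<Sum>i\<in>insert p I. \<Sum>j\<in>insert p I. t i j (k i j))" .
  have "t i j (h i j) = t i j (h' i j) + t i j (k i j)" if "i \<in> insert p I" "j \<in> insert p I" for i j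
    using hc[OF that] kc[OF that] lt[OF that] by (simp add: h'_def lin_simps)
  then have "(\<Sum>i\<in>insert p I. \<Sum>j\<in>insert p I. t i j (h i j)) =
     (\<Sum>i\<in>insert p I. \<Sum>j\<in>insert p I. t i j (h' i j)) + (\<Sum>i\<in>insert p I. \<Sum>j\<in>insert p I. t i j (k i j))"
    unfolding sum.distrib[symmetric] by (intro sum.cong refl) auto
  also have "(\<Sum>i\<in>insert p I. \<Sum>j\<in>insert p I. t i j (h' i j)) = (\<Sum>i\<in>I. \<Sum>j\<in>I. t i j (h' i j))"
    using lt by (intro reduce) (auto simp: lin_zero)
  finally show ?case using IH K by simp
qed simp

section \<open>The convex cone of finite-rank kernels\<close>

lemma fin_kernel_add:
  assumes "fin_kernel A I r \<psi> c" "fin_kernel A I s \<phi> d"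
  shows "\<exists>\<theta> b. fin_kernel A I (r + s) \<theta> b \<and> (\<forall>i j a. kernel_of A (r + s) \<theta> b i j a = kernel_of A r \<psi> c i j a + kernel_of A s \<phi> d i j a)"
proof (intro exI conjI allI)
  let ?\<theta> = "\<lambda>k. if k < r then \<psi> k else \<phi> (k - r)"
  let ?b = "\<lambda>k. if k < r then c k else d (k - r)"
  show "fin_kernel A I (r + s) ?\<theta> ?b" using assms by (auto simp: fin_kernel_def)
  show "kernel_of A (r + s) ?\<theta> ?b i j a = kernel_of A r \<psi> c i j a + kernel_of A s \<phi> d i j a" for i j a
    unfolding kernel_of_def by (induction s) simp_all
qed

lemma fin_kernel_scale:
  assumes A: "cstar_algebra A" and c: "fin_kernel A I r \<psi> c" and l: "0 \<le> l"
  shows "\<exists>b. fin_kernel A I r \<psi> b \<and>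
     (\<forall>i\<in>I. \<forall>j\<in>I. \<forall>a\<in>carrier A. kernel_of A r \<psi> b i j a = complex_of_real l * kernel_of A r \<psi> c i j a)"
proof (intro exI conjI ballI)
  interpret cstar_algebra A by fact
  let ?b = "\<lambda>k i. complex_of_real (sqrt l) \<odot>\<^bsub>A\<^esub> c k i"
  show "fin_kernel A I r \<psi> ?b" using c by (auto simp: fin_kernel_def)
  fix i j a assume ij: "i \<in> I" "j \<in> I" and a: "a \<in> carrier A"
  have sq: "complex_of_real (sqrt l) * (complex_of_real (sqrt l) * z) = complex_of_real l * z" for z
    using l by (simp add: mult.assoc[symmetric] flip: of_real_mult)
  show "kernel_of A r \<psi> ?b i j a = complex_of_real l * kernel_of A r \<psi> c i j a"
    unfolding kernel_of_def sum_distrib_left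
  proof (intro sum.cong refl)
    fix k assume "k \<in> {..<r}"
    then have "c k i \<in> carrier A" "c k j \<in> carrier A" "lin A (\<psi> k)" using c ij by (auto simp: fin_kernel_def fin_rank_posf posf_lin)
    then show "\<psi> k (star A (?b k i) \<otimes>\<^bsub>A\<^esub> (a \<otimes>\<^bsub>A\<^esub> ?b k j)) = complex_of_real l * \<psi> k (star A (c k i) \<otimes>\<^bsub>A\<^esub> (a \<otimes>\<^bsub>A\<^esub> c k j))"
      using a sq by (simp add: star_simps distrib lin_smult)
  qed
qed

text \<open>The finite-rank kernels form a convex cone. If \<open>t\<close> had positive distance to it, the difference
  of \<open>t\<close> and a nearly closest point would define a hermitian matrix over \<open>A\<close> that is small on the cone
  but not on \<open>t\<close>, contradicting \<open>Schur_positivity\<close>.\<close>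

lemma kernel_approximation:
  assumes A: "unital_cstar_algebra A"
    and sep: "\<And>x. x \<in> carrier A \<Longrightarrow> x \<noteq> \<zero>\<^bsub>A\<^esub> \<Longrightarrow> \<exists>\<psi>. fin_rank A \<psi> \<and> \<psi> (star A x \<otimes>\<^bsub>A\<^esub> x) \<noteq> 0"
    and I: "finite I" and S: "finite S" "S \<subseteq> carrier A" and t: "kernel A I t" and eps: "0 < eps"
  shows "\<exists>r \<psi> c. fin_kernel A I r \<psi> c \<and>
     (\<forall>i\<in>I. \<forall>j\<in>I. \<forall>a\<in>S. cmod (kernel_of A r \<psi> c i j a - t i j a) < eps)"
proof -
  interpret unital_cstar_algebra A by fact
  define J where "J = I \<times> I \<times> S"
  have J: "finite J" using I S by (simp add: J_def)
  have JI: "x \<in> J \<longleftrightarrow> fst x \<in> I \<and> fst (snd x) \<in> I \<and> snd (snd x) \<in> S" for x by (cases x) (auto simp: J_def)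
  \<comment> \<open>Only finitely many coordinates of a kernel matter; \<open>ev\<close> collects
    them in one vector, and \<open>Q\<close> is the squared Euclidean norm there.\<close>
  define ev :: "('b \<Rightarrow> 'b \<Rightarrow> 'a \<Rightarrow> complex) \<Rightarrow> 'b \<times> 'b \<times> 'a \<Rightarrow> complex" where "ev m x = m (fst x) (fst (snd x)) (snd (snd x))" for m x
  define Q where "Q f = (\<Sum>x\<in>J. (cmod (f x))\<^sup>2)" for f :: "'b \<times> 'b \<times> 'a \<Rightarrow> complex"
  define ip where "ip f g = (\<Sum>x\<in>J. f x * cnj (g x))" for f g :: "'b \<times> 'b \<times> 'a \<Rightarrow> complex"
  have Q0: "0 \<le> Q f" for f by (simp add: Q_def sum_nonneg)
  have Qexp: "Q (\<lambda>x. f x - complex_of_real l * g x) = Q f - 2 * l * Re (ip g f) + l\<^sup>2 * Q g" for f g l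
  proof -
    have "(cmod (f x - complex_of_real l * g x))\<^sup>2 = (cmod (f x))\<^sup>2 - 2 * l * Re (g x * cnj (f x)) + l\<^sup>2 * (cmod (g x))\<^sup>2" for x
      unfolding cmod_power2 by (simp add: power2_eq_square algebra_simps)
    then show ?thesis unfolding Q_def ip_def Re_sum by (simp only: sum.distrib sum_subtractf sum_distrib_left)
  qed
  define Cone where "Cone = {m. \<exists>r \<psi> c. fin_kernel A I r \<psi> c \<and> m = kernel_of A r \<psi> c}"
  define D where "D = (\<lambda>m. Q (\<lambda>x. ev t x - ev m x)) ` Cone"
  have Dne: "D \<noteq> {}" 
  proof -
    have "kernel_of A 0 (\<lambda>_ _. 0) (\<lambda>_ _. \<zero>\<^bsub>A\<^esub>) \<in> Cone" unfolding Cone_def fin_kernel_def by blast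
    then show ?thesis by (auto simp: D_def)
  qed
  have Dbd: "bdd_below D" by (rule bdd_belowI[of _ 0]) (auto simp: D_def Q0)
  define d where "d = Inf D"
  have d_le: "d \<le> Q (\<lambda>x. ev t x - ev m x)" if "m \<in> Cone" for m
    unfolding d_def using that Dbd by (intro cInf_lower) (auto simp: D_def)
  have d_ex: "\<exists>m\<in>Cone. Q (\<lambda>x. ev t x - ev m x) < d + e" if "e > 0" for e
  proof -
    have "Inf D < d + e" using that by (simp add: d_def)
    then show ?thesis using cInf_lessD[OF Dne, of "d + e"] by (auto simp: D_def)
  qed
  have cone_add: "\<exists>m''\<in>Cone. \<forall>x\<in>J. ev m'' x = ev m x + complex_of_real l * ev m' x" if m: "m \<in> Cone" "m' \<in> Cone" "0 \<le> l" for m m' l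
  proof -
    obtain r \<psi> c s \<phi> b where 1: "fin_kernel A I r \<psi> c" "m = kernel_of A r \<psi> c" "fin_kernel A I s \<phi> b" "m' = kernel_of A s \<phi> b"
      using m by (auto simp: Cone_def)
    obtain b' where 2: "fin_kernel A I s \<phi> b'" "\<And>i j a. i \<in> I \<Longrightarrow> j \<in> I \<Longrightarrow> a \<in> carrier A \<Longrightarrow> kernel_of A s \<phi> b' i j a = complex_of_real l * m' i j a"
      using fin_kernel_scale[OF cstar_algebra_axioms 1(3) m(3)] 1(4) by blast
    obtain \<theta> e where 3: "fin_kernel A I (r + s) \<theta> e" "\<And>i j a. kernel_of A (r + s) \<theta> e i j a = m i j a + kernel_of A s \<phi> b' i j a"
      using fin_kernel_add[OF 1(1) 2(1)] 1(2) by blast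
    have "kernel_of A (r + s) \<theta> e \<in> Cone" using 3(1) by (auto simp: Cone_def)
    moreover have "\<forall>x\<in>J. ev (kernel_of A (r + s) \<theta> e) x = ev m x + complex_of_real l * ev m' x"
      using S(2) by (auto simp: ev_def 3(2) 2(2) JI subset_iff)
    ultimately show ?thesis by blast
  qed
  have Qcong: "Q f = Q g" if "\<And>x. x \<in> J \<Longrightarrow> f x = g x" for f g using that by (simp add: Q_def)
  show ?thesis
  proof (cases "d \<le> 0")
    case True
    obtain m where m: "m \<in> Cone" "Q (\<lambda>x. ev t x - ev m x) < eps\<^sup>2" using d_ex[of "eps\<^sup>2"] eps True by fastforce
    have "cmod (m i j a - t i j a) < eps" if ij: "i \<in> I" "j \<in> I" "a \<in> S" for i j a
    proof -
      have "(cmod (ev t (i,j,a) - ev m (i,j,a)))\<^sup>2 \<le> Q (\<lambda>x. ev t x - ev m x)"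
        unfolding Q_def using J ij by (intro member_le_sum) (auto simp: JI)
      then have "(cmod (ev t (i,j,a) - ev m (i,j,a)))\<^sup>2 < eps\<^sup>2" using m(2) by simp
      then show ?thesis using eps by (simp add: power_less_imp_less_base ev_def norm_minus_commute)
    qed
    then show ?thesis using m(1) unfolding Cone_def by blast
  next
    case False
    then have d0: "d > 0" by simp
    note lt = t[unfolded kernel_def]
    define T where "T = Re (\<Sum>i\<in>I. t i i \<one>\<^bsub>A\<^esub>)"
    \<comment> \<open>For a kernel \<open>\<psi> (c_i* a c_j)\<close> with \<open>P\<close> the sum
      of the \<open>\<psi> (c_i* c_i)\<close>, the moduli of the coordinates sum up to at most
      \<open>(L - 1) P\<close>; the extra 1 keeps \<open>L\<close> positive.\<close>
    define L where "L = 1 + real (card I) * (real (card I) * (\<Sum>a\<in>S. cnorm A a))"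
    have Sn: "0 \<le> (\<Sum>a\<in>S. cnorm A a)" using S by (intro sum_nonneg) (auto intro: cnorm_nonneg)
    then have L1: "1 \<le> L" by (simp add: L_def)
    \<comment> \<open>A bound for \<open>Q (ev m0)\<close> that does not depend on
      \<open>\<delta>\<close>, because \<open>Q r < d + 1\<close>.\<close>
    define R where "R = 2 * Q (ev t) + 2 * (d + 1)"
    have bound: "d \<le> \<delta> * ((1 + R) / 2 + (L + 1) * T)" if \<delta>: "0 < \<delta>" "\<delta> \<le> 1" for \<delta>
    proof -
      obtain m0 where m0: "m0 \<in> Cone" "Q (\<lambda>x. ev t x - ev m0 x) < d + \<delta>\<^sup>2" using d_ex[of "\<delta>\<^sup>2"] \<delta> by auto
      define r where "r = (\<lambda>x. ev t x - ev m0 x)"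
      have qr: "d \<le> Q r" "Q r < d + \<delta>\<^sup>2" using d_le[OF m0(1)] m0(2) by (auto simp: r_def)
      have \<delta>2: "\<delta>\<^sup>2 \<le> 1" using \<delta> by (simp add: power_le_one)
      have Qm0: "Q (ev m0) \<le> R"
      proof -
        have "(cmod (ev m0 x))\<^sup>2 \<le> 2 * (cmod (ev t x))\<^sup>2 + 2 * (cmod (r x))\<^sup>2" for x
        proof -
          have "cmod (ev m0 x) \<le> cmod (ev t x) + cmod (r x)" using norm_triangle_ineq4[of "ev t x" "r x"] by (simp add: r_def)
          then have "(cmod (ev m0 x))\<^sup>2 \<le> (cmod (ev t x) + cmod (r x))\<^sup>2" by (intro power_mono) auto
          also have "\<dots> \<le> 2 * (cmod (ev t x))\<^sup>2 + 2 * (cmod (r x))\<^sup>2"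
            using zero_le_power2[of "cmod (ev t x) - cmod (r x)"] by (simp add: power2_eq_square algebra_simps)
          finally show ?thesis .
        qed
        then have "Q (ev m0) \<le> 2 * Q (ev t) + 2 * Q r"
          unfolding Q_def sum_distrib_left sum.distrib[symmetric] by (intro sum_mono)
        then show ?thesis using qr \<delta>2 by (simp add: R_def)
      qed
      \<comment> \<open>A step of length \<open>l\<close> from \<open>m0\<close> along
        \<open>m\<close> stays in the cone, so it cannot bring the squared distance below
        \<open>d\<close>, which \<open>m0\<close> already attains up to
        \<open>\<delta>^2\<close>.\<close>
      have small: "2 * l * Re (ip (ev m) r) \<le> \<delta>\<^sup>2 + l\<^sup>2 * Q (ev m)" if m: "m \<in> Cone" "0 \<le> l" for m l
      proof -
        obtain m'' where m'': "m'' \<in> Cone" "\<forall>x\<in>J. ev m'' x = ev m0 x + complex_of_real l * ev m x" using cone_add[OF m0(1) m] by blast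
        have "d \<le> Q (\<lambda>x. ev t x - ev m'' x)" by (rule d_le[OF m''(1)])
        also have "\<dots> = Q (\<lambda>x. r x - complex_of_real l * ev m x)" using m''(2) by (intro Qcong) (simp add: r_def)
        also have "\<dots> = Q r - 2 * l * Re (ip (ev m) r) + l\<^sup>2 * Q (ev m)" by (rule Qexp)
        finally show ?thesis using qr by simp
      qed
      \<comment> \<open>The same for a step from \<open>m0\<close> towards the apex, which replaces
        \<open>m0\<close> by \<open>(1 - \<delta>) m0\<close>.\<close>
      have low: "- 2 * Re (ip (ev m0) r) \<le> \<delta> * (1 + R)"
      proof -
        obtain z where z: "z \<in> Cone" "\<And>x. x \<in> J \<Longrightarrow> ev z x = 0"
        proof -
          have "kernel_of A 0 (\<lambda>_ _. 0) (\<lambda>_ _. \<zero>\<^bsub>A\<^esub>) \<in> Cone" unfolding Cone_def fin_kernel_def by blast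
          moreover have "ev (kernel_of A 0 (\<lambda>_ _. 0) (\<lambda>_ _. \<zero>\<^bsub>A\<^esub>)) x = 0" for x by (simp add: ev_def kernel_of_def)
          ultimately show ?thesis using that by blast
        qed
        obtain m'' where m'': "m'' \<in> Cone" "\<forall>x\<in>J. ev m'' x = ev z x + complex_of_real (1 - \<delta>) * ev m0 x"
          using cone_add[OF z(1) m0(1), of "1 - \<delta>"] \<delta> by auto
        have "d \<le> Q (\<lambda>x. ev t x - ev m'' x)" by (rule d_le[OF m''(1)])
        also have "\<dots> = Q (\<lambda>x. r x - complex_of_real (- \<delta>) * ev m0 x)"
          using m''(2) z(2) by (intro Qcong) (simp add: r_def algebra_simps)
        also have "\<dots> = Q r - 2 * (- \<delta>) * Re (ip (ev m0) r) + (- \<delta>)\<^sup>2 * Q (ev m0)" by (rule Qexp)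
        finally have "- (2 * \<delta> * Re (ip (ev m0) r)) \<le> \<delta>\<^sup>2 + \<delta>\<^sup>2 * Q (ev m0)" using qr by simp
        also have "\<dots> \<le> \<delta>\<^sup>2 + \<delta>\<^sup>2 * R" using Qm0 by (simp add: mult_left_mono)
        finally have "\<delta> * (- 2 * Re (ip (ev m0) r)) \<le> \<delta> * (\<delta> * (1 + R))" by (simp add: power2_eq_square algebra_simps)
        then show ?thesis using \<delta>(1) by (simp only: mult_le_cancel_left_pos)
      qed
      have ipt: "Re (ip (ev t) r) = Q r + Re (ip (ev m0) r)"
      proof -
        have "ev t x * cnj (r x) = (complex_of_real (cmod (r x)))\<^sup>2 + ev m0 x * cnj (r x)" for x
        proof -
          have "(complex_of_real (cmod (r x)))\<^sup>2 = r x * cnj (r x)" using complex_norm_square[of "r x"] by simp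
          then show ?thesis by (simp add: r_def algebra_simps)
        qed
        then have "Re (ev t x * cnj (r x)) = (cmod (r x))\<^sup>2 + Re (ev m0 x * cnj (r x))" for x 
          by (metis Re_complex_of_real of_real_power plus_complex.simps(1))
        then show ?thesis by (simp add: ip_def Q_def sum.distrib)
      qed
      \<comment> \<open>Pairing a kernel with the matrix \<open>b\<close> over \<open>A\<close>
        reproduces its inner product with \<open>r\<close>; passing to the hermitian part
        \<open>h0\<close> yields the real part of that inner product.\<close>
      define b where "b i j = (\<Oplus>\<^bsub>A\<^esub>a\<in>S. cnj (r (i,j,a)) \<odot>\<^bsub>A\<^esub> a)" for i j
      have bc: "b i j \<in> carrier A" for i j unfolding b_def using S by (intro M.finsum_closed) auto
      define h0 where "h0 i j = (1/2) \<odot>\<^bsub>A\<^esub> (b i j \<oplus>\<^bsub>A\<^esub> star A (b j i))" for i j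
      have h0: "h0 i j \<in> carrier A" "star A (h0 i j) = h0 j i" for i j
        using bc[of i j] bc[of j i] by (auto simp: h0_def star_simps M.a_comm)
      have pair: "(\<Sum>i\<in>I. \<Sum>j\<in>I. m i j (h0 i j)) = complex_of_real (Re (ip (ev m) r))"
        if m: "\<And>i j. i \<in> I \<Longrightarrow> j \<in> I \<Longrightarrow> lin A (m i j)" "\<And>i j a. i \<in> I \<Longrightarrow> j \<in> I \<Longrightarrow> a \<in> carrier A \<Longrightarrow> m i j (star A a) = cnj (m j i a)" for m
      proof -
        have mb: "m i j (b i j) = (\<Sum>a\<in>S. m i j a * cnj (r (i,j,a)))" if "i \<in> I" "j \<in> I" for i j
        proof -
          have "m i j (b i j) = (\<Sum>a\<in>S. m i j (cnj (r (i,j,a)) \<odot>\<^bsub>A\<^esub> a))"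
            unfolding b_def using S by (intro lin_finsum m that) auto
          also have "\<dots> = (\<Sum>a\<in>S. m i j a * cnj (r (i,j,a)))"
            using S by (intro sum.cong refl) (auto simp: lin_smult[OF m(1)[OF that]] mult.commute)
          finally show ?thesis .
        qed
        have X: "(\<Sum>i\<in>I. \<Sum>j\<in>I. m i j (b i j)) = ip (ev m) r"
          using mb by (simp add: ip_def J_def sum.cartesian_product' ev_def cong: sum.cong)
        have "(\<Sum>i\<in>I. \<Sum>j\<in>I. m i j (h0 i j)) = (\<Sum>i\<in>I. \<Sum>j\<in>I. (1/2) * (m i j (b i j) + cnj (m j i (b j i))))"
          using bc m by (intro sum.cong refl) (simp add: h0_def lin_smult lin_add)
        also have "\<dots> = (1/2) * ((\<Sum>i\<in>I. \<Sum>j\<in>I. m i j (b i j)) + (\<Sum>i\<in>I. \<Sum>j\<in>I. cnj (m j i (b j i))))"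
          by (simp only: sum_distrib_left[symmetric] sum.distrib)
        also have "(\<Sum>i\<in>I. \<Sum>j\<in>I. cnj (m j i (b j i))) = cnj (\<Sum>i\<in>I. \<Sum>j\<in>I. m i j (b i j))"
          by (subst sum.swap) simp
        finally show ?thesis unfolding X by (simp add: complex_add_cnj)
      qed
      \<comment> \<open>For the kernel of a single finite-rank functional the pairing with
        \<open>h0\<close> is at most \<open>\<delta> L P\<close>. The diagonal term contributes
        \<open>\<delta> (L + 1) P\<close>, which leaves the margin \<open>\<delta> P\<close> that
        the positivity test demands.\<close>
      define h where "h i j = (if i = j then complex_of_real (\<delta> * (L + 1)) \<odot>\<^bsub>A\<^esub> \<one>\<^bsub>A\<^esub> else \<zero>\<^bsub>A\<^esub>) \<ominus>\<^bsub>A\<^esub> h0 i j" for i j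
      have hc: "h i j \<in> carrier A" "star A (h i j) = h j i" for i j
        using h0[of i j] by (auto simp: h_def star_simps)
      have pairh: "(\<Sum>i\<in>I. \<Sum>j\<in>I. m i j (h i j)) = complex_of_real (\<delta> * (L + 1)) * (\<Sum>i\<in>I. m i i \<one>\<^bsub>A\<^esub>) - complex_of_real (Re (ip (ev m) r))"
        if m: "\<And>i j. i \<in> I \<Longrightarrow> j \<in> I \<Longrightarrow> lin A (m i j)" "\<And>i j a. i \<in> I \<Longrightarrow> j \<in> I \<Longrightarrow> a \<in> carrier A \<Longrightarrow> m i j (star A a) = cnj (m j i a)" for m
      proof -
        have "m i j (h i j) = (if i = j then complex_of_real (\<delta> * (L + 1)) * m i i \<one>\<^bsub>A\<^esub> else 0) - m i j (h0 i j)" if "i \<in> I" "j \<in> I" for i j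
          using m(1)[OF that] h0[of i j] by (cases "i = j") (simp_all add: h_def lin_simps)
        then have "(\<Sum>i\<in>I. \<Sum>j\<in>I. m i j (h i j)) = (\<Sum>i\<in>I. \<Sum>j\<in>I. (if i = j then complex_of_real (\<delta> * (L + 1)) * m i i \<one>\<^bsub>A\<^esub> else 0)) - (\<Sum>i\<in>I. \<Sum>j\<in>I. m i j (h0 i j))"
          unfolding sum_subtractf[symmetric] by (intro sum.cong refl) auto
        also have "(\<Sum>i\<in>I. \<Sum>j\<in>I. (if i = j then complex_of_real (\<delta> * (L + 1)) * m i i \<one>\<^bsub>A\<^esub> else 0)) = complex_of_real (\<delta> * (L + 1)) * (\<Sum>i\<in>I. m i i \<one>\<^bsub>A\<^esub>)"
          using I by (simp add: sum_distrib_left)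
        also have "(\<Sum>i\<in>I. \<Sum>j\<in>I. m i j (h0 i j)) = complex_of_real (Re (ip (ev m) r))" by (rule pair) (fact m)+
        finally show ?thesis .
      qed
      have "0 \<le> Re (\<Sum>i\<in>I. \<Sum>j\<in>I. t i j (h i j))"
      proof (rule Schur_positivity[OF A sep I \<delta>(1) _ _ _ t])
        fix \<psi> c assume \<psi>: "fin_rank A \<psi>" and c: "\<forall>i\<in>I. c i \<in> carrier A"
        note f = fin_rank_posf[OF \<psi>]
        define m where "m i j a = \<psi> (star A (c i) \<otimes>\<^bsub>A\<^esub> (a \<otimes>\<^bsub>A\<^esub> c j))" for i j a
        have m1: "lin A (m i j)" if "i \<in> I" "j \<in> I" for i j
          unfolding m_def using c that posf_lin[OF f] lin_mult_r[OF lin_mult_l[of \<psi> "star A (c i)"]] by auto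
        have m2: "m i j (star A a) = cnj (m j i a)" if "i \<in> I" "j \<in> I" "a \<in> carrier A" for i j a
          using posf_star[OF f, of "star A (c j) \<otimes>\<^bsub>A\<^esub> (a \<otimes>\<^bsub>A\<^esub> c i)"] c that by (simp add: m_def star_simps mult_assoc)
        define P where "P = (\<Sum>i\<in>I. Re (\<psi> (star A (c i) \<otimes>\<^bsub>A\<^esub> c i)))"
        have Pi: "0 \<le> Re (\<psi> (star A (c i) \<otimes>\<^bsub>A\<^esub> c i))" "Re (\<psi> (star A (c i) \<otimes>\<^bsub>A\<^esub> c i)) \<le> P" if "i \<in> I" for i
          unfolding P_def using posf_nonneg[OF f] c that I by (auto intro!: member_le_sum[where f = "\<lambda>i. Re (\<psi> (star A (c i) \<otimes>\<^bsub>A\<^esub> c i))"])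
        have P0: "0 \<le> P" unfolding P_def using posf_nonneg[OF f] c by (intro sum_nonneg) auto
        have mb: "cmod (m i j a) \<le> cnorm A a * P" if ij: "i \<in> I" "j \<in> I" "a \<in> carrier A" for i j a
        proof -
          have "(cmod (m i j a))\<^sup>2 \<le> Re (\<psi> (star A (a \<otimes>\<^bsub>A\<^esub> c j) \<otimes>\<^bsub>A\<^esub> (a \<otimes>\<^bsub>A\<^esub> c j))) * Re (\<psi> (star A (c i) \<otimes>\<^bsub>A\<^esub> c i))"
            unfolding m_def using c ij by (intro posf_Cauchy_Schwarz[OF f]) auto
          also have "\<dots> \<le> ((cnorm A a)\<^sup>2 * P) * P"
          proof (rule mult_mono)
            have "Re (\<psi> (star A (a \<otimes>\<^bsub>A\<^esub> c j) \<otimes>\<^bsub>A\<^esub> (a \<otimes>\<^bsub>A\<^esub> c j))) \<le> (cnorm A a)\<^sup>2 * Re (\<psi> (star A (c j) \<otimes>\<^bsub>A\<^esub> c j))"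
              using c ij by (intro posf_bound[OF f]) auto
            also have "\<dots> \<le> (cnorm A a)\<^sup>2 * P" using Pi[OF ij(2)] by (intro mult_left_mono) auto
            finally show "Re (\<psi> (star A (a \<otimes>\<^bsub>A\<^esub> c j) \<otimes>\<^bsub>A\<^esub> (a \<otimes>\<^bsub>A\<^esub> c j))) \<le> (cnorm A a)\<^sup>2 * P" .
          qed (use Pi[OF ij(1)] P0 in auto)
          also have "\<dots> = (cnorm A a * P)\<^sup>2" by (simp add: power2_eq_square)
          finally show ?thesis
            by (rule power2_le_imp_le) (intro mult_nonneg_nonneg cnorm_nonneg P0 ij)
        qed
        have Qm: "Q (ev m) \<le> (L * P)\<^sup>2"
        proof -
          have "Q (ev m) \<le> (\<Sum>x\<in>J. cmod (ev m x))\<^sup>2"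
          proof -
            have "Q (ev m) = (L2_set (\<lambda>x. cmod (ev m x)) J)\<^sup>2" by (simp add: Q_def L2_set_def sum_nonneg)
            also have "\<dots> \<le> (\<Sum>x\<in>J. cmod (ev m x))\<^sup>2" by (intro power_mono L2_set_le_sum) auto
            finally show ?thesis .
          qed
          also have "\<dots> \<le> (L * P)\<^sup>2"
          proof (rule power_mono)
            have "(\<Sum>x\<in>J. cmod (ev m x)) = (\<Sum>i\<in>I. \<Sum>j\<in>I. \<Sum>a\<in>S. cmod (m i j a))"
              by (simp add: J_def sum.cartesian_product' ev_def)
            also have "\<dots> \<le> (\<Sum>i\<in>I. \<Sum>j\<in>I. \<Sum>a\<in>S. cnorm A a * P)"
              using S mb by (intro sum_mono) auto
            also have "\<dots> = (L - 1) * P" by (simp add: L_def sum_distrib_right)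
            also have "\<dots> \<le> L * P" using P0 by (intro mult_right_mono) auto
            finally show "(\<Sum>x\<in>J. cmod (ev m x)) \<le> L * P" .
          qed (auto intro: sum_nonneg)
          finally show ?thesis .
        qed
        have "fin_kernel A I 1 (\<lambda>_. \<psi>) (\<lambda>_. c)" using \<psi> c by (simp add: fin_kernel_def)
        then have mC: "kernel_of A 1 (\<lambda>_. \<psi>) (\<lambda>_. c) \<in> Cone" unfolding Cone_def by blast
        have "kernel_of A 1 (\<lambda>_. \<psi>) (\<lambda>_. c) = m" by (intro ext) (simp add: kernel_of_def m_def)
        then have mC: "m \<in> Cone" using mC by simp
        have key: "Re (ip (ev m) r) \<le> \<delta> * (L * P)"
        proof (cases "P = 0")
          case True
          then have "Q (ev m) = 0" using Qm Q0[of "ev m"] by simp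
          then have le: "2 * l * Re (ip (ev m) r) \<le> \<delta>\<^sup>2" if "0 \<le> l" for l using small[OF mC that] by simp
          have "Re (ip (ev m) r) \<le> 0"
          proof (rule ccontr)
            assume n: "\<not> ?thesis"
            then have "2 * (1 / Re (ip (ev m) r)) * Re (ip (ev m) r) \<le> \<delta>\<^sup>2" by (intro le) auto
            then show False using n \<delta>2 by simp
          qed
          then show ?thesis using True by simp
        next
          case False
          then have LP: "0 < L * P" using P0 L1 by simp
          define l where "l = \<delta> / (L * P)"
          have lLP: "l * (L * P) = \<delta>" unfolding l_def using LP by (metis less_irrefl nonzero_eq_divide_eq)
          have l0: "0 < l" using LP \<delta> by (simp add: l_def)
          have "2 * l * Re (ip (ev m) r) \<le> \<delta>\<^sup>2 + l\<^sup>2 * Q (ev m)" using small[OF mC] l0 by simp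
          also have "\<dots> \<le> \<delta>\<^sup>2 + l\<^sup>2 * (L * P)\<^sup>2" using Qm by (intro add_left_mono mult_left_mono) auto
          also have "l\<^sup>2 * (L * P)\<^sup>2 = \<delta>\<^sup>2" by (simp only: power_mult_distrib[symmetric] lLP)
          also have "\<delta>\<^sup>2 + \<delta>\<^sup>2 = 2 * l * (\<delta> * (L * P))" 
          proof -
            have "2 * l * (\<delta> * (L * P)) = 2 * (\<delta> * (l * (L * P)))" by (simp only: ac_simps)
            also have "\<dots> = 2 * (\<delta> * \<delta>)" by (simp only: lLP)
            finally have "2 * l * (\<delta> * (L * P)) = 2 * (\<delta> * \<delta>)" .
            then show ?thesis using mult_2[of "\<delta> * \<delta>"] by (simp only: power2_eq_square)
          qed
          finally show ?thesis using l0 by simp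
        qed
        have "(\<Sum>i\<in>I. m i i \<one>\<^bsub>A\<^esub>) = complex_of_real P"
          unfolding P_def of_real_sum using c posf_eq_Re[OF f] by (intro sum.cong refl) (simp add: m_def)
        then have "(\<Sum>i\<in>I. \<Sum>j\<in>I. m i j (h i j)) = complex_of_real (\<delta> * (L + 1) * P - Re (ip (ev m) r))"
          using pairh[OF m1 m2] by simp
        then have "Re (\<Sum>i\<in>I. \<Sum>j\<in>I. \<psi> (star A (c i) \<otimes>\<^bsub>A\<^esub> (h i j \<otimes>\<^bsub>A\<^esub> c j))) = \<delta> * (L + 1) * P - Re (ip (ev m) r)"
          unfolding m_def by simp
        then show "\<delta> * (\<Sum>i\<in>I. Re (\<psi> (star A (c i) \<otimes>\<^bsub>A\<^esub> c i))) \<le> Re (\<Sum>i\<in>I. \<Sum>j\<in>I. \<psi> (star A (c i) \<otimes>\<^bsub>A\<^esub> (h i j \<otimes>\<^bsub>A\<^esub> c j)))"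
          using key by (simp add: P_def[symmetric] algebra_simps)
      qed (use hc in auto)
      \<comment> \<open>Positivity bounds the pairing of \<open>t\<close> with \<open>r\<close> by a
        multiple of \<open>\<delta>\<close>; yet that pairing is \<open>Q r\<close> plus the one of
        \<open>m0\<close>, hence at least \<open>d\<close> up to a multiple of
        \<open>\<delta>\<close>.\<close>
      then have "0 \<le> \<delta> * (L + 1) * T - Re (ip (ev t) r)"
        using pairh[of t] lt by (simp add: T_def)
      then have "Re (ip (ev t) r) \<le> \<delta> * (L + 1) * T" by simp
      then have "d \<le> \<delta> * (L + 1) * T + \<delta> * (1 + R) / 2" using ipt low qr by linarith
      then show ?thesis by (simp add: algebra_simps add_divide_distrib)
    qed
    define K where "K = \<bar>(1 + R) / 2 + (L + 1) * T\<bar>"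
    define \<delta> where "\<delta> = min 1 (d / (2 * (K + 1)))"
    have K0: "0 \<le> K" by (simp add: K_def)
    have "0 < \<delta>" "\<delta> \<le> 1" using d0 K0 by (auto simp: \<delta>_def)
    then have "d \<le> \<delta> * ((1 + R) / 2 + (L + 1) * T)" by (rule bound)
    also have "\<dots> \<le> \<delta> * K" using \<open>0 < \<delta>\<close> by (intro mult_left_mono) (auto simp: K_def)
    also have "\<dots> \<le> d / (2 * (K + 1)) * K" using K0 by (intro mult_right_mono) (auto simp: \<delta>_def)
    also have "\<dots> < d" 
    proof -
      have "0 < K * d + d * 2" using mult_nonneg_nonneg[OF K0 less_imp_le[OF d0]] d0 by linarith
      then show ?thesis using d0 K0 by (simp add: field_simps)
    qed
    finally show ?thesis by simp
  qed
qed

section \<open>Averaging over a finite-dimensional algebra\<close>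

context unital_cstar_algebra
begin

lemma posf_conjugate:
  assumes "posf A f" "c \<in> carrier A" shows "posf A (\<lambda>x. f (star A c \<otimes> (x \<otimes> c)))"
  unfolding posf_def
proof (intro conjI ballI)
  show "lin A (\<lambda>x. f (star A c \<otimes> (x \<otimes> c)))"
    using lin_mult_r[OF lin_mult_l[OF posf_lin[OF assms(1)], of "star A c"], of c] assms by simp
  fix x assume x: "x \<in> carrier A"
  show "f (star A c \<otimes> (star A x \<otimes> c)) = cnj (f (star A c \<otimes> (x \<otimes> c)))"
    using posf_star[OF assms(1), of "star A c \<otimes> (x \<otimes> c)"] x assms by (simp add: star_simps mult_assoc)
  show "0 \<le> Re (f (star A c \<otimes> (star A x \<otimes> x \<otimes> c)))"
    using posf_nonneg[OF assms(1), of "x \<otimes> c"] x assms by (simp add: star_simps mult_assoc)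
qed

text \<open>The Parseval identity shows that \<open>a\<close> minus its Fourier sum is null, hence
  zero as \<open>f\<close> is faithful. So the \<open>e i\<close> span the algebra, with coordinates
  \<open>f (star (e i) a)\<close>.\<close>

lemma faithful_expansion:
  fixes r :: nat
  assumes f: "posf A f" and faith: "\<And>x. x \<in> carrier A \<Longrightarrow> f (star A x \<otimes> x) = 0 \<Longrightarrow> x = \<zero>"
    and e: "\<And>i. i < r \<Longrightarrow> e i \<in> carrier A"
    and complete: "\<And>a b. a \<in> carrier A \<Longrightarrow> b \<in> carrier A \<Longrightarrow>
      f (star A b \<otimes> a) = (\<Sum>i<r. f (star A (e i) \<otimes> a) * f (star A b \<otimes> e i))"
    and h: "lin A h" and a: "a \<in> carrier A"
  shows "h a = (\<Sum>i<r. f (star A (e i) \<otimes> a) * h (e i))"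
proof -
  define s where "s = (\<Oplus>\<^bsub>A\<^esub>i\<in>{..<r}. f (star A (e i) \<otimes> a) \<odot> e i)"
  have eI: "(\<lambda>i. f (star A (e i) \<otimes> a) \<odot> e i) \<in> {..<r} \<rightarrow> carrier A" using e by auto
  have sc: "s \<in> carrier A" unfolding s_def using eI by (rule M.finsum_closed)
  have hs: "k s = (\<Sum>i<r. f (star A (e i) \<otimes> a) * k (e i))" if "lin A k" for k
  proof -
    have "k s = (\<Sum>i<r. k (f (star A (e i) \<otimes> a) \<odot> e i))" unfolding s_def by (rule lin_finsum[OF that _ eI]) simp
    also have "\<dots> = (\<Sum>i<r. f (star A (e i) \<otimes> a) * k (e i))" by (intro sum.cong refl lin_smult[OF that] e) simp
    finally show ?thesis .
  qed
  note lf = posf_lin[OF f]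
  have "f (star A (a \<ominus> s) \<otimes> (a \<ominus> s)) = 0"
    using complete[OF a, of "a \<ominus> s"] hs[OF lin_mult_l[OF lf, of "star A (a \<ominus> s)"]] a sc lf
    by (simp add: minus_mult_r lin_minus)
  then have "a \<ominus> s = \<zero>" using faith a sc by simp
  then have "a = s" using a sc by (simp add: minus_eq_zero)
  then show ?thesis using hs[OF h] by simp
qed

text \<open>The vectors \<open>x k\<close> of a maximal triangular system give a faithful functional: the sum of the
  \<open>\<phi> k\<close>.\<close>

lemma exists_faithful_posf:
  assumes B: "finite B"
    and c: "\<And>g y. lin A g \<Longrightarrow> y \<in> carrier A \<Longrightarrow> g y = (\<Sum>b\<in>B. c y b * g b)"
  shows "\<exists>f. posf A f \<and> (\<forall>x\<in>carrier A. f (star A x \<otimes> x) = 0 \<longrightarrow> x = \<zero>)"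
proof -
  \<comment> \<open>A triangular system of length \<open>n\<close>: each \<open>\<phi> k\<close>
    sees \<open>x k\<close> but annihilates all later \<open>x j\<close>. This makes the
    \<open>x k\<close> linearly independent, so \<open>n\<close> is bounded.\<close>
  define T where "T n \<longleftrightarrow> (\<exists>x \<phi>. (\<forall>k<n. posf A (\<phi> k) \<and> x k \<in> carrier A \<and> \<phi> k (star A (x k) \<otimes> x k) \<noteq> 0) \<and>
     (\<forall>j<n. \<forall>k<j. \<phi> k (star A (x j) \<otimes> x j) = 0))" for n :: nat
  have "n \<le> card B" if "T n" for n
  proof (rule ccontr)
    assume "\<not> n \<le> card B"
    obtain x \<phi> where x': "\<forall>k<n. posf A (\<phi> k) \<and> x k \<in> carrier A \<and> \<phi> k (star A (x k) \<otimes> x k) \<noteq> 0"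
      "\<forall>j<n. \<forall>k<j. \<phi> k (star A (x j) \<otimes> x j) = 0" using \<open>T n\<close> unfolding T_def by - (elim exE conjE, rule that)
    have x: "\<And>k. k < n \<Longrightarrow> posf A (\<phi> k)" "\<And>k. k < n \<Longrightarrow> x k \<in> carrier A" "\<And>k. k < n \<Longrightarrow> \<phi> k (star A (x k) \<otimes> x k) \<noteq> 0"
      "\<And>j k. j < n \<Longrightarrow> k < j \<Longrightarrow> \<phi> k (star A (x j) \<otimes> x j) = 0" using x' by blast+
    obtain l where l: "\<exists>j<n. l j \<noteq> 0" "\<forall>b\<in>B. (\<Sum>j<n. l j * c (x j) b) = 0"
      using homogeneous_system[of B "{..<n}" "\<lambda>j b. c (x j) b"] B \<open>\<not> n \<le> card B\<close> by auto
    \<comment> \<open>In a linear relation among the \<open>x j\<close>, apply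
      \<open>\<phi> k (star (x k) _)\<close> at the first nonzero coefficient: earlier terms have
      coefficient zero, later ones are null vectors of \<open>\<phi> k\<close>.\<close>
    define k where "k = (LEAST k. k < n \<and> l k \<noteq> 0)"
    have k: "k < n" "l k \<noteq> 0" using LeastI_ex[of "\<lambda>k. k < n \<and> l k \<noteq> 0"] l(1) by (auto simp: k_def)
    have kl: "l j = 0" if "j < k" for j using not_less_Least[of j "\<lambda>k. k < n \<and> l k \<noteq> 0"] that k by (auto simp: k_def)
    have lk: "lin A (\<lambda>y. \<phi> k (star A (x k) \<otimes> y))" using x k by (intro lin_mult_l posf_lin) auto
    have "(\<Sum>j<n. l j * \<phi> k (star A (x k) \<otimes> x j)) = (\<Sum>j<n. \<Sum>b\<in>B. l j * c (x j) b * \<phi> k (star A (x k) \<otimes> b))"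
      using c[OF lk] x by (simp add: sum_distrib_left mult.assoc)
    also have "\<dots> = (\<Sum>b\<in>B. (\<Sum>j<n. l j * c (x j) b) * \<phi> k (star A (x k) \<otimes> b))"
      by (subst sum.swap) (simp add: sum_distrib_right)
    also have "\<dots> = 0" using l(2) by simp
    finally have 0: "(\<Sum>j<n. l j * \<phi> k (star A (x k) \<otimes> x j)) = 0" .
    have lj: "l j * \<phi> k (star A (x k) \<otimes> x j) = (if j = k then l k * \<phi> k (star A (x k) \<otimes> x k) else 0)" if "j < n" for j
    proof -
      have "\<phi> k (star A (x k) \<otimes> x j) = 0" if "k < j"
        using posf_null(1)[OF x(1)[OF k(1)] x(2)[OF \<open>j < n\<close>] x(2)[OF k(1)]] x(4)[OF \<open>j < n\<close> that] by simp
      then show ?thesis using kl[of j] by (cases j k rule: linorder_cases) auto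
    qed
    have "(\<Sum>j<n. l j * \<phi> k (star A (x k) \<otimes> x j)) = (\<Sum>j<n. if j = k then l k * \<phi> k (star A (x k) \<otimes> x k) else 0)"
      by (intro sum.cong refl lj) simp
    then have "(\<Sum>j<n. if j = k then l k * \<phi> k (star A (x k) \<otimes> x k) else 0) = 0" using 0 by simp
    then show False using k x(3) by simp
  qed
  moreover have "T 0" by (auto simp: T_def)
  ultimately obtain n where n: "T n" "\<And>m. T m \<Longrightarrow> m \<le> n" using Nat.ex_has_greatest_nat[of T 0 "card B"] by blast
  obtain x \<phi> where x': "\<forall>k<n. posf A (\<phi> k) \<and> x k \<in> carrier A \<and> \<phi> k (star A (x k) \<otimes> x k) \<noteq> 0"
      "\<forall>j<n. \<forall>k<j. \<phi> k (star A (x j) \<otimes> x j) = 0" using n(1) unfolding T_def by - (elim exE conjE, rule that)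
    have x: "\<And>k. k < n \<Longrightarrow> posf A (\<phi> k)" "\<And>k. k < n \<Longrightarrow> x k \<in> carrier A" "\<And>k. k < n \<Longrightarrow> \<phi> k (star A (x k) \<otimes> x k) \<noteq> 0"
      "\<And>j k. j < n \<Longrightarrow> k < j \<Longrightarrow> \<phi> k (star A (x j) \<otimes> x j) = 0" using x' by blast+
  define f where "f y = (\<Sum>k<n. \<phi> k y)" for y
  have f: "posf A f" unfolding f_def using x(1) by (intro posf_sum) auto
  have "y = \<zero>" if y: "y \<in> carrier A" "f (star A y \<otimes> y) = 0" for y
  proof (rule ccontr)
    assume "y \<noteq> \<zero>"
    then obtain \<theta> where \<theta>: "posf A \<theta>" "0 < Re (\<theta> (star A y \<otimes> y))" using exists_posf y by blast
    have "(\<Sum>k<n. Re (\<phi> k (star A y \<otimes> y))) = 0" using arg_cong[OF y(2), of Re] by (simp add: f_def)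
    then have 0: "Re (\<phi> k (star A y \<otimes> y)) = 0" if "k < n" for k
      using sum_nonneg_eq_0_iff[of "{..<n}" "\<lambda>k. Re (\<phi> k (star A y \<otimes> y))"] posf_nonneg[OF x(1) y(1)] that by auto
    then have 0: "\<phi> k (star A y \<otimes> y) = 0" if "k < n" for k
      using posf_eq_Re[OF x(1)[OF that] y(1)] that by simp
    \<comment> \<open>A nonzero null vector \<open>y\<close> of the sum is null for every
      \<open>\<phi> k\<close>; together with a functional that detects it, it would prolong the
      maximal system.\<close>
    have "T (Suc n)" unfolding T_def
    proof (intro exI conjI allI impI)
      fix k assume k: "k < Suc n"
      show "posf A ((\<phi>(n := \<theta>)) k)" using k x(1) \<theta> by (auto simp: less_Suc_eq)
      show "(x(n := y)) k \<in> carrier A" using k x(2) y by (auto simp: less_Suc_eq)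
      show "(\<phi>(n := \<theta>)) k (star A ((x(n := y)) k) \<otimes> (x(n := y)) k) \<noteq> 0" using k x(3) \<theta> by (auto simp: less_Suc_eq)
    next
      fix j k assume "j < Suc n" "k < j"
      then show "(\<phi>(n := \<theta>)) k (star A ((x(n := y)) j) \<otimes> (x(n := y)) j) = 0"
        using x(4) 0 by (auto simp: less_Suc_eq)
    qed
    then show False using n(2) by force
  qed
  then show ?thesis using f by blast
qed

text \<open>The elements \<open>d j\<close> form an orthonormal basis for the trace of the left regular representation,
  so that \<open>x \<mapsto> \<Sum> d j x star (d j)\<close> maps into the commutant of the algebra and fixes it.\<close>

lemma exists_averaging:
  assumes fd: "finite_dimensional A"
  shows "\<exists>(N::nat) d. (\<forall>j<N. d j \<in> carrier A) \<and> (\<forall>g. lin A g \<longrightarrow> (\<Sum>j<N. g (d j \<otimes> star A (d j))) = g \<one>) \<and>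
     (\<forall>x\<in>carrier A. \<exists>l. \<forall>g. lin A g \<longrightarrow> (\<forall>j<N. g (x \<otimes> d j) = (\<Sum>k<N. l k j * g (d k))) \<and>
        (\<forall>k<N. g (star A (d k) \<otimes> x) = (\<Sum>j<N. l k j * g (star A (d j)))))"
proof -
  obtain B where B: "finite B" "B \<subseteq> carrier A" "\<And>y. y \<in> carrier A \<Longrightarrow> \<exists>c. y = (\<Oplus>\<^bsub>A\<^esub>b\<in>B. c b \<odot>\<^bsub>A\<^esub> b)"
    using fd unfolding finite_dimensional_def by blast
  obtain c where c: "\<And>y. y \<in> carrier A \<Longrightarrow> y = (\<Oplus>\<^bsub>A\<^esub>b\<in>B. c y b \<odot>\<^bsub>A\<^esub> b)" using B(3) by metis
  have lc: "g y = (\<Sum>b\<in>B. c y b * g b)" if g: "lin A g" and y: "y \<in> carrier A" for g y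
  proof -
    have "g y = (\<Sum>b\<in>B. g (c y b \<odot> b))"
      using lin_finsum[OF g B(1), of "\<lambda>b. c y b \<odot> b"] c[OF y] B(2) by auto
    also have "\<dots> = (\<Sum>b\<in>B. c y b * g b)" using B(2) by (intro sum.cong lin_smult[OF g]) auto
    finally show ?thesis .
  qed
  have bd: "r \<le> card B" if f: "posf A f" and e: "\<forall>i<r. e i \<in> carrier A" "orthonormal A f r e" for f r e
  proof (rule orthonormal_bound[OF e(2) B(1)])
    fix i j assume "i < r" "j < r"
    then show "f (star A (e j) \<otimes> e i) = (\<Sum>b\<in>B. c (e i) b * f (star A (e j) \<otimes> b))"
      using e(1) f by (intro lc lin_mult_l posf_lin) auto
  qed
  have basis: "\<exists>(r::nat) e. (\<forall>i<r. e i \<in> carrier A) \<and> (\<forall>h. \<forall>a. lin A h \<longrightarrow> a \<in> carrier A \<longrightarrow> h a = (\<Sum>i<r. f (star A (e i) \<otimes> a) * h (e i)))"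
    if f: "posf A f" and faith: "\<And>x. x \<in> carrier A \<Longrightarrow> f (star A x \<otimes> x) = 0 \<Longrightarrow> x = \<zero>" for f
  proof -
    have "\<exists>r e. (\<forall>i<r. e i \<in> carrier A) \<and> orthonormal A f r e \<and>
      (\<forall>a\<in>carrier A. \<forall>b\<in>carrier A. f (star A b \<otimes> a) = (\<Sum>i<r. f (star A (e i) \<otimes> a) * f (star A b \<otimes> e i)))"
    proof (rule exists_complete_orthonormal[OF f order_refl M.zero_closed M.add.m_closed smult_closed'])
      fix r e assume "\<forall>i<r. e i \<in> carrier A" "orthonormal A f r e"
      then show "r \<le> card B" by (rule bd[OF f])
    qed
    then obtain r :: nat and e where e: "\<forall>i<r. e i \<in> carrier A" "orthonormal A f r e"
      "\<forall>a\<in>carrier A. \<forall>b\<in>carrier A. f (star A b \<otimes> a) = (\<Sum>i<r. f (star A (e i) \<otimes> a) * f (star A b \<otimes> e i))"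
      by - (elim exE conjE, rule that)
    have "h a = (\<Sum>i<r. f (star A (e i) \<otimes> a) * h (e i))" if "lin A h" "a \<in> carrier A" for h a
      by (rule faithful_expansion[OF f faith]) (use e that in blast)+
    then show ?thesis using e(1) by blast
  qed
  obtain f where f: "posf A f" "\<And>x. x \<in> carrier A \<Longrightarrow> f (star A x \<otimes> x) = 0 \<Longrightarrow> x = \<zero>"
    using exists_faithful_posf[OF B(1) lc] by blast
  obtain r :: nat and b where b': "\<forall>i<r. b i \<in> carrier A"
    "\<forall>h. \<forall>a. lin A h \<longrightarrow> a \<in> carrier A \<longrightarrow> h a = (\<Sum>i<r. f (star A (b i) \<otimes> a) * h (b i))"
  proof -
    from f have "\<exists>(r::nat) b. (\<forall>i<r. b i \<in> carrier A) \<and> (\<forall>h. \<forall>a. lin A h \<longrightarrow> a \<in> carrier A \<longrightarrow> h a = (\<Sum>i<r. f (star A (b i) \<otimes> a) * h (b i)))"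
      by (rule basis)
    then show thesis by (elim exE conjE) (rule that)
  qed
  have b: "\<And>i. i < r \<Longrightarrow> b i \<in> carrier A"
    and bexp: "\<And>h a. lin A h \<Longrightarrow> a \<in> carrier A \<Longrightarrow> h a = (\<Sum>i<r. f (star A (b i) \<otimes> a) * h (b i))"
    using b' by blast+
  \<comment> \<open>The \<open>k\<close>-th coordinate of \<open>y\<close> in the basis
    \<open>b\<close> is \<open>f (star (b k) y)\<close>, so \<open>\<tau> x\<close> is the trace of
    left multiplication by \<open>x\<close>. The functional \<open>f\<close> itself need not be
    tracial, which the computation of \<open>\<Sum> e j star (e j)\<close> requires.\<close>
  define \<tau> where "\<tau> x = (\<Sum>k<r. f (star A (b k) \<otimes> (x \<otimes> b k)))" for x
  have \<tau>: "posf A \<tau>" unfolding \<tau>_def using b f by (intro posf_sum posf_conjugate) auto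
  note lf = posf_lin[OF f(1)] and l\<tau> = posf_lin[OF \<tau>]
  have faith: "x = \<zero>" if x: "x \<in> carrier A" "\<tau> (star A x \<otimes> x) = 0" for x
  proof -
    have eq: "star A (b k) \<otimes> (star A x \<otimes> x \<otimes> b k) = star A (x \<otimes> b k) \<otimes> (x \<otimes> b k)" if "k < r" for k
      using b[OF that] x by (simp add: star_simps mult_assoc)
    have "(\<Sum>k<r. Re (f (star A (x \<otimes> b k) \<otimes> (x \<otimes> b k)))) = 0"
      using arg_cong[OF x(2), of Re] by (simp add: \<tau>_def eq)
    then have "Re (f (star A (x \<otimes> b k) \<otimes> (x \<otimes> b k))) = 0" if "k < r" for k
      using sum_nonneg_eq_0_iff[of "{..<r}" "\<lambda>k. Re (f (star A (x \<otimes> b k) \<otimes> (x \<otimes> b k)))"] posf_nonneg[OF f(1)] x b that by auto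
    then have xb: "x \<otimes> b k = \<zero>" if "k < r" for k
      using f(2)[of "x \<otimes> b k"] posf_eq_Re[OF f(1), of "x \<otimes> b k"] x b[OF that] that by simp
    show "x = \<zero>"
    proof (rule lin_eqI)
      fix g assume g: "lin A g"
      have "g (x \<otimes> \<one>) = (\<Sum>i<r. f (star A (b i) \<otimes> \<one>) * g (x \<otimes> b i))" using bexp[OF lin_mult_l[OF g x(1)], of \<one>] by simp
      also have "\<dots> = 0" using xb lin_zero[OF g] by simp
      finally show "g x = g \<zero>" using x lin_zero[OF g] by simp
    qed (use x in auto)
  qed
  have trace: "\<tau> (x \<otimes> y) = \<tau> (y \<otimes> x)" if xy: "x \<in> carrier A" "y \<in> carrier A" for x y
  proof -
    have "f (star A (b k) \<otimes> (x \<otimes> y \<otimes> b k)) = (\<Sum>l<r. f (star A (b l) \<otimes> (y \<otimes> b k)) * f (star A (b k) \<otimes> (x \<otimes> b l)))"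
      if xy: "x \<in> carrier A" "y \<in> carrier A" and k: "k < r" for x y k
      using bexp[of "\<lambda>z. f (star A (b k) \<otimes> (x \<otimes> z))" "y \<otimes> b k"] lin_mult_l[OF lin_mult_l[OF lf, of "star A (b k)"], of x] xy b[OF k]
      by (simp add: mult_assoc)
    then have eq: "\<tau> (x \<otimes> y) = (\<Sum>k<r. \<Sum>l<r. f (star A (b l) \<otimes> (y \<otimes> b k)) * f (star A (b k) \<otimes> (x \<otimes> b l)))"
      if "x \<in> carrier A" "y \<in> carrier A" for x y using that by (simp add: \<tau>_def)
    show ?thesis unfolding eq[OF xy] eq[OF xy(2,1)] by (subst sum.swap) (simp add: mult.commute)
  qed
  obtain s :: nat and e where e': "\<forall>i<s. e i \<in> carrier A"
    "\<forall>h. \<forall>a. lin A h \<longrightarrow> a \<in> carrier A \<longrightarrow> h a = (\<Sum>i<s. \<tau> (star A (e i) \<otimes> a) * h (e i))"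
  proof -
    from \<tau> faith have "\<exists>(s::nat) e. (\<forall>i<s. e i \<in> carrier A) \<and> (\<forall>h. \<forall>a. lin A h \<longrightarrow> a \<in> carrier A \<longrightarrow> h a = (\<Sum>i<s. \<tau> (star A (e i) \<otimes> a) * h (e i)))"
      by (rule basis)
    then show thesis by (elim exE conjE) (rule that)
  qed
  have e: "\<And>i. i < s \<Longrightarrow> e i \<in> carrier A"
    and eexp: "\<And>h a. lin A h \<Longrightarrow> a \<in> carrier A \<Longrightarrow> h a = (\<Sum>i<s. \<tau> (star A (e i) \<otimes> a) * h (e i))"
    using e' by blast+
  have one: "(\<Sum>j<s. g (e j \<otimes> star A (e j))) = g \<one>" if g: "lin A g" for g
  proof -
    define z where "z = (\<Oplus>\<^bsub>A\<^esub>j\<in>{..<s}. e j \<otimes> star A (e j))"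
    have zI: "(\<lambda>j. e j \<otimes> star A (e j)) \<in> {..<s} \<rightarrow> carrier A" using e by auto
    have zc: "z \<in> carrier A" unfolding z_def using zI by (rule M.finsum_closed)
    have hz: "h z = (\<Sum>j<s. h (e j \<otimes> star A (e j)))" if "lin A h" for h
      unfolding z_def by (rule lin_finsum[OF that _ zI]) simp
    \<comment> \<open>By cyclicity the left side becomes the sum of the
      \<open>\<tau> (star (e j) d (e j))\<close>, the trace of left multiplication by
      \<open>d\<close> computed in the basis \<open>e\<close> instead of \<open>b\<close>.\<close>
    have eq: "\<tau> (d \<otimes> z) = \<tau> d" if d: "d \<in> carrier A" for d
    proof -
      have "\<tau> (d \<otimes> z) = (\<Sum>j<s. \<tau> (d \<otimes> (e j \<otimes> star A (e j))))" using hz[OF lin_mult_l[OF l\<tau> d]] .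
      also have "\<dots> = (\<Sum>j<s. \<tau> (star A (e j) \<otimes> (d \<otimes> e j)))"
        using trace[of "d \<otimes> e _" "star A (e _)"] d e by (intro sum.cong refl) (simp add: mult_assoc[symmetric])
      also have "\<dots> = (\<Sum>j<s. \<Sum>k<r. f (star A (b k) \<otimes> (d \<otimes> e j)) * \<tau> (star A (e j) \<otimes> b k))"
        using bexp[OF lin_mult_l[OF l\<tau>]] d e by (intro sum.cong refl) auto
      also have "\<dots> = (\<Sum>k<r. \<Sum>j<s. \<tau> (star A (e j) \<otimes> b k) * f (star A (b k) \<otimes> (d \<otimes> e j)))"
        by (subst sum.swap) (simp add: mult.commute)
      also have "\<dots> = (\<Sum>k<r. f (star A (b k) \<otimes> (d \<otimes> b k)))"
        using eexp[OF lin_mult_l[OF lin_mult_l[OF lf]]] d b by (intro sum.cong refl) (simp add: star_closed)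
      finally show ?thesis by (simp add: \<tau>_def)
    qed
    have "\<tau> (star A (z \<ominus> \<one>) \<otimes> (z \<ominus> \<one>)) = 0"
      using eq[of "star A (z \<ominus> \<one>)"] zc l\<tau> by (simp add: minus_mult_r lin_minus)
    then have "z = \<one>" using faith[of "z \<ominus> \<one>"] zc by (simp add: minus_eq_zero)
    then show ?thesis using hz[OF g] by simp
  qed
  have "g (x \<otimes> e j) = (\<Sum>k<s. \<tau> (star A (e k) \<otimes> (x \<otimes> e j)) * g (e k))" if "lin A g" "x \<in> carrier A" "j < s" for g x j
    using eexp[OF that(1)] that e by auto
  moreover have "g (star A (e k) \<otimes> x) = (\<Sum>j<s. \<tau> (star A (e k) \<otimes> (x \<otimes> e j)) * g (star A (e j)))"
    if g: "lin A g" and x: "x \<in> carrier A" and k: "k < s" for g x k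
  proof -
    \<comment> \<open>This functional is linear again; expanding \<open>star x (e k)\<close> under
      it gives the second relation with the same coefficients
      \<open>\<tau> (star (e k) x (e j))\<close> as the first.\<close>
    have "lin A (\<lambda>y. cnj (g (star A y)))" using g by (simp add: lin_def star_add star_smult)
    then have "cnj (g (star A (star A x \<otimes> e k))) = (\<Sum>j<s. \<tau> (star A (e j) \<otimes> (star A x \<otimes> e k)) * cnj (g (star A (e j))))"
      using eexp[of "\<lambda>y. cnj (g (star A y))" "star A x \<otimes> e k"] x e[OF k] by simp
    then have "g (star A (star A x \<otimes> e k)) = cnj (\<Sum>j<s. \<tau> (star A (e j) \<otimes> (star A x \<otimes> e k)) * cnj (g (star A (e j))))"
      by (metis complex_cnj_cnj)
    also have "\<dots> = (\<Sum>j<s. cnj (\<tau> (star A (e j) \<otimes> (star A x \<otimes> e k))) * g (star A (e j)))" by simp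
    also have "\<dots> = (\<Sum>j<s. \<tau> (star A (e k) \<otimes> (x \<otimes> e j)) * g (star A (e j)))"
      using posf_star[OF \<tau>, of "star A (e _) \<otimes> (star A x \<otimes> e k)", symmetric] x e k
      by (intro sum.cong refl) (simp add: star_simps mult_assoc)
    finally show ?thesis using x e[OF k] by (simp add: star_simps)
  qed
  ultimately show ?thesis using e one 
    by (intro exI[of _ s] exI[of _ e] conjI ballI exI[of _ "\<lambda>k j. \<tau> (star A (e k) \<otimes> (_ \<otimes> e j))"]) auto
qed

end

section \<open>Matrix algebras on sequences\<close>

text \<open>The targets in \<open>rfd\<close> and in the universal property have elements of type
  \<open>seq\<close>, so matrices are stored as sequences; \<open>ent\<close> reads and
  \<open>mk\<close> builds them. Indices range over an arbitrary finite set of numbers, which lets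
  direct sums be indexed by coded pairs.\<close>

definition ent :: "seq \<Rightarrow> nat \<Rightarrow> nat \<Rightarrow> complex" where
  "ent M i j = M (prod_encode (i, j))"

definition mk :: "(nat \<Rightarrow> nat \<Rightarrow> complex) \<Rightarrow> seq" where
  "mk m = (\<lambda>k. m (fst (prod_decode k)) (snd (prod_decode k)))"

lemma ent_mk [simp]: "ent (mk m) i j = m i j"
  by (simp add: ent_def mk_def)

lemma ent_eqI: "(\<And>i j. ent M i j = ent N i j) \<Longrightarrow> M = N"
  unfolding ent_def by (metis ext prod_decode_inverse surj_pair)

definition nrm :: "nat set \<Rightarrow> seq \<Rightarrow> real" where
  "nrm X v = L2_set (\<lambda>x. cmod (v x)) X"

text \<open>Linear in the first argument, matching the convention \<open>\<phi> (star y x)\<close>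
  for the inner product of \<open>x\<close> and \<open>y\<close>.\<close>

definition ip :: "nat set \<Rightarrow> seq \<Rightarrow> seq \<Rightarrow> complex" where
  "ip X v w = (\<Sum>x\<in>X. v x * cnj (w x))"

text \<open>\<open>nrm\<close>, \<open>ip\<close> and \<open>app\<close> read only the coordinates
  in \<open>X\<close> of their vector arguments. Vanishing elsewhere is a normalization for those
  places where vectors must be equal as functions, as in \<open>app_one\<close>.\<close>

definition vecs :: "nat set \<Rightarrow> seq set" where
  "vecs X = {v. \<forall>i. i \<notin> X \<longrightarrow> v i = 0}"

definition app :: "nat set \<Rightarrow> seq \<Rightarrow> seq \<Rightarrow> seq" where
  "app X M v = (\<lambda>i. \<Sum>j\<in>X. ent M i j * v j)"

text \<open>The bounds are to hold for all sequences; as coordinates of \<open>v\<close> outside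
  \<open>X\<close> are ignored, this is the operator norm on the vectors indexed by
  \<open>X\<close>.\<close>

definition opn :: "nat set \<Rightarrow> seq \<Rightarrow> real" where
  "opn X M = Inf {K. 0 \<le> K \<and> (\<forall>v. nrm X (app X M v) \<le> K * nrm X v)}"

text \<open>Matrices with index set \<open>X\<close>, stored as sequences through \<open>prod_encode\<close>, with the operator norm.\<close>

definition mats :: "nat set \<Rightarrow> seq cstar" where
  "mats X = \<lparr>carrier = {M. \<forall>i j. i \<notin> X \<or> j \<notin> X \<longrightarrow> ent M i j = 0},
     monoid.mult = (\<lambda>M N. mk (\<lambda>i j. \<Sum>l\<in>X. ent M i l * ent N l j)),
     one = mk (\<lambda>i j. if i = j \<and> i \<in> X then 1 else 0),
     ring.zero = (\<lambda>_. 0), add = (\<lambda>M N k. M k + N k), smult = (\<lambda>c M k. c * M k),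
     star = (\<lambda>M. mk (\<lambda>i j. cnj (ent M j i))), cnorm = opn X\<rparr>"

lemma mats_simps:
  "M \<in> carrier (mats X) \<longleftrightarrow> (\<forall>i j. i \<notin> X \<or> j \<notin> X \<longrightarrow> ent M i j = 0)"
  "ent (M \<otimes>\<^bsub>mats X\<^esub> N) i j = (\<Sum>l\<in>X. ent M i l * ent N l j)"
  "ent \<one>\<^bsub>mats X\<^esub> i j = (if i = j \<and> i \<in> X then 1 else 0)"
  "ent \<zero>\<^bsub>mats X\<^esub> i j = 0"
  "ent (M \<oplus>\<^bsub>mats X\<^esub> N) i j = ent M i j + ent N i j"
  "ent (c \<odot>\<^bsub>mats X\<^esub> M) i j = c * ent M i j"
  "ent (star (mats X) M) i j = cnj (ent M j i)"
  "cnorm (mats X) = opn X"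
  by (simp_all add: mats_def) (simp_all add: ent_def)

section \<open>The Euclidean space of vectors\<close>

lemma nrm_nonneg [simp]: "0 \<le> nrm X v" by (simp add: nrm_def)

lemma nrm_power2: "(nrm X v)\<^sup>2 = (\<Sum>x\<in>X. (cmod (v x))\<^sup>2)"
  by (simp add: nrm_def L2_set_def sum_nonneg)

lemma ip_self: "ip X v v = complex_of_real ((nrm X v)\<^sup>2)"
  unfolding nrm_power2 ip_def of_real_sum by (intro sum.cong refl) (simp add: complex_norm_square[symmetric])

lemma nrm_add: "nrm X (\<lambda>x. v x + w x) \<le> nrm X v + nrm X w"
proof -
  have "nrm X (\<lambda>x. v x + w x) \<le> L2_set (\<lambda>x. cmod (v x) + cmod (w x)) X"
    unfolding nrm_def by (intro L2_set_mono norm_triangle_ineq) auto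
  also have "\<dots> \<le> nrm X v + nrm X w" unfolding nrm_def by (rule L2_set_triangle_ineq)
  finally show ?thesis .
qed

lemma nrm_scale: "nrm X (\<lambda>x. c * v x) = cmod c * nrm X v"
  unfolding nrm_def norm_mult by (simp add: L2_set_right_distrib)

lemma nrm_diff: "nrm X (\<lambda>x. v x - w x) \<le> nrm X v + nrm X w"
  using nrm_add[of X v "\<lambda>x. (-1) * w x"] nrm_scale[of X "-1" w] by simp

lemma nrm_diff_triangle: "nrm X (\<lambda>x. v x - w x) \<le> nrm X (\<lambda>x. v x - u x) + nrm X (\<lambda>x. u x - w x)"
  using nrm_add[of X "\<lambda>x. v x - u x" "\<lambda>x. u x - w x"] by simp

lemma nrm_sum: "finite J \<Longrightarrow> nrm X (\<lambda>x. \<Sum>j\<in>J. f j x) \<le> (\<Sum>j\<in>J. nrm X (f j))"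
proof (induction J rule: finite_induct)
  case empty
  then show ?case by (simp add: nrm_def L2_set_def)
next
  case (insert j J)
  then show ?case using nrm_add[of X "f j" "\<lambda>x. \<Sum>j\<in>J. f j x"] by simp
qed

lemma ip_bound: "cmod (ip X v w) \<le> nrm X v * nrm X w"
proof -
  have "cmod (ip X v w) \<le> (\<Sum>x\<in>X. \<bar>cmod (v x)\<bar> * \<bar>cmod (w x)\<bar>)"
    unfolding ip_def by (rule order_trans[OF norm_sum]) (simp add: norm_mult)
  also have "\<dots> \<le> nrm X v * nrm X w" unfolding nrm_def by (rule L2_set_mult_ineq)
  finally show ?thesis .
qed

lemma ip_swap: "ip X w v = cnj (ip X v w)"
  by (simp add: ip_def mult.commute)

lemma ip_add_left: "ip X (\<lambda>x. v x + w x) u = ip X v u + ip X w u"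
  and ip_add_right: "ip X u (\<lambda>x. v x + w x) = ip X u v + ip X u w"
  and ip_diff_left: "ip X (\<lambda>x. v x - w x) u = ip X v u - ip X w u"
  and ip_diff_right: "ip X u (\<lambda>x. v x - w x) = ip X u v - ip X u w"
  and ip_scale_left: "ip X (\<lambda>x. c * v x) u = c * ip X v u"
  and ip_scale_right: "ip X u (\<lambda>x. c * v x) = cnj c * ip X u v"
  by (simp_all add: ip_def algebra_simps sum.distrib sum_subtractf sum_distrib_left)

lemma ip_sum_left: "ip X (\<lambda>x. \<Sum>j\<in>J. f j x) u = (\<Sum>j\<in>J. ip X (f j) u)"
  unfolding ip_def sum_distrib_right by (rule sum.swap)

lemma ip_sum_right: "ip X u (\<lambda>x. \<Sum>j\<in>J. f j x) = (\<Sum>j\<in>J. ip X u (f j))"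
  unfolding ip_def cnj_sum sum_distrib_left by (rule sum.swap)

lemma nrm_diff_power2: "(nrm X (\<lambda>x. v x - w x))\<^sup>2 = Re (ip X v v) - 2 * Re (ip X v w) + Re (ip X w w)"
proof -
  have "complex_of_real ((nrm X (\<lambda>x. v x - w x))\<^sup>2) = ip X v v - ip X v w - (ip X w v - ip X w w)"
    unfolding ip_self[symmetric] by (simp add: ip_diff_left ip_diff_right)
  then have "(nrm X (\<lambda>x. v x - w x))\<^sup>2 = Re (ip X v v - ip X v w - (ip X w v - ip X w w))"
    by (metis Re_complex_of_real)
  then show ?thesis using ip_swap[of X w v] by simp
qed

section \<open>The action of matrices on vectors\<close>

lemma app_add: "app X M (\<lambda>x. v x + w x) = (\<lambda>x. app X M v x + app X M w x)"
  and app_diff: "app X M (\<lambda>x. v x - w x) = (\<lambda>x. app X M v x - app X M w x)"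
  and app_scale: "app X M (\<lambda>x. c * v x) = (\<lambda>x. c * app X M v x)"
  by (simp_all add: app_def algebra_simps sum.distrib sum_subtractf sum_distrib_left)

lemma app_sum: "app X M (\<lambda>x. \<Sum>j\<in>J. f j x) = (\<lambda>x. \<Sum>j\<in>J. app X M (f j) x)"
  unfolding app_def sum_distrib_left by (intro ext sum.swap)

lemma app_vec: "M \<in> carrier (mats X) \<Longrightarrow> app X M v \<in> vecs X"
  by (simp add: vecs_def app_def mats_simps)

lemma app_ring:
  "app X (M \<oplus>\<^bsub>mats X\<^esub> N) v = (\<lambda>x. app X M v x + app X N v x)"
  "app X (c \<odot>\<^bsub>mats X\<^esub> M) v = (\<lambda>x. c * app X M v x)"
  "app X (M \<otimes>\<^bsub>mats X\<^esub> N) v = app X M (app X N v)"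
  by (auto simp: app_def mats_simps algebra_simps sum.distrib sum_distrib_left sum_distrib_right intro!: ext)
     (rule sum.swap)

lemma app_one: "finite X \<Longrightarrow> v \<in> vecs X \<Longrightarrow> app X \<one>\<^bsub>mats X\<^esub> v = v"
proof
  fix i assume X: "finite X" and v: "v \<in> vecs X"
  have "app X \<one>\<^bsub>mats X\<^esub> v i = (\<Sum>j\<in>X. if i = j then v j else 0)"
    unfolding app_def by (intro sum.cong refl) (auto simp: mats_simps)
  then show "app X \<one>\<^bsub>mats X\<^esub> v i = v i" using X v by (simp add: vecs_def)
qed

lemma app_adjoint: "ip X (app X M v) w = ip X v (app X (star (mats X) M) w)"
proof -
  have "ip X (app X M v) w = (\<Sum>i\<in>X. \<Sum>j\<in>X. ent M i j * v j * cnj (w i))"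
    by (simp add: ip_def app_def sum_distrib_right)
  also have "\<dots> = (\<Sum>j\<in>X. \<Sum>i\<in>X. ent M i j * v j * cnj (w i))" by (rule sum.swap)
  also have "\<dots> = ip X v (app X (star (mats X) M) w)"
    by (simp add: ip_def app_def sum_distrib_left mats_simps algebra_simps)
  finally show ?thesis .
qed

lemma mats_eqI:
  assumes "finite X" "M \<in> carrier (mats X)" "N \<in> carrier (mats X)" "\<And>v. v \<in> vecs X \<Longrightarrow> app X M v = app X N v"
  shows "M = N"
proof (rule ent_eqI)
  fix i j
  show "ent M i j = ent N i j"
  proof (cases "j \<in> X")
    case True
    define v where "v = (\<lambda>x. if x = j then 1 else (0::complex))"
    have e: "app X K v i = ent K i j" for K
    proof -
      have "app X K v i = (\<Sum>l\<in>X. if l = j then ent K i l else 0)" unfolding app_def v_def by (intro sum.cong) auto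
      then show ?thesis using True assms(1) by simp
    qed
    have "v \<in> vecs X" using True by (auto simp: v_def vecs_def)
    then show ?thesis using assms(4)[of v] e by metis
  qed (use assms in \<open>simp add: mats_simps\<close>)
qed

lemma nrm_app_le_sum:
  assumes "finite X"
  shows "nrm X (app X M v) \<le> (\<Sum>i\<in>X. \<Sum>j\<in>X. cmod (ent M i j)) * nrm X v"
proof -
  have "nrm X (app X M v) \<le> (\<Sum>i\<in>X. cmod (app X M v i))" unfolding nrm_def by (rule L2_set_le_sum) simp
  also have "\<dots> \<le> (\<Sum>i\<in>X. \<Sum>j\<in>X. cmod (ent M i j) * nrm X v)"
  proof (rule sum_mono)
    fix i assume "i \<in> X"
    have "cmod (app X M v i) \<le> (\<Sum>j\<in>X. cmod (ent M i j * v j))" unfolding app_def by (rule norm_sum)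
    also have "\<dots> \<le> (\<Sum>j\<in>X. cmod (ent M i j) * nrm X v)"
      unfolding norm_mult nrm_def using assms by (intro sum_mono mult_left_mono member_le_L2_set) auto
    finally show "cmod (app X M v i) \<le> (\<Sum>j\<in>X. cmod (ent M i j) * nrm X v)" .
  qed
  finally show ?thesis by (simp add: sum_distrib_right)
qed

section \<open>The operator norm\<close>

lemma opn_least: "0 \<le> K \<Longrightarrow> (\<And>v. nrm X (app X M v) \<le> K * nrm X v) \<Longrightarrow> opn X M \<le> K"
  unfolding opn_def by (intro cInf_lower) (auto intro!: bdd_belowI[of _ 0])

lemma opn_nonempty: "finite X \<Longrightarrow> (\<Sum>i\<in>X. \<Sum>j\<in>X. cmod (ent M i j)) \<in> {K. 0 \<le> K \<and> (\<forall>v. nrm X (app X M v) \<le> K * nrm X v)}"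
  using nrm_app_le_sum by (auto intro!: sum_nonneg)

lemma opn_nonneg: "finite X \<Longrightarrow> 0 \<le> opn X M"
  unfolding opn_def using opn_nonempty by (intro cInf_greatest) blast+

lemma opn_bound:
  assumes "finite X" shows "nrm X (app X M v) \<le> opn X M * nrm X v"
proof (cases "nrm X v = 0")
  case True
  then show ?thesis using nrm_app_le_sum[OF assms, of M v] by simp
next
  case False
  then have "0 < nrm X v" using nrm_nonneg[of X v] by linarith
  have "nrm X (app X M v) / nrm X v \<le> opn X M"
    unfolding opn_def using opn_nonempty[OF assms] \<open>0 < nrm X v\<close>
    by (intro cInf_greatest) (blast, auto simp: field_simps)
  then show ?thesis using \<open>0 < nrm X v\<close> by (simp add: field_simps)
qed

lemma opn_le_sum: "finite X \<Longrightarrow> opn X M \<le> (\<Sum>i\<in>X. \<Sum>j\<in>X. cmod (ent M i j))"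
  using nrm_app_le_sum by (intro opn_least) (auto intro!: sum_nonneg)

lemma ent_le_opn:
  assumes X: "finite X" and ij: "i \<in> X" "j \<in> X"
  shows "cmod (ent M i j) \<le> opn X M"
proof -
  define v where "v = (\<lambda>x. if x = j then 1 else (0::complex))"
  have "app X M v i = (\<Sum>l\<in>X. if l = j then ent M i l else 0)" unfolding app_def v_def by (intro sum.cong) auto
  then have "app X M v i = ent M i j" using ij X by simp
  then have "cmod (ent M i j) \<le> nrm X (app X M v)"
    unfolding nrm_def using member_le_L2_set[OF X ij(1), of "\<lambda>x. cmod (app X M v x)"] by simp
  also have "\<dots> \<le> opn X M * nrm X v" by (rule opn_bound[OF X])
  also have "nrm X v = 1"
  proof -
    have "(nrm X v)\<^sup>2 = (\<Sum>x\<in>X. if x = j then 1 else 0)" unfolding nrm_power2 v_def by (intro sum.cong) auto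
    then have "(nrm X v)\<^sup>2 = 1" using X ij by simp
    then show ?thesis using nrm_nonneg[of X v] by (simp add: power2_eq_1_iff)
  qed
  finally show ?thesis by simp
qed

lemma opn_star_mult_aux:
  assumes X: "finite X" shows "(nrm X (app X M v))\<^sup>2 \<le> opn X (star (mats X) M \<otimes>\<^bsub>mats X\<^esub> M) * (nrm X v)\<^sup>2"
proof -
  have "complex_of_real ((nrm X (app X M v))\<^sup>2) = ip X v (app X (star (mats X) M \<otimes>\<^bsub>mats X\<^esub> M) v)"
    unfolding ip_self[symmetric] app_ring by (rule app_adjoint)
  then have "(nrm X (app X M v))\<^sup>2 = cmod (ip X v (app X (star (mats X) M \<otimes>\<^bsub>mats X\<^esub> M) v))"
    by (metis norm_of_real abs_of_nonneg zero_le_power2)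
  also have "\<dots> \<le> nrm X v * nrm X (app X (star (mats X) M \<otimes>\<^bsub>mats X\<^esub> M) v)" by (rule ip_bound)
  also have "\<dots> \<le> nrm X v * (opn X (star (mats X) M \<otimes>\<^bsub>mats X\<^esub> M) * nrm X v)"
    using opn_bound[OF X] by (intro mult_left_mono) auto
  finally show ?thesis by (simp add: power2_eq_square mult.left_commute)
qed

lemma opn_mult: "finite X \<Longrightarrow> opn X (M \<otimes>\<^bsub>mats X\<^esub> N) \<le> opn X M * opn X N"
proof (rule opn_least)
  assume X: "finite X"
  then show "0 \<le> opn X M * opn X N" by (simp add: opn_nonneg)
  fix v
  have "nrm X (app X (M \<otimes>\<^bsub>mats X\<^esub> N) v) \<le> opn X M * nrm X (app X N v)" unfolding app_ring by (rule opn_bound[OF X])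
  also have "\<dots> \<le> opn X M * (opn X N * nrm X v)" using opn_bound[OF X] opn_nonneg[OF X] by (intro mult_left_mono) auto
  finally show "nrm X (app X (M \<otimes>\<^bsub>mats X\<^esub> N) v) \<le> opn X M * opn X N * nrm X v" by (simp add: mult.assoc)
qed

text \<open>The lower bound comes from \<open><M v, M v> = <v, M* M v>\<close> and Cauchy-Schwarz.
  The upper one is submultiplicativity, once \<open>M*\<close> is known to have no larger norm than
  \<open>M\<close>; that in turn follows from the lower bound.\<close>

lemma opn_cstar:
  assumes X: "finite X" shows "opn X (star (mats X) M \<otimes>\<^bsub>mats X\<^esub> M) = (opn X M)\<^sup>2"
proof -
  have le: "opn X K \<le> sqrt (opn X (star (mats X) K \<otimes>\<^bsub>mats X\<^esub> K))" for K
  proof (rule opn_least)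
    fix v
    show "nrm X (app X K v) \<le> sqrt (opn X (star (mats X) K \<otimes>\<^bsub>mats X\<^esub> K)) * nrm X v"
      using real_sqrt_le_mono[OF opn_star_mult_aux[OF X, of K v]] by (simp add: real_sqrt_mult)
  qed (simp add: opn_nonneg X)
  have sq: "(opn X K)\<^sup>2 \<le> opn X (star (mats X) K \<otimes>\<^bsub>mats X\<^esub> K)" for K
    using power_mono[OF le opn_nonneg[OF X], of K 2] opn_nonneg[OF X] by simp
  have st: "opn X K \<le> opn X (star (mats X) K)" for K
  proof (cases "opn X K = 0")
    case False
    have "opn X K * opn X K \<le> opn X (star (mats X) K) * opn X K"
      using sq[of K] opn_mult[OF X, of "star (mats X) K" K] by (simp add: power2_eq_square)
    then show ?thesis using False opn_nonneg[OF X, of K] by (simp add: mult_le_cancel_right)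
  qed (simp add: opn_nonneg X)
  have "star (mats X) (star (mats X) M) = M" by (rule ent_eqI) (simp add: mats_simps)
  then have "opn X (star (mats X) M) \<le> opn X M" using st[of "star (mats X) M"] by simp
  then have "opn X (star (mats X) M \<otimes>\<^bsub>mats X\<^esub> M) \<le> (opn X M)\<^sup>2"
    using opn_mult[OF X, of "star (mats X) M" M] mult_right_mono[of _ _ "opn X M"] opn_nonneg[OF X, of M] 
    by (smt (verit, best) power2_eq_square)
  then show ?thesis using sq[of M] by simp
qed

text \<open>Completeness holds because \<open>opn\<close> lies between the moduli of the single
  entries and the sum of them all: Cauchy sequences converge entrywise, and the entrywise limit is a
  limit in norm.\<close>

lemma unital_cstar_algebra_mats:
  assumes X: "finite X" shows "unital_cstar_algebra (mats X)"
proof -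
  have ag: "abelian_group (mats X)"
  proof (rule abelian_groupI)
    fix M assume "M \<in> carrier (mats X)"
    then show "\<exists>N\<in>carrier (mats X). N \<oplus>\<^bsub>mats X\<^esub> M = \<zero>\<^bsub>mats X\<^esub>"
      by (intro bexI[of _ "(-1) \<odot>\<^bsub>mats X\<^esub> M"]) (auto simp: mats_simps intro!: ent_eqI)
  qed (auto simp: mats_simps intro!: ent_eqI)
  interpret M: abelian_group "mats X" by fact
  have mod: "Module.module complex_ring (mats X)"
    by (rule moduleI[OF cring_complex_ring ag]) (auto simp: mats_simps algebra_simps intro!: ent_eqI)
  have inv: "ent (\<ominus>\<^bsub>mats X\<^esub> M) i j = - ent M i j" if "M \<in> carrier (mats X)" for M i j
  proof -
    have "\<ominus>\<^bsub>mats X\<^esub> M = (-1) \<odot>\<^bsub>mats X\<^esub> M"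
      by (rule M.minus_equality) (use that in \<open>auto simp: mats_simps intro!: ent_eqI\<close>)
    then show ?thesis by (simp add: mats_simps)
  qed
  have minus: "ent (M \<ominus>\<^bsub>mats X\<^esub> N) i j = ent M i j - ent N i j" if "N \<in> carrier (mats X)" for M N i j
    using inv[OF that] by (simp add: a_minus_def mats_simps)
  have zero: "opn X M = 0 \<longleftrightarrow> M = \<zero>\<^bsub>mats X\<^esub>" if M: "M \<in> carrier (mats X)" for M
  proof
    assume "opn X M = 0"
    then have "ent M i j = 0" if "i \<in> X" "j \<in> X" for i j using ent_le_opn[OF X that, of M] by simp
    then have "ent M i j = 0" for i j using M unfolding mats_simps by blast
    then show "M = \<zero>\<^bsub>mats X\<^esub>" by (intro ent_eqI) (simp add: mats_simps)
  next
    assume "M = \<zero>\<^bsub>mats X\<^esub>"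
    then show "opn X M = 0" using opn_le_sum[OF X, of M] opn_nonneg[OF X, of M] by (simp add: mats_simps)
  qed
  have tri: "opn X (M \<oplus>\<^bsub>mats X\<^esub> N) \<le> opn X M + opn X N" for M N
  proof (rule opn_least)
    fix v
    show "nrm X (app X (M \<oplus>\<^bsub>mats X\<^esub> N) v) \<le> (opn X M + opn X N) * nrm X v"
      unfolding app_ring using nrm_add[of X "app X M v" "app X N v"] opn_bound[OF X, of M v] opn_bound[OF X, of N v]
      by (simp add: distrib_right)
  qed (simp add: opn_nonneg X)
  have scale_le: "opn X (c \<odot>\<^bsub>mats X\<^esub> M) \<le> cmod c * opn X M" for c M
  proof (rule opn_least)
    fix v
    show "nrm X (app X (c \<odot>\<^bsub>mats X\<^esub> M) v) \<le> cmod c * opn X M * nrm X v"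
      unfolding app_ring nrm_scale using opn_bound[OF X, of M v] by (simp add: mult_left_mono mult.assoc)
  qed (simp add: opn_nonneg X)
  have scale: "opn X (c \<odot>\<^bsub>mats X\<^esub> M) = cmod c * opn X M" for c M
  proof (cases "c = 0")
    case True
    then show ?thesis using scale_le[of c M] opn_nonneg[OF X, of "c \<odot>\<^bsub>mats X\<^esub> M"] by simp
  next
    case False
    have "(1/c) \<odot>\<^bsub>mats X\<^esub> (c \<odot>\<^bsub>mats X\<^esub> M) = M" using False by (intro ent_eqI) (simp add: mats_simps)
    then have "opn X M \<le> cmod (1/c) * opn X (c \<odot>\<^bsub>mats X\<^esub> M)" using scale_le[of "1/c" "c \<odot>\<^bsub>mats X\<^esub> M"] by simp
    then have "cmod c * opn X M \<le> opn X (c \<odot>\<^bsub>mats X\<^esub> M)" using False by (simp add: norm_divide field_simps)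
    then show ?thesis using scale_le[of c M] by simp
  qed
  have minus_eq: "M \<ominus>\<^bsub>mats X\<^esub> N = M \<oplus>\<^bsub>mats X\<^esub> (-1) \<odot>\<^bsub>mats X\<^esub> N" if "N \<in> carrier (mats X)" for M N
    by (rule ent_eqI) (simp add: minus[OF that] mats_simps)
  have mc: "M \<ominus>\<^bsub>mats X\<^esub> N \<in> carrier (mats X)" if "M \<in> carrier (mats X)" "N \<in> carrier (mats X)" for M N
    using that by (simp add: minus_eq mats_simps)
  have met: "Metric_space (carrier (mats X)) (cdist (mats X))"
  proof
    show "0 \<le> cdist (mats X) M N" for M N by (simp add: cdist_def mats_simps(8) opn_nonneg X)
    show "cdist (mats X) M N = cdist (mats X) N M" for M N
    proof (cases "M \<in> carrier (mats X) \<and> N \<in> carrier (mats X)")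
      case True
      then have "N \<ominus>\<^bsub>mats X\<^esub> M = (-1) \<odot>\<^bsub>mats X\<^esub> (M \<ominus>\<^bsub>mats X\<^esub> N)"
        by (intro ent_eqI) (simp add: minus mats_simps)
      then show ?thesis using scale[of "-1" "M \<ominus>\<^bsub>mats X\<^esub> N"] by (simp add: cdist_def mats_simps(8))
    qed (auto simp: cdist_def)
    show "cdist (mats X) M N = 0 \<longleftrightarrow> M = N" if MN: "M \<in> carrier (mats X)" "N \<in> carrier (mats X)" for M N
    proof -
      have "M \<ominus>\<^bsub>mats X\<^esub> N = \<zero>\<^bsub>mats X\<^esub> \<longleftrightarrow> M = N"
        using minus[OF MN(2), of M] by (metis ent_eqI eq_iff_diff_eq_0 mats_simps(4))
      then show ?thesis using zero[OF mc[OF MN]] MN by (simp add: cdist_def mats_simps(8))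
    qed
    show "cdist (mats X) M K \<le> cdist (mats X) M N + cdist (mats X) N K"
      if "M \<in> carrier (mats X)" "N \<in> carrier (mats X)" "K \<in> carrier (mats X)" for M N K
    proof -
      have "M \<ominus>\<^bsub>mats X\<^esub> K = (M \<ominus>\<^bsub>mats X\<^esub> N) \<oplus>\<^bsub>mats X\<^esub> (N \<ominus>\<^bsub>mats X\<^esub> K)"
        using that by (intro ent_eqI) (simp add: minus mats_simps)
      then show ?thesis using that tri[of "M \<ominus>\<^bsub>mats X\<^esub> N" "N \<ominus>\<^bsub>mats X\<^esub> K"] by (simp add: cdist_def mats_simps(8))
    qed
  qed
  have comp: "Metric_space.mcomplete (carrier (mats X)) (cdist (mats X))"
  proof (rule mcompleteI[OF met])
    fix x :: "nat \<Rightarrow> seq" assume x: "\<And>n. x n \<in> carrier (mats X)"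
      and C: "\<And>e. e > 0 \<Longrightarrow> \<exists>N. \<forall>m\<ge>N. \<forall>n\<ge>N. cnorm (mats X) (x m \<ominus>\<^bsub>mats X\<^esub> x n) < e"
    have "\<exists>l. (\<lambda>n. ent (x n) i j) \<longlonglongrightarrow> l" if ij: "i \<in> X" "j \<in> X" for i j
    proof -
      have "Cauchy (\<lambda>n. ent (x n) i j)"
      proof (rule CauchyI)
        fix e :: real assume "e > 0"
        then obtain N where N: "\<And>m n. m \<ge> N \<Longrightarrow> n \<ge> N \<Longrightarrow> opn X (x m \<ominus>\<^bsub>mats X\<^esub> x n) < e" using C[of e] by (auto simp: mats_simps(8))
        have "cmod (ent (x m) i j - ent (x n) i j) < e" if "m \<ge> N" "n \<ge> N" for m n
          using ent_le_opn[OF X ij, of "x m \<ominus>\<^bsub>mats X\<^esub> x n"] N[OF that] minus[OF x, of "x m" n] by simp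
        then show "\<exists>M. \<forall>m\<ge>M. \<forall>n\<ge>M. cmod (ent (x m) i j - ent (x n) i j) < e" by blast
      qed
      then show ?thesis using Cauchy_convergent convergent_def by blast
    qed
    then obtain L where L: "\<And>i j. i \<in> X \<Longrightarrow> j \<in> X \<Longrightarrow> (\<lambda>n. ent (x n) i j) \<longlonglongrightarrow> L i j" by metis
    define l where "l = mk (\<lambda>i j. if i \<in> X \<and> j \<in> X then L i j else 0)"
    have l: "l \<in> carrier (mats X)" by (simp add: l_def mats_simps)
    have "(\<lambda>n. \<Sum>i\<in>X. \<Sum>j\<in>X. cmod (ent (x n) i j - L i j)) \<longlonglongrightarrow> (\<Sum>i\<in>X. \<Sum>j\<in>X. 0)"
      using L by (intro tendsto_sum tendsto_norm_zero LIM_zero) auto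
    then have lim: "(\<lambda>n. \<Sum>i\<in>X. \<Sum>j\<in>X. cmod (ent (x n) i j - L i j)) \<longlonglongrightarrow> 0" by simp
    have "opn X (x n \<ominus>\<^bsub>mats X\<^esub> l) \<le> (\<Sum>i\<in>X. \<Sum>j\<in>X. cmod (ent (x n) i j - L i j))" for n
    proof -
      have "ent (x n \<ominus>\<^bsub>mats X\<^esub> l) i j = ent (x n) i j - L i j" if "i \<in> X" "j \<in> X" for i j
        using minus[OF l, of "x n" i j] that by (simp add: l_def)
      then have "(\<Sum>i\<in>X. \<Sum>j\<in>X. cmod (ent (x n \<ominus>\<^bsub>mats X\<^esub> l) i j)) = (\<Sum>i\<in>X. \<Sum>j\<in>X. cmod (ent (x n) i j - L i j))"
        by (intro sum.cong refl) simp
      then show ?thesis using opn_le_sum[OF X, of "x n \<ominus>\<^bsub>mats X\<^esub> l"] by simp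
    qed
    then have "(\<lambda>n. opn X (x n \<ominus>\<^bsub>mats X\<^esub> l)) \<longlonglongrightarrow> 0"
      by (intro tendsto_sandwich[OF _ _ tendsto_const lim]) (auto simp: opn_nonneg X)
    then show "\<exists>l\<in>carrier (mats X). (\<lambda>n. cnorm (mats X) (x n \<ominus>\<^bsub>mats X\<^esub> l)) \<longlonglongrightarrow> 0" using l by (auto simp: mats_simps(8))
  qed
  have mult_c: "M \<otimes>\<^bsub>mats X\<^esub> N \<in> carrier (mats X)" if "M \<in> carrier (mats X)" "N \<in> carrier (mats X)" for M N
    using that by (auto simp: mats_simps)
  have one_c: "\<one>\<^bsub>mats X\<^esub> \<in> carrier (mats X)" by (auto simp: mats_simps)
  have star_c: "star (mats X) M \<in> carrier (mats X)" if "M \<in> carrier (mats X)" for M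
    using that by (auto simp: mats_simps)
  have assoc: "M \<otimes>\<^bsub>mats X\<^esub> N \<otimes>\<^bsub>mats X\<^esub> K = M \<otimes>\<^bsub>mats X\<^esub> (N \<otimes>\<^bsub>mats X\<^esub> K)" 
    if "M \<in> carrier (mats X)" "N \<in> carrier (mats X)" "K \<in> carrier (mats X)" for M N K
    using that by - (rule mats_eqI[OF X], simp_all add: app_ring mult_c)
  have cs: "cstar_algebra (mats X)"
  proof (intro cstar_algebra.intro mod cstar_algebra_axioms.intro)
    show "cnorm (mats X) (M \<otimes>\<^bsub>mats X\<^esub> N) \<le> cnorm (mats X) M * cnorm (mats X) N" for M N
      by (simp add: mats_simps(8) opn_mult X)
    show "cnorm (mats X) (star (mats X) M \<otimes>\<^bsub>mats X\<^esub> M) = (cnorm (mats X) M)\<^sup>2" for M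
      by (simp add: mats_simps(8) opn_cstar X)
    show "cnorm (mats X) M = 0 \<longleftrightarrow> M = \<zero>\<^bsub>mats X\<^esub>" if "M \<in> carrier (mats X)" for M
      using zero[OF that] by (simp add: mats_simps(8))
  qed (auto simp: mult_c assoc star_c comp tri scale opn_nonneg[OF X] mats_simps(2-8) sum.distrib sum_distrib_left algebra_simps
      intro!: ent_eqI)
  show ?thesis
  proof (intro unital_cstar_algebra.intro cs unital_cstar_algebra_axioms.intro one_c)
    fix M assume M: "M \<in> carrier (mats X)"
    show "\<one>\<^bsub>mats X\<^esub> \<otimes>\<^bsub>mats X\<^esub> M = M" 
      using M by - (rule mats_eqI[OF X], simp_all add: mult_c one_c app_ring app_one[OF X app_vec])
    show "M \<otimes>\<^bsub>mats X\<^esub> \<one>\<^bsub>mats X\<^esub> = M"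
      using M by - (rule mats_eqI[OF X], simp_all add: mult_c one_c app_ring app_one[OF X])
  qed
qed

lemma finite_dimensional_mats:
  assumes X: "finite X" shows "finite_dimensional (mats X)"
proof -
  interpret M: unital_cstar_algebra "mats X" by (rule unital_cstar_algebra_mats[OF X])
  define u where "u i j = mk (\<lambda>a b. if a = i \<and> b = j then 1 else 0)" for i j
  define B where "B = (\<lambda>(i, j). u i j) ` (X \<times> X)"
  have inj: "inj_on (\<lambda>(i, j). u i j) (X \<times> X)"
  proof (rule inj_onI, clarify)
    fix i j i' j' assume "u i j = u i' j'"
    then have "ent (u i j) i j = ent (u i' j') i j" by simp
    then show "i = i' \<and> j = j'" by (simp add: u_def split: if_splits)
  qed
  have Bc: "B \<subseteq> carrier (mats X)" by (auto simp: B_def u_def mats_simps)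
  have fs: "finite I \<Longrightarrow> f \<in> I \<rightarrow> carrier (mats X) \<Longrightarrow> ent (finsum (mats X) f I) a b = (\<Sum>i\<in>I. ent (f i) a b)" for I f a b
    by (rule M.lin_finsum[of "\<lambda>M. ent M a b"]) (auto simp: lin_def mats_simps)
  have "\<exists>c. M = (\<Oplus>\<^bsub>mats X\<^esub>b\<in>B. c b \<odot>\<^bsub>mats X\<^esub> b)" if M: "M \<in> carrier (mats X)" for M
  proof -
    define c where "c b = (case the_inv_into (X \<times> X) (\<lambda>(i, j). u i j) b of (i, j) \<Rightarrow> ent M i j)" for b
    have cu: "c (u i j) = ent M i j" if "i \<in> X" "j \<in> X" for i j
      using the_inv_into_f_f[OF inj, of "(i, j)"] that by (simp add: c_def)
    have cB: "(\<lambda>b. c b \<odot>\<^bsub>mats X\<^esub> b) \<in> B \<rightarrow> carrier (mats X)" using Bc by auto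
    have "ent (\<Oplus>\<^bsub>mats X\<^esub>b\<in>B. c b \<odot>\<^bsub>mats X\<^esub> b) a b = ent M a b" for a b
    proof -
      have "ent (\<Oplus>\<^bsub>mats X\<^esub>b\<in>B. c b \<odot>\<^bsub>mats X\<^esub> b) a b = (\<Sum>x\<in>B. c x * ent x a b)"
        using fs[OF _ cB] X by (simp add: B_def mats_simps)
      also have "\<dots> = (\<Sum>p\<in>X \<times> X. case p of (i, j) \<Rightarrow> ent M i j * ent (u i j) a b)"
        unfolding B_def by (subst sum.reindex[OF inj]) (auto intro!: sum.cong simp: cu)
      also have "\<dots> = (\<Sum>p\<in>X \<times> X. if p = (a, b) then ent M a b else 0)"
        by (intro sum.cong refl) (auto simp: u_def split: if_splits)
      also have "\<dots> = ent M a b" using X M by (simp add: mats_simps)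
      finally show ?thesis .
    qed
    then show ?thesis by (intro exI[of _ c] ent_eqI) simp
  qed
  then show ?thesis unfolding finite_dimensional_def using Bc X by (intro exI[of _ B]) (auto simp: B_def)
qed

section \<open>Approximating representations\<close>

lemma fin_rank_orthonormal_basis:
  assumes A: "unital_cstar_algebra A" and \<psi>: "fin_rank A \<psi>"
  shows "\<exists>r e. (\<forall>i<r. e i \<in> carrier A) \<and> orthonormal A \<psi> r e \<and>
     (\<forall>a\<in>carrier A. \<forall>b\<in>carrier A. \<psi> (star A b \<otimes>\<^bsub>A\<^esub> a) = (\<Sum>i<r. \<psi> (star A (e i) \<otimes>\<^bsub>A\<^esub> a) * \<psi> (star A b \<otimes>\<^bsub>A\<^esub> e i)))"
proof -
  interpret unital_cstar_algebra A by fact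
  obtain N where N: "\<And>r e. (\<forall>i<r. e i \<in> carrier A) \<Longrightarrow> orthonormal A \<psi> r e \<Longrightarrow> r \<le> N" using \<psi> unfolding fin_rank_def by blast
  show ?thesis
    by (rule exists_complete_orthonormal[OF fin_rank_posf[OF \<psi>] order_refl M.zero_closed M.add.m_closed smult_closed' N])
qed

text \<open>The direct sum of the GNS representations of the \<open>\<psi> k\<close>, written in
  orthonormal bases. \<open>\<gamma> k a\<close> is the class of \<open>a\<close> in the
  \<open>k\<close>-th summand, and \<open>P\<close> acts on that summand as the scalar
  \<open>s k\<close>, so it lies in the commutant; signs \<open>s k\<close> make it a
  symmetry.\<close>

lemma fin_rank_representation:
  fixes \<psi> :: "nat \<Rightarrow> 'a \<Rightarrow> complex"
  assumes A: "unital_cstar_algebra A" and "\<forall>k<K. fin_rank A (\<psi> k)"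
  shows "\<exists>X \<rho> \<gamma> P. finite X \<and> \<rho> \<in> star_hom A (mats X) \<and> \<rho> \<one>\<^bsub>A\<^esub> = \<one>\<^bsub>mats X\<^esub> \<and>
     (\<forall>k<K. \<forall>a\<in>carrier A. \<gamma> k a \<in> vecs X \<and> app X P (\<gamma> k a) = (\<lambda>x. s k * \<gamma> k a x)) \<and>
     (\<forall>k<K. \<forall>l<K. \<forall>a\<in>carrier A. \<forall>b\<in>carrier A. ip X (\<gamma> k a) (\<gamma> l b) = (if k = l then \<psi> k (star A b \<otimes>\<^bsub>A\<^esub> a) else 0)) \<and>
     (\<forall>k<K. \<forall>a\<in>carrier A. \<forall>b\<in>carrier A. app X (\<rho> a) (\<gamma> k b) = \<gamma> k (a \<otimes>\<^bsub>A\<^esub> b)) \<and>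
     P \<in> carrier (mats X) \<and> (\<forall>a\<in>carrier A. P \<otimes>\<^bsub>mats X\<^esub> \<rho> a = \<rho> a \<otimes>\<^bsub>mats X\<^esub> P) \<and>
     ((\<forall>k. s k = 1 \<or> s k = -1) \<longrightarrow> star (mats X) P = P \<and> P \<otimes>\<^bsub>mats X\<^esub> P = \<one>\<^bsub>mats X\<^esub>)"
proof -
  interpret unital_cstar_algebra A by fact
  have \<psi>: "\<And>k. k < K \<Longrightarrow> fin_rank A (\<psi> k)" using assms(2) by blast
  have "\<forall>k. \<exists>r e. k < K \<longrightarrow> (\<forall>i<r. e i \<in> carrier A) \<and> orthonormal A (\<psi> k) r e \<and>
     (\<forall>a\<in>carrier A. \<forall>b\<in>carrier A. \<psi> k (star A b \<otimes>\<^bsub>A\<^esub> a) = (\<Sum>i<r. \<psi> k (star A (e i) \<otimes>\<^bsub>A\<^esub> a) * \<psi> k (star A b \<otimes>\<^bsub>A\<^esub> e i)))"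
    using fin_rank_orthonormal_basis[OF A \<psi>] by blast
  from choice[OF this] obtain r where "\<forall>k. \<exists>e. k < K \<longrightarrow> (\<forall>i<r k. e i \<in> carrier A) \<and> orthonormal A (\<psi> k) (r k) e \<and>
     (\<forall>a\<in>carrier A. \<forall>b\<in>carrier A. \<psi> k (star A b \<otimes>\<^bsub>A\<^esub> a) = (\<Sum>i<r k. \<psi> k (star A (e i) \<otimes>\<^bsub>A\<^esub> a) * \<psi> k (star A b \<otimes>\<^bsub>A\<^esub> e i)))" ..
  from choice[OF this] obtain e where re: "\<forall>k. k < K \<longrightarrow> (\<forall>i<r k. e k i \<in> carrier A) \<and> orthonormal A (\<psi> k) (r k) (e k) \<and>
     (\<forall>a\<in>carrier A. \<forall>b\<in>carrier A. \<psi> k (star A b \<otimes>\<^bsub>A\<^esub> a) = (\<Sum>i<r k. \<psi> k (star A (e k i) \<otimes>\<^bsub>A\<^esub> a) * \<psi> k (star A b \<otimes>\<^bsub>A\<^esub> e k i)))" ..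
  have ec: "e k i \<in> carrier A" if "k < K" "i < r k" for k i using re that by blast
  have on: "\<psi> k (star A (e k j) \<otimes>\<^bsub>A\<^esub> e k i) = (if i = j then 1 else 0)" if "k < K" "i < r k" "j < r k" for k i j
    using re that unfolding orthonormal_def by blast
  have complete: "\<psi> k (star A b \<otimes>\<^bsub>A\<^esub> a) = (\<Sum>i<r k. \<psi> k (star A (e k i) \<otimes>\<^bsub>A\<^esub> a) * \<psi> k (star A b \<otimes>\<^bsub>A\<^esub> e k i))"
    if "k < K" "a \<in> carrier A" "b \<in> carrier A" for k a b using re that by blast
  have f: "posf A (\<psi> k)" and lf: "lin A (\<psi> k)" if "k < K" for k using \<psi>[OF that] by (auto intro: fin_rank_posf posf_lin)
  \<comment> \<open>A basis vector is coded as the pair of its summand and its position there,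
    recovered by \<open>kk\<close> and \<open>ll\<close>.\<close>
  define X where "X = prod_encode ` (SIGMA k:{..<K}. {..<r k})"
  have X: "finite X" by (simp add: X_def)
  define kk where "kk x = fst (prod_decode x)" for x
  define ll where "ll x = snd (prod_decode x)" for x
  have XI: "kk x < K" "ll x < r (kk x)" if "x \<in> X" for x using that by (auto simp: X_def kk_def ll_def)
  have sumX: "(\<Sum>x\<in>X. if kk x = k then F (ll x) else 0) = (\<Sum>l<r k. F l)" if k: "k < K" for k and F :: "nat \<Rightarrow> complex"
  proof -
    have "(\<Sum>x\<in>X. if kk x = k then F (ll x) else 0) = (\<Sum>p\<in>(SIGMA k:{..<K}. {..<r k}). case p of (i, l) \<Rightarrow> if i = k then F l else 0)"
      unfolding X_def by (subst sum.reindex) (auto simp: inj_on_def kk_def ll_def intro!: sum.cong)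
    also have "\<dots> = (\<Sum>i<K. \<Sum>l<r i. if i = k then F l else 0)"
      by (subst sum.Sigma) auto
    also have "\<dots> = (\<Sum>i<K. if i = k then (\<Sum>l<r k. F l) else 0)" by (intro sum.cong) auto
    also have "\<dots> = (\<Sum>l<r k. F l)" using k by simp
    finally show ?thesis .
  qed
  define b where "b x = e (kk x) (ll x)" for x
  have bc: "b x \<in> carrier A" if "x \<in> X" for x using XI[OF that] ec by (simp add: b_def)
  define \<gamma> where "\<gamma> k a = (\<lambda>x. if x \<in> X \<and> kk x = k then \<psi> k (star A (b x) \<otimes>\<^bsub>A\<^esub> a) else 0)" for k a
  define \<rho> where "\<rho> a = mk (\<lambda>x y. if x \<in> X \<and> y \<in> X \<and> kk x = kk y then \<psi> (kk x) (star A (b x) \<otimes>\<^bsub>A\<^esub> (a \<otimes>\<^bsub>A\<^esub> b y)) else 0)" for a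
  define P where "P = mk (\<lambda>x y. if x = y \<and> x \<in> X then s (kk x) else 0)"
  have ent\<rho>: "ent (\<rho> a) x y = (if x \<in> X \<and> y \<in> X \<and> kk x = kk y then \<psi> (kk x) (star A (b x) \<otimes>\<^bsub>A\<^esub> (a \<otimes>\<^bsub>A\<^esub> b y)) else 0)" for a x y
    by (simp add: \<rho>_def)
  \<comment> \<open>Parseval in the summand \<open>k\<close>. It yields the multiplicativity of
    \<open>\<rho>\<close>, the inner products of the \<open>\<gamma> k a\<close> and the action of
    \<open>\<rho>\<close> on them.\<close>
  have expand: "(\<Sum>y\<in>X. if kk y = k then \<psi> k (u \<otimes>\<^bsub>A\<^esub> b y) * \<psi> k (star A (b y) \<otimes>\<^bsub>A\<^esub> a) else 0) = \<psi> k (u \<otimes>\<^bsub>A\<^esub> a)"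
    if k: "k < K" and a: "a \<in> carrier A" and u: "u \<in> carrier A" for k a u
  proof -
    have "(\<Sum>y\<in>X. if kk y = k then \<psi> k (u \<otimes>\<^bsub>A\<^esub> b y) * \<psi> k (star A (b y) \<otimes>\<^bsub>A\<^esub> a) else 0) =
        (\<Sum>y\<in>X. if kk y = k then \<psi> k (u \<otimes>\<^bsub>A\<^esub> e k (ll y)) * \<psi> k (star A (e k (ll y)) \<otimes>\<^bsub>A\<^esub> a) else 0)"
      by (intro sum.cong refl) (auto simp: b_def)
    also have "\<dots> = (\<Sum>l<r k. \<psi> k (u \<otimes>\<^bsub>A\<^esub> e k l) * \<psi> k (star A (e k l) \<otimes>\<^bsub>A\<^esub> a))" by (rule sumX[OF k])
    also have "\<dots> = \<psi> k (u \<otimes>\<^bsub>A\<^esub> a)" using complete[OF k a, of "star A u"] u by (simp add: star_star mult.commute)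
    finally show ?thesis .
  qed
  have \<rho>c: "\<rho> a \<in> carrier (mats X)" for a by (auto simp: mats_simps ent\<rho>)
  have Pc: "P \<in> carrier (mats X)" by (auto simp: mats_simps P_def)
  have \<rho>: "\<rho> \<in> star_hom A (mats X)" unfolding star_hom_def
  proof (intro CollectI conjI ballI allI funcsetI \<rho>c)
    fix a d assume ad: "a \<in> carrier A" "d \<in> carrier A"
    show "\<rho> (a \<oplus>\<^bsub>A\<^esub> d) = \<rho> a \<oplus>\<^bsub>mats X\<^esub> \<rho> d"
      using ad bc lf[OF XI(1)] by (intro ent_eqI) (simp add: mats_simps ent\<rho> distrib lin_simps)
    show "\<rho> (a \<otimes>\<^bsub>A\<^esub> d) = \<rho> a \<otimes>\<^bsub>mats X\<^esub> \<rho> d"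
    proof (rule ent_eqI)
      fix x y
      show "ent (\<rho> (a \<otimes>\<^bsub>A\<^esub> d)) x y = ent (\<rho> a \<otimes>\<^bsub>mats X\<^esub> \<rho> d) x y"
      proof (cases "x \<in> X \<and> y \<in> X \<and> kk x = kk y")
        case True
        then have xy: "x \<in> X" "y \<in> X" "kk y = kk x" by auto
        have "ent (\<rho> a \<otimes>\<^bsub>mats X\<^esub> \<rho> d) x y = (\<Sum>z\<in>X. if kk z = kk x then \<psi> (kk x) ((star A (b x) \<otimes>\<^bsub>A\<^esub> a) \<otimes>\<^bsub>A\<^esub> b z) * \<psi> (kk x) (star A (b z) \<otimes>\<^bsub>A\<^esub> (d \<otimes>\<^bsub>A\<^esub> b y)) else 0)"
          unfolding mats_simps ent\<rho> using xy ad bc by (intro sum.cong refl) (auto simp: mult_assoc)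
        also have "\<dots> = \<psi> (kk x) ((star A (b x) \<otimes>\<^bsub>A\<^esub> a) \<otimes>\<^bsub>A\<^esub> (d \<otimes>\<^bsub>A\<^esub> b y))"
          using xy ad bc XI by (intro expand) auto
        finally show ?thesis using xy ad bc by (simp add: ent\<rho> mult_assoc)
      next
        case False
        then have "ent (\<rho> a \<otimes>\<^bsub>mats X\<^esub> \<rho> d) x y = 0" unfolding mats_simps ent\<rho> by (intro sum.neutral) auto
        then show ?thesis using False by (auto simp: ent\<rho>)
      qed
    qed
  next
    fix c a assume a: "a \<in> carrier A"
    show "\<rho> (c \<odot>\<^bsub>A\<^esub> a) = c \<odot>\<^bsub>mats X\<^esub> \<rho> a"
      using a bc lf[OF XI(1)] by (intro ent_eqI) (simp add: mats_simps ent\<rho> distrib lin_simps)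
  next
    fix a assume a: "a \<in> carrier A"
    show "\<rho> (star A a) = star (mats X) (\<rho> a)"
    proof (rule ent_eqI)
      fix x y
      show "ent (\<rho> (star A a)) x y = ent (star (mats X) (\<rho> a)) x y"
        using posf_star[OF f[OF XI(1)], of y "star A (b y) \<otimes>\<^bsub>A\<^esub> (a \<otimes>\<^bsub>A\<^esub> b x)"] a bc
        by (auto simp: mats_simps ent\<rho> star_simps mult_assoc)
    qed
  qed
  have one: "\<rho> \<one>\<^bsub>A\<^esub> = \<one>\<^bsub>mats X\<^esub>"
  proof (rule ent_eqI)
    fix x y
    show "ent (\<rho> \<one>\<^bsub>A\<^esub>) x y = ent \<one>\<^bsub>mats X\<^esub> x y"
    proof (cases "x \<in> X \<and> y \<in> X \<and> kk x = kk y")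
      case True
      have "x = y \<longleftrightarrow> ll y = ll x" using True unfolding kk_def ll_def by (metis prod_decode_inverse prod.collapse)
      then show ?thesis using True on[OF XI(1), of x "ll y" "ll x"] XI(2)[of x] XI(2)[of y] bc[of y] by (auto simp: ent\<rho> mats_simps b_def)
    next
      case False
      then show ?thesis unfolding ent\<rho> mats_simps by auto
    qed
  qed
  have \<gamma>v: "\<gamma> k a \<in> vecs X" for k a by (auto simp: \<gamma>_def vecs_def)
  have Papp: "app X P v = (\<lambda>x. if x \<in> X then s (kk x) * v x else 0)" for v
  proof
    fix x
    have "app X P v x = (\<Sum>j\<in>X. if j = x then (if x \<in> X then s (kk x) * v x else 0) else 0)"
      unfolding app_def P_def by (intro sum.cong refl) auto
    then show "app X P v x = (if x \<in> X then s (kk x) * v x else 0)" using X by simp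
  qed
  have P\<gamma>: "app X P (\<gamma> k a) = (\<lambda>x. s k * \<gamma> k a x)" for k a by (auto simp: Papp \<gamma>_def)
  have ip\<gamma>: "ip X (\<gamma> k a) (\<gamma> l d) = (if k = l then \<psi> k (star A d \<otimes>\<^bsub>A\<^esub> a) else 0)"
    if kl: "k < K" "l < K" "a \<in> carrier A" "d \<in> carrier A" for k l a d
  proof (cases "k = l")
    case True
    have "ip X (\<gamma> k a) (\<gamma> l d) = (\<Sum>x\<in>X. if kk x = k then \<psi> k (star A d \<otimes>\<^bsub>A\<^esub> b x) * \<psi> k (star A (b x) \<otimes>\<^bsub>A\<^esub> a) else 0)"
      unfolding ip_def \<gamma>_def using True posf_swap[OF f[OF kl(2)] kl(4) bc] by (intro sum.cong refl) (auto simp: mult.commute)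
    also have "\<dots> = \<psi> k (star A d \<otimes>\<^bsub>A\<^esub> a)" using kl by (intro expand) auto
    finally show ?thesis using True by simp
  next
    case False
    have "ip X (\<gamma> k a) (\<gamma> l d) = 0" unfolding ip_def \<gamma>_def using False by (intro sum.neutral) auto
    then show ?thesis using False by simp
  qed
  have \<rho>\<gamma>: "app X (\<rho> a) (\<gamma> k d) = \<gamma> k (a \<otimes>\<^bsub>A\<^esub> d)" if k: "k < K" "a \<in> carrier A" "d \<in> carrier A" for k a d
  proof
    fix x
    show "app X (\<rho> a) (\<gamma> k d) x = \<gamma> k (a \<otimes>\<^bsub>A\<^esub> d) x"
    proof (cases "x \<in> X \<and> kk x = k")
      case True
      have "app X (\<rho> a) (\<gamma> k d) x = (\<Sum>y\<in>X. if kk y = k then \<psi> k ((star A (b x) \<otimes>\<^bsub>A\<^esub> a) \<otimes>\<^bsub>A\<^esub> b y) * \<psi> k (star A (b y) \<otimes>\<^bsub>A\<^esub> d) else 0)"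
        unfolding app_def ent\<rho> \<gamma>_def using True bc k by (intro sum.cong refl) (auto simp: mult_assoc)
      also have "\<dots> = \<psi> k ((star A (b x) \<otimes>\<^bsub>A\<^esub> a) \<otimes>\<^bsub>A\<^esub> d)" using True bc k by (intro expand) auto
      finally show ?thesis using True bc k by (auto simp: \<gamma>_def mult_assoc)
    next
      case False
      have "app X (\<rho> a) (\<gamma> k d) x = 0" unfolding app_def ent\<rho> \<gamma>_def using False by (intro sum.neutral) auto
      then show ?thesis using False by (auto simp: \<gamma>_def)
    qed
  qed
  interpret MX: unital_cstar_algebra "mats X" by (rule unital_cstar_algebra_mats[OF X])
  have comm: "P \<otimes>\<^bsub>mats X\<^esub> \<rho> a = \<rho> a \<otimes>\<^bsub>mats X\<^esub> P" for a
  proof (rule mats_eqI[OF X])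
    fix v
    have "app X P (app X (\<rho> a) v) x = app X (\<rho> a) (app X P v) x" for x
    proof -
      have "app X (\<rho> a) (app X P v) x = (\<Sum>y\<in>X. (if x \<in> X then s (kk x) else 0) * (ent (\<rho> a) x y * v y))"
        unfolding app_def[of X "\<rho> a"] Papp by (intro sum.cong refl) (auto simp: ent\<rho>)
      then show ?thesis unfolding Papp by (simp add: app_def sum_distrib_left)
    qed
    then show "app X (P \<otimes>\<^bsub>mats X\<^esub> \<rho> a) v = app X (\<rho> a \<otimes>\<^bsub>mats X\<^esub> P) v" by (auto simp: app_ring)
  qed (use Pc \<rho>c in auto)
  have sP: "star (mats X) P = P \<and> P \<otimes>\<^bsub>mats X\<^esub> P = \<one>\<^bsub>mats X\<^esub>" if s: "\<forall>k. s k = 1 \<or> s k = -1"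
  proof
    have s2: "cnj (s k) = s k" "s k * s k = 1" for k using s[rule_format, of k] by auto
    show "star (mats X) P = P" by (rule ent_eqI) (auto simp: mats_simps P_def s2)
    show "P \<otimes>\<^bsub>mats X\<^esub> P = \<one>\<^bsub>mats X\<^esub>"
    proof (rule mats_eqI[OF X])
      fix v assume v: "v \<in> vecs X"
      have "app X P (app X P v) = v"
        unfolding Papp using v s2(2) by (auto simp: vecs_def mult.assoc[symmetric])
      then show "app X (P \<otimes>\<^bsub>mats X\<^esub> P) v = app X \<one>\<^bsub>mats X\<^esub> v" using v by (simp add: app_ring app_one[OF X])
    qed (use Pc in auto)
  qed
  show ?thesis
    by (rule exI[of _ X], rule exI[of _ \<rho>], rule exI[of _ \<gamma>], rule exI[of _ P], intro conjI allI impI ballI)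
      (simp_all add: X \<rho> one \<gamma>v P\<gamma> ip\<gamma> \<rho>\<gamma> Pc comm sP)
qed

text \<open>The entries of the Gram matrix differ from those of the identity by at most
  \<open>e\<close>, so its norm is at most \<open>1 + card J * e\<close>; that is the first
  estimate. The second, a Bessel inequality, is the adjoint statement: pair \<open>v\<close> with
  the combination whose coefficients are the inner products themselves.\<close>

lemma almost_orthonormal_bounds:
  assumes J: "finite J" and e: "0 \<le> e"
    and k: "\<And>x y. x \<in> J \<Longrightarrow> y \<in> J \<Longrightarrow> cmod (ip X (k x) (k y) - (if x = y then 1 else 0)) \<le> e"
  shows "(nrm X (\<lambda>z. \<Sum>x\<in>J. a x * k x z))\<^sup>2 \<le> (1 + real (card J) * e) * (\<Sum>x\<in>J. (cmod (a x))\<^sup>2)" (is ?A)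
    and "(\<Sum>x\<in>J. (cmod (ip X v (k x)))\<^sup>2) \<le> (1 + real (card J) * e) * (nrm X v)\<^sup>2" (is ?B)
proof -
  have up: "(nrm X (\<lambda>z. \<Sum>x\<in>J. a x * k x z))\<^sup>2 \<le> (1 + real (card J) * e) * (\<Sum>x\<in>J. (cmod (a x))\<^sup>2)" for a
  proof -
    have "complex_of_real ((nrm X (\<lambda>z. \<Sum>x\<in>J. a x * k x z))\<^sup>2) = (\<Sum>x\<in>J. \<Sum>y\<in>J. a x * (cnj (a y) * ip X (k x) (k y)))"
      unfolding ip_self[symmetric] by (simp add: ip_sum_left ip_sum_right ip_scale_left ip_scale_right sum_distrib_left)
    also have "\<dots> = (\<Sum>x\<in>J. \<Sum>y\<in>J. a x * (cnj (a y) * (ip X (k x) (k y) - (if x = y then 1 else 0)))) + (\<Sum>x\<in>J. \<Sum>y\<in>J. if x = y then a x * cnj (a x) else 0)"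
      unfolding sum.distrib[symmetric] by (intro sum.cong refl) (auto simp: algebra_simps)
    also have "(\<Sum>x\<in>J. \<Sum>y\<in>J. if x = y then a x * cnj (a x) else 0) = complex_of_real (\<Sum>x\<in>J. (cmod (a x))\<^sup>2)"
      using J by (simp add: complex_norm_square[symmetric])
    finally have "(nrm X (\<lambda>z. \<Sum>x\<in>J. a x * k x z))\<^sup>2 \<le> cmod (\<Sum>x\<in>J. \<Sum>y\<in>J. a x * (cnj (a y) * (ip X (k x) (k y) - (if x = y then 1 else 0)))) + (\<Sum>x\<in>J. (cmod (a x))\<^sup>2)"
      by (smt (verit, best) Re_complex_of_real complex_Re_le_cmod plus_complex.simps(1))
    also have "cmod (\<Sum>x\<in>J. \<Sum>y\<in>J. a x * (cnj (a y) * (ip X (k x) (k y) - (if x = y then 1 else 0)))) \<le> (\<Sum>x\<in>J. \<Sum>y\<in>J. cmod (a x) * (cmod (a y) * e))"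
    proof (rule order_trans[OF norm_sum], rule sum_mono, rule order_trans[OF norm_sum], rule sum_mono)
      fix x y assume "x \<in> J" "y \<in> J"
      then show "cmod (a x * (cnj (a y) * (ip X (k x) (k y) - (if x = y then 1 else 0)))) \<le> cmod (a x) * (cmod (a y) * e)"
        using k unfolding norm_mult complex_mod_cnj by (intro mult_left_mono) auto
    qed
    also have "\<dots> = (\<Sum>x\<in>J. cmod (a x))\<^sup>2 * e"
      
      unfolding power2_eq_square sum_product by (simp add: sum_distrib_right mult.assoc)
    also have "\<dots> \<le> ((\<Sum>x\<in>J. (cmod (a x))\<^sup>2) * card J) * e"
      using sum_squared_le_sum_of_squares[of "\<lambda>x. cmod (a x)" J] e by (intro mult_right_mono) auto
    finally show ?thesis by (simp add: algebra_simps)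
  qed
  then show ?A .
  define \<alpha> where "\<alpha> x = ip X v (k x)" for x
  define T where "T = (\<Sum>x\<in>J. (cmod (\<alpha> x))\<^sup>2)"
  define c where "c = 1 + real (card J) * e"
  have T0: "0 \<le> T" by (simp add: T_def sum_nonneg)
  have "complex_of_real T = ip X v (\<lambda>z. \<Sum>x\<in>J. \<alpha> x * k x z)"
    unfolding T_def of_real_sum ip_sum_right ip_scale_right
    by (intro sum.cong refl) (simp add: \<alpha>_def complex_norm_square mult.commute del: of_real_power)
  then have "T = cmod (ip X v (\<lambda>z. \<Sum>x\<in>J. \<alpha> x * k x z))" using T0 by (metis norm_of_real abs_of_nonneg)
  then have "T \<le> nrm X v * nrm X (\<lambda>z. \<Sum>x\<in>J. \<alpha> x * k x z)" using ip_bound by metis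
  then have "T\<^sup>2 \<le> (nrm X v * nrm X (\<lambda>z. \<Sum>x\<in>J. \<alpha> x * k x z))\<^sup>2" using T0 by (intro power_mono)
  also have "\<dots> \<le> (nrm X v)\<^sup>2 * (c * T)"
    unfolding power_mult_distrib using up[of \<alpha>] by (intro mult_left_mono) (auto simp: T_def c_def)
  finally have "T * T \<le> T * (c * (nrm X v)\<^sup>2)" by (simp add: power2_eq_square ac_simps)
  then have "T \<le> c * (nrm X v)\<^sup>2"
  proof (cases "T = 0")
    case True
    then show ?thesis using e by (simp add: c_def)
  next
    case False
    then show ?thesis using \<open>T * T \<le> T * (c * (nrm X v)\<^sup>2)\<close> T0 by (simp add: mult_le_cancel_left)
  qed
  then show ?B by (simp add: T_def \<alpha>_def c_def)
qed

context unital_cstar_algebra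
begin

text \<open>Since \<open>p\<close> anticommutes with \<open>c\<close>, it commutes with
  \<open>c^2\<close> and thus with the root \<open>s\<close> of \<open>1 - c^2\<close>. In the
  square of \<open>c + p s\<close> the cross terms cancel, and the rest is
  \<open>c^2 + s^2 = 1\<close>. Commutation with \<open>c\<close> passes to \<open>s\<close>, and
  together with commutation with \<open>p\<close> to \<open>w\<close>.\<close>

lemma symmetry_dilation:
  assumes c: "self_adjoint A c" "cnorm A c \<le> 1" and p: "self_adjoint A p" "p \<otimes> p = \<one>" "p \<otimes> c = \<ominus> (c \<otimes> p)"
  shows "\<exists>s w. self_adjoint A s \<and> s \<otimes> s = \<one> \<ominus> c \<otimes> c \<and> w = c \<oplus> p \<otimes> s \<and> self_adjoint A w \<and> w \<otimes> w = \<one> \<and>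
     (\<forall>z\<in>carrier A. z \<otimes> c = c \<otimes> z \<longrightarrow> z \<otimes> p = p \<otimes> z \<longrightarrow> z \<otimes> w = w \<otimes> z)"
proof -
  have cc: "c \<in> carrier A" "star A c = c" and pc: "p \<in> carrier A" "star A p = p" using c p by (auto simp: self_adjoint_def)
  have "cnorm A (c \<otimes> c) \<le> 1" using cnorm_square[OF c(1)] c(2) cnorm_nonneg[OF cc(1)] by (simp add: power_le_one)
  then have "pos A (\<one> \<ominus> c \<otimes> c)" using pos_scalar_minus[OF self_adjoint_square[OF c(1)], of 1] by simp
  then obtain s where s: "self_adjoint A s" "s \<otimes> s = \<one> \<ominus> c \<otimes> c"
    "\<And>z. z \<in> carrier A \<Longrightarrow> z \<otimes> (\<one> \<ominus> c \<otimes> c) = (\<one> \<ominus> c \<otimes> c) \<otimes> z \<Longrightarrow> z \<otimes> s = s \<otimes> z" using pos_sqrt by blast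
  have sc: "s \<in> carrier A" "star A s = s" using s(1) by (auto simp: self_adjoint_def)
  have cs: "c \<otimes> s = s \<otimes> c" using cc by (intro s(3)) (auto simp: distrib)
  have "p \<otimes> (c \<otimes> c) = (\<ominus> (c \<otimes> p)) \<otimes> c" using p(3) cc pc by (simp add: mult_assoc[symmetric])
  also have "\<dots> = \<ominus> (c \<otimes> (p \<otimes> c))" using cc pc by (simp add: a_inv_mult_l mult_assoc)
  also have "\<dots> = (c \<otimes> c) \<otimes> p" using p(3) cc pc by (simp add: a_inv_mult_r mult_assoc)
  finally have pcc: "p \<otimes> (c \<otimes> c) = (c \<otimes> c) \<otimes> p" .
  have ps: "p \<otimes> s = s \<otimes> p" using pc cc pcc by (intro s(3)) (auto simp: minus_mult_l minus_mult_r)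
  define w where "w = c \<oplus> p \<otimes> s"
  have wc: "w \<in> carrier A" using cc pc sc by (simp add: w_def)
  have "self_adjoint A w" using cc pc sc ps by (simp add: self_adjoint_def w_def star_simps)
  moreover have "w \<otimes> w = \<one>"
  proof -
    have 1: "(p \<otimes> s) \<otimes> (p \<otimes> s) = s \<otimes> s"
    proof -
      have "(p \<otimes> s) \<otimes> (p \<otimes> s) = p \<otimes> (s \<otimes> p) \<otimes> s" using pc sc by (simp add: mult_assoc)
      also have "\<dots> = p \<otimes> (p \<otimes> s) \<otimes> s" by (simp only: ps)
      also have "\<dots> = (p \<otimes> p) \<otimes> (s \<otimes> s)" using pc sc by (simp add: mult_assoc)
      finally show ?thesis using p(2) sc by simp
    qed
    have 2: "(p \<otimes> s) \<otimes> c = \<ominus> (c \<otimes> (p \<otimes> s))"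
    proof -
      have "(p \<otimes> s) \<otimes> c = p \<otimes> (c \<otimes> s)" using pc sc cc cs by (simp add: mult_assoc)
      also have "\<dots> = (\<ominus> (c \<otimes> p)) \<otimes> s" using p(3) pc sc cc by (simp add: mult_assoc[symmetric])
      finally show ?thesis using pc sc cc by (simp add: a_inv_mult_l mult_assoc)
    qed
    show ?thesis
    proof (rule lin_eqI)
      fix g assume g: "lin A g"
      have "w \<otimes> w = (c \<otimes> c \<oplus> (p \<otimes> s) \<otimes> c) \<oplus> (c \<otimes> (p \<otimes> s) \<oplus> (p \<otimes> s) \<otimes> (p \<otimes> s))"
        using cc pc sc by (simp add: w_def mult_l_distr mult_r_distr)
      then show "g (w \<otimes> w) = g \<one>" unfolding 1 2 s(2) using g cc pc sc by (simp add: lin_simps)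
    qed (use wc in auto)
  qed
  moreover have "z \<otimes> w = w \<otimes> z" if z: "z \<in> carrier A" "z \<otimes> c = c \<otimes> z" "z \<otimes> p = p \<otimes> z" for z
  proof -
    have "z \<otimes> (c \<otimes> c) = (c \<otimes> c) \<otimes> z" using z cc mult_assoc by metis
    then have "z \<otimes> s = s \<otimes> z" using z cc by (intro s(3)) (auto simp: minus_mult_l minus_mult_r)
    then have "z \<otimes> (p \<otimes> s) = (p \<otimes> s) \<otimes> z" using z pc sc mult_assoc by metis
    then show ?thesis using z cc pc sc by (simp add: w_def mult_l_distr mult_r_distr)
  qed
  ultimately show ?thesis using s w_def by blast
qed

end

text \<open>The two embeddings form one family indexed by \<open>bool\<close>, so that each estimate
  is proved once for both. The GNS space of \<open>q\<close> is to be approximated, and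
  \<open>separating\<close> is the form in which residual finite-dimensionality enters.\<close>

locale representation_pair = A: unital_cstar_algebra A + C: unital_cstar_algebra C
  for A :: "'a cstar" and C :: "'c cstar" +
  fixes \<sigma> :: "bool \<Rightarrow> 'a \<Rightarrow> 'c" and q :: "'c \<Rightarrow> complex"
  assumes \<sigma>: "\<sigma> s \<in> star_hom A C" and \<sigma>_one: "\<sigma> s \<one>\<^bsub>A\<^esub> = \<one>\<^bsub>C\<^esub>" and q: "posf C q"
    and separating: "\<And>x. x \<in> carrier A \<Longrightarrow> x \<noteq> \<zero>\<^bsub>A\<^esub> \<Longrightarrow> \<exists>\<psi>. fin_rank A \<psi> \<and> \<psi> (star A x \<otimes>\<^bsub>A\<^esub> x) \<noteq> 0"
begin

lemmas \<sigma>_simps = star_homD[OF \<sigma>]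

lemma lin_q: "lin C q" by (rule C.posf_lin[OF q])

text \<open>The positivity sum is \<open>q (star z z)\<close> for \<open>z\<close> the sum of the
  \<open>\<sigma> s (c i) (e i)\<close>.\<close>

lemma kernel_\<sigma>:
  fixes e :: "nat \<Rightarrow> 'c"
  assumes e: "\<And>i. i < r \<Longrightarrow> e i \<in> carrier C"
  shows "kernel A {..<r} (\<lambda>i j a. q (star C (e i) \<otimes>\<^bsub>C\<^esub> (\<sigma> s a \<otimes>\<^bsub>C\<^esub> e j)))"
  unfolding kernel_def
proof (intro conjI ballI allI impI)
  fix i j assume ij: "i \<in> {..<r}" "j \<in> {..<r}"
  then have ec: "e i \<in> carrier C" "e j \<in> carrier C" using e by auto
  show "lin A (\<lambda>a. q (star C (e i) \<otimes>\<^bsub>C\<^esub> (\<sigma> s a \<otimes>\<^bsub>C\<^esub> e j)))"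
    using star_hom_lin[OF A.cstar_algebra_axioms \<sigma> C.lin_mult_r[OF C.lin_mult_l[OF lin_q]]] ec by auto
  fix a assume a: "a \<in> carrier A"
  show "q (star C (e i) \<otimes>\<^bsub>C\<^esub> (\<sigma> s (star A a) \<otimes>\<^bsub>C\<^esub> e j)) = cnj (q (star C (e j) \<otimes>\<^bsub>C\<^esub> (\<sigma> s a \<otimes>\<^bsub>C\<^esub> e i)))"
    using C.posf_star[OF q, of "star C (e j) \<otimes>\<^bsub>C\<^esub> (\<sigma> s a \<otimes>\<^bsub>C\<^esub> e i)"] ec a
    by (simp add: C.star_simps C.mult_assoc \<sigma>_simps)
next
  fix c assume c: "\<forall>i\<in>{..<r}. c i \<in> carrier A"
  define y where "y i = \<sigma> s (c i) \<otimes>\<^bsub>C\<^esub> e i" for i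
  have yc: "y \<in> {..<r} \<rightarrow> carrier C" using c e \<sigma>_simps(1) by (auto simp: y_def)
  define z where "z = (\<Oplus>\<^bsub>C\<^esub>i\<in>{..<r}. y i)"
  have zc: "z \<in> carrier C" unfolding z_def using yc by (rule C.M.finsum_closed)
  have lz: "g z = (\<Sum>i<r. g (y i))" if "lin C g" for g unfolding z_def by (rule C.lin_finsum[OF that _ yc]) simp
  have "q (star C z \<otimes>\<^bsub>C\<^esub> z) = (\<Sum>j<r. q (star C z \<otimes>\<^bsub>C\<^esub> y j))" using zc by (intro lz C.lin_mult_l lin_q) auto
  also have "\<dots> = (\<Sum>j<r. \<Sum>i<r. q (star C (y i) \<otimes>\<^bsub>C\<^esub> y j))"
  proof (intro sum.cong refl)
    fix j assume "j \<in> {..<r}"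
    have "q (star C z \<otimes>\<^bsub>C\<^esub> y j) = cnj (q (star C (y j) \<otimes>\<^bsub>C\<^esub> z))" using \<open>j \<in> {..<r}\<close> zc yc by (intro C.posf_swap[OF q]) auto
    also have "q (star C (y j) \<otimes>\<^bsub>C\<^esub> z) = (\<Sum>i<r. q (star C (y j) \<otimes>\<^bsub>C\<^esub> y i))"
      using \<open>j \<in> {..<r}\<close> yc by (intro lz C.lin_mult_l lin_q) auto
    also have "cnj \<dots> = (\<Sum>i<r. q (star C (y i) \<otimes>\<^bsub>C\<^esub> y j))"
      unfolding cnj_sum using \<open>j \<in> {..<r}\<close> yc by (intro sum.cong refl C.posf_swap[OF q, symmetric]) auto
    finally show "q (star C z \<otimes>\<^bsub>C\<^esub> y j) = (\<Sum>i<r. q (star C (y i) \<otimes>\<^bsub>C\<^esub> y j))" .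
  qed
  also have "\<dots> = (\<Sum>i<r. \<Sum>j<r. q (star C (y i) \<otimes>\<^bsub>C\<^esub> y j))" by (rule sum.swap)
  also have "\<dots> = (\<Sum>i<r. \<Sum>j<r. q (star C (e i) \<otimes>\<^bsub>C\<^esub> (\<sigma> s (star A (c i) \<otimes>\<^bsub>A\<^esub> c j) \<otimes>\<^bsub>C\<^esub> e j)))"
    using c e by (intro sum.cong refl) (auto simp: y_def C.star_simps C.mult_assoc \<sigma>_simps)
  finally show "0 \<le> Re (\<Sum>i<r. \<Sum>j<r. q (star C (e i) \<otimes>\<^bsub>C\<^esub> (\<sigma> s (star A (c i) \<otimes>\<^bsub>A\<^esub> c j) \<otimes>\<^bsub>C\<^esub> e j)))"
    using C.posf_nonneg[OF q zc] by simp
qed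

text \<open>The span of \<open>Y\<close>, described by coefficients that every linear functional
  respects, has dimension at most \<open>card Y\<close>; this bounds the orthonormal systems inside
  it.\<close>

lemma orthonormal_basis_of_span:
  assumes Y: "finite Y" "Y \<subseteq> carrier C"
  shows "\<exists>r e. (\<forall>i<r. e i \<in> carrier C) \<and> orthonormal C q r e \<and>
     (\<forall>a\<in>Y. \<forall>b\<in>carrier C. q (star C b \<otimes>\<^bsub>C\<^esub> a) = (\<Sum>i<r. q (star C (e i) \<otimes>\<^bsub>C\<^esub> a) * q (star C b \<otimes>\<^bsub>C\<^esub> e i)))"
proof -
  define V where "V = {x \<in> carrier C. \<exists>c. \<forall>g. lin C g \<longrightarrow> g x = (\<Sum>y\<in>Y. c y * g y)}"
  have YV: "Y \<subseteq> V"
  proof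
    fix z assume z: "z \<in> Y"
    have "g z = (\<Sum>y\<in>Y. (if y = z then 1 else 0) * g y)" for g :: "'c \<Rightarrow> complex"
      using Y z by (simp add: if_distrib[of "\<lambda>t. t * _"] cong: if_cong)
    then show "z \<in> V" unfolding V_def using z Y by (intro CollectI conjI exI[of _ "\<lambda>y. if y = z then 1 else 0"]) auto
  qed
  have V1: "V \<subseteq> carrier C" by (auto simp: V_def)
  have V2: "\<zero>\<^bsub>C\<^esub> \<in> V" unfolding V_def by (intro CollectI conjI exI[of _ "\<lambda>_. 0"]) (auto simp: C.lin_zero)
  have V3: "x \<oplus>\<^bsub>C\<^esub> y \<in> V" if xy: "x \<in> V" "y \<in> V" for x y
  proof -
    obtain c d where "x \<in> carrier C" "y \<in> carrier C" "\<forall>g. lin C g \<longrightarrow> g x = (\<Sum>y\<in>Y. c y * g y)" "\<forall>g. lin C g \<longrightarrow> g y = (\<Sum>y\<in>Y. d y * g y)"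
      using xy unfolding V_def by blast
    then show ?thesis unfolding V_def
      by (intro CollectI conjI exI[of _ "\<lambda>z. c z + d z"]) (auto simp: C.lin_add distrib_right sum.distrib)
  qed
  have V4: "a \<odot>\<^bsub>C\<^esub> x \<in> V" if xy: "x \<in> V" for a x
  proof -
    obtain c where "x \<in> carrier C" "\<forall>g. lin C g \<longrightarrow> g x = (\<Sum>y\<in>Y. c y * g y)" using xy unfolding V_def by blast
    then show ?thesis unfolding V_def
      by (intro CollectI conjI exI[of _ "\<lambda>z. a * c z"]) (auto simp: C.lin_smult sum_distrib_left mult.assoc)
  qed
  have "\<exists>r e. (\<forall>i<r. e i \<in> V) \<and> orthonormal C q r e \<and>
     (\<forall>a\<in>V. \<forall>b\<in>carrier C. q (star C b \<otimes>\<^bsub>C\<^esub> a) = (\<Sum>i<r. q (star C (e i) \<otimes>\<^bsub>C\<^esub> a) * q (star C b \<otimes>\<^bsub>C\<^esub> e i)))"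
  proof (rule C.exists_complete_orthonormal[OF q V1 V2 V3 V4])
    fix r e assume e: "\<forall>i<r. e i \<in> V" "orthonormal C q r e"
    then have "\<forall>i. \<exists>c. i < r \<longrightarrow> (\<forall>g. lin C g \<longrightarrow> g (e i) = (\<Sum>y\<in>Y. c y * g y))" by (auto simp: V_def)
    from choice[OF this] obtain c where c: "\<forall>i. i < r \<longrightarrow> (\<forall>g. lin C g \<longrightarrow> g (e i) = (\<Sum>y\<in>Y. c i y * g y))" ..
    show "r \<le> card Y"
    proof (rule orthonormal_bound[OF e(2) Y(1)])
      fix i j assume ij: "i < r" "j < r"
      then have "lin C (\<lambda>z. q (star C (e j) \<otimes>\<^bsub>C\<^esub> z))" using e V1 by (intro C.lin_mult_l lin_q) auto
      then show "q (star C (e j) \<otimes>\<^bsub>C\<^esub> e i) = (\<Sum>y\<in>Y. c i y * q (star C (e j) \<otimes>\<^bsub>C\<^esub> y))" using c ij by blast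
    qed
  qed
  then show ?thesis using V1 YV by (meson subset_iff)
qed

text \<open>Both kernels are approximated by finite-rank ones, and all functionals together are
  represented on one direct sum; the first \<open>K1\<close> summands serve
  \<open>\<sigma> True\<close>, the others \<open>\<sigma> False\<close>. The signs
  \<open>sg\<close> turn \<open>P\<close> into the symmetry that tells the two groups apart.\<close>

lemma approximate_representation:
  fixes e :: "nat \<Rightarrow> 'c"
  assumes "\<forall>i<r. e i \<in> carrier C" and S: "finite S" "S \<subseteq> carrier A" and eps: "0 < eps"
  shows "\<exists>X \<rho> P \<eta>. finite X \<and> \<rho> \<in> star_hom A (mats X) \<and> \<rho> \<one>\<^bsub>A\<^esub> = \<one>\<^bsub>mats X\<^esub> \<and>
     P \<in> carrier (mats X) \<and> star (mats X) P = P \<and> P \<otimes>\<^bsub>mats X\<^esub> P = \<one>\<^bsub>mats X\<^esub> \<and>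
     (\<forall>a\<in>carrier A. P \<otimes>\<^bsub>mats X\<^esub> \<rho> a = \<rho> a \<otimes>\<^bsub>mats X\<^esub> P) \<and>
     (\<forall>s. \<forall>i<r. \<eta> s i \<in> vecs X \<and> app X P (\<eta> s i) = (\<lambda>x. (if s then 1 else -1) * \<eta> s i x)) \<and>
     (\<forall>s. \<forall>i<r. \<forall>j<r. \<forall>a\<in>S. cmod (ip X (app X (\<rho> a) (\<eta> s j)) (\<eta> s i) - q (star C (e i) \<otimes>\<^bsub>C\<^esub> (\<sigma> s a \<otimes>\<^bsub>C\<^esub> e j))) < eps)"
proof -
  have e: "\<And>i. i < r \<Longrightarrow> e i \<in> carrier C" using assms(1) by blast
  have "\<exists>K \<psi> c. fin_kernel A {..<r} K \<psi> c \<and>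
     (\<forall>i\<in>{..<r}. \<forall>j\<in>{..<r}. \<forall>a\<in>S. cmod (kernel_of A K \<psi> c i j a - q (star C (e i) \<otimes>\<^bsub>C\<^esub> (\<sigma> s a \<otimes>\<^bsub>C\<^esub> e j))) < eps)" for s
    by (rule kernel_approximation[OF A.unital_cstar_algebra_axioms separating finite_lessThan S kernel_\<sigma>[OF e] eps])
  note app_s = this
  obtain K1 \<psi>1 c1 where 1: "fin_kernel A {..<r} K1 \<psi>1 c1" 
    "\<forall>i\<in>{..<r}. \<forall>j\<in>{..<r}. \<forall>a\<in>S. cmod (kernel_of A K1 \<psi>1 c1 i j a - q (star C (e i) \<otimes>\<^bsub>C\<^esub> (\<sigma> True a \<otimes>\<^bsub>C\<^esub> e j))) < eps"
    using app_s[of True] by - (elim exE conjE, rule that)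
  obtain K2 \<psi>2 c2 where 2: "fin_kernel A {..<r} K2 \<psi>2 c2" 
    "\<forall>i\<in>{..<r}. \<forall>j\<in>{..<r}. \<forall>a\<in>S. cmod (kernel_of A K2 \<psi>2 c2 i j a - q (star C (e i) \<otimes>\<^bsub>C\<^esub> (\<sigma> False a \<otimes>\<^bsub>C\<^esub> e j))) < eps"
    using app_s[of False] by - (elim exE conjE, rule that)
  define \<psi> where "\<psi> k = (if k < K1 then \<psi>1 k else \<psi>2 (k - K1))" for k
  define c where "c k = (if k < K1 then c1 k else c2 (k - K1))" for k
  define sg where "sg k = (if k < K1 then 1 else -1 :: complex)" for k
  have \<psi>f: "\<forall>k<K1 + K2. fin_rank A (\<psi> k)" using 1(1) 2(1) by (auto simp: \<psi>_def fin_kernel_def)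
  have cc: "c k i \<in> carrier A" if "k < K1 + K2" "i < r" for k i using 1(1) 2(1) that by (auto simp: c_def fin_kernel_def)
  obtain X \<rho> \<gamma> P where X: "finite X" and \<rho>: "\<rho> \<in> star_hom A (mats X)" "\<rho> \<one>\<^bsub>A\<^esub> = \<one>\<^bsub>mats X\<^esub>"
    and \<gamma>: "\<forall>k<K1 + K2. \<forall>a\<in>carrier A. \<gamma> k a \<in> vecs X \<and> app X P (\<gamma> k a) = (\<lambda>x. sg k * \<gamma> k a x)"
    and ip\<gamma>: "\<forall>k<K1 + K2. \<forall>l<K1 + K2. \<forall>a\<in>carrier A. \<forall>b\<in>carrier A. ip X (\<gamma> k a) (\<gamma> l b) = (if k = l then \<psi> k (star A b \<otimes>\<^bsub>A\<^esub> a) else 0)"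
    and \<rho>\<gamma>: "\<forall>k<K1 + K2. \<forall>a\<in>carrier A. \<forall>b\<in>carrier A. app X (\<rho> a) (\<gamma> k b) = \<gamma> k (a \<otimes>\<^bsub>A\<^esub> b)"
    and P: "P \<in> carrier (mats X)" "\<forall>a\<in>carrier A. P \<otimes>\<^bsub>mats X\<^esub> \<rho> a = \<rho> a \<otimes>\<^bsub>mats X\<^esub> P"
      "(\<forall>k. sg k = 1 \<or> sg k = -1) \<longrightarrow> star (mats X) P = P \<and> P \<otimes>\<^bsub>mats X\<^esub> P = \<one>\<^bsub>mats X\<^esub>"
    using fin_rank_representation[OF A.unital_cstar_algebra_axioms, where \<psi> = \<psi> and K = "K1 + K2" and s = sg, OF \<psi>f] by - (elim exE conjE, rule that)
  have Pp: "star (mats X) P = P" "P \<otimes>\<^bsub>mats X\<^esub> P = \<one>\<^bsub>mats X\<^esub>" using P(3) by (auto simp: sg_def)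
  define Ks where "Ks s = (if s then {..<K1} else {K1..<K1+K2})" for s
  have Ks: "k < K1 + K2" "sg k = (if s then 1 else -1)" if "k \<in> Ks s" for k s using that by (auto simp: Ks_def sg_def split: if_splits)
  have Kf: "finite (Ks s)" for s by (simp add: Ks_def)
  define \<eta> where "\<eta> s i = (\<lambda>x. \<Sum>k\<in>Ks s. \<gamma> k (c k i) x)" for s i
  have \<eta>v: "\<eta> s i \<in> vecs X" if "i < r" for s i
    unfolding vecs_def \<eta>_def using \<gamma> Ks(1)[of _ s] cc that by (auto simp: vecs_def intro!: sum.neutral)
  have P\<eta>: "app X P (\<eta> s i) = (\<lambda>x. (if s then 1 else -1) * \<eta> s i x)" if i: "i < r" for s i
  proof -
    have "app X P (\<eta> s i) = (\<lambda>x. \<Sum>k\<in>Ks s. app X P (\<gamma> k (c k i)) x)" unfolding \<eta>_def by (rule app_sum)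
    also have "\<dots> = (\<lambda>x. \<Sum>k\<in>Ks s. (if s then 1 else -1) * \<gamma> k (c k i) x)"
      by (intro ext sum.cong refl) (use \<gamma> Ks[of _ s] cc[OF _ i] in auto)
    finally show ?thesis by (simp add: \<eta>_def sum_distrib_left)
  qed
  have ip\<eta>: "ip X (app X (\<rho> a) (\<eta> s j)) (\<eta> s i) = (\<Sum>k\<in>Ks s. \<psi> k (star A (c k i) \<otimes>\<^bsub>A\<^esub> (a \<otimes>\<^bsub>A\<^esub> c k j)))"
    if a: "a \<in> carrier A" and ij: "i < r" "j < r" for a s i j
  proof -
    have "app X (\<rho> a) (\<eta> s j) = (\<lambda>x. \<Sum>k\<in>Ks s. \<gamma> k (a \<otimes>\<^bsub>A\<^esub> c k j) x)"
      unfolding \<eta>_def app_sum by (intro ext sum.cong refl) (use \<rho>\<gamma> Ks(1)[of _ s] cc[OF _ ij(2)] a in auto)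
    then have "ip X (app X (\<rho> a) (\<eta> s j)) (\<eta> s i) = (\<Sum>k\<in>Ks s. \<Sum>l\<in>Ks s. ip X (\<gamma> k (a \<otimes>\<^bsub>A\<^esub> c k j)) (\<gamma> l (c l i)))"
      unfolding \<eta>_def[of s i] by (simp add: ip_sum_left ip_sum_right)
    also have "\<dots> = (\<Sum>k\<in>Ks s. \<Sum>l\<in>Ks s. if k = l then \<psi> k (star A (c k i) \<otimes>\<^bsub>A\<^esub> (a \<otimes>\<^bsub>A\<^esub> c k j)) else 0)"
      by (intro sum.cong refl) (use ip\<gamma> Ks(1)[of _ s] cc ij a in auto)
    also have "\<dots> = (\<Sum>k\<in>Ks s. \<psi> k (star A (c k i) \<otimes>\<^bsub>A\<^esub> (a \<otimes>\<^bsub>A\<^esub> c k j)))" using Kf by simp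
    finally show ?thesis .
  qed
  have "(\<Sum>k\<in>Ks True. \<psi> k (star A (c k i) \<otimes>\<^bsub>A\<^esub> (a \<otimes>\<^bsub>A\<^esub> c k j))) = kernel_of A K1 \<psi>1 c1 i j a" for i j a
    unfolding kernel_of_def Ks_def by (simp add: \<psi>_def c_def)
  moreover have "(\<Sum>k\<in>Ks False. \<psi> k (star A (c k i) \<otimes>\<^bsub>A\<^esub> (a \<otimes>\<^bsub>A\<^esub> c k j))) = kernel_of A K2 \<psi>2 c2 i j a" for i j a
  proof -
    have "(\<Sum>k\<in>{0 + K1..<K2 + K1}. \<psi> k (star A (c k i) \<otimes>\<^bsub>A\<^esub> (a \<otimes>\<^bsub>A\<^esub> c k j))) = (\<Sum>k = 0..<K2. \<psi> (k + K1) (star A (c (k + K1) i) \<otimes>\<^bsub>A\<^esub> (a \<otimes>\<^bsub>A\<^esub> c (k + K1) j)))"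
      by (rule sum.shift_bounds_nat_ivl)
    then show ?thesis unfolding kernel_of_def Ks_def by (simp add: \<psi>_def c_def add.commute atLeast0LessThan)
  qed
  ultimately have "cmod (ip X (app X (\<rho> a) (\<eta> s j)) (\<eta> s i) - q (star C (e i) \<otimes>\<^bsub>C\<^esub> (\<sigma> s a \<otimes>\<^bsub>C\<^esub> e j))) < eps"
    if "i < r" "j < r" "a \<in> S" for s i j a
    using 1(2) 2(2) that ip\<eta>[of a i j s] S(2) by (cases s) auto
  then show ?thesis
    by - (rule exI[of _ X], rule exI[of _ \<rho>], rule exI[of _ P], rule exI[of _ \<eta>],
      intro conjI allI impI ballI, simp_all add: X \<rho> P(1,2) Pp \<eta>v P\<eta>)
qed

text \<open>The contraction \<open>c\<close> approximately exchanges the approximating vectors of the two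
  representations, which \<open>P\<close> keeps apart.\<close>

lemma approximate_exchange:
  assumes Y: "finite Y" "Y \<subseteq> carrier C" and S: "finite S" "S \<subseteq> carrier A" and d: "0 < \<delta>"
  shows "\<exists>X \<rho> P c \<eta>. finite X \<and> \<rho> \<in> star_hom A (mats X) \<and> \<rho> \<one>\<^bsub>A\<^esub> = \<one>\<^bsub>mats X\<^esub> \<and>
     self_adjoint (mats X) P \<and> P \<otimes>\<^bsub>mats X\<^esub> P = \<one>\<^bsub>mats X\<^esub> \<and>
     (\<forall>a\<in>carrier A. P \<otimes>\<^bsub>mats X\<^esub> \<rho> a = \<rho> a \<otimes>\<^bsub>mats X\<^esub> P) \<and>
     self_adjoint (mats X) c \<and> opn X c \<le> 1 \<and> P \<otimes>\<^bsub>mats X\<^esub> c = \<ominus>\<^bsub>mats X\<^esub> (c \<otimes>\<^bsub>mats X\<^esub> P) \<and>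
     (\<forall>s v. \<eta> s v \<in> vecs X) \<and> (\<forall>s x. lin C (\<lambda>v. \<eta> s v x)) \<and>
     (\<forall>s. \<forall>v\<in>Y. \<forall>w\<in>Y. \<forall>a\<in>S. cmod (ip X (app X (\<rho> a) (\<eta> s v)) (\<eta> s w) - q (star C w \<otimes>\<^bsub>C\<^esub> (\<sigma> s a \<otimes>\<^bsub>C\<^esub> v))) < \<delta>) \<and>
     (\<forall>s. \<forall>v\<in>Y. nrm X (\<lambda>x. app X c (\<eta> s v) x - \<eta> (\<not> s) v x) < \<delta>)"
proof -
  obtain r e where e: "\<forall>i<r. e i \<in> carrier C" and on: "orthonormal C q r e"
    and complete: "\<forall>a\<in>Y. \<forall>b\<in>carrier C. q (star C b \<otimes>\<^bsub>C\<^esub> a) = (\<Sum>i<r. q (star C (e i) \<otimes>\<^bsub>C\<^esub> a) * q (star C b \<otimes>\<^bsub>C\<^esub> e i))"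
    using orthonormal_basis_of_span[OF Y] by - (elim exE conjE, rule that)
  have ec: "e i \<in> carrier C" if "i < r" for i using e that by blast
  define \<alpha> where "\<alpha> v i = q (star C (e i) \<otimes>\<^bsub>C\<^esub> v)" for v i
  define M where "M = (\<Sum>v\<in>Y. \<Sum>i<r. cmod (\<alpha> v i))"
  have M0: "0 \<le> M" unfolding M_def by (intro sum_nonneg) auto
  have \<alpha>sum: "(\<Sum>i<r. cmod (\<alpha> v i)) \<le> M" if "v \<in> Y" for v
    unfolding M_def using that Y by (intro member_le_sum[where f = "\<lambda>v. \<Sum>i<r. cmod (\<alpha> v i)"]) (auto intro: sum_nonneg)
  have \<alpha>M: "cmod (\<alpha> v i) \<le> M" if "v \<in> Y" "i < r" for v i
    using order_trans[OF member_le_sum[of i "{..<r}" "\<lambda>i. cmod (\<alpha> v i)"] \<alpha>sum[OF that(1)]] that by auto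
  \<comment> \<open>\<open>M * M\<close> controls the error of inner products. The rest controls the
    exchange: \<open>r\<close> terms, each with coefficient error at most
    \<open>(M + 2 r M) eps\<close> and a vector of norm at most 2.\<close>
  define K where "K = M * M + 2 * real r * (M + 2 * real r * M)"
  have K0: "0 \<le> K" using M0 by (simp add: K_def)
  define eps where "eps = min 1 (\<delta> / (K + 1))"
  have eps: "0 < eps" "eps \<le> 1" using d K0 by (auto simp: eps_def)
  have Keps: "K * eps < \<delta>"
  proof -
    have "K * eps \<le> K * (\<delta> / (K + 1))" using K0 by (intro mult_left_mono) (auto simp: eps_def)
    also have "\<dots> < \<delta>" using d K0 by (simp add: field_simps)
    finally show ?thesis .
  qed
  \<comment> \<open>The unit is added to \<open>S\<close> so that the Gram matrices of the
    \<open>\<eta>0 s i\<close> are close to the identity.\<close>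
  have S1: "finite (insert \<one>\<^bsub>A\<^esub> S)" "insert \<one>\<^bsub>A\<^esub> S \<subseteq> carrier A" using S by auto
  obtain X \<rho> P \<eta>0 where X: "finite X" and \<rho>: "\<rho> \<in> star_hom A (mats X)" "\<rho> \<one>\<^bsub>A\<^esub> = \<one>\<^bsub>mats X\<^esub>"
    and P: "P \<in> carrier (mats X)" "star (mats X) P = P" "P \<otimes>\<^bsub>mats X\<^esub> P = \<one>\<^bsub>mats X\<^esub>" 
      "\<forall>a\<in>carrier A. P \<otimes>\<^bsub>mats X\<^esub> \<rho> a = \<rho> a \<otimes>\<^bsub>mats X\<^esub> P"
    and \<eta>0: "\<forall>s. \<forall>i<r. \<eta>0 s i \<in> vecs X \<and> app X P (\<eta>0 s i) = (\<lambda>x. (if s then 1 else -1) * \<eta>0 s i x)"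
    and near: "\<forall>s. \<forall>i<r. \<forall>j<r. \<forall>a\<in>insert \<one>\<^bsub>A\<^esub> S. cmod (ip X (app X (\<rho> a) (\<eta>0 s j)) (\<eta>0 s i) - q (star C (e i) \<otimes>\<^bsub>C\<^esub> (\<sigma> s a \<otimes>\<^bsub>C\<^esub> e j))) < eps"
    using approximate_representation[OF e S1 eps(1)] by - (elim exE conjE, rule that)
  interpret MX: unital_cstar_algebra "mats X" by (rule unital_cstar_algebra_mats[OF X])
  have \<eta>0v: "\<eta>0 s i \<in> vecs X" and P\<eta>0: "app X P (\<eta>0 s i) = (\<lambda>x. (if s then 1 else -1) * \<eta>0 s i x)" if "i < r" for s i
    using \<eta>0 that by blast+
  have gram: "cmod (ip X (\<eta>0 s j) (\<eta>0 s i) - (if j = i then 1 else 0)) \<le> eps" if ij: "i < r" "j < r" for s i j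
  proof -
    have "cmod (ip X (app X (\<rho> \<one>\<^bsub>A\<^esub>) (\<eta>0 s j)) (\<eta>0 s i) - q (star C (e i) \<otimes>\<^bsub>C\<^esub> (\<sigma> s \<one>\<^bsub>A\<^esub> \<otimes>\<^bsub>C\<^esub> e j))) < eps"
      using near ij by blast
    moreover have "q (star C (e i) \<otimes>\<^bsub>C\<^esub> e j) = (if j = i then 1 else 0)" using on ij unfolding orthonormal_def by blast
    ultimately show ?thesis using ec ij \<eta>0v by (simp add: \<rho>(2) \<sigma>_one app_one[OF X])
  qed
  \<comment> \<open>Vectors of different kind are eigenvectors of the self-adjoint \<open>P\<close>
    for different eigenvalues.\<close>
  have cross: "ip X (\<eta>0 s j) (\<eta>0 t i) = 0" if ij: "i < r" "j < r" "s \<noteq> t" for s t i j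
  proof -
    have "ip X (app X P (\<eta>0 s j)) (\<eta>0 t i) = ip X (\<eta>0 s j) (app X P (\<eta>0 t i))" using app_adjoint[of X P] P(2) by simp
    then have "(if s then 1 else -1) * ip X (\<eta>0 s j) (\<eta>0 t i) = cnj (if t then 1 else -1) * ip X (\<eta>0 s j) (\<eta>0 t i)"
      unfolding P\<eta>0[OF ij(1)] P\<eta>0[OF ij(2)] ip_scale_left ip_scale_right .
    then show ?thesis using ij(3) by (cases s; cases t) auto
  qed
  define J where "J = {..<r} \<times> (UNIV :: bool set)"
  have J: "finite J" "card J = 2 * r" by (auto simp: J_def card_cartesian_product)
  define \<kappa> where "\<kappa> p = \<eta>0 (snd p) (fst p)" for p
  define \<tau> where "\<tau> p = (fst p, \<not> snd p)" for p :: "nat \<times> bool"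
  have \<tau>J: "\<tau> p \<in> J" "\<tau> (\<tau> p) = p" if "p \<in> J" for p using that by (auto simp: J_def \<tau>_def)
  have reindex: "(\<Sum>p\<in>J. F (\<tau> p)) = (\<Sum>p\<in>J. F p)" for F :: "nat \<times> bool \<Rightarrow> 'x::comm_monoid_add"
    by (rule sum.reindex_bij_witness[of J \<tau> \<tau>]) (auto simp: \<tau>J)
  have \<kappa>gram: "cmod (ip X (\<kappa> x) (\<kappa> y) - (if x = y then 1 else 0)) \<le> eps" if "x \<in> J" "y \<in> J" for x y
  proof (cases "snd x = snd y")
    case True
    then have "x = y \<longleftrightarrow> fst x = fst y" by (simp add: prod_eq_iff)
    then show ?thesis using True that gram[of "fst y" "fst x" "snd x"] by (auto simp: J_def \<kappa>_def)
  next
    case False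
    then show ?thesis using that cross[of "fst y" "fst x" "snd x" "snd y"] eps by (auto simp: J_def \<kappa>_def)
  qed
  note bnd = almost_orthonormal_bounds[OF J(1) less_imp_le[OF eps(1)] \<kappa>gram]
  define L where "L = 1 + real (card J) * eps"
  \<comment> \<open>\<open>L\<close> bounds the squared norm both of the synthesis map of the
    vectors \<open>\<kappa> p\<close> and of its adjoint; dividing by it makes \<open>c\<close> a
    contraction, at the price of a factor \<open>\<beta>\<close> close to 1.\<close>
  define \<beta> where "\<beta> = 1 / L"
  have L1: "1 \<le> L" using eps by (simp add: L_def)
  have \<beta>: "0 < \<beta>" "\<beta> \<le> 1" "\<beta> * L = 1" using L1 by (auto simp: \<beta>_def)
  have \<beta>': "1 - \<beta> \<le> 2 * real r * eps"
  proof -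
    have "1 - \<beta> = \<beta> * (L - 1)" using \<beta>(3) by (simp add: algebra_simps)
    also have "\<dots> \<le> 1 * (L - 1)" using \<beta> L1 by (intro mult_right_mono) auto
    finally show ?thesis by (simp add: L_def J)
  qed
  \<comment> \<open>The scaled sum of the rank-one maps
    \<open>v \<mapsto> <v, \<kappa> (\<tau> p)> \<kappa> p\<close>, where \<open>\<tau>\<close>
    switches the kind. It is self-adjoint because \<open>\<tau>\<close> is an involution, and it
    anticommutes with \<open>P\<close> because it switches eigenspaces.\<close>
  define c where "c = mk (\<lambda>x y. complex_of_real \<beta> * (\<Sum>p\<in>J. \<kappa> p x * cnj (\<kappa> (\<tau> p) y)))"
  have \<kappa>v: "\<kappa> p \<in> vecs X" if "p \<in> J" for p using that \<eta>0v by (auto simp: J_def \<kappa>_def)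
  have \<kappa>0: "\<kappa> p x = 0" if "p \<in> J" "x \<notin> X" for p x using \<kappa>v[OF that(1)] that(2) by (simp add: vecs_def)
  have cc: "c \<in> carrier (mats X)" 
  proof -
    have "\<kappa> p x * cnj (\<kappa> (\<tau> p) y) = 0" if "p \<in> J" "x \<notin> X \<or> y \<notin> X" for p x y
      using \<kappa>0[OF that(1), of x] \<kappa>0[OF \<tau>J(1)[OF that(1)], of y] that(2) by auto
    then show ?thesis unfolding mats_simps c_def ent_mk by (simp add: sum.neutral)
  qed
  have capp: "app X c v = (\<lambda>x. \<Sum>p\<in>J. (complex_of_real \<beta> * ip X v (\<kappa> (\<tau> p))) * \<kappa> p x)" for v
  proof
    fix x
    have "app X c v x = (\<Sum>y\<in>X. \<Sum>p\<in>J. complex_of_real \<beta> * (v y * cnj (\<kappa> (\<tau> p) y)) * \<kappa> p x)"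
      unfolding app_def c_def ent_mk by (intro sum.cong refl) (simp add: sum_distrib_left sum_distrib_right ac_simps)
    also have "\<dots> = (\<Sum>p\<in>J. \<Sum>y\<in>X. complex_of_real \<beta> * (v y * cnj (\<kappa> (\<tau> p) y)) * \<kappa> p x)" by (rule sum.swap)
    also have "\<dots> = (\<Sum>p\<in>J. (complex_of_real \<beta> * ip X v (\<kappa> (\<tau> p))) * \<kappa> p x)"
      by (simp add: ip_def sum_distrib_left sum_distrib_right)
    finally show "app X c v x = (\<Sum>p\<in>J. (complex_of_real \<beta> * ip X v (\<kappa> (\<tau> p))) * \<kappa> p x)" .
  qed
  have cstar: "star (mats X) c = c"
  proof (rule ent_eqI)
    fix x y
    have "ent (star (mats X) c) x y = complex_of_real \<beta> * (\<Sum>p\<in>J. \<kappa> (\<tau> p) x * cnj (\<kappa> p y))"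
      by (simp add: mats_simps c_def mult.commute)
    also have "(\<Sum>p\<in>J. \<kappa> (\<tau> p) x * cnj (\<kappa> p y)) = (\<Sum>p\<in>J. \<kappa> (\<tau> (\<tau> p)) x * cnj (\<kappa> (\<tau> p) y))"
      by (rule reindex[symmetric])
    also have "\<dots> = (\<Sum>p\<in>J. \<kappa> p x * cnj (\<kappa> (\<tau> p) y))" using \<tau>J by (intro sum.cong refl) simp
    finally show "ent (star (mats X) c) x y = ent c x y" by (simp add: c_def)
  qed
  have copn: "opn X c \<le> 1"
  proof (rule opn_least)
    fix v
    have "(nrm X (app X c v))\<^sup>2 \<le> L * (\<Sum>p\<in>J. (cmod (complex_of_real \<beta> * ip X v (\<kappa> (\<tau> p))))\<^sup>2)"
      unfolding capp L_def by (rule bnd(1))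
    also have "(\<Sum>p\<in>J. (cmod (complex_of_real \<beta> * ip X v (\<kappa> (\<tau> p))))\<^sup>2) = (\<Sum>p\<in>J. (cmod (complex_of_real \<beta> * ip X v (\<kappa> p)))\<^sup>2)"
      by (rule reindex)
    also have "\<dots> = \<beta>\<^sup>2 * (\<Sum>p\<in>J. (cmod (ip X v (\<kappa> p)))\<^sup>2)" using \<beta> by (simp add: norm_mult power_mult_distrib sum_distrib_left)
    also have "L * \<dots> \<le> L * (\<beta>\<^sup>2 * (L * (nrm X v)\<^sup>2))"
      using L1 bnd(2)[of v] by (intro mult_left_mono) (auto simp: L_def)
    also have "\<dots> = (\<beta> * L)\<^sup>2 * (nrm X v)\<^sup>2" by (simp add: power2_eq_square ac_simps)
    also have "\<dots> = (1 * nrm X v)\<^sup>2" by (simp add: \<beta>(3))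
    finally show "nrm X (app X c v) \<le> 1 * nrm X v" by (rule power2_le_imp_le) simp
  qed simp
  have anti: "P \<otimes>\<^bsub>mats X\<^esub> c = \<ominus>\<^bsub>mats X\<^esub> (c \<otimes>\<^bsub>mats X\<^esub> P)"
  proof -
    have "P \<otimes>\<^bsub>mats X\<^esub> c = (-1) \<odot>\<^bsub>mats X\<^esub> (c \<otimes>\<^bsub>mats X\<^esub> P)"
    proof (rule mats_eqI[OF X])
      fix v
      define sg where "sg p = (if snd p then 1 else -1 :: complex)" for p :: "nat \<times> bool"
      have P\<kappa>: "app X P (\<kappa> p) = (\<lambda>x. sg p * \<kappa> p x)" if "p \<in> J" for p
        using P\<eta>0[of "fst p" "snd p"] that by (auto simp: J_def \<kappa>_def sg_def)
      have 1: "app X P (app X c v) = (\<lambda>x. \<Sum>p\<in>J. (complex_of_real \<beta> * ip X v (\<kappa> (\<tau> p))) * (sg p * \<kappa> p x))"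
        unfolding capp app_sum app_scale using P\<kappa> by (intro ext sum.cong refl) simp
      have 2: "ip X (app X P v) (\<kappa> (\<tau> p)) = - sg p * ip X v (\<kappa> (\<tau> p))" if "p \<in> J" for p
        using app_adjoint[of X P v "\<kappa> (\<tau> p)"] P(2) P\<kappa>[OF \<tau>J(1)[OF that]] by (auto simp: ip_scale_right sg_def \<tau>_def)
      have "app X (P \<otimes>\<^bsub>mats X\<^esub> c) v x = app X ((-1) \<odot>\<^bsub>mats X\<^esub> (c \<otimes>\<^bsub>mats X\<^esub> P)) v x" for x
        unfolding app_ring 1 capp[of "app X P v"] sum_distrib_left by (intro sum.cong refl) (simp add: 2)
      then show "app X (P \<otimes>\<^bsub>mats X\<^esub> c) v = app X ((-1) \<odot>\<^bsub>mats X\<^esub> (c \<otimes>\<^bsub>mats X\<^esub> P)) v" by blast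
    qed (use P cc in auto)
    then show ?thesis using P cc by (simp add: MX.smult_m1)
  qed
  \<comment> \<open>Elements of \<open>Y\<close> agree with their Fourier sums in the GNS space of
    \<open>q\<close>, so their approximating vectors are the same combinations of the
    \<open>\<eta>0 s i\<close>.\<close>
  define \<eta> where "\<eta> s v = (\<lambda>x. \<Sum>i<r. \<alpha> v i * \<eta>0 s i x)" for s v
  have \<eta>v: "\<eta> s v \<in> vecs X" for s v unfolding \<eta>_def vecs_def using \<eta>0v by (auto simp: vecs_def)
  have \<eta>lin: "lin C (\<lambda>v. \<eta> s v x)" for s x
    unfolding lin_def \<eta>_def
  proof (intro conjI ballI allI)
    fix v w assume "v \<in> carrier C" "w \<in> carrier C"
    then show "(\<Sum>i<r. \<alpha> (v \<oplus>\<^bsub>C\<^esub> w) i * \<eta>0 s i x) = (\<Sum>i<r. \<alpha> v i * \<eta>0 s i x) + (\<Sum>i<r. \<alpha> w i * \<eta>0 s i x)"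
      unfolding sum.distrib[symmetric] using ec
      by (intro sum.cong refl) (simp add: \<alpha>_def C.mult_r_distr C.lin_add[OF lin_q] distrib_right)
  next
    fix a v assume "v \<in> carrier C"
    then show "(\<Sum>i<r. \<alpha> (a \<odot>\<^bsub>C\<^esub> v) i * \<eta>0 s i x) = a * (\<Sum>i<r. \<alpha> v i * \<eta>0 s i x)"
      unfolding sum_distrib_left using ec
      by (intro sum.cong refl) (simp add: \<alpha>_def C.smult_mult_r C.lin_smult[OF lin_q])
  qed
  have close: "cmod (ip X (app X (\<rho> a) (\<eta> s v)) (\<eta> s w) - q (star C w \<otimes>\<^bsub>C\<^esub> (\<sigma> s a \<otimes>\<^bsub>C\<^esub> v))) < \<delta>"
    if vw: "v \<in> Y" "w \<in> Y" "a \<in> S" for s v w a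
  proof -
    have c: "v \<in> carrier C" "w \<in> carrier C" "\<sigma> s a \<in> carrier C" using vw Y S \<sigma>_simps(1) by auto
    have 1: "ip X (app X (\<rho> a) (\<eta> s v)) (\<eta> s w) = (\<Sum>j<r. \<Sum>i<r. \<alpha> v j * (cnj (\<alpha> w i) * ip X (app X (\<rho> a) (\<eta>0 s j)) (\<eta>0 s i)))"
      unfolding \<eta>_def by (simp add: app_sum app_scale ip_sum_left ip_sum_right ip_scale_left ip_scale_right sum_distrib_left)
    have 2: "q (star C w \<otimes>\<^bsub>C\<^esub> (\<sigma> s a \<otimes>\<^bsub>C\<^esub> v)) = (\<Sum>j<r. \<Sum>i<r. \<alpha> v j * (cnj (\<alpha> w i) * q (star C (e i) \<otimes>\<^bsub>C\<^esub> (\<sigma> s a \<otimes>\<^bsub>C\<^esub> e j))))"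
    proof -
      have "q (star C w \<otimes>\<^bsub>C\<^esub> (\<sigma> s a \<otimes>\<^bsub>C\<^esub> v)) = q (star C (star C (\<sigma> s a) \<otimes>\<^bsub>C\<^esub> w) \<otimes>\<^bsub>C\<^esub> v)"
        using c by (simp add: C.star_simps C.mult_assoc)
      also have "\<dots> = (\<Sum>j<r. \<alpha> v j * q (star C (star C (\<sigma> s a) \<otimes>\<^bsub>C\<^esub> w) \<otimes>\<^bsub>C\<^esub> e j))"
        unfolding \<alpha>_def by (rule complete[rule_format]) (use vw c in auto)
      also have "\<dots> = (\<Sum>j<r. \<alpha> v j * q (star C w \<otimes>\<^bsub>C\<^esub> (\<sigma> s a \<otimes>\<^bsub>C\<^esub> e j)))"
        using c ec by (intro sum.cong refl) (simp add: C.star_simps C.mult_assoc)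
      also have "\<dots> = (\<Sum>j<r. \<alpha> v j * (\<Sum>i<r. cnj (\<alpha> w i) * q (star C (e i) \<otimes>\<^bsub>C\<^esub> (\<sigma> s a \<otimes>\<^bsub>C\<^esub> e j))))"
      proof (intro sum.cong refl arg_cong[where f = "\<lambda>z. _ * z"])
        fix j assume "j \<in> {..<r}"
        then have u: "\<sigma> s a \<otimes>\<^bsub>C\<^esub> e j \<in> carrier C" using ec c by auto
        have "q (star C w \<otimes>\<^bsub>C\<^esub> (\<sigma> s a \<otimes>\<^bsub>C\<^esub> e j)) = cnj (q (star C (\<sigma> s a \<otimes>\<^bsub>C\<^esub> e j) \<otimes>\<^bsub>C\<^esub> w))" by (rule C.posf_swap[OF q c(2) u])
        also have "q (star C (\<sigma> s a \<otimes>\<^bsub>C\<^esub> e j) \<otimes>\<^bsub>C\<^esub> w) = (\<Sum>i<r. \<alpha> w i * q (star C (\<sigma> s a \<otimes>\<^bsub>C\<^esub> e j) \<otimes>\<^bsub>C\<^esub> e i))"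
          unfolding \<alpha>_def by (rule complete[rule_format]) (use vw u in auto)
        also have "cnj \<dots> = (\<Sum>i<r. cnj (\<alpha> w i) * q (star C (e i) \<otimes>\<^bsub>C\<^esub> (\<sigma> s a \<otimes>\<^bsub>C\<^esub> e j)))"
          unfolding cnj_sum using u ec by (intro sum.cong refl) (simp add: C.posf_swap[OF q _ u, symmetric])
        finally show "q (star C w \<otimes>\<^bsub>C\<^esub> (\<sigma> s a \<otimes>\<^bsub>C\<^esub> e j)) = (\<Sum>i<r. cnj (\<alpha> w i) * q (star C (e i) \<otimes>\<^bsub>C\<^esub> (\<sigma> s a \<otimes>\<^bsub>C\<^esub> e j)))" .
      qed
      finally show ?thesis by (simp only: sum_distrib_left)
    qed
    have "cmod (ip X (app X (\<rho> a) (\<eta> s v)) (\<eta> s w) - q (star C w \<otimes>\<^bsub>C\<^esub> (\<sigma> s a \<otimes>\<^bsub>C\<^esub> v))) =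
      cmod (\<Sum>j<r. \<Sum>i<r. \<alpha> v j * (cnj (\<alpha> w i) * (ip X (app X (\<rho> a) (\<eta>0 s j)) (\<eta>0 s i) - q (star C (e i) \<otimes>\<^bsub>C\<^esub> (\<sigma> s a \<otimes>\<^bsub>C\<^esub> e j)))))"
      unfolding 1 2 by (simp only: right_diff_distrib sum_subtractf)
    also have "\<dots> \<le> (\<Sum>j<r. \<Sum>i<r. cmod (\<alpha> v j) * (cmod (\<alpha> w i) * eps))"
    proof (rule order_trans[OF norm_sum], rule sum_mono, rule order_trans[OF norm_sum], rule sum_mono)
      fix j i assume "j \<in> {..<r}" "i \<in> {..<r}"
      then have "cmod (ip X (app X (\<rho> a) (\<eta>0 s j)) (\<eta>0 s i) - q (star C (e i) \<otimes>\<^bsub>C\<^esub> (\<sigma> s a \<otimes>\<^bsub>C\<^esub> e j))) < eps"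
        using near vw(3) by blast
      then show "cmod (\<alpha> v j * (cnj (\<alpha> w i) * (ip X (app X (\<rho> a) (\<eta>0 s j)) (\<eta>0 s i) - q (star C (e i) \<otimes>\<^bsub>C\<^esub> (\<sigma> s a \<otimes>\<^bsub>C\<^esub> e j))))) \<le> cmod (\<alpha> v j) * (cmod (\<alpha> w i) * eps)"
        unfolding norm_mult complex_mod_cnj by (intro mult_left_mono) auto
    qed
    also have "\<dots> = (\<Sum>j<r. cmod (\<alpha> v j)) * (\<Sum>i<r. cmod (\<alpha> w i)) * eps"
      unfolding sum_product by (simp add: sum_distrib_right mult.assoc)
    also have "\<dots> \<le> M * M * eps"
      using \<alpha>sum[OF vw(1)] \<alpha>sum[OF vw(2)] M0 eps by (intro mult_right_mono mult_mono) (auto intro: sum_nonneg)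
    also have "\<dots> \<le> K * eps" using M0 eps by (intro mult_right_mono) (auto simp: K_def)
    finally show ?thesis using Keps by simp
  qed
  have exch: "nrm X (\<lambda>x. app X c (\<eta> s v) x - \<eta> (\<not> s) v x) < \<delta>" if v: "v \<in> Y" for s v
  proof -
    have \<eta>ip: "ip X (\<eta> s v) (\<eta>0 t i) = (\<Sum>j<r. \<alpha> v j * ip X (\<eta>0 s j) (\<eta>0 t i))" for t i
      unfolding \<eta>_def by (simp add: ip_sum_left ip_scale_left)
    have zero: "ip X (\<eta> s v) (\<eta>0 (\<not> s) i) = 0" if "i < r" for i
      unfolding \<eta>ip using cross[OF that, of _ s "\<not> s"] by (intro sum.neutral ballI) simp
    have "app X c (\<eta> s v) x = (\<Sum>i<r. complex_of_real \<beta> * ip X (\<eta> s v) (\<eta>0 s i) * \<eta>0 (\<not> s) i x)" for x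
      unfolding capp J_def sum.cartesian_product' 
      by (cases s) (use zero in \<open>auto simp: UNIV_bool \<kappa>_def \<tau>_def intro!: sum.cong\<close>)
    then have "(\<lambda>x. app X c (\<eta> s v) x - \<eta> (\<not> s) v x) = (\<lambda>x. \<Sum>i<r. (complex_of_real \<beta> * ip X (\<eta> s v) (\<eta>0 s i) - \<alpha> v i) * \<eta>0 (\<not> s) i x)"
      by (simp add: \<eta>_def sum_subtractf left_diff_distrib)
    then have "nrm X (\<lambda>x. app X c (\<eta> s v) x - \<eta> (\<not> s) v x) \<le> (\<Sum>i<r. nrm X (\<lambda>x. (complex_of_real \<beta> * ip X (\<eta> s v) (\<eta>0 s i) - \<alpha> v i) * \<eta>0 (\<not> s) i x))"
      using nrm_sum[of "{..<r}" X "\<lambda>i x. (complex_of_real \<beta> * ip X (\<eta> s v) (\<eta>0 s i) - \<alpha> v i) * \<eta>0 (\<not> s) i x"] by simp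
    also have "\<dots> \<le> (\<Sum>i<r. ((M + 2 * real r * M) * eps) * 2)"
    proof (rule sum_mono)
      fix i assume "i \<in> {..<r}"
      then have i: "i < r" by simp
      have "ip X (\<eta> s v) (\<eta>0 s i) - \<alpha> v i = (\<Sum>j<r. \<alpha> v j * (ip X (\<eta>0 s j) (\<eta>0 s i) - (if j = i then 1 else 0)))"
      proof -
        have "(\<Sum>j<r. \<alpha> v j * (if j = i then 1 else 0)) = \<alpha> v i" using i by (simp add: if_distrib[of "\<lambda>t. _ * t"] cong: if_cong)
        then show ?thesis unfolding \<eta>ip right_diff_distrib sum_subtractf by simp
      qed
      then have "cmod (ip X (\<eta> s v) (\<eta>0 s i) - \<alpha> v i) \<le> (\<Sum>j<r. cmod (\<alpha> v j * (ip X (\<eta>0 s j) (\<eta>0 s i) - (if j = i then 1 else 0))))"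
        by (metis norm_sum)
      also have "\<dots> \<le> (\<Sum>j<r. cmod (\<alpha> v j) * eps)"
        unfolding norm_mult using gram[OF i] by (intro sum_mono mult_left_mono) auto
      also have "\<dots> \<le> M * eps" unfolding sum_distrib_right[symmetric] using \<alpha>sum[OF v] eps by (intro mult_right_mono) auto
      finally have g: "cmod (ip X (\<eta> s v) (\<eta>0 s i) - \<alpha> v i) \<le> M * eps" .
      have "complex_of_real \<beta> * ip X (\<eta> s v) (\<eta>0 s i) - \<alpha> v i = complex_of_real \<beta> * (ip X (\<eta> s v) (\<eta>0 s i) - \<alpha> v i) - complex_of_real (1 - \<beta>) * \<alpha> v i"
        by (simp add: algebra_simps)
      then have "cmod (complex_of_real \<beta> * ip X (\<eta> s v) (\<eta>0 s i) - \<alpha> v i) \<le> cmod (complex_of_real \<beta> * (ip X (\<eta> s v) (\<eta>0 s i) - \<alpha> v i)) + cmod (complex_of_real (1 - \<beta>) * \<alpha> v i)"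
        by (metis norm_triangle_ineq4)
      also have "\<dots> = \<beta> * cmod (ip X (\<eta> s v) (\<eta>0 s i) - \<alpha> v i) + (1 - \<beta>) * cmod (\<alpha> v i)"
        unfolding norm_mult norm_of_real using \<beta> by simp
      also have "\<dots> \<le> 1 * (M * eps) + (2 * real r * eps) * M"
        using g \<beta> \<beta>' \<alpha>M[OF v i] M0 eps by (intro add_mono mult_mono) auto
      also have "\<dots> = (M + 2 * real r * M) * eps" by (simp add: algebra_simps)
      finally have coef: "cmod (complex_of_real \<beta> * ip X (\<eta> s v) (\<eta>0 s i) - \<alpha> v i) \<le> (M + 2 * real r * M) * eps" .
      have "cmod (ip X (\<eta>0 (\<not> s) i) (\<eta>0 (\<not> s) i)) \<le> cmod (ip X (\<eta>0 (\<not> s) i) (\<eta>0 (\<not> s) i) - 1) + cmod 1"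
        by (metis diff_add_cancel norm_triangle_ineq)
      moreover have "cmod (ip X (\<eta>0 (\<not> s) i) (\<eta>0 (\<not> s) i)) = (nrm X (\<eta>0 (\<not> s) i))\<^sup>2" by (simp only: ip_self norm_of_real) simp
      ultimately have "(nrm X (\<eta>0 (\<not> s) i))\<^sup>2 \<le> 2\<^sup>2" using gram[OF i i, of "\<not> s"] eps(2) by simp
      then have n2: "nrm X (\<eta>0 (\<not> s) i) \<le> 2" by (rule power2_le_imp_le) simp
      show "nrm X (\<lambda>x. (complex_of_real \<beta> * ip X (\<eta> s v) (\<eta>0 s i) - \<alpha> v i) * \<eta>0 (\<not> s) i x) \<le> ((M + 2 * real r * M) * eps) * 2"
        unfolding nrm_scale using coef n2 M0 eps by (intro mult_mono) auto
    qed
    also have "\<dots> = (2 * real r * (M + 2 * real r * M)) * eps" by simp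
    also have "\<dots> \<le> K * eps" using M0 eps by (intro mult_right_mono) (auto simp: K_def)
    finally show ?thesis using Keps by simp
  qed
  have "self_adjoint (mats X) P" "self_adjoint (mats X) c" using P cc cstar by (auto simp: self_adjoint_def)
  then show ?thesis
    by - (rule exI[of _ X], rule exI[of _ \<rho>], rule exI[of _ P], rule exI[of _ c], rule exI[of _ \<eta>],
      intro conjI allI impI ballI, simp_all add: X \<rho> P(3,4) copn anti \<eta>v \<eta>lin close exch)
qed

end

section \<open>Norm identities for matrices applied to vectors\<close>

lemma app_one_restrict:
  assumes "finite X" shows "app X \<one>\<^bsub>mats X\<^esub> v = (\<lambda>x. if x \<in> X then v x else 0)"
proof
  fix x
  have "app X \<one>\<^bsub>mats X\<^esub> v x = (\<Sum>y\<in>X. if y = x then (if x \<in> X then v x else 0) else 0)"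
    unfolding app_def by (intro sum.cong refl) (auto simp: mats_simps)
  then show "app X \<one>\<^bsub>mats X\<^esub> v x = (if x \<in> X then v x else 0)" using assms by simp
qed

lemma ip_app_one: "finite X \<Longrightarrow> ip X (app X \<one>\<^bsub>mats X\<^esub> v) w = ip X v w"
  unfolding ip_def by (intro sum.cong refl) (simp add: app_one_restrict)

lemma nrm_app_power2:
  "complex_of_real ((nrm X (app X M v))\<^sup>2) = ip X (app X (star (mats X) M \<otimes>\<^bsub>mats X\<^esub> M) v) v"
proof -
  have "complex_of_real ((nrm X (app X M v))\<^sup>2) = ip X v (app X (star (mats X) M \<otimes>\<^bsub>mats X\<^esub> M) v)"
    unfolding ip_self[symmetric] app_ring by (rule app_adjoint)
  also have "\<dots> = cnj (ip X (app X (star (mats X) M \<otimes>\<^bsub>mats X\<^esub> M) v) v)" by (rule ip_swap)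
  finally show ?thesis by (metis complex_cnj_cnj complex_cnj_complex_of_real)
qed

lemma nrm_app_symmetry:
  assumes "finite X" "self_adjoint (mats X) W" "W \<otimes>\<^bsub>mats X\<^esub> W = \<one>\<^bsub>mats X\<^esub>"
  shows "nrm X (app X W v) = nrm X v"
proof -
  have W: "star (mats X) W = W" using assms(2) by (simp add: self_adjoint_def)
  have "complex_of_real ((nrm X (app X W v))\<^sup>2) = complex_of_real ((nrm X v)\<^sup>2)"
    unfolding nrm_app_power2 W assms(3) ip_app_one[OF assms(1)] ip_self ..
  then show ?thesis by (simp only: of_real_eq_iff) simp
qed

lemma lin_app: "lin (mats X) (\<lambda>M. app X M v x)"
  by (simp add: lin_def app_ring)

lemma lin_ent: "lin (mats X) (\<lambda>M. ent M x y)"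
  by (simp add: lin_def mats_simps)

section \<open>Symmetries commuting with the amalgamated subalgebra\<close>

text \<open>The algebra structure of \<open>D\<close> is carried by the finite system
  \<open>d\<close>: the sum of the \<open>d j star (d j)\<close> is 1, and multiplying the
  \<open>d j\<close> from the left or the \<open>star (d k)\<close> from the right by an element of
  \<open>D\<close> mixes them with the same coefficients.\<close>

locale amalgamated_pair = representation_pair +
  fixes D :: "'a set" and N :: nat and d :: "nat \<Rightarrow> 'a"
  assumes D: "D \<subseteq> carrier A" and d: "\<And>j. j < N \<Longrightarrow> d j \<in> D"
    and agree: "\<And>x. x \<in> D \<Longrightarrow> \<sigma> True x = \<sigma> False x"
    and d_one: "\<And>g. lin A g \<Longrightarrow> (\<Sum>j<N. g (d j \<otimes>\<^bsub>A\<^esub> star A (d j))) = g \<one>\<^bsub>A\<^esub>"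
    and d_commute: "\<And>x. x \<in> D \<Longrightarrow> \<exists>l. \<forall>g. lin A g \<longrightarrow> (\<forall>j<N. g (x \<otimes>\<^bsub>A\<^esub> d j) = (\<Sum>k<N. l k j * g (d k))) \<and>
        (\<forall>k<N. g (star A (d k) \<otimes>\<^bsub>A\<^esub> x) = (\<Sum>j<N. l k j * g (star A (d j))))"
begin

text \<open>The matrix \<open>\<Sum> \<rho> (d j) c \<rho> (star (d j))\<close> applied to
  \<open>v\<close>. It is defined on vectors because the limit argument follows it term by term
  there.\<close>

definition average :: "nat set \<Rightarrow> ('a \<Rightarrow> seq) \<Rightarrow> seq \<Rightarrow> seq \<Rightarrow> seq" where
  "average X \<rho> c v = (\<lambda>x. \<Sum>j<N. app X (\<rho> (d j)) (app X c (app X (\<rho> (star A (d j))) v)) x)"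

text \<open>The average \<open>b\<close> is a contraction, by Cauchy-Schwarz over \<open>j\<close>
  and \<open>\<Sum> |\<rho> (star (d j)) v|^2 = |v|^2\<close>. It commutes with
  \<open>\<rho> D\<close> by \<open>d_commute\<close>, and it still anticommutes with
  \<open>P\<close>, which commutes with all of \<open>\<rho> A\<close>. Its dilation is
  \<open>W = b + P s\<close> with \<open>s^2 = 1 - b^2\<close>, so the last identity reads
  \<open>|P s v|^2 = |v|^2 - |b v|^2\<close>.\<close>

lemma commuting_symmetry:
  assumes X: "finite X" and \<rho>: "\<rho> \<in> star_hom A (mats X)" "\<rho> \<one>\<^bsub>A\<^esub> = \<one>\<^bsub>mats X\<^esub>"
    and P: "self_adjoint (mats X) P" "P \<otimes>\<^bsub>mats X\<^esub> P = \<one>\<^bsub>mats X\<^esub>" "\<And>a. a \<in> carrier A \<Longrightarrow> P \<otimes>\<^bsub>mats X\<^esub> \<rho> a = \<rho> a \<otimes>\<^bsub>mats X\<^esub> P"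
    and c: "self_adjoint (mats X) c" "opn X c \<le> 1" "P \<otimes>\<^bsub>mats X\<^esub> c = \<ominus>\<^bsub>mats X\<^esub> (c \<otimes>\<^bsub>mats X\<^esub> P)"
  shows "\<exists>W. self_adjoint (mats X) W \<and> W \<otimes>\<^bsub>mats X\<^esub> W = \<one>\<^bsub>mats X\<^esub> \<and>
     (\<forall>x\<in>D. \<rho> x \<otimes>\<^bsub>mats X\<^esub> W = W \<otimes>\<^bsub>mats X\<^esub> \<rho> x) \<and>
     (\<forall>v. (nrm X (\<lambda>x. app X W v x - average X \<rho> c v x))\<^sup>2 = (nrm X v)\<^sup>2 - (nrm X (average X \<rho> c v))\<^sup>2)"
proof -
  interpret MX: unital_cstar_algebra "mats X" by (rule unital_cstar_algebra_mats[OF X])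
  let ?m = "\<lambda>x y. x \<otimes>\<^bsub>mats X\<^esub> y"
  note h = star_homD[OF \<rho>(1)]
  have cc: "c \<in> carrier (mats X)" "star (mats X) c = c" and Pc: "P \<in> carrier (mats X)" "star (mats X) P = P"
    using c P by (auto simp: self_adjoint_def)
  have dc: "d j \<in> carrier A" if "j < N" for j using d[OF that] D by blast
  have \<rho>d: "\<rho> (d j) \<in> carrier (mats X)" "\<rho> (star A (d j)) \<in> carrier (mats X)" "star (mats X) (\<rho> (d j)) = \<rho> (star A (d j))"
    "star (mats X) (\<rho> (star A (d j))) = \<rho> (d j)" if "j < N" for j
    using dc[OF that] h by (auto simp: A.star_star simp flip: h(5))
  define T where "T j = ?m (\<rho> (d j)) (?m c (\<rho> (star A (d j))))" for j
  have Tc: "T \<in> {..<N} \<rightarrow> carrier (mats X)" using \<rho>d cc by (auto simp: T_def)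
  define b where "b = (\<Oplus>\<^bsub>mats X\<^esub>j\<in>{..<N}. T j)"
  have bc: "b \<in> carrier (mats X)" unfolding b_def using Tc by (rule MX.M.finsum_closed)
  have gb: "g b = (\<Sum>j<N. g (T j))" if "lin (mats X) g" for g unfolding b_def by (rule MX.lin_finsum[OF that _ Tc]) simp
  have bapp: "app X b v = average X \<rho> c v" for v
    using gb[OF lin_app] by (auto simp: average_def T_def app_ring)
  have bstar: "star (mats X) b = b"
  proof (rule ent_eqI)
    fix x y
    have "ent (star (mats X) b) x y = (\<Sum>j<N. ent (star (mats X) (T j)) x y)"
      using gb[OF lin_ent, of y x] by (simp add: mats_simps)
    also have "\<dots> = (\<Sum>j<N. ent (T j) x y)"
      using \<rho>d cc by (intro sum.cong refl) (simp add: T_def MX.star_simps MX.mult_assoc)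
    finally show "ent (star (mats X) b) x y = ent b x y" using gb[OF lin_ent, of x y] by simp
  qed
  have sumnrm: "(\<Sum>j<N. (nrm X (app X (\<rho> (star A (d j))) v))\<^sup>2) = (nrm X v)\<^sup>2" for v
  proof -
    have "complex_of_real (\<Sum>j<N. (nrm X (app X (\<rho> (star A (d j))) v))\<^sup>2) = (\<Sum>j<N. ip X (app X (\<rho> (d j \<otimes>\<^bsub>A\<^esub> star A (d j))) v) v)"
      unfolding of_real_sum nrm_app_power2 by (intro sum.cong refl) (simp add: \<rho>d dc h(4))
    also have "\<dots> = ip X (app X (\<rho> \<one>\<^bsub>A\<^esub>) v) v"
    proof (rule d_one)
      have "lin (mats X) (\<lambda>M. ip X (app X M v) v)" by (simp add: lin_def app_ring ip_add_left ip_scale_left)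
      then show "lin A (\<lambda>a. ip X (app X (\<rho> a) v) v)" by (rule star_hom_lin[OF A.cstar_algebra_axioms \<rho>(1)])
    qed
    also have "\<dots> = complex_of_real ((nrm X v)\<^sup>2)" by (simp only: \<rho>(2) ip_app_one[OF X] ip_self)
    finally show ?thesis by (simp only: of_real_eq_iff)
  qed
  have bopn: "opn X b \<le> 1"
  proof (rule opn_least)
    fix v
    define w where "w = app X b v"
    have "ip X w w = (\<Sum>j<N. ip X (app X (\<rho> (d j)) (app X c (app X (\<rho> (star A (d j))) v))) w)"
      by (subst (1) w_def) (simp add: bapp average_def ip_sum_left)
    also have "\<dots> = (\<Sum>j<N. ip X (app X c (app X (\<rho> (star A (d j))) v)) (app X (\<rho> (star A (d j))) w))"
      using \<rho>d(3) by (intro sum.cong refl) (subst app_adjoint, simp)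
    finally have "cmod (ip X w w) \<le> (\<Sum>j<N. \<bar>nrm X (app X (\<rho> (star A (d j))) v)\<bar> * \<bar>nrm X (app X (\<rho> (star A (d j))) w)\<bar>)"
    proof (simp only:, intro order_trans[OF norm_sum] sum_mono)
      fix j
      have "cmod (ip X (app X c (app X (\<rho> (star A (d j))) v)) (app X (\<rho> (star A (d j))) w)) \<le> nrm X (app X c (app X (\<rho> (star A (d j))) v)) * nrm X (app X (\<rho> (star A (d j))) w)"
        by (rule ip_bound)
      also have "\<dots> \<le> (1 * nrm X (app X (\<rho> (star A (d j))) v)) * nrm X (app X (\<rho> (star A (d j))) w)"
        using order_trans[OF opn_bound[OF X, of c "app X (\<rho> (star A (d j))) v"] mult_right_mono[OF c(2) nrm_nonneg]] by (intro mult_right_mono) auto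
      finally show "cmod (ip X (app X c (app X (\<rho> (star A (d j))) v)) (app X (\<rho> (star A (d j))) w)) \<le> \<bar>nrm X (app X (\<rho> (star A (d j))) v)\<bar> * \<bar>nrm X (app X (\<rho> (star A (d j))) w)\<bar>" by simp
    qed
    also have "\<dots> \<le> L2_set (\<lambda>j. nrm X (app X (\<rho> (star A (d j))) v)) {..<N} * L2_set (\<lambda>j. nrm X (app X (\<rho> (star A (d j))) w)) {..<N}"
      by (rule L2_set_mult_ineq)
    also have "\<dots> = nrm X v * nrm X w" unfolding L2_set_def sumnrm by simp
    finally have "nrm X w * nrm X w \<le> nrm X v * nrm X w" by (simp only: ip_self norm_of_real) (simp add: power2_eq_square)
    then have "nrm X w \<le> nrm X v" using nrm_nonneg[of X w] nrm_nonneg[of X v] by (cases "nrm X w = 0") (auto simp: mult_le_cancel_right)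
    then show "nrm X (app X b v) \<le> 1 * nrm X v" by (simp add: w_def)
  qed simp
  \<comment> \<open>Multiplication by \<open>\<rho> x\<close> on the left mixes the first factors
    with the coefficients \<open>l k j\<close>; summed over \<open>j\<close> instead, the same
    coefficients mix the last factors, which is multiplication on the right.\<close>
  have bD: "?m (\<rho> x) b = ?m b (\<rho> x)" if x: "x \<in> D" for x
  proof (rule MX.lin_eqI)
    have xc: "x \<in> carrier A" "\<rho> x \<in> carrier (mats X)" using x D h by auto
    then show "?m (\<rho> x) b \<in> carrier (mats X)" "?m b (\<rho> x) \<in> carrier (mats X)" using bc by auto
    obtain l where l: "\<And>g j. lin A g \<Longrightarrow> j < N \<Longrightarrow> g (x \<otimes>\<^bsub>A\<^esub> d j) = (\<Sum>k<N. l k j * g (d k))"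
      "\<And>g k. lin A g \<Longrightarrow> k < N \<Longrightarrow> g (star A (d k) \<otimes>\<^bsub>A\<^esub> x) = (\<Sum>j<N. l k j * g (star A (d j)))"
      using d_commute[OF x] by blast
    fix g assume g: "lin (mats X) g"
    have "g (?m (\<rho> x) b) = (\<Sum>j<N. g (?m (\<rho> x) (T j)))" using gb[OF MX.lin_mult_l[OF g xc(2)]] .
    also have "\<dots> = (\<Sum>j<N. \<Sum>k<N. l k j * g (?m (\<rho> (d k)) (?m c (\<rho> (star A (d j))))))"
    proof (intro sum.cong refl)
      fix j assume "j \<in> {..<N}"
      then have j: "j < N" by simp
      have "lin A (\<lambda>a. g (?m (\<rho> a) (?m c (\<rho> (star A (d j))))))"
        using \<rho>d[OF j] cc by (intro star_hom_lin[OF A.cstar_algebra_axioms \<rho>(1)] MX.lin_mult_r[OF g]) auto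
      then have "g (?m (\<rho> (x \<otimes>\<^bsub>A\<^esub> d j)) (?m c (\<rho> (star A (d j))))) = (\<Sum>k<N. l k j * g (?m (\<rho> (d k)) (?m c (\<rho> (star A (d j))))))"
        using l(1)[of "\<lambda>a. g (?m (\<rho> a) (?m c (\<rho> (star A (d j)))))" j] j by blast
      then show "g (?m (\<rho> x) (T j)) = (\<Sum>k<N. l k j * g (?m (\<rho> (d k)) (?m c (\<rho> (star A (d j))))))"
        using \<rho>d[OF j] cc xc dc[OF j] by (simp add: T_def h(4) MX.mult_assoc)
    qed
    also have "\<dots> = (\<Sum>k<N. \<Sum>j<N. l k j * g (?m (\<rho> (d k)) (?m c (\<rho> (star A (d j))))))" by (rule sum.swap)
    also have "\<dots> = (\<Sum>k<N. g (?m (T k) (\<rho> x)))"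
    proof (intro sum.cong refl)
      fix k assume "k \<in> {..<N}"
      then have k: "k < N" by simp
      have "lin A (\<lambda>a. g (?m (\<rho> (d k)) (?m c (\<rho> a))))"
        using \<rho>d[OF k] cc by (intro star_hom_lin[OF A.cstar_algebra_axioms \<rho>(1), of "\<lambda>M. g (?m (\<rho> (d k)) (?m c M))"] MX.lin_mult_l MX.lin_mult_l[OF g]) auto
      then have "g (?m (\<rho> (d k)) (?m c (\<rho> (star A (d k) \<otimes>\<^bsub>A\<^esub> x)))) = (\<Sum>j<N. l k j * g (?m (\<rho> (d k)) (?m c (\<rho> (star A (d j))))))"
        using l(2)[of "\<lambda>a. g (?m (\<rho> (d k)) (?m c (\<rho> a)))" k] k by blast
      then show "(\<Sum>j<N. l k j * g (?m (\<rho> (d k)) (?m c (\<rho> (star A (d j)))))) = g (?m (T k) (\<rho> x))"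
        using \<rho>d[OF k] cc xc dc[OF k] by (simp add: T_def h(4) MX.mult_assoc)
    qed
    also have "\<dots> = g (?m b (\<rho> x))" using gb[OF MX.lin_mult_r[OF g xc(2)]] by simp
    finally show "g (?m (\<rho> x) b) = g (?m b (\<rho> x))" .
  qed
  have Pb: "?m P b = \<ominus>\<^bsub>mats X\<^esub> (?m b P)"
  proof (rule MX.lin_eqI)
    fix g assume g: "lin (mats X) g"
    have PT: "?m P (T j) = \<ominus>\<^bsub>mats X\<^esub> (?m (T j) P)" if j: "j < N" for j
    proof -
      have "?m P (T j) = ?m (?m P (\<rho> (d j))) (?m c (\<rho> (star A (d j))))" using \<rho>d[OF j] cc Pc by (simp add: T_def MX.mult_assoc)
      also have "\<dots> = ?m (\<rho> (d j)) (?m (?m P c) (\<rho> (star A (d j))))" using \<rho>d[OF j] cc Pc dc[OF j] by (simp add: P(3) MX.mult_assoc)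
      also have "\<dots> = \<ominus>\<^bsub>mats X\<^esub> (?m (\<rho> (d j)) (?m c (?m P (\<rho> (star A (d j))))))"
        unfolding c(3) using \<rho>d[OF j] cc Pc by (simp add: MX.a_inv_mult_l MX.a_inv_mult_r MX.mult_assoc)
      also have "\<dots> = \<ominus>\<^bsub>mats X\<^esub> (?m (T j) P)" using \<rho>d[OF j] cc Pc dc[OF j] by (simp add: T_def P(3) MX.mult_assoc)
      finally show ?thesis .
    qed
    have "g (?m P b) = (\<Sum>j<N. g (?m P (T j)))" using gb[OF MX.lin_mult_l[OF g Pc(1)]] .
    also have "\<dots> = (\<Sum>j<N. - g (?m (T j) P))" using Tc Pc by (intro sum.cong refl) (simp add: PT Pi_iff MX.lin_a_inv[OF g])
    also have "\<dots> = - g (?m b P)" using gb[OF MX.lin_mult_r[OF g Pc(1)]] by (simp add: sum_negf)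
    finally show "g (?m P b) = g (\<ominus>\<^bsub>mats X\<^esub> (?m b P))" using bc Pc by (simp add: MX.lin_a_inv[OF g])
  qed (use bc Pc in auto)
  have bsa: "self_adjoint (mats X) b" using bc bstar by (simp add: self_adjoint_def)
  obtain s W where s: "self_adjoint (mats X) s" "?m s s = \<one>\<^bsub>mats X\<^esub> \<ominus>\<^bsub>mats X\<^esub> ?m b b" and W: "W = b \<oplus>\<^bsub>mats X\<^esub> ?m P s"
    "self_adjoint (mats X) W" "?m W W = \<one>\<^bsub>mats X\<^esub>"
    "\<forall>z\<in>carrier (mats X). ?m z b = ?m b z \<longrightarrow> ?m z P = ?m P z \<longrightarrow> ?m z W = ?m W z"
    using MX.symmetry_dilation[OF bsa _ P(1,2) Pb] bopn by (auto simp: mats_simps(8))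
  have "(nrm X (\<lambda>x. app X W v x - average X \<rho> c v x))\<^sup>2 = (nrm X v)\<^sup>2 - (nrm X (average X \<rho> c v))\<^sup>2" for v
  proof -
    have "(\<lambda>x. app X W v x - average X \<rho> c v x) = app X P (app X s v)"
      unfolding W(1) by (simp add: app_ring bapp)
    then have 1: "nrm X (\<lambda>x. app X W v x - average X \<rho> c v x) = nrm X (app X s v)"
      using nrm_app_symmetry[OF X P(1,2)] by simp
    have "\<one>\<^bsub>mats X\<^esub> \<ominus>\<^bsub>mats X\<^esub> ?m b b = \<one>\<^bsub>mats X\<^esub> \<oplus>\<^bsub>mats X\<^esub> (-1) \<odot>\<^bsub>mats X\<^esub> ?m b b" using bc by (simp add: a_minus_def MX.smult_m1)
    then have "complex_of_real ((nrm X (app X s v))\<^sup>2) = ip X (app X \<one>\<^bsub>mats X\<^esub> v) v - ip X (app X (?m b b) v) v"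
      unfolding nrm_app_power2 using s by (simp add: self_adjoint_def app_ring(1,2) ip_add_left ip_diff_left ip_scale_left[of X "-1", simplified])
    also have "ip X (app X (?m b b) v) v = complex_of_real ((nrm X (app X b v))\<^sup>2)" unfolding nrm_app_power2 bstar ..
    finally have "complex_of_real ((nrm X (app X s v))\<^sup>2) = complex_of_real ((nrm X v)\<^sup>2 - (nrm X (app X b v))\<^sup>2)"
      by (simp only: ip_app_one[OF X] ip_self of_real_diff)
    then show ?thesis unfolding 1 bapp by (simp only: of_real_eq_iff)
  qed
  moreover have "?m (\<rho> x) W = ?m W (\<rho> x)" if "x \<in> D" for x
  proof -
    have "x \<in> carrier A" "\<rho> x \<in> carrier (mats X)" using that D h by auto
    then show ?thesis using W(4) bD[OF that] P(3)[of x] by simp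
  qed
  ultimately show ?thesis using W(2,3) by blast
qed

end

section \<open>The limit of the approximating models\<close>

lemma tendsto_zero_le:
  fixes f g :: "'z \<Rightarrow> real"
  assumes "(g \<longlongrightarrow> 0) F" "\<And>z. 0 \<le> f z" "\<And>z. f z \<le> g z"
  shows "(f \<longlongrightarrow> 0) F"
  by (rule real_tendsto_sandwich[OF _ _ tendsto_const assms(1)]) (simp_all add: assms(2,3))

context cstar_algebra
begin

lemma closedin_norm_topologyI:
  assumes "S \<subseteq> carrier A" "\<And>x. x \<in> carrier A \<Longrightarrow> (\<And>e. e > 0 \<Longrightarrow> \<exists>y\<in>S. cnorm A (x \<ominus> y) < e) \<Longrightarrow> x \<in> S"
  shows "closedin (norm_topology A) S"
proof -
  interpret Ms: Metric_space "carrier A" "cdist A" by (rule Metric_space)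
  show ?thesis unfolding norm_topology_def Ms.closedin_metric
  proof (intro conjI allI impI assms(1))
    fix x assume x: "x \<in> carrier A - S"
    then obtain e where e: "e > 0" "\<forall>y\<in>S. \<not> cnorm A (x \<ominus> y) < e" using assms(2)[of x] by blast
    then have "disjnt S (Ms.mball x e)" using x assms(1) by (auto simp: disjnt_iff Ms.in_mball cdist_def)
    then show "\<exists>r>0. disjnt S (Ms.mball x r)" using e(1) by blast
  qed
qed

lemma cstar_subalgebraI:
  assumes "S \<subseteq> carrier A" "\<zero> \<in> S" "\<And>x y. x \<in> S \<Longrightarrow> y \<in> S \<Longrightarrow> x \<oplus> y \<in> S" "\<And>c x. x \<in> S \<Longrightarrow> c \<odot> x \<in> S"
    "\<And>x y. x \<in> S \<Longrightarrow> y \<in> S \<Longrightarrow> x \<otimes> y \<in> S" "\<And>x. x \<in> S \<Longrightarrow> star A x \<in> S"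
    "\<And>x. x \<in> carrier A \<Longrightarrow> (\<And>e. e > 0 \<Longrightarrow> \<exists>y\<in>S. cnorm A (x \<ominus> y) < e) \<Longrightarrow> x \<in> S"
  shows "cstar_subalgebra S A"
proof -
  have "\<ominus> x \<in> S" if "x \<in> S" for x using assms(4)[OF that, of "-1"] smult_m1[of x] that assms(1) by auto
  then have "submodule S complex_ring A" using assms by (intro submoduleI) auto
  moreover have "closedin (norm_topology A) S"
  proof (rule closedin_norm_topologyI[OF assms(1)])
    fix x assume "x \<in> carrier A" "\<And>e. e > 0 \<Longrightarrow> \<exists>y\<in>S. cnorm A (x \<ominus> y) < e"
    then show "x \<in> S" by (rule assms(7))
  qed
  ultimately show ?thesis unfolding cstar_subalgebra_def by (simp add: assms(5,6))
qed

end

text \<open>Along a filter the models control all elements and vectors simultaneously, in the limit.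
  \<open>\<eta> z s v\<close> stands for the GNS class of \<open>v\<close>, on the part of the model
  that imitates the action \<open>\<sigma> s\<close>; \<open>R z\<close> is the resulting
  representation of \<open>C\<close>.\<close>

locale approximating_net = amalgamated_pair A C \<sigma> q D N d
  for A :: "'a cstar" and C :: "'c cstar" and \<sigma> q D N d +
  fixes F :: "'z filter" and X :: "'z \<Rightarrow> nat set" and \<rho> :: "'z \<Rightarrow> 'a \<Rightarrow> seq" and c :: "'z \<Rightarrow> seq"
    and \<eta> :: "'z \<Rightarrow> bool \<Rightarrow> 'c \<Rightarrow> seq" and W :: "'z \<Rightarrow> seq" and R :: "'z \<Rightarrow> 'c \<Rightarrow> seq"
  assumes F: "F \<noteq> bot" and X: "finite (X z)" and \<rho>: "\<rho> z \<in> star_hom A (mats (X z))" "\<rho> z \<one>\<^bsub>A\<^esub> = \<one>\<^bsub>mats (X z)\<^esub>"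
    and c: "opn (X z) (c z) \<le> 1" and \<eta>_lin: "lin C (\<lambda>v. \<eta> z s v x)"
    and close: "\<lbrakk>a \<in> carrier A; v \<in> carrier C; w \<in> carrier C\<rbrakk> \<Longrightarrow>
      ((\<lambda>z. ip (X z) (app (X z) (\<rho> z a) (\<eta> z s v)) (\<eta> z s w)) \<longlongrightarrow> q (star C w \<otimes>\<^bsub>C\<^esub> (\<sigma> s a \<otimes>\<^bsub>C\<^esub> v))) F"
    and exchange: "v \<in> carrier C \<Longrightarrow> ((\<lambda>z. nrm (X z) (\<lambda>x. app (X z) (c z) (\<eta> z s v) x - \<eta> z (\<not> s) v x)) \<longlongrightarrow> 0) F"
    and W: "self_adjoint (mats (X z)) (W z)" "W z \<otimes>\<^bsub>mats (X z)\<^esub> W z = \<one>\<^bsub>mats (X z)\<^esub>"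
      "(nrm (X z) (\<lambda>x. app (X z) (W z) u x - average (X z) (\<rho> z) (c z) u x))\<^sup>2 = (nrm (X z) u)\<^sup>2 - (nrm (X z) (average (X z) (\<rho> z) (c z) u))\<^sup>2"
    and R: "R z \<in> star_hom C (mats (X z))"
      "a \<in> carrier A \<Longrightarrow> R z (\<sigma> True a) = \<rho> z a"
      "a \<in> carrier A \<Longrightarrow> R z (\<sigma> False a) = W z \<otimes>\<^bsub>mats (X z)\<^esub> (\<rho> z a \<otimes>\<^bsub>mats (X z)\<^esub> W z)"
begin

lemma app_\<rho>_bound: "a \<in> carrier A \<Longrightarrow> nrm (X z) (app (X z) (\<rho> z a) v) \<le> cnorm A a * nrm (X z) v"
proof -
  assume a: "a \<in> carrier A"
  have "opn (X z) (\<rho> z a) \<le> cnorm A a"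
    using star_hom_contractive[OF A.unital_cstar_algebra_axioms unital_cstar_algebra_mats[OF X] \<rho> a] by (simp add: mats_simps(8))
  then show ?thesis using order_trans[OF opn_bound[OF X] mult_right_mono] by simp
qed

lemma app_c_bound: "nrm (X z) (app (X z) (c z) v) \<le> nrm (X z) v"
  using order_trans[OF opn_bound[OF X] mult_right_mono[OF c nrm_nonneg]] by simp

lemma nrm_\<eta>_power2: "v \<in> carrier C \<Longrightarrow> ((\<lambda>z. (nrm (X z) (\<eta> z s v))\<^sup>2) \<longlongrightarrow> Re (q (star C v \<otimes>\<^bsub>C\<^esub> v))) F"
proof -
  assume v: "v \<in> carrier C"
  have "((\<lambda>z. Re (ip (X z) (app (X z) (\<rho> z \<one>\<^bsub>A\<^esub>) (\<eta> z s v)) (\<eta> z s v))) \<longlongrightarrow> Re (q (star C v \<otimes>\<^bsub>C\<^esub> (\<sigma> s \<one>\<^bsub>A\<^esub> \<otimes>\<^bsub>C\<^esub> v)))) F"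
    using v by (intro tendsto_Re close) auto
  moreover have "Re (ip (X z) (app (X z) (\<rho> z \<one>\<^bsub>A\<^esub>) (\<eta> z s v)) (\<eta> z s v)) = (nrm (X z) (\<eta> z s v))\<^sup>2" for z
    by (simp only: \<rho>(2) ip_app_one[OF X] ip_self Re_complex_of_real)
  ultimately show ?thesis using v by (simp add: \<sigma>_one)
qed

lemma nrm_\<eta>: "v \<in> carrier C \<Longrightarrow> ((\<lambda>z. nrm (X z) (\<eta> z s v)) \<longlongrightarrow> sqrt (Re (q (star C v \<otimes>\<^bsub>C\<^esub> v)))) F"
  using tendsto_real_sqrt[OF nrm_\<eta>_power2] by simp

lemma null_of_power2: "((\<lambda>z. (nrm (X z) (f z))\<^sup>2) \<longlongrightarrow> 0) F \<Longrightarrow> ((\<lambda>z. nrm (X z) (f z)) \<longlongrightarrow> 0) F"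
  using tendsto_real_sqrt[of "\<lambda>z. (nrm (X z) (f z))\<^sup>2" 0 F] by simp

text \<open>The squared norm of the difference expands into three terms governed by
  \<open>close\<close>; for \<open>w = \<sigma> s (a) v\<close> they tend to 1, -2 and 1 times the
  real part of \<open>q (star w w)\<close>.\<close>

lemma \<rho>_net:
  assumes a: "a \<in> carrier A" and v: "v \<in> carrier C"
  shows "((\<lambda>z. nrm (X z) (\<lambda>x. app (X z) (\<rho> z a) (\<eta> z s v) x - \<eta> z s (\<sigma> s a \<otimes>\<^bsub>C\<^esub> v) x)) \<longlongrightarrow> 0) F"
proof (rule null_of_power2)
  define w where "w = \<sigma> s a \<otimes>\<^bsub>C\<^esub> v"
  have sc: "\<sigma> s a \<in> carrier C" using a by (rule \<sigma>_simps(1))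
  have w: "w \<in> carrier C" using sc v by (simp add: w_def)
  have eq: "(nrm (X z) (\<lambda>x. app (X z) (\<rho> z a) (\<eta> z s v) x - \<eta> z s w x))\<^sup>2 =
     Re (ip (X z) (app (X z) (\<rho> z (star A a \<otimes>\<^bsub>A\<^esub> a)) (\<eta> z s v)) (\<eta> z s v))
     - 2 * Re (ip (X z) (app (X z) (\<rho> z a) (\<eta> z s v)) (\<eta> z s w)) + (nrm (X z) (\<eta> z s w))\<^sup>2" for z
  proof -
    have "\<rho> z (star A a \<otimes>\<^bsub>A\<^esub> a) = star (mats (X z)) (\<rho> z a) \<otimes>\<^bsub>mats (X z)\<^esub> \<rho> z a" using star_homD[OF \<rho>(1)] a by simp
    then have "Re (ip (X z) (app (X z) (\<rho> z (star A a \<otimes>\<^bsub>A\<^esub> a)) (\<eta> z s v)) (\<eta> z s v)) = (nrm (X z) (app (X z) (\<rho> z a) (\<eta> z s v)))\<^sup>2"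
      by (simp only: nrm_app_power2[symmetric] Re_complex_of_real)
    then show ?thesis unfolding nrm_diff_power2 by (simp only: ip_self Re_complex_of_real)
  qed
  have "((\<lambda>z. Re (ip (X z) (app (X z) (\<rho> z (star A a \<otimes>\<^bsub>A\<^esub> a)) (\<eta> z s v)) (\<eta> z s v))
     - 2 * Re (ip (X z) (app (X z) (\<rho> z a) (\<eta> z s v)) (\<eta> z s w)) + (nrm (X z) (\<eta> z s w))\<^sup>2) \<longlongrightarrow>
     Re (q (star C v \<otimes>\<^bsub>C\<^esub> (\<sigma> s (star A a \<otimes>\<^bsub>A\<^esub> a) \<otimes>\<^bsub>C\<^esub> v))) - 2 * Re (q (star C w \<otimes>\<^bsub>C\<^esub> (\<sigma> s a \<otimes>\<^bsub>C\<^esub> v))) + Re (q (star C w \<otimes>\<^bsub>C\<^esub> w))) F"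
    using a v w by (intro tendsto_add tendsto_diff tendsto_mult tendsto_const tendsto_Re close nrm_\<eta>_power2) auto
  moreover have "star C v \<otimes>\<^bsub>C\<^esub> (\<sigma> s (star A a \<otimes>\<^bsub>A\<^esub> a) \<otimes>\<^bsub>C\<^esub> v) = star C w \<otimes>\<^bsub>C\<^esub> w"
    using sc v a by (simp add: w_def \<sigma>_simps C.star_simps C.mult_assoc)
  ultimately show "((\<lambda>z. (nrm (X z) (\<lambda>x. app (X z) (\<rho> z a) (\<eta> z s v) x - \<eta> z s (\<sigma> s a \<otimes>\<^bsub>C\<^esub> v) x))\<^sup>2) \<longlongrightarrow> 0) F"
    unfolding w_def[symmetric] eq by (simp add: w_def[symmetric])
qed

text \<open>Here the amalgamation enters. The \<open>j\<close>-th term is followed through three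
  approximations: \<open>\<rho> (star (d j))\<close> acts as the embedding
  \<open>\<sigma> s\<close>, \<open>c\<close> switches the copy, \<open>\<rho> (d j)\<close> acts as
  the other embedding. As both agree on \<open>D\<close>, the outcome is
  \<open>d j star (d j)\<close> acting through one embedding, and summing over \<open>j\<close>
  gives \<open>v\<close> back.\<close>

lemma average_net:
  assumes v: "v \<in> carrier C"
  shows "((\<lambda>z. nrm (X z) (\<lambda>x. average (X z) (\<rho> z) (c z) (\<eta> z s v) x - \<eta> z (\<not> s) v x)) \<longlongrightarrow> 0) F"
proof -
  define u where "u j = \<sigma> s (star A (d j)) \<otimes>\<^bsub>C\<^esub> v" for j
  define w where "w j = \<sigma> (\<not> s) (d j) \<otimes>\<^bsub>C\<^esub> u j" for j
  have dc: "d j \<in> carrier A" "star A (d j) \<in> carrier A" if "j < N" for j using d[OF that] D by auto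
  have uc: "u j \<in> carrier C" and wc: "w j \<in> carrier C" if "j < N" for j using dc[OF that] v \<sigma>_simps(1) by (auto simp: u_def w_def)
  have sagree: "\<sigma> s (star A (d j)) = \<sigma> (\<not> s) (star A (d j))" if "j < N" for j
    using agree[OF d[OF that]] dc[OF that] by (cases s) (simp_all add: \<sigma>_simps)
  have sum_w: "(\<Sum>j<N. \<eta> z (\<not> s) (w j) x) = \<eta> z (\<not> s) v x" for z x
  proof -
    have "lin A (\<lambda>a. \<eta> z (\<not> s) (\<sigma> (\<not> s) a \<otimes>\<^bsub>C\<^esub> v) x)"
      using star_hom_lin[OF A.cstar_algebra_axioms \<sigma> C.lin_mult_r[OF \<eta>_lin v]] .
    from d_one[OF this] have "(\<Sum>j<N. \<eta> z (\<not> s) (\<sigma> (\<not> s) (d j \<otimes>\<^bsub>A\<^esub> star A (d j)) \<otimes>\<^bsub>C\<^esub> v) x) = \<eta> z (\<not> s) v x"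
      using v by (simp add: \<sigma>_one)
    moreover have "\<sigma> (\<not> s) (d j \<otimes>\<^bsub>A\<^esub> star A (d j)) \<otimes>\<^bsub>C\<^esub> v = w j" if "j < N" for j
      using dc[OF that] v sagree[OF that] \<sigma>_simps(1) by (simp add: w_def u_def \<sigma>_simps(4) C.mult_assoc)
    ultimately show ?thesis by simp
  qed
  \<comment> \<open>The errors of the three approximations; an earlier error is multiplied by the
    norm bounds of the operators applied after it, which is 1 for \<open>c\<close>.\<close>
  define T where "T j z = cnorm A (d j) * (nrm (X z) (\<lambda>x. app (X z) (\<rho> z (star A (d j))) (\<eta> z s v) x - \<eta> z s (u j) x)
      + nrm (X z) (\<lambda>x. app (X z) (c z) (\<eta> z s (u j)) x - \<eta> z (\<not> s) (u j) x))
      + nrm (X z) (\<lambda>x. app (X z) (\<rho> z (d j)) (\<eta> z (\<not> s) (u j)) x - \<eta> z (\<not> s) (w j) x)" for j z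
  have T0: "(T j \<longlongrightarrow> 0) F" if j: "j < N" for j
  proof -
    have "(T j \<longlongrightarrow> cnorm A (d j) * (0 + 0) + 0) F"
      unfolding T_def u_def w_def using dc[OF j] v uc[OF j, unfolded u_def]
      by (intro tendsto_add tendsto_mult tendsto_const \<rho>_net exchange) auto
    then show ?thesis by simp
  qed
  have Tb: "nrm (X z) (\<lambda>x. app (X z) (\<rho> z (d j)) (app (X z) (c z) (app (X z) (\<rho> z (star A (d j))) (\<eta> z s v))) x - \<eta> z (\<not> s) (w j) x) \<le> T j z"
    if j: "j < N" for j z
  proof -
    let ?r = "app (X z) (\<rho> z (star A (d j))) (\<eta> z s v)" and ?n = "\<eta> z s (u j)" and ?m = "\<eta> z (\<not> s) (u j)"
    have 1: "nrm (X z) (\<lambda>x. app (X z) (c z) ?r x - ?m x) \<le> nrm (X z) (\<lambda>x. ?r x - ?n x) + nrm (X z) (\<lambda>x. app (X z) (c z) ?n x - ?m x)"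
      using nrm_diff_triangle[of "X z" "app (X z) (c z) ?r" ?m "app (X z) (c z) ?n"] app_c_bound[of z "\<lambda>x. ?r x - ?n x"]
      by (simp add: app_diff)
    have "nrm (X z) (\<lambda>x. app (X z) (\<rho> z (d j)) (app (X z) (c z) ?r) x - app (X z) (\<rho> z (d j)) ?m x) \<le> cnorm A (d j) * nrm (X z) (\<lambda>x. app (X z) (c z) ?r x - ?m x)"
      using app_\<rho>_bound[OF dc(1)[OF j], of z "\<lambda>x. app (X z) (c z) ?r x - ?m x"] by (simp add: app_diff)
    also have "\<dots> \<le> cnorm A (d j) * (nrm (X z) (\<lambda>x. ?r x - ?n x) + nrm (X z) (\<lambda>x. app (X z) (c z) ?n x - ?m x))"
      using 1 A.cnorm_nonneg[OF dc(1)[OF j]] by (rule mult_left_mono)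
    finally show ?thesis
      using nrm_diff_triangle[of "X z" "app (X z) (\<rho> z (d j)) (app (X z) (c z) ?r)" "\<eta> z (\<not> s) (w j)" "app (X z) (\<rho> z (d j)) ?m"]
      unfolding T_def by linarith
  qed
  have le: "nrm (X z) (\<lambda>x. average (X z) (\<rho> z) (c z) (\<eta> z s v) x - \<eta> z (\<not> s) v x) \<le> (\<Sum>j<N. T j z)" for z
  proof -
    have "(\<lambda>x. average (X z) (\<rho> z) (c z) (\<eta> z s v) x - \<eta> z (\<not> s) v x) =
      (\<lambda>x. \<Sum>j<N. app (X z) (\<rho> z (d j)) (app (X z) (c z) (app (X z) (\<rho> z (star A (d j))) (\<eta> z s v))) x - \<eta> z (\<not> s) (w j) x)"
      by (simp add: average_def sum_w[symmetric] sum_subtractf)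
    then have "nrm (X z) (\<lambda>x. average (X z) (\<rho> z) (c z) (\<eta> z s v) x - \<eta> z (\<not> s) v x) \<le>
      (\<Sum>j<N. nrm (X z) (\<lambda>x. app (X z) (\<rho> z (d j)) (app (X z) (c z) (app (X z) (\<rho> z (star A (d j))) (\<eta> z s v))) x - \<eta> z (\<not> s) (w j) x))"
      using nrm_sum[of "{..<N}" "X z" "\<lambda>j x. app (X z) (\<rho> z (d j)) (app (X z) (c z) (app (X z) (\<rho> z (star A (d j))) (\<eta> z s v))) x - \<eta> z (\<not> s) (w j) x"] by simp
    also have "\<dots> \<le> (\<Sum>j<N. T j z)" using Tb by (intro sum_mono) auto
    finally show ?thesis .
  qed
  have "((\<lambda>z. \<Sum>j<N. T j z) \<longlongrightarrow> (\<Sum>j<N. 0)) F" using T0 by (intro tendsto_sum) auto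
  then have "((\<lambda>z. \<Sum>j<N. T j z) \<longlongrightarrow> 0) F" by simp
  then show ?thesis by (rule tendsto_zero_le) (rule nrm_nonneg, rule le)
qed

text \<open>By \<open>average_net\<close> the averaged contraction asymptotically preserves the norm
  of \<open>\<eta> z s v\<close>, so by the identity for \<open>W\<close> the difference between
  \<open>W\<close> and the average tends to zero there; and the average itself exchanges the two
  copies.\<close>

lemma W_net:
  assumes v: "v \<in> carrier C"
  shows "((\<lambda>z. nrm (X z) (\<lambda>x. app (X z) (W z) (\<eta> z s v) x - \<eta> z (\<not> s) v x)) \<longlongrightarrow> 0) F"
proof -
  let ?a = "\<lambda>z. average (X z) (\<rho> z) (c z) (\<eta> z s v)"
  have "((\<lambda>z. nrm (X z) (?a z) - nrm (X z) (\<eta> z (\<not> s) v)) \<longlongrightarrow> 0) F"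
  proof (rule tendsto_rabs_zero_cancel, rule tendsto_zero_le[OF average_net[OF v, of s]])
    fix z
    show "\<bar>nrm (X z) (?a z) - nrm (X z) (\<eta> z (\<not> s) v)\<bar> \<le> nrm (X z) (\<lambda>x. ?a z x - \<eta> z (\<not> s) v x)"
      using nrm_add[of "X z" "\<lambda>x. ?a z x - \<eta> z (\<not> s) v x" "\<eta> z (\<not> s) v"] nrm_diff[of "X z" "?a z" "\<lambda>x. ?a z x - \<eta> z (\<not> s) v x"] by simp
  qed simp
  from tendsto_add[OF this nrm_\<eta>[OF v, of "\<not> s"]]
  have "((\<lambda>z. nrm (X z) (?a z)) \<longlongrightarrow> sqrt (Re (q (star C v \<otimes>\<^bsub>C\<^esub> v)))) F" by simp
  from tendsto_diff[OF nrm_\<eta>_power2[OF v, of s] tendsto_power[OF this, of 2]]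
  have "((\<lambda>z. (nrm (X z) (\<lambda>x. app (X z) (W z) (\<eta> z s v) x - ?a z x))\<^sup>2) \<longlongrightarrow> 0) F"
    using C.posf_nonneg[OF q v] by (simp add: W(3))
  then have "((\<lambda>z. nrm (X z) (\<lambda>x. app (X z) (W z) (\<eta> z s v) x - ?a z x)) \<longlongrightarrow> 0) F" by (rule null_of_power2)
  from tendsto_add[OF this average_net[OF v, of s]]
  have "((\<lambda>z. nrm (X z) (\<lambda>x. app (X z) (W z) (\<eta> z s v) x - ?a z x) + nrm (X z) (\<lambda>x. ?a z x - \<eta> z (\<not> s) v x)) \<longlongrightarrow> 0) F" by simp
  then show ?thesis by (rule tendsto_zero_le) (auto intro: nrm_diff_triangle)
qed

text \<open>Strong convergence to the GNS representation of \<open>q\<close>, observed on the copies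
  with index \<open>True\<close> only.\<close>

definition converges :: "'c \<Rightarrow> bool" where
  "converges y \<longleftrightarrow> y \<in> carrier C \<and> (\<forall>v\<in>carrier C. ((\<lambda>z. nrm (X z) (\<lambda>x. app (X z) (R z y) (\<eta> z True v) x - \<eta> z True (y \<otimes>\<^bsub>C\<^esub> v) x)) \<longlongrightarrow> 0) F)"

lemma R_one: "R z \<one>\<^bsub>C\<^esub> = \<one>\<^bsub>mats (X z)\<^esub>"
  using R(2)[of "\<one>\<^bsub>A\<^esub>" z] by (simp add: \<sigma>_one \<rho>(2))

lemma app_R_bound: "y \<in> carrier C \<Longrightarrow> nrm (X z) (app (X z) (R z y) v) \<le> cnorm C y * nrm (X z) v"
proof -
  assume y: "y \<in> carrier C"
  have "opn (X z) (R z y) \<le> cnorm C y"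
    using star_hom_contractive[OF C.unital_cstar_algebra_axioms unital_cstar_algebra_mats[OF X] R(1) R_one y] by (simp add: mats_simps(8))
  then show ?thesis using order_trans[OF opn_bound[OF X] mult_right_mono] by simp
qed

text \<open>For the first embedding this is \<open>\<rho>_net\<close>. For the second,
  \<open>R z\<close> acts as \<open>W \<rho> W\<close>: \<open>W\<close> moves the vector to the
  copy \<open>False\<close>, where \<open>\<rho>\<close> imitates the second action, and
  \<open>W\<close> moves the result back.\<close>

lemma converges_\<sigma>: "a \<in> carrier A \<Longrightarrow> converges (\<sigma> s a)"
proof -
  assume a: "a \<in> carrier A"
  have sc: "\<sigma> s a \<in> carrier C" for s using a by (rule \<sigma>_simps(1))
  have "((\<lambda>z. nrm (X z) (\<lambda>x. app (X z) (R z (\<sigma> s a)) (\<eta> z True v) x - \<eta> z True (\<sigma> s a \<otimes>\<^bsub>C\<^esub> v) x)) \<longlongrightarrow> 0) F" if v: "v \<in> carrier C" for v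
  proof (cases s)
    case True
    then show ?thesis using \<rho>_net[OF a v, of True] R(2)[OF a] by simp
  next
    case False
    define T where "T z = (cnorm A a * nrm (X z) (\<lambda>x. app (X z) (W z) (\<eta> z True v) x - \<eta> z False v x)
       + nrm (X z) (\<lambda>x. app (X z) (\<rho> z a) (\<eta> z False v) x - \<eta> z False (\<sigma> False a \<otimes>\<^bsub>C\<^esub> v) x))
       + nrm (X z) (\<lambda>x. app (X z) (W z) (\<eta> z False (\<sigma> False a \<otimes>\<^bsub>C\<^esub> v)) x - \<eta> z True (\<sigma> False a \<otimes>\<^bsub>C\<^esub> v) x)" for z
    have "(T \<longlongrightarrow> (cnorm A a * 0 + 0) + 0) F"
      unfolding T_def using W_net[OF v, of True] \<rho>_net[OF a v, of False] W_net[of "\<sigma> False a \<otimes>\<^bsub>C\<^esub> v" False] sc[of False] v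
      by (intro tendsto_add tendsto_mult tendsto_const) auto
    then have T0: "(T \<longlongrightarrow> 0) F" by simp
    have "nrm (X z) (\<lambda>x. app (X z) (R z (\<sigma> False a)) (\<eta> z True v) x - \<eta> z True (\<sigma> False a \<otimes>\<^bsub>C\<^esub> v) x) \<le> T z" for z
    proof -
      let ?A = "app (X z)" and ?w = "\<sigma> False a \<otimes>\<^bsub>C\<^esub> v"
      have 1: "nrm (X z) (\<lambda>x. ?A (\<rho> z a) (?A (W z) (\<eta> z True v)) x - ?A (\<rho> z a) (\<eta> z False v) x) \<le> cnorm A a * nrm (X z) (\<lambda>x. ?A (W z) (\<eta> z True v) x - \<eta> z False v x)"
        using app_\<rho>_bound[OF a, of z "\<lambda>x. ?A (W z) (\<eta> z True v) x - \<eta> z False v x"] by (simp add: app_diff)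
      have 2: "nrm (X z) (\<lambda>x. ?A (W z) (?A (\<rho> z a) (?A (W z) (\<eta> z True v))) x - ?A (W z) (\<eta> z False ?w) x) = nrm (X z) (\<lambda>x. ?A (\<rho> z a) (?A (W z) (\<eta> z True v)) x - \<eta> z False ?w x)"
        using nrm_app_symmetry[OF X W(1,2), of z "\<lambda>x. ?A (\<rho> z a) (?A (W z) (\<eta> z True v)) x - \<eta> z False ?w x"] by (simp add: app_diff)
      show ?thesis
        using 1 2 nrm_diff_triangle[of "X z" "?A (\<rho> z a) (?A (W z) (\<eta> z True v))" "\<eta> z False ?w" "?A (\<rho> z a) (\<eta> z False v)"]
          nrm_diff_triangle[of "X z" "?A (W z) (?A (\<rho> z a) (?A (W z) (\<eta> z True v)))" "\<eta> z True ?w" "?A (W z) (\<eta> z False ?w)"]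
        unfolding T_def by (simp add: R(3)[OF a] app_ring)
    qed
    then show ?thesis unfolding False[simplified] using False by (auto intro: tendsto_zero_le[OF T0])
  qed
  then show ?thesis using sc by (simp add: converges_def)
qed

lemma converges_add: "converges y \<Longrightarrow> converges y' \<Longrightarrow> converges (y \<oplus>\<^bsub>C\<^esub> y')"
  unfolding converges_def
proof (intro conjI ballI, simp)
  fix v assume y: "y \<in> carrier C \<and> (\<forall>v\<in>carrier C. ((\<lambda>z. nrm (X z) (\<lambda>x. app (X z) (R z y) (\<eta> z True v) x - \<eta> z True (y \<otimes>\<^bsub>C\<^esub> v) x)) \<longlongrightarrow> 0) F)"
    and y': "y' \<in> carrier C \<and> (\<forall>v\<in>carrier C. ((\<lambda>z. nrm (X z) (\<lambda>x. app (X z) (R z y') (\<eta> z True v) x - \<eta> z True (y' \<otimes>\<^bsub>C\<^esub> v) x)) \<longlongrightarrow> 0) F)"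
    and v: "v \<in> carrier C"
  let ?f = "\<lambda>y z x. app (X z) (R z y) (\<eta> z True v) x - \<eta> z True (y \<otimes>\<^bsub>C\<^esub> v) x"
  have "((\<lambda>z. nrm (X z) (?f y z) + nrm (X z) (?f y' z)) \<longlongrightarrow> 0 + 0) F" using y y' v by (intro tendsto_add) auto
  then have "((\<lambda>z. nrm (X z) (?f y z) + nrm (X z) (?f y' z)) \<longlongrightarrow> 0) F" by simp
  then show "((\<lambda>z. nrm (X z) (?f (y \<oplus>\<^bsub>C\<^esub> y') z)) \<longlongrightarrow> 0) F"
  proof (rule tendsto_zero_le)
    fix z
    have "?f (y \<oplus>\<^bsub>C\<^esub> y') z = (\<lambda>x. ?f y z x + ?f y' z x)"
      using y y' v by (simp add: star_homD[OF R(1)] app_ring C.mult_l_distr C.lin_add[OF \<eta>_lin] algebra_simps)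
    then show "nrm (X z) (?f (y \<oplus>\<^bsub>C\<^esub> y') z) \<le> nrm (X z) (?f y z) + nrm (X z) (?f y' z)" using nrm_add by simp
  qed simp
qed

lemma converges_smult: "converges y \<Longrightarrow> converges (a \<odot>\<^bsub>C\<^esub> y)"
  unfolding converges_def
proof (intro conjI ballI, simp)
  fix v assume y: "y \<in> carrier C \<and> (\<forall>v\<in>carrier C. ((\<lambda>z. nrm (X z) (\<lambda>x. app (X z) (R z y) (\<eta> z True v) x - \<eta> z True (y \<otimes>\<^bsub>C\<^esub> v) x)) \<longlongrightarrow> 0) F)"
    and v: "v \<in> carrier C"
  let ?f = "\<lambda>y z x. app (X z) (R z y) (\<eta> z True v) x - \<eta> z True (y \<otimes>\<^bsub>C\<^esub> v) x"
  have "?f (a \<odot>\<^bsub>C\<^esub> y) z = (\<lambda>x. a * ?f y z x)" for z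
    using y v by (simp add: star_homD[OF R(1)] app_ring C.smult_mult_l C.lin_smult[OF \<eta>_lin] algebra_simps)
  then have "nrm (X z) (?f (a \<odot>\<^bsub>C\<^esub> y) z) = cmod a * nrm (X z) (?f y z)" for z using nrm_scale by simp
  moreover have "((\<lambda>z. cmod a * nrm (X z) (?f y z)) \<longlongrightarrow> cmod a * 0) F" using y v by (intro tendsto_mult tendsto_const) auto
  ultimately show "((\<lambda>z. nrm (X z) (?f (a \<odot>\<^bsub>C\<^esub> y) z)) \<longlongrightarrow> 0) F" by simp
qed

lemma converges_mult: "converges y \<Longrightarrow> converges y' \<Longrightarrow> converges (y \<otimes>\<^bsub>C\<^esub> y')"
  unfolding converges_def
proof (intro conjI ballI, simp)
  fix v assume y: "y \<in> carrier C \<and> (\<forall>v\<in>carrier C. ((\<lambda>z. nrm (X z) (\<lambda>x. app (X z) (R z y) (\<eta> z True v) x - \<eta> z True (y \<otimes>\<^bsub>C\<^esub> v) x)) \<longlongrightarrow> 0) F)"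
    and y': "y' \<in> carrier C \<and> (\<forall>v\<in>carrier C. ((\<lambda>z. nrm (X z) (\<lambda>x. app (X z) (R z y') (\<eta> z True v) x - \<eta> z True (y' \<otimes>\<^bsub>C\<^esub> v) x)) \<longlongrightarrow> 0) F)"
    and v: "v \<in> carrier C"
  let ?f = "\<lambda>y v z x. app (X z) (R z y) (\<eta> z True v) x - \<eta> z True (y \<otimes>\<^bsub>C\<^esub> v) x"
  have "((\<lambda>z. cnorm C y * nrm (X z) (?f y' v z) + nrm (X z) (?f y (y' \<otimes>\<^bsub>C\<^esub> v) z)) \<longlongrightarrow> cnorm C y * 0 + 0) F"
    using y y' v by (intro tendsto_add tendsto_mult tendsto_const) auto
  then have "((\<lambda>z. cnorm C y * nrm (X z) (?f y' v z) + nrm (X z) (?f y (y' \<otimes>\<^bsub>C\<^esub> v) z)) \<longlongrightarrow> 0) F" by simp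
  then show "((\<lambda>z. nrm (X z) (?f (y \<otimes>\<^bsub>C\<^esub> y') v z)) \<longlongrightarrow> 0) F"
  proof (rule tendsto_zero_le)
    fix z
    have "?f (y \<otimes>\<^bsub>C\<^esub> y') v z = (\<lambda>x. app (X z) (R z y) (\<lambda>x. ?f y' v z x) x + ?f y (y' \<otimes>\<^bsub>C\<^esub> v) z x)"
      using y y' v by (simp add: star_homD[OF R(1)] app_ring app_diff C.mult_assoc)
    then show "nrm (X z) (?f (y \<otimes>\<^bsub>C\<^esub> y') v z) \<le> cnorm C y * nrm (X z) (?f y' v z) + nrm (X z) (?f y (y' \<otimes>\<^bsub>C\<^esub> v) z)"
      using nrm_add[of "X z" "app (X z) (R z y) (\<lambda>x. ?f y' v z x)" "?f y (y' \<otimes>\<^bsub>C\<^esub> v) z"] app_R_bound[of y z "\<lambda>x. ?f y' v z x"] y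
      by simp
  qed simp
qed

text \<open>The bounds are uniform along the net: \<open>R z u\<close> and left multiplication by
  \<open>u\<close> in the GNS space both have norm at most \<open>cnorm C u\<close>.\<close>

lemma converges_closed:
  assumes y: "y \<in> carrier C" and lim: "\<And>e. e > 0 \<Longrightarrow> \<exists>y'. converges y' \<and> cnorm C (y \<ominus>\<^bsub>C\<^esub> y') < e"
  shows "converges y"
  unfolding converges_def
proof (intro conjI ballI y)
  fix v assume v: "v \<in> carrier C"
  let ?f = "\<lambda>y z x. app (X z) (R z y) (\<eta> z True v) x - \<eta> z True (y \<otimes>\<^bsub>C\<^esub> v) x"
  define B where "B = sqrt (Re (q (star C v \<otimes>\<^bsub>C\<^esub> v)))"
  have B0: "0 \<le> B" using C.posf_nonneg[OF q v] by (simp add: B_def)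
  show "((\<lambda>z. nrm (X z) (?f y z)) \<longlongrightarrow> 0) F"
  proof (rule order_tendstoI)
    fix e :: real assume e: "0 < e"
    \<comment> \<open>The two contributions of \<open>u = y - y'\<close> are in the limit at most
      \<open>\<delta> B\<close> each; the summand 1 covers the case \<open>B = 0\<close>.\<close>
    define \<delta> where "\<delta> = e / (2 * (2 * B + 1))"
    have \<delta>0: "0 < \<delta>" using e B0 by (simp add: \<delta>_def)
    obtain y' where y': "converges y'" "cnorm C (y \<ominus>\<^bsub>C\<^esub> y') < \<delta>" using lim[OF \<delta>0] by blast
    have y'c: "y' \<in> carrier C" using y'(1) by (simp add: converges_def)
    define u where "u = y \<ominus>\<^bsub>C\<^esub> y'"
    have uc: "u \<in> carrier C" using y y'c by (simp add: u_def)
    have uv: "sqrt (Re (q (star C (u \<otimes>\<^bsub>C\<^esub> v) \<otimes>\<^bsub>C\<^esub> (u \<otimes>\<^bsub>C\<^esub> v)))) \<le> cnorm C u * B"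
      using real_sqrt_le_mono[OF C.posf_bound[OF q uc v]] C.cnorm_nonneg[OF uc] by (simp add: real_sqrt_mult B_def)
    have "((\<lambda>z. cnorm C u * nrm (X z) (\<eta> z True v) + nrm (X z) (?f y' z) + nrm (X z) (\<eta> z True (u \<otimes>\<^bsub>C\<^esub> v))) \<longlongrightarrow>
      cnorm C u * B + 0 + sqrt (Re (q (star C (u \<otimes>\<^bsub>C\<^esub> v) \<otimes>\<^bsub>C\<^esub> (u \<otimes>\<^bsub>C\<^esub> v))))) F"
      unfolding B_def using uc v y'(1) by (intro tendsto_add tendsto_mult tendsto_const nrm_\<eta>) (auto simp: converges_def)
    moreover have "cnorm C u * B + 0 + sqrt (Re (q (star C (u \<otimes>\<^bsub>C\<^esub> v) \<otimes>\<^bsub>C\<^esub> (u \<otimes>\<^bsub>C\<^esub> v)))) < e"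
    proof -
      have "cnorm C u * B + 0 + sqrt (Re (q (star C (u \<otimes>\<^bsub>C\<^esub> v) \<otimes>\<^bsub>C\<^esub> (u \<otimes>\<^bsub>C\<^esub> v)))) \<le> cnorm C u * (2 * B)" using uv by (simp add: mult.commute)
      also have "\<dots> \<le> \<delta> * (2 * B)" using y'(2) B0 by (intro mult_right_mono) (auto simp: u_def)
      also have "\<dots> < e" using e B0 by (simp add: \<delta>_def field_simps add_pos_nonneg)
      finally show ?thesis .
    qed
    ultimately have "\<forall>\<^sub>F z in F. cnorm C u * nrm (X z) (\<eta> z True v) + nrm (X z) (?f y' z) + nrm (X z) (\<eta> z True (u \<otimes>\<^bsub>C\<^esub> v)) < e"
      by (rule order_tendstoD(2))
    then show "\<forall>\<^sub>F z in F. nrm (X z) (?f y z) < e"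
    proof (rule eventually_mono)
      fix z assume less: "cnorm C u * nrm (X z) (\<eta> z True v) + nrm (X z) (?f y' z) + nrm (X z) (\<eta> z True (u \<otimes>\<^bsub>C\<^esub> v)) < e"
      have yu: "y = u \<oplus>\<^bsub>C\<^esub> y'" using y y'c by (intro C.lin_eqI) (auto simp: u_def C.lin_simps)
      have "?f y z = (\<lambda>x. (app (X z) (R z u) (\<eta> z True v) x + ?f y' z x) - \<eta> z True (u \<otimes>\<^bsub>C\<^esub> v) x)"
        unfolding yu using uc y'c v by (simp add: star_homD[OF R(1)] app_ring C.mult_l_distr C.lin_add[OF \<eta>_lin] algebra_simps)
      then have "nrm (X z) (?f y z) \<le> nrm (X z) (app (X z) (R z u) (\<eta> z True v)) + nrm (X z) (?f y' z) + nrm (X z) (\<eta> z True (u \<otimes>\<^bsub>C\<^esub> v))"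
        using nrm_diff[of "X z" "\<lambda>x. app (X z) (R z u) (\<eta> z True v) x + ?f y' z x" "\<eta> z True (u \<otimes>\<^bsub>C\<^esub> v)"]
          nrm_add[of "X z" "app (X z) (R z u) (\<eta> z True v)" "?f y' z"] by simp
      then show "nrm (X z) (?f y z) < e" using less app_R_bound[OF uc, of z "\<eta> z True v"] by linarith
    qed
  next
    fix e :: real assume "e < 0"
    then have "e < nrm (X z) (?f y z)" for z by (rule less_le_trans) simp
    then show "\<forall>\<^sub>F z in F. e < nrm (X z) (?f y z)" by simp
  qed
qed

text \<open>The elements that converge together with their adjoints form a C*-subalgebra containing
  both copies of \<open>A\<close>, hence everything. If every \<open>R z y\<close> vanished,
  convergence at the unit would force the norms of \<open>\<eta> z True y\<close> to zero, but they
  tend to the square root of \<open>q (star y y)\<close>.\<close>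

lemma exists_nonvanishing:
  assumes gen: "\<And>S. cstar_subalgebra S C \<Longrightarrow> (\<And>s. \<sigma> s ` carrier A \<subseteq> S) \<Longrightarrow> S = carrier C"
    and y: "y \<in> carrier C" "0 < Re (q (star C y \<otimes>\<^bsub>C\<^esub> y))"
  shows "\<exists>z. R z y \<noteq> \<zero>\<^bsub>mats (X z)\<^esub>"
proof (rule ccontr)
  assume n: "\<not> ?thesis"
  \<comment> \<open>Adjoints are part of the definition because strong convergence does not pass to
    them in general.\<close>
  define S where "S = {y. converges y \<and> converges (star C y)}"
  have Sc: "S \<subseteq> carrier C" by (auto simp: S_def converges_def)
  have "cstar_subalgebra S C"
  proof (rule C.cstar_subalgebraI[OF Sc])
    have "converges (0 \<odot>\<^bsub>C\<^esub> \<sigma> True \<one>\<^bsub>A\<^esub>)" by (intro converges_smult converges_\<sigma>) simp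
    then show "\<zero>\<^bsub>C\<^esub> \<in> S" using \<sigma>_simps(1)[of "\<one>\<^bsub>A\<^esub>" True] by (simp add: S_def)
    fix x assume x: "x \<in> carrier C" and lim: "\<And>e. e > 0 \<Longrightarrow> \<exists>y\<in>S. cnorm C (x \<ominus>\<^bsub>C\<^esub> y) < e"
    have "converges x" using lim by (intro converges_closed[OF x]) (auto simp: S_def)
    moreover have "converges (star C x)"
    proof (rule converges_closed)
      fix e :: real assume "e > 0"
      then obtain y where y: "y \<in> S" "cnorm C (x \<ominus>\<^bsub>C\<^esub> y) < e" using lim by blast
      then have "cnorm C (star C x \<ominus>\<^bsub>C\<^esub> star C y) < e" using x Sc C.cnorm_star[of "x \<ominus>\<^bsub>C\<^esub> y"] by (auto simp: C.star_minus)
      then show "\<exists>y'. converges y' \<and> cnorm C (star C x \<ominus>\<^bsub>C\<^esub> y') < e" using y(1) by (auto simp: S_def)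
    qed (use x in simp)
    ultimately show "x \<in> S" by (simp add: S_def)
  qed (use Sc in \<open>auto simp: S_def C.star_simps subset_iff intro: converges_add converges_smult converges_mult\<close>)
  moreover have "\<sigma> s ` carrier A \<subseteq> S" for s
    using converges_\<sigma> by (auto simp: S_def \<sigma>_simps(5)[symmetric])
  ultimately have "S = carrier C" using gen by blast
  then have "converges y" using y(1) by (auto simp: S_def)
  then have "((\<lambda>z. nrm (X z) (\<lambda>x. app (X z) (R z y) (\<eta> z True \<one>\<^bsub>C\<^esub>) x - \<eta> z True (y \<otimes>\<^bsub>C\<^esub> \<one>\<^bsub>C\<^esub>) x)) \<longlongrightarrow> 0) F"
    using C.unit_closed unfolding converges_def by blast
  moreover have "app (X z) (R z y) v = (\<lambda>x. 0)" for z v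
    using n by (simp add: app_def mats_simps)
  ultimately have "((\<lambda>z. nrm (X z) (\<lambda>x. (-1) * \<eta> z True y x)) \<longlongrightarrow> 0) F" using y(1) by simp
  then have "((\<lambda>z. nrm (X z) (\<eta> z True y)) \<longlongrightarrow> 0) F" unfolding nrm_scale by simp
  then have "sqrt (Re (q (star C y \<otimes>\<^bsub>C\<^esub> y))) = 0" using tendsto_unique[OF F nrm_\<eta>[OF y(1)]] by blast
  then show False using y(2) by simp
qed

end

section \<open>Construction of the net\<close>

context amalgamated_pair
begin

text \<open>One index of \<open>approximating_net\<close>: the exact requirements as they stand, the
  two limits as estimates up to \<open>\<delta>\<close> on the finite sets \<open>S\<close> and
  \<open>Y\<close>. Bundling them allows all components to be chosen at once.\<close>

definition model :: "'a set \<Rightarrow> 'b set \<Rightarrow> real \<Rightarrow> nat set \<Rightarrow> ('a \<Rightarrow> seq) \<Rightarrow> seq \<Rightarrow> (bool \<Rightarrow> 'b \<Rightarrow> seq) \<Rightarrow> seq \<Rightarrow> ('b \<Rightarrow> seq) \<Rightarrow> bool" where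
  "model S Y \<delta> X \<rho> c \<eta> W R \<longleftrightarrow> finite X \<and> \<rho> \<in> star_hom A (mats X) \<and> \<rho> \<one>\<^bsub>A\<^esub> = \<one>\<^bsub>mats X\<^esub> \<and> opn X c \<le> 1 \<and>
     (\<forall>s x. lin C (\<lambda>v. \<eta> s v x)) \<and>
     (\<forall>s. \<forall>v\<in>Y. \<forall>w\<in>Y. \<forall>a\<in>S. cmod (ip X (app X (\<rho> a) (\<eta> s v)) (\<eta> s w) - q (star C w \<otimes>\<^bsub>C\<^esub> (\<sigma> s a \<otimes>\<^bsub>C\<^esub> v))) < \<delta>) \<and>
     (\<forall>s. \<forall>v\<in>Y. nrm X (\<lambda>x. app X c (\<eta> s v) x - \<eta> (\<not> s) v x) < \<delta>) \<and>
     self_adjoint (mats X) W \<and> W \<otimes>\<^bsub>mats X\<^esub> W = \<one>\<^bsub>mats X\<^esub> \<and>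
     (\<forall>u. (nrm X (\<lambda>x. app X W u x - average X \<rho> c u x))\<^sup>2 = (nrm X u)\<^sup>2 - (nrm X (average X \<rho> c u))\<^sup>2) \<and>
     R \<in> star_hom C (mats X) \<and> (\<forall>a\<in>carrier A. R (\<sigma> True a) = \<rho> a) \<and>
     (\<forall>a\<in>carrier A. R (\<sigma> False a) = W \<otimes>\<^bsub>mats X\<^esub> (\<rho> a \<otimes>\<^bsub>mats X\<^esub> W))"

lemma star_hom_conjugate:
  assumes X: "finite X" and \<rho>: "\<rho> \<in> star_hom A (mats X)" and W: "self_adjoint (mats X) W" "W \<otimes>\<^bsub>mats X\<^esub> W = \<one>\<^bsub>mats X\<^esub>"
  shows "(\<lambda>a. W \<otimes>\<^bsub>mats X\<^esub> (\<rho> a \<otimes>\<^bsub>mats X\<^esub> W)) \<in> star_hom A (mats X)"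
proof -
  interpret MX: unital_cstar_algebra "mats X" by (rule unital_cstar_algebra_mats[OF X])
  note h = star_homD[OF \<rho>]
  have Wc: "W \<in> carrier (mats X)" "star (mats X) W = W" using W by (auto simp: self_adjoint_def)
  have WW: "W \<otimes>\<^bsub>mats X\<^esub> (W \<otimes>\<^bsub>mats X\<^esub> M) = M" if "M \<in> carrier (mats X)" for M
    using MX.mult_assoc[of W W M, symmetric] Wc that W(2) by simp
  show ?thesis
    unfolding star_hom_def using Wc WW
    by (auto simp: h MX.mult_l_distr MX.mult_r_distr MX.smult_mult_l MX.smult_mult_r MX.star_mult MX.mult_assoc)
qed

text \<open>As \<open>W\<close> is a symmetry commuting with \<open>\<rho> D\<close>, conjugation by
  it fixes \<open>\<rho>\<close> on \<open>D\<close>; the universal property, assumed as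
  \<open>univ\<close> for matrix algebras, then merges \<open>\<rho>\<close> and its
  conjugate.\<close>

lemma exists_model:
  assumes univ: "\<And>X R1 R2. finite X \<Longrightarrow> R1 \<in> star_hom A (mats X) \<Longrightarrow> R2 \<in> star_hom A (mats X) \<Longrightarrow> (\<forall>x\<in>D. R1 x = R2 x) \<Longrightarrow>
      \<exists>\<pi>\<in>star_hom C (mats X). (\<forall>a\<in>carrier A. \<pi> (\<sigma> True a) = R1 a) \<and> (\<forall>a\<in>carrier A. \<pi> (\<sigma> False a) = R2 a)"
    and S: "finite S" "S \<subseteq> carrier A" and Y: "finite Y" "Y \<subseteq> carrier C" and "0 < \<delta>"
  shows "\<exists>X \<rho> c \<eta> W R. model S Y \<delta> X \<rho> c \<eta> W R"
proof -
  obtain X \<rho> P c \<eta> where X: "finite X" and \<rho>: "\<rho> \<in> star_hom A (mats X)" "\<rho> \<one>\<^bsub>A\<^esub> = \<one>\<^bsub>mats X\<^esub>"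
    and P: "self_adjoint (mats X) P" "P \<otimes>\<^bsub>mats X\<^esub> P = \<one>\<^bsub>mats X\<^esub>" "\<forall>a\<in>carrier A. P \<otimes>\<^bsub>mats X\<^esub> \<rho> a = \<rho> a \<otimes>\<^bsub>mats X\<^esub> P"
    and c: "self_adjoint (mats X) c" "opn X c \<le> 1" "P \<otimes>\<^bsub>mats X\<^esub> c = \<ominus>\<^bsub>mats X\<^esub> (c \<otimes>\<^bsub>mats X\<^esub> P)"
    and \<eta>: "\<forall>s v. \<eta> s v \<in> vecs X" "\<forall>s x. lin C (\<lambda>v. \<eta> s v x)"
      "\<forall>s. \<forall>v\<in>Y. \<forall>w\<in>Y. \<forall>a\<in>S. cmod (ip X (app X (\<rho> a) (\<eta> s v)) (\<eta> s w) - q (star C w \<otimes>\<^bsub>C\<^esub> (\<sigma> s a \<otimes>\<^bsub>C\<^esub> v))) < \<delta>"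
      "\<forall>s. \<forall>v\<in>Y. nrm X (\<lambda>x. app X c (\<eta> s v) x - \<eta> (\<not> s) v x) < \<delta>"
    using approximate_exchange[OF Y S \<open>0 < \<delta>\<close>] by - (elim exE conjE, rule that)
  have "\<exists>W. self_adjoint (mats X) W \<and> W \<otimes>\<^bsub>mats X\<^esub> W = \<one>\<^bsub>mats X\<^esub> \<and>
     (\<forall>x\<in>D. \<rho> x \<otimes>\<^bsub>mats X\<^esub> W = W \<otimes>\<^bsub>mats X\<^esub> \<rho> x) \<and>
     (\<forall>v. (nrm X (\<lambda>x. app X W v x - average X \<rho> c v x))\<^sup>2 = (nrm X v)\<^sup>2 - (nrm X (average X \<rho> c v))\<^sup>2)"
    by (rule commuting_symmetry[OF X \<rho> P(1,2) _ c]) (use P(3) in blast)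
  then obtain W where W: "self_adjoint (mats X) W" "W \<otimes>\<^bsub>mats X\<^esub> W = \<one>\<^bsub>mats X\<^esub>"
     "\<forall>x\<in>D. \<rho> x \<otimes>\<^bsub>mats X\<^esub> W = W \<otimes>\<^bsub>mats X\<^esub> \<rho> x"
     "\<forall>v. (nrm X (\<lambda>x. app X W v x - average X \<rho> c v x))\<^sup>2 = (nrm X v)\<^sup>2 - (nrm X (average X \<rho> c v))\<^sup>2"
    by - (elim exE conjE, rule that)
  interpret MX: unital_cstar_algebra "mats X" by (rule unital_cstar_algebra_mats[OF X])
  have Wc: "W \<in> carrier (mats X)" using W(1) by (simp add: self_adjoint_def)
  have "\<rho> x = W \<otimes>\<^bsub>mats X\<^esub> (\<rho> x \<otimes>\<^bsub>mats X\<^esub> W)" if x: "x \<in> D" for x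
  proof -
    have r: "\<rho> x \<in> carrier (mats X)" using x D star_homD(1)[OF \<rho>(1)] by blast
    have "W \<otimes>\<^bsub>mats X\<^esub> (\<rho> x \<otimes>\<^bsub>mats X\<^esub> W) = W \<otimes>\<^bsub>mats X\<^esub> (W \<otimes>\<^bsub>mats X\<^esub> \<rho> x)" using W(3) x by simp
    also have "\<dots> = \<rho> x" using MX.mult_assoc[of W W "\<rho> x", symmetric] Wc r W(2) by simp
    finally show ?thesis by simp
  qed
  then obtain R where R: "R \<in> star_hom C (mats X)" "\<forall>a\<in>carrier A. R (\<sigma> True a) = \<rho> a"
    "\<forall>a\<in>carrier A. R (\<sigma> False a) = W \<otimes>\<^bsub>mats X\<^esub> (\<rho> a \<otimes>\<^bsub>mats X\<^esub> W)"
    using univ[OF X \<rho>(1) star_hom_conjugate[OF X \<rho>(1) W(1,2)]] by blast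
  show ?thesis
    by (rule exI[of _ X], rule exI[of _ \<rho>], rule exI[of _ c], rule exI[of _ \<eta>], rule exI[of _ W], rule exI[of _ R])
      (unfold model_def, intro conjI, (fact X \<rho> c \<eta> W R)+)
qed

lemma exists_finite_representation:
  assumes univ: "\<And>X R1 R2. finite X \<Longrightarrow> R1 \<in> star_hom A (mats X) \<Longrightarrow> R2 \<in> star_hom A (mats X) \<Longrightarrow> (\<forall>x\<in>D. R1 x = R2 x) \<Longrightarrow>
      \<exists>\<pi>\<in>star_hom C (mats X). (\<forall>a\<in>carrier A. \<pi> (\<sigma> True a) = R1 a) \<and> (\<forall>a\<in>carrier A. \<pi> (\<sigma> False a) = R2 a)"
    and gen: "\<And>S. cstar_subalgebra S C \<Longrightarrow> (\<And>s. \<sigma> s ` carrier A \<subseteq> S) \<Longrightarrow> S = carrier C"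
    and y: "y \<in> carrier C" "0 < Re (q (star C y \<otimes>\<^bsub>C\<^esub> y))"
  shows "\<exists>X \<pi>. finite X \<and> \<pi> \<in> star_hom C (mats X) \<and> \<pi> y \<noteq> \<zero>\<^bsub>mats X\<^esub>"
proof -
  \<comment> \<open>An index is a set of elements of \<open>A\<close> and \<open>C\<close> together
    with an accuracy. Infinite sets get empty data, so that a model exists for every index; the
    filter concentrates on finite sets.\<close>
  define S where "S z = (if finite (fst z) then {a \<in> carrier A. Inl a \<in> fst z} else {})" for z :: "('a + 'b) set \<times> nat"
  define Y where "Y z = (if finite (fst z) then {v \<in> carrier C. Inr v \<in> fst z} else {})" for z :: "('a + 'b) set \<times> nat"
  define \<delta> where "\<delta> z = inverse (real (Suc (snd z)))" for z :: "('a + 'b) set \<times> nat"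
  have S: "finite (S z)" "S z \<subseteq> carrier A" for z
  proof -
    have "finite (Inl -` Z :: 'a set)" if "finite Z" for Z :: "('a + 'b) set" using that by (intro finite_vimageI) auto
    then show "finite (S z)" unfolding S_def by (auto intro: finite_subset[of _ "Inl -` fst z"])
  qed (auto simp: S_def)
  have Y: "finite (Y z)" "Y z \<subseteq> carrier C" for z
  proof -
    have "finite (Inr -` Z :: 'b set)" if "finite Z" for Z :: "('a + 'b) set" using that by (intro finite_vimageI) auto
    then show "finite (Y z)" unfolding Y_def by (auto intro: finite_subset[of _ "Inr -` fst z"])
  qed (auto simp: Y_def)
  have "\<forall>z. \<exists>X \<rho> c \<eta> W R. model (S z) (Y z) (\<delta> z) X \<rho> c \<eta> W R"
  proof
    fix z
    show "\<exists>X \<rho> c \<eta> W R. model (S z) (Y z) (\<delta> z) X \<rho> c \<eta> W R"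
      by (rule exists_model[OF univ S Y]) (simp_all add: \<delta>_def)
  qed
  then obtain X \<rho> c \<eta> W R where m: "\<And>z. model (S z) (Y z) (\<delta> z) (X z) (\<rho> z) (c z) (\<eta> z) (W z) (R z)"
    by metis
  \<comment> \<open>Finite sets growing by inclusion, times accuracies tending to zero: every given
    element eventually belongs to the index.\<close>
  define F where "F = finite_subsets_at_top (UNIV :: ('a + 'b) set) \<times>\<^sub>F sequentially"
  have evS: "\<forall>\<^sub>F z in F. p \<in> fst z \<and> finite (fst z)" for p
  proof -
    have "\<forall>\<^sub>F Z in finite_subsets_at_top UNIV. p \<in> Z \<and> finite Z"
      unfolding eventually_finite_subsets_at_top by (intro exI[of _ "{p}"]) auto
    then show ?thesis unfolding F_def using filterlim_fst by (auto simp: filterlim_iff)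
  qed
  have d: "(\<delta> \<longlongrightarrow> 0) F"
    unfolding F_def \<delta>_def[abs_def] by (rule filterlim_compose[OF LIMSEQ_inverse_real_of_nat filterlim_snd])
  interpret net: approximating_net A C \<sigma> q D N d F X \<rho> c \<eta> W R
  proof
    show "F \<noteq> bot" by (simp add: F_def prod_filter_eq_bot)
    fix z
    note mz = m[of z, unfolded model_def]
    show "finite (X z)" "\<rho> z \<in> star_hom A (mats (X z))" "\<rho> z \<one>\<^bsub>A\<^esub> = \<one>\<^bsub>mats (X z)\<^esub>" "opn (X z) (c z) \<le> 1"
      "self_adjoint (mats (X z)) (W z)" "W z \<otimes>\<^bsub>mats (X z)\<^esub> W z = \<one>\<^bsub>mats (X z)\<^esub>" "R z \<in> star_hom C (mats (X z))"
      using mz by blast+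
    show "lin C (\<lambda>v. \<eta> z s v x)" for s x using mz by blast
    show "(nrm (X z) (\<lambda>x. app (X z) (W z) u x - average (X z) (\<rho> z) (c z) u x))\<^sup>2 = (nrm (X z) u)\<^sup>2 - (nrm (X z) (average (X z) (\<rho> z) (c z) u))\<^sup>2" for u
      using mz by blast
    show "R z (\<sigma> True a) = \<rho> z a" "R z (\<sigma> False a) = W z \<otimes>\<^bsub>mats (X z)\<^esub> (\<rho> z a \<otimes>\<^bsub>mats (X z)\<^esub> W z)" if "a \<in> carrier A" for a
      using mz that by blast+
  next
    fix a v w s assume avw: "a \<in> carrier A" "v \<in> carrier C" "w \<in> carrier C"
    have "\<forall>\<^sub>F z in F. norm (ip (X z) (app (X z) (\<rho> z a) (\<eta> z s v)) (\<eta> z s w) - q (star C w \<otimes>\<^bsub>C\<^esub> (\<sigma> s a \<otimes>\<^bsub>C\<^esub> v))) \<le> \<delta> z"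
      using eventually_conj[OF evS[of "Inl a"] eventually_conj[OF evS[of "Inr v"] evS[of "Inr w"]]]
    proof (rule eventually_mono)
      fix z :: "('a + 'b) set \<times> nat" assume "(Inl a \<in> fst z \<and> finite (fst z)) \<and> (Inr v \<in> fst z \<and> finite (fst z)) \<and> (Inr w \<in> fst z \<and> finite (fst z))"
      then have "a \<in> S z" "v \<in> Y z" "w \<in> Y z" using avw by (auto simp: S_def Y_def)
      then have "cmod (ip (X z) (app (X z) (\<rho> z a) (\<eta> z s v)) (\<eta> z s w) - q (star C w \<otimes>\<^bsub>C\<^esub> (\<sigma> s a \<otimes>\<^bsub>C\<^esub> v))) < \<delta> z"
        using m[of z, unfolded model_def] by blast
      then show "norm (ip (X z) (app (X z) (\<rho> z a) (\<eta> z s v)) (\<eta> z s w) - q (star C w \<otimes>\<^bsub>C\<^esub> (\<sigma> s a \<otimes>\<^bsub>C\<^esub> v))) \<le> \<delta> z" by simp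
    qed
    from LIM_zero_cancel[OF Lim_null_comparison[OF this d]]
    show "((\<lambda>z. ip (X z) (app (X z) (\<rho> z a) (\<eta> z s v)) (\<eta> z s w)) \<longlongrightarrow> q (star C w \<otimes>\<^bsub>C\<^esub> (\<sigma> s a \<otimes>\<^bsub>C\<^esub> v))) F" .
  next
    fix v s assume v: "v \<in> carrier C"
    have "\<forall>\<^sub>F z in F. norm (nrm (X z) (\<lambda>x. app (X z) (c z) (\<eta> z s v) x - \<eta> z (\<not> s) v x)) \<le> \<delta> z"
      using evS[of "Inr v"]
    proof (rule eventually_mono)
      fix z :: "('a + 'b) set \<times> nat" assume "Inr v \<in> fst z \<and> finite (fst z)"
      then have "v \<in> Y z" using v by (auto simp: Y_def)
      then have "nrm (X z) (\<lambda>x. app (X z) (c z) (\<eta> z s v) x - \<eta> z (\<not> s) v x) < \<delta> z"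
        using m[of z, unfolded model_def] by blast
      then show "norm (nrm (X z) (\<lambda>x. app (X z) (c z) (\<eta> z s v) x - \<eta> z (\<not> s) v x)) \<le> \<delta> z" by simp
    qed
    from Lim_null_comparison[OF this d]
    show "((\<lambda>z. nrm (X z) (\<lambda>x. app (X z) (c z) (\<eta> z s v) x - \<eta> z (\<not> s) v x)) \<longlongrightarrow> 0) F" .
  qed
  obtain z where "R z y \<noteq> \<zero>\<^bsub>mats (X z)\<^esub>" using net.exists_nonvanishing[OF gen y] by blast
  then show ?thesis using net.X[of z] net.R(1)[of z] by blast
qed

end

section \<open>Separability and conclusion\<close>

context cstar_algebra
begin

lemma closedin_norm_topologyD:
  assumes "closedin (norm_topology A) S" "x \<in> carrier A" "\<And>e. e > 0 \<Longrightarrow> \<exists>y\<in>S. cnorm A (x \<ominus> y) < e"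
  shows "x \<in> S"
proof (rule ccontr)
  interpret Ms: Metric_space "carrier A" "cdist A" by (rule Metric_space)
  assume "x \<notin> S"
  then obtain r where r: "r > 0" "disjnt S (Ms.mball x r)" and S: "S \<subseteq> carrier A"
    using assms(1,2) unfolding norm_topology_def Ms.closedin_metric by blast
  obtain y where y: "y \<in> S" "cnorm A (x \<ominus> y) < r" using assms(3)[OF r(1)] by blast
  then have "y \<in> Ms.mball x r" using S assms(2) by (auto simp: Ms.in_mball cdist_def)
  then show False using y r(2) by (auto simp: disjnt_iff)
qed

lemma separable_norm_topology_iff:
  "separable_space (norm_topology A) \<longleftrightarrow>
     (\<exists>T. countable T \<and> T \<subseteq> carrier A \<and> (\<forall>x\<in>carrier A. \<forall>e>0. \<exists>y\<in>T. cnorm A (x \<ominus> y) < e))"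
proof -
  interpret Ms: Metric_space "carrier A" "cdist A" by (rule Metric_space)
  have eq: "Ms.mtopology closure_of T = carrier A \<longleftrightarrow> (\<forall>x\<in>carrier A. \<forall>e>0. \<exists>y\<in>T. cnorm A (x \<ominus> y) < e)" if T: "T \<subseteq> carrier A" for T
  proof -
    have "y \<in> Ms.mball x e \<longleftrightarrow> cnorm A (x \<ominus> y) < e" if "x \<in> carrier A" "y \<in> T" for x y e
      using that T by (auto simp: Ms.in_mball cdist_def)
    then have "Ms.mtopology closure_of T = {x \<in> carrier A. \<forall>e>0. \<exists>y\<in>T. cnorm A (x \<ominus> y) < e}"
      unfolding Ms.metric_closure_of by blast
    then show ?thesis by blast
  qed
  show ?thesis
    unfolding separable_space_def norm_topology_def Ms.topspace_mtopology by (intro ex_cong1 conj_cong refl eq)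
qed

text \<open>The bound avoids \<open>cnorm A x'\<close>, so it tends to zero as soon as the two
  distances do.\<close>

lemma cnorm_mult_diff:
  assumes "x \<in> carrier A" "y \<in> carrier A" "x' \<in> carrier A" "y' \<in> carrier A"
  shows "cnorm A (x \<otimes> y \<ominus> x' \<otimes> y') \<le> cnorm A (x \<ominus> x') * cnorm A y + (cnorm A x + cnorm A (x \<ominus> x')) * cnorm A (y \<ominus> y')"
proof -
  have "x \<otimes> y \<ominus> x' \<otimes> y' = (x \<ominus> x') \<otimes> y \<oplus> x' \<otimes> (y \<ominus> y')"
    using assms by (intro lin_eqI) (auto simp: lin_simps distrib)
  then have "cnorm A (x \<otimes> y \<ominus> x' \<otimes> y') \<le> cnorm A (x \<ominus> x') * cnorm A y + cnorm A x' * cnorm A (y \<ominus> y')"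
    using assms cnorm_triangle[of "(x \<ominus> x') \<otimes> y" "x' \<otimes> (y \<ominus> y')"] cnorm_mult[of "x \<ominus> x'" y] cnorm_mult[of x' "y \<ominus> y'"] by simp
  moreover have "cnorm A x' \<le> cnorm A x + cnorm A (x \<ominus> x')"
    using cnorm_diff_le[of x' x] cnorm_minus_commute[of x x'] assms by simp
  then have "cnorm A x' * cnorm A (y \<ominus> y') \<le> (cnorm A x + cnorm A (x \<ominus> x')) * cnorm A (y \<ominus> y')"
    using assms by (intro mult_right_mono cnorm_nonneg) auto
  ultimately show ?thesis by linarith
qed

text \<open>Closing \<open>G\<close> under the operations, with scalars from the countable dense set
  \<open>Q\<close>, keeps it countable; its norm closure is a C*-subalgebra because the operations
  are continuous and every scalar is a limit of elements of \<open>Q\<close>.\<close>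

lemma separable_if_countably_generated:
  assumes G: "countable G" "G \<subseteq> carrier A"
    and gen: "\<And>S. cstar_subalgebra S A \<Longrightarrow> G \<subseteq> S \<Longrightarrow> S = carrier A"
  shows "separable_space (norm_topology A)"
proof -
  define Q where "Q = (\<lambda>(a, b). Complex (of_rat a) (of_rat b)) ` (UNIV :: (rat \<times> rat) set)"
  have Q: "countable Q" unfolding Q_def by (intro countable_image) simp
  have Qd: "\<exists>p\<in>Q. cmod (c - p) < e" if "e > 0" for c e
  proof -
    obtain a b where ab: "Re c < of_rat a" "of_rat a < Re c + e/2" "Im c < of_rat b" "of_rat b < Im c + e/2"
      using of_rat_dense[of "Re c" "Re c + e/2"] of_rat_dense[of "Im c" "Im c + e/2"] \<open>e > 0\<close> by auto
    have "cmod (c - Complex (of_rat a) (of_rat b)) \<le> \<bar>Re c - of_rat a\<bar> + \<bar>Im c - of_rat b\<bar>"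
      using cmod_le[of "c - Complex (of_rat a) (of_rat b)"] by simp
    then have "cmod (c - Complex (of_rat a) (of_rat b)) < e" using ab by linarith
    moreover have "Complex (of_rat a) (of_rat b) \<in> Q" by (auto simp: Q_def)
    ultimately show ?thesis by blast
  qed
  define step where "step U = U \<union> (\<lambda>(x, y). x \<oplus> y) ` (U \<times> U) \<union> (\<lambda>(x, y). x \<otimes> y) ` (U \<times> U) \<union> star A ` U \<union> (\<lambda>(c, x). c \<odot> x) ` (Q \<times> U)" for U
  define T where "T n = (step ^^ n) (insert \<zero> G)" for n
  define V where "V = (\<Union>n. T n)"
  have TS: "T (Suc n) = step (T n)" for n by (simp add: T_def)
  have "countable (T n) \<and> T n \<subseteq> carrier A" for n
  proof (induction n)
    case 0
    then show ?case using G by (simp add: T_def)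
  next
    case (Suc n)
    then show ?case unfolding TS step_def using Q by auto
  qed
  then have V: "countable V" "V \<subseteq> carrier A" by (auto simp: V_def)
  have Tmono: "m \<le> n \<Longrightarrow> T m \<subseteq> T n" for m n
    by (rule lift_Suc_mono_le[of T]) (auto simp: TS step_def)
  have V2: "\<exists>n. x \<in> T n \<and> y \<in> T n" if "x \<in> V" "y \<in> V" for x y
  proof -
    obtain m n where "x \<in> T m" "y \<in> T n" using \<open>x \<in> V\<close> \<open>y \<in> V\<close> by (auto simp: V_def)
    then show ?thesis using Tmono[of m "max m n"] Tmono[of n "max m n"] by auto
  qed
  have VI: "step (T n) \<subseteq> V" for n using TS[of n] by (auto simp: V_def)
  have Vadd: "x \<oplus> y \<in> V" and Vmult: "x \<otimes> y \<in> V" if xy: "x \<in> V" "y \<in> V" for x y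
  proof -
    obtain n where n: "x \<in> T n" "y \<in> T n" using V2[OF xy] by blast
    then have "(x, y) \<in> T n \<times> T n" by simp
    then have "x \<oplus> y \<in> step (T n)" "x \<otimes> y \<in> step (T n)" unfolding step_def by force+
    then show "x \<oplus> y \<in> V" "x \<otimes> y \<in> V" using VI by blast+
  qed
  have Vstar: "star A x \<in> V" and Vscale: "c \<in> Q \<Longrightarrow> c \<odot> x \<in> V" if x: "x \<in> V" for x c
  proof -
    obtain n where n: "x \<in> T n" using V2[OF x x] by blast
    then show "star A x \<in> V" using VI[of n] by (auto simp: step_def)
    assume "c \<in> Q"
    then have "(c, x) \<in> Q \<times> T n" using n by simp
    then have "c \<odot> x \<in> step (T n)" unfolding step_def by force
    then show "c \<odot> x \<in> V" using VI by blast
  qed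
  have VT0: "T 0 \<subseteq> V" by (auto simp: V_def)
  have V0: "\<zero> \<in> V" "G \<subseteq> V" using VT0 by (simp_all add: T_def)
  have Vc: "x \<in> V \<Longrightarrow> x \<in> carrier A" for x using V by blast
  define cl where "cl = {x \<in> carrier A. \<exists>f. (\<forall>n. f n \<in> V) \<and> (\<lambda>n. cnorm A (x \<ominus> f n)) \<longlonglongrightarrow> 0}"
  have clI: "x \<in> cl" if x: "x \<in> carrier A" "\<And>e. e > 0 \<Longrightarrow> \<exists>y\<in>V. cnorm A (x \<ominus> y) < e" for x
  proof -
    have "\<forall>n. \<exists>y. y \<in> V \<and> cnorm A (x \<ominus> y) < inverse (real (Suc n))" using x(2) by (meson inverse_positive_iff_positive of_nat_0_less_iff zero_less_Suc)
    from choice[OF this] obtain f where f: "\<forall>n. f n \<in> V \<and> cnorm A (x \<ominus> f n) < inverse (real (Suc n))" ..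
    then have "(\<lambda>n. cnorm A (x \<ominus> f n)) \<longlonglongrightarrow> 0"
      by (intro tendsto_sandwich[OF _ _ tendsto_const LIMSEQ_inverse_real_of_nat] always_eventually allI)
        (use x(1) f Vc in \<open>auto intro: cnorm_nonneg less_imp_le\<close>)
    then show ?thesis using f x(1) by (auto simp: cl_def)
  qed
  have clD: "\<exists>y\<in>V. cnorm A (x \<ominus> y) < e" if x: "x \<in> cl" "e > 0" for x e
  proof -
    obtain f where f: "\<forall>n. f n \<in> V" "(\<lambda>n. cnorm A (x \<ominus> f n)) \<longlonglongrightarrow> 0" using x(1) by (auto simp: cl_def)
    have "\<forall>\<^sub>F n in sequentially. cnorm A (x \<ominus> f n) < e" by (rule order_tendstoD(2)[OF f(2) x(2)])
    then obtain n where "cnorm A (x \<ominus> f n) < e" using eventually_happens[of "\<lambda>n. cnorm A (x \<ominus> f n) < e" sequentially] by auto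
    then show ?thesis using f(1) by blast
  qed
  have clseq: "x \<in> cl" if "x \<in> carrier A" "\<And>n. f n \<in> V" "\<And>n. cnorm A (x \<ominus> f n) \<le> b n" "b \<longlonglongrightarrow> 0" for x f and b :: "nat \<Rightarrow> real"
  proof -
    have "(\<lambda>n. cnorm A (x \<ominus> f n)) \<longlonglongrightarrow> 0"
      by (rule tendsto_sandwich[OF _ _ tendsto_const that(4)]) (use that Vc in \<open>auto intro!: always_eventually cnorm_nonneg\<close>)
    then show ?thesis using that by (auto simp: cl_def)
  qed
  have clV: "V \<subseteq> cl"
  proof
    fix x assume "x \<in> V"
    then show "x \<in> cl" using Vc by (intro clseq[of x "\<lambda>_. x" "\<lambda>_. 0"]) (auto simp: minus_eq_zero[THEN iffD2])
  qed
  have "cstar_subalgebra cl A"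
  proof (rule cstar_subalgebraI)
    show "cl \<subseteq> carrier A" by (auto simp: cl_def)
    show "\<zero> \<in> cl" using clV V0 by blast
  next
    fix x y assume "x \<in> cl" "y \<in> cl"
    then obtain f g where f: "x \<in> carrier A" "\<And>n. f n \<in> V" "(\<lambda>n. cnorm A (x \<ominus> f n)) \<longlonglongrightarrow> 0"
      and g: "y \<in> carrier A" "\<And>n. g n \<in> V" "(\<lambda>n. cnorm A (y \<ominus> g n)) \<longlonglongrightarrow> 0" by (auto simp: cl_def)
    show "x \<oplus> y \<in> cl"
    proof (rule clseq[of "x \<oplus> y" "\<lambda>n. f n \<oplus> g n" "\<lambda>n. cnorm A (x \<ominus> f n) + cnorm A (y \<ominus> g n)"])
      show "(\<lambda>n. cnorm A (x \<ominus> f n) + cnorm A (y \<ominus> g n)) \<longlonglongrightarrow> 0" using tendsto_add[OF f(3) g(3)] by simp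
      fix n
      have "(x \<oplus> y) \<ominus> (f n \<oplus> g n) = (x \<ominus> f n) \<oplus> (y \<ominus> g n)" using f(1) g(1) Vc[OF f(2)[of n]] Vc[OF g(2)[of n]]
        by (intro lin_eqI) (auto simp: lin_simps)
      then show "cnorm A ((x \<oplus> y) \<ominus> (f n \<oplus> g n)) \<le> cnorm A (x \<ominus> f n) + cnorm A (y \<ominus> g n)"
        using cnorm_triangle f(1) g(1) Vc[OF f(2)[of n]] Vc[OF g(2)[of n]] by simp
    qed (use f g Vadd in auto)
    show "x \<otimes> y \<in> cl"
    proof (rule clseq[of "x \<otimes> y" "\<lambda>n. f n \<otimes> g n" "\<lambda>n. cnorm A (x \<ominus> f n) * cnorm A y + (cnorm A x + cnorm A (x \<ominus> f n)) * cnorm A (y \<ominus> g n)"])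
      have "(\<lambda>n. cnorm A (x \<ominus> f n) * cnorm A y + (cnorm A x + cnorm A (x \<ominus> f n)) * cnorm A (y \<ominus> g n)) \<longlonglongrightarrow> 0 * cnorm A y + (cnorm A x + 0) * 0"
        by (intro tendsto_add tendsto_mult tendsto_const f(3) g(3))
      then show "(\<lambda>n. cnorm A (x \<ominus> f n) * cnorm A y + (cnorm A x + cnorm A (x \<ominus> f n)) * cnorm A (y \<ominus> g n)) \<longlonglongrightarrow> 0" by simp
      show "cnorm A (x \<otimes> y \<ominus> f n \<otimes> g n) \<le> cnorm A (x \<ominus> f n) * cnorm A y + (cnorm A x + cnorm A (x \<ominus> f n)) * cnorm A (y \<ominus> g n)" for n
        using f(1) g(1) Vc[OF f(2)] Vc[OF g(2)] by (intro cnorm_mult_diff) auto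
    qed (use f g Vmult in auto)
  next
    fix c x assume "x \<in> cl"
    then obtain f where f: "x \<in> carrier A" "\<And>n. f n \<in> V" "(\<lambda>n. cnorm A (x \<ominus> f n)) \<longlonglongrightarrow> 0" by (auto simp: cl_def)
    have "\<forall>n. \<exists>p. p \<in> Q \<and> cmod (c - p) < inverse (real (Suc n))" using Qd by (meson inverse_positive_iff_positive of_nat_0_less_iff zero_less_Suc)
    from choice[OF this] obtain p where p: "\<forall>n. p n \<in> Q \<and> cmod (c - p n) < inverse (real (Suc n))" ..
    have plim: "(\<lambda>n. cmod (c - p n)) \<longlonglongrightarrow> 0"
      using p by (intro tendsto_sandwich[OF _ _ tendsto_const LIMSEQ_inverse_real_of_nat]) (auto intro!: always_eventually less_imp_le)
    show "c \<odot> x \<in> cl"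
    proof (rule clseq[of "c \<odot> x" "\<lambda>n. p n \<odot> f n" "\<lambda>n. cmod (c - p n) * cnorm A x + (cmod c + cmod (c - p n)) * cnorm A (x \<ominus> f n)"])
      have "(\<lambda>n. cmod (c - p n) * cnorm A x + (cmod c + cmod (c - p n)) * cnorm A (x \<ominus> f n)) \<longlonglongrightarrow> 0 * cnorm A x + (cmod c + 0) * 0"
        by (intro tendsto_add tendsto_mult tendsto_const f(3) plim)
      then show "(\<lambda>n. cmod (c - p n) * cnorm A x + (cmod c + cmod (c - p n)) * cnorm A (x \<ominus> f n)) \<longlonglongrightarrow> 0" by simp
      fix n
      have fc: "f n \<in> carrier A" using f(2) Vc by blast
      have "c \<odot> x \<ominus> p n \<odot> f n = (c - p n) \<odot> x \<oplus> p n \<odot> (x \<ominus> f n)"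
        using f(1) fc by (intro lin_eqI) (auto simp: lin_simps algebra_simps)
      then have "cnorm A (c \<odot> x \<ominus> p n \<odot> f n) \<le> cmod (c - p n) * cnorm A x + cmod (p n) * cnorm A (x \<ominus> f n)"
        using cnorm_triangle[of "(c - p n) \<odot> x" "p n \<odot> (x \<ominus> f n)"] f(1) fc by (simp add: cnorm_smult)
      moreover have "cmod (p n) \<le> cmod c + cmod (c - p n)"
        using norm_triangle_ineq4[of c "c - p n"] by simp
      then have "cmod (p n) * cnorm A (x \<ominus> f n) \<le> (cmod c + cmod (c - p n)) * cnorm A (x \<ominus> f n)"
        using f(1) fc by (intro mult_right_mono cnorm_nonneg) auto
      ultimately show "cnorm A (c \<odot> x \<ominus> p n \<odot> f n) \<le> cmod (c - p n) * cnorm A x + (cmod c + cmod (c - p n)) * cnorm A (x \<ominus> f n)" by linarith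
    qed (use f p Vscale in auto)
  next
    fix x assume "x \<in> cl"
    then obtain f where f: "x \<in> carrier A" "\<And>n. f n \<in> V" "(\<lambda>n. cnorm A (x \<ominus> f n)) \<longlonglongrightarrow> 0" by (auto simp: cl_def)
    show "star A x \<in> cl"
    proof (rule clseq[of "star A x" "\<lambda>n. star A (f n)" "\<lambda>n. cnorm A (x \<ominus> f n)"])
      show "cnorm A (star A x \<ominus> star A (f n)) \<le> cnorm A (x \<ominus> f n)" for n
        using cnorm_star[of "x \<ominus> f n"] f(1) Vc[OF f(2)[of n]] by (simp add: star_minus)
    qed (use f Vstar in auto)
  next
    fix x assume x: "x \<in> carrier A" "\<And>e. e > 0 \<Longrightarrow> \<exists>y\<in>cl. cnorm A (x \<ominus> y) < e"
    show "x \<in> cl"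
    proof (rule clI[OF x(1)])
      fix e :: real assume e: "e > 0"
      then obtain y where y: "y \<in> cl" "cnorm A (x \<ominus> y) < e/2" using x(2)[of "e/2"] by auto
      obtain w where w: "w \<in> V" "cnorm A (y \<ominus> w) < e/2" using clD[OF y(1), of "e/2"] e by auto
      have "y \<in> carrier A" using y by (auto simp: cl_def)
      then have "cnorm A (x \<ominus> w) < e" using cnorm_triangle3[of x y w] x(1) Vc[OF w(1)] y w by simp
      then show "\<exists>y\<in>V. cnorm A (x \<ominus> y) < e" using w by blast
    qed
  qed
  then have "cl = carrier A" using gen V0 clV by blast
  then show ?thesis unfolding separable_norm_topology_iff using V clD by blast
qed

end

theorem corollary4p1:
  fixes A :: "'a cstar" and D :: "'a set"
    and C :: "'c cstar" and \<sigma>\<^sub>1 \<sigma>\<^sub>2 :: "'a \<Rightarrow> 'c"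
  assumes "unital_cstar_algebra A"
    and "separable_space (norm_topology A)"
    and "rfd A"
    and "unital_cstar_subalgebra D A"
    and "finite_dimensional (A\<lparr>carrier := D\<rparr>)"
    and "amalgamated_free_product (A\<lparr>carrier := D\<rparr>) A A id id C \<sigma>\<^sub>1 \<sigma>\<^sub>2"
  shows "rfd C"
proof -
  interpret am: amalgamated_free_product "A\<lparr>carrier := D\<rparr>" A A id id C \<sigma>\<^sub>1 \<sigma>\<^sub>2 by (rule assms(6))
  define \<sigma> where "\<sigma> s = (if s then \<sigma>\<^sub>1 else \<sigma>\<^sub>2)" for s
  have \<sigma>: "\<sigma> s \<in> star_hom A C" "\<sigma> s \<one>\<^bsub>A\<^esub> = \<one>\<^bsub>C\<^esub>" for s
    using am.embedding_\<sigma>\<^sub>A am.embedding_\<sigma>\<^sub>B by (auto simp: \<sigma>_def unital_embedding_def)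
  have D: "D \<subseteq> carrier A"
    using assms(4) subgroup.subset[of D "add_monoid A"]
    by (simp add: unital_cstar_subalgebra_def cstar_subalgebra_def submodule_def)
  \<comment> \<open>Matrix algebras have type \<open>seq cstar\<close>, so the universal property of
    \<open>C\<close> applies to them; with inclusions as the maps from \<open>D\<close>,
    compatibility is agreement on \<open>D\<close>.\<close>
  have univ: "\<exists>\<pi>\<in>star_hom C (mats X). (\<forall>a\<in>carrier A. \<pi> (\<sigma> True a) = R1 a) \<and> (\<forall>a\<in>carrier A. \<pi> (\<sigma> False a) = R2 a)"
    if "finite X" "R1 \<in> star_hom A (mats X)" "R2 \<in> star_hom A (mats X)" "\<forall>x\<in>D. R1 x = R2 x" for X R1 R2
  proof -
    have "cstar_algebra (mats X)" using unital_cstar_algebra_mats[OF that(1)] by (rule unital_cstar_algebra.axioms)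
    from am.universal[OF this that(2,3)] that(4) show ?thesis by (simp add: \<sigma>_def)
  qed
  have gen: "S = carrier C" if S: "cstar_subalgebra S C" "\<And>s. \<sigma> s ` carrier A \<subseteq> S" for S
    using am.generated[OF S(1)] S(2)[of True] S(2)[of False] by (auto simp: \<sigma>_def)
  have lin_D: "lin (A\<lparr>carrier := D\<rparr>) g" if "lin A g" for g
    using that D unfolding lin_def by (auto simp: subset_iff)
  obtain N :: nat and d where d: "\<forall>j<N. d j \<in> carrier (A\<lparr>carrier := D\<rparr>)"
    "\<forall>g. lin (A\<lparr>carrier := D\<rparr>) g \<longrightarrow> (\<Sum>j<N. g (d j \<otimes>\<^bsub>A\<^esub> star A (d j))) = g \<one>\<^bsub>A\<^esub>"
    "\<forall>x\<in>carrier (A\<lparr>carrier := D\<rparr>). \<exists>l. \<forall>g. lin (A\<lparr>carrier := D\<rparr>) g \<longrightarrow>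
      (\<forall>j<N. g (x \<otimes>\<^bsub>A\<^esub> d j) = (\<Sum>k<N. l k j * g (d k))) \<and>
      (\<forall>k<N. g (star A (d k) \<otimes>\<^bsub>A\<^esub> x) = (\<Sum>j<N. l k j * g (star A (d j))))"
    using am.D.exists_averaging[OF assms(5)] by (simp, elim exE conjE) (rule that, simp_all)
  have "\<exists>(F :: seq cstar) \<pi>. cstar_algebra F \<and> finite_dimensional F \<and> \<pi> \<in> star_hom C F \<and> \<pi> y \<noteq> \<zero>\<^bsub>F\<^esub>"
    if y: "y \<in> carrier C" "y \<noteq> \<zero>\<^bsub>C\<^esub>" for y
  proof -
    \<comment> \<open>Every nonzero \<open>y\<close> is detected by some positive functional; the
      approximation is carried out for this one.\<close>
    obtain q where q: "posf C q" "0 < Re (q (star C y \<otimes>\<^bsub>C\<^esub> y))" using am.C.exists_posf[OF y] by blast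
    interpret pair: amalgamated_pair A C \<sigma> q D N d
    proof
      show "\<sigma> s \<in> star_hom A C" "\<sigma> s \<one>\<^bsub>A\<^esub> = \<one>\<^bsub>C\<^esub>" for s by (rule \<sigma>)+
      show "posf C q" by (rule q)
      show "\<exists>\<psi>. fin_rank A \<psi> \<and> \<psi> (star A x \<otimes>\<^bsub>A\<^esub> x) \<noteq> 0" if "x \<in> carrier A" "x \<noteq> \<zero>\<^bsub>A\<^esub>" for x
        by (rule rfd_separating[OF assms(1,3) that])
      show "D \<subseteq> carrier A" by (rule D)
      show "d j \<in> D" if "j < N" for j using d(1) that by simp
      show "\<sigma> True x = \<sigma> False x" if "x \<in> D" for x using am.amalgamated[of x] that by (simp add: \<sigma>_def)
      show "(\<Sum>j<N. g (d j \<otimes>\<^bsub>A\<^esub> star A (d j))) = g \<one>\<^bsub>A\<^esub>" if "lin A g" for g using d(2) lin_D[OF that] by blast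
      show "\<exists>l. \<forall>g. lin A g \<longrightarrow> (\<forall>j<N. g (x \<otimes>\<^bsub>A\<^esub> d j) = (\<Sum>k<N. l k j * g (d k))) \<and>
          (\<forall>k<N. g (star A (d k) \<otimes>\<^bsub>A\<^esub> x) = (\<Sum>j<N. l k j * g (star A (d j))))" if "x \<in> D" for x
      proof -
        have "x \<in> carrier (A\<lparr>carrier := D\<rparr>)" using that by simp
        from d(3)[rule_format, OF this] obtain l where l: "\<forall>g. lin (A\<lparr>carrier := D\<rparr>) g \<longrightarrow>
          (\<forall>j<N. g (x \<otimes>\<^bsub>A\<^esub> d j) = (\<Sum>k<N. l k j * g (d k))) \<and>
          (\<forall>k<N. g (star A (d k) \<otimes>\<^bsub>A\<^esub> x) = (\<Sum>j<N. l k j * g (star A (d j))))" ..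
        show ?thesis
          by (intro exI[of _ l] allI impI) (rule l[rule_format, OF lin_D])
      qed
    qed
    obtain X \<pi> where X: "finite X" "\<pi> \<in> star_hom C (mats X)" "\<pi> y \<noteq> \<zero>\<^bsub>mats X\<^esub>"
      using pair.exists_finite_representation[OF univ gen y(1) q(2)] by blast
    show ?thesis
      using X finite_dimensional_mats[OF X(1)] unital_cstar_algebra.axioms(1)[OF unital_cstar_algebra_mats[OF X(1)]] by blast
  qed
  \<comment> \<open>The images of a countable dense subset of \<open>A\<close> under both embeddings
    generate \<open>C\<close>: homomorphisms are contractive, so a closed subalgebra containing
    these images contains all of both copies.\<close>
  moreover have "separable_space (norm_topology C)"
  proof -
    obtain T where T: "countable T" "T \<subseteq> carrier A" "\<forall>x\<in>carrier A. \<forall>e>0. \<exists>y\<in>T. cnorm A (x \<ominus>\<^bsub>A\<^esub> y) < e"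
      using assms(2) unfolding am.A.separable_norm_topology_iff by blast
    show ?thesis
    proof (rule am.C.separable_if_countably_generated[of "\<Union>s. \<sigma> s ` T"])
      show "countable (\<Union>s. \<sigma> s ` T)" using T(1) by (intro countable_UN) auto
      show "(\<Union>s. \<sigma> s ` T) \<subseteq> carrier C" using T(2) star_homD(1)[OF \<sigma>(1)] by blast
      fix S assume S: "cstar_subalgebra S C" "(\<Union>s. \<sigma> s ` T) \<subseteq> S"
      show "S = carrier C"
      proof (rule gen[OF S(1)], rule subsetI)
        fix s y assume "y \<in> \<sigma> s ` carrier A"
        then obtain x where x: "x \<in> carrier A" "y = \<sigma> s x" by blast
        show "y \<in> S"
        proof (rule am.C.closedin_norm_topologyD)
          show "closedin (norm_topology C) S" using S(1) by (simp add: cstar_subalgebra_def)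
          show "y \<in> carrier C" using x star_homD(1)[OF \<sigma>(1)] by blast
          fix e :: real assume "e > 0"
          then obtain t where t: "t \<in> T" "cnorm A (x \<ominus>\<^bsub>A\<^esub> t) < e" using T(3) x(1) by blast
          have tc: "t \<in> carrier A" using t T(2) by blast
          have "cnorm C (y \<ominus>\<^bsub>C\<^esub> \<sigma> s t) \<le> cnorm A (x \<ominus>\<^bsub>A\<^esub> t)"
            using star_hom_contractive[OF assms(1) am.C.unital_cstar_algebra_axioms \<sigma>(1) \<sigma>(2), of "x \<ominus>\<^bsub>A\<^esub> t"] x tc
            by (simp add: star_hom_minus[OF am.A.cstar_algebra_axioms am.C.cstar_algebra_axioms \<sigma>(1)])
          then show "\<exists>y'\<in>S. cnorm C (y \<ominus>\<^bsub>C\<^esub> y') < e" using t S(2) by (intro bexI[of _ "\<sigma> s t"]) auto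
        qed
      qed
    qed
  qed
  ultimately show ?thesis using am.C.cstar_algebra_axioms by (simp add: rfd_def)
qed

end
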